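(* Let $M\subset\mathbb{R}^D$ be an admissibly triangulable space (i.e. there is an admissible triangulation $\phi:K\to M$, with $K$ purely $d$-dimensional) and let $f:M\to\mathbb{R}_{\ge0}$ be a good density. Let $\mathcal{H}_n$ be a functional that satisfies conditions (1)--(7) listed in the context (rigidity, control homogeneity, scale-invariant reference, continuity, cube additivity, simplex additivity, metric stability). Then there exists a real number $\overline{\mathcal{H}}^*$ so that the following holds independently of $M$ and $f$: $$\lim_{n\to\infty}\frac1n\overline{\mathcal{H}}_n(nf)=\overline{\mathcal{H}}^*.$$
   Context: Triangulations. A simplicial complex is a space obtained by gluing affine simplices compatibly across their faces; it is purely $d$-dimensional if all its maximal simplices are $d$-dimensional. A triangulation $\phi:K\to M$ is a homeomorphism from a simplicial complex $K$ to a metric space $M$. It is a $C^2$ triangulation if it is $C^2$ on each closed simplex, i.e. has continuous second partial derivatives on some open neighbourhood of the simplex. For a $C^2$ embedding $\phi:\sigma\hookrightarrow\mathbb{R}^D$ of an affine simplex put $\tilde\sigma=\phi(\sigma)$. For $x\in\partial\tilde\sigma$ let $\tilde\sigma_x$ be the smallest closed face of $\tilde\sigma$ containing $x$. The normal inward cone $\mathfrak{N}_x\tilde\sigma$ is the set of all $v\in\mathbb{R}^D$ that are perpendicular to $\tilde\sigma_x$ and satisfy $x+\epsilon v\in\tilde\sigma$ for some $\epsilon>0$. The strata separation angle of $\phi:K\to M$ is $$\Theta_\phi=\inf_{\sigma_1,\sigma_2,x}d_{\mathbb S}\big(\mathfrak{N}_{x}\tilde\sigma_1,\mathfrak{N}_{x}\tilde\sigma_2\big),$$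 the infimum over $d$-simplices $\sigma_1\ne\sigma_2$ of $K$ and interior points $x$ of $\sigma_1\cap\sigma_2$ (identified with its image under $\phi$ when writing the cones); $d_{\mathbb S}(A_1,A_2)$ is the spherical distance between $A_1\cap\mathbb{S}^{D-1}$ and $A_2\cap\mathbb{S}^{D-1}$. A $C^2$ triangulation $\phi:K\to M\subset\mathbb{R}^D$ is admissible if $M$ is compact, $K$ is purely $d$-dimensional and $\Theta_\phi>0$. Good density. A probability density $f$ on $M$ (with respect to $d$-dimensional Hausdorff measure) is good if $\operatorname{supp}(f)$ is compact and either $\inf_{\operatorname{supp}(f)}f>0$, or there are constants $c_\pm,q>0$ with $c_-\delta(x)^q\le f(x)\le c_+\delta(x)^q$ on the support, where $\delta(x)$ is the Euclidean distance from $x$ to $f^{-1}(0)\cap\operatorname{supp}(f)$. Functionals. A functional $\mathcal{H}_n$, depending on an optional control parameter $n$, takes a finite set $\mathcal{X}\subset\mathbb{R}^D$ and outputs a real number $\mathcal{H}_n(\mathcal{X})$. For a nonnegative measurable $g$ with finite positive integral, $\mathcal{P}_g$ is the Poisson point process with intensity $g$, and $\overline{\mathcal{H}}_n(g)=\mathbb{E}[\mathcal{H}_n(\mathcal{P}_g)]$. To specify the dependence of the functional on a metric $\mathsf d$ one writes $\mathcal{H}_n(\mathcal{X};\mathsf{d})$ and $\overline{\mathcal{H}}_n(g;\mathsf{d})=\mathbb{E}[\mathcal{H}_n(\mathcal{P}_g;\mathsf{d})]$. Conditions. (1) Rigidity: $\mathcal{H}_n(x+R(\mathcal{X}))=\mathcal{H}_n(\mathcal{X})$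 for every finite $\mathcal{X}\subset\mathbb{R}^D$, $x\in\mathbb{R}^D$, $R\in SO(D)$. (2) Control homogeneity: for a probability density $f$ and any $c>1$, $\lim_{n\to\infty}\overline{\mathcal{H}}_{cn}(nf)/\overline{\mathcal{H}}_n(nf)=1$. (3) Scale-invariant reference: with $f_\epsilon=\epsilon^{-d}\mathbf{1}_{[0,\epsilon]^d}$, there is a number $\overline{\mathcal{H}}^*$ such that $\lim_{n\to\infty}\frac1n\overline{\mathcal{H}}_n(nf_\epsilon)=\overline{\mathcal{H}}^*$ for every $\epsilon\in(0,1]$. (4) Continuity: if $f$ is a probability density and $\{f_i\}$ is a sequence of nonnegative functions with $f_i\le f_j$ whenever $i\le j$ and $f_i\to f$ pointwise, then $\lim_{i\to\infty}\limsup_{n\to\infty}\frac1n|\overline{\mathcal{H}}_n(nf)-\overline{\mathcal{H}}_n(nf_i)|=0$. (5) Cube additivity: let $Q=[0,1]^d$ be partitioned into cubes $Q_1,\dots,Q_{m^d}$ of side $1/m$, $f=\mathbf{1}_Q$, $f_i=c_im^d\mathbf{1}_{Q_i}$ with $c_i\ge0$, $\sum_ic_i=1$. Then $\lim_{n\to\infty}\frac1n\big|\overline{\mathcal{H}}_n(nf)-\sum_{i=1}^{m^d}\overline{\mathcal{H}}_n(nf_i)\big|=0$. (6) Simplex additivity: for any admissible triangulation $\phi:K\to M$ and probability density $f:M\to\mathbb{R}_{\ge0}$, $\lim_{n\to\infty}\frac1n\big|\overline{\mathcal{H}}_n(nf)-\sum_{\dim\sigma=d}\overline{\mathcal{H}}_n(nf|_{\phi(\sigma)})\big|=0$.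 (7) Metric stability: for every affine simplex $\sigma$ with the Euclidean metric $\mathsf{d}_E$ and probability density $f:\sigma\to\mathbb{R}_{\ge0}$, there is a function $\mathcal{E}$ with $\lim_{t\downarrow0}\mathcal{E}(t)=0$ such that for any metric $\mathsf{d}$ on $\sigma$, $\limsup_{n\to\infty}\frac1n|\overline{\mathcal{H}}_n(nf;\mathsf{d})-\overline{\mathcal{H}}_n(nf;\mathsf{d}_E)|\le\mathcal{E}(\Delta(\mathsf{d},\mathsf{d}_E))$, where $\Delta(\mathsf{d}_1,\mathsf{d}_2)$ is the infimum of all $\delta>0$ with $(1+\delta)^{-1}\mathsf{d}_1(x,y)\le\mathsf{d}_2(x,y)\le(1+\delta)\mathsf{d}_1(x,y)$ for all $x,y\in\sigma$. *)

theory Defs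
  imports "HOL-Probability.Probability"
begin

section \<open>Hausdorff measure\<close>

text \<open>Normalised so that the measure of dimension d agrees with Lebesgue measure on
  d-dimensional affine subspaces. Empty covering sets count 0, also when \<open>d = 0\<close>.\<close>

definition hausdorff_weight :: "nat \<Rightarrow> 'a::metric_space set \<Rightarrow> ennreal" where
  "hausdorff_weight d C =
     (if C = {} then 0 else ennreal (unit_ball_vol (real d) * (diameter C / 2) ^ d))"

definition hausdorff_covers :: "real \<Rightarrow> 'a::metric_space set \<Rightarrow> (nat \<Rightarrow> 'a set) set" where
  "hausdorff_covers \<delta> A = {C. A \<subseteq> (\<Union>i. C i) \<and> (\<forall>i. bounded (C i) \<and> diameter (C i) \<le> \<delta>)}"

definition hausdorff_outer :: "nat \<Rightarrow> 'a::metric_space set \<Rightarrow> ennreal" where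
  "hausdorff_outer d A =
     (SUP \<delta>\<in>{0<..}. INF C\<in>hausdorff_covers \<delta> A. \<Sum>i. hausdorff_weight d (C i))"

definition hausdorff :: "nat \<Rightarrow> 'a::metric_space measure" where
  "hausdorff d = measure_of UNIV (sets borel) (hausdorff_outer d)"

subsection \<open>The outer measure is a measure on the Borel sets\<close>

lemma hausdorff_weight_mono:
  assumes "C \<subseteq> D" "bounded D"
  shows "hausdorff_weight d C \<le> hausdorff_weight d D"
proof (cases "C = {}")
  case False
  have "0 \<le> diameter C" "diameter C \<le> diameter D"
    using assms by (auto intro: diameter_subset diameter_ge_0 bounded_subset)
  then show ?thesis using False assms
    by (auto simp: hausdorff_weight_def intro!: ennreal_leI mult_left_mono power_mono)
qed (simp add: hausdorff_weight_def)

lemma hausdorff_outer_empty: "hausdorff_outer d ({} :: 'a::metric_space set) = 0"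
proof -
  have "(INF C\<in>hausdorff_covers \<delta> ({}::'a set). \<Sum>i. hausdorff_weight d (C i)) = 0"
    if "\<delta> > 0" for \<delta>
  proof -
    have "(\<lambda>_. {}) \<in> hausdorff_covers \<delta> ({}::'a set)"
      using that by (simp add: hausdorff_covers_def)
    then have "(INF C\<in>hausdorff_covers \<delta> ({}::'a set). \<Sum>i. hausdorff_weight d (C i)) \<le>
               (\<Sum>i::nat. hausdorff_weight d ({}::'a set))"
      by (rule INF_lower)
    then show ?thesis by (simp add: hausdorff_weight_def)
  qed
  then show ?thesis unfolding hausdorff_outer_def by (auto intro!: SUP_eq_const simp: gt_ex)
qed

lemma hausdorff_outer_mono: "A \<subseteq> B \<Longrightarrow> hausdorff_outer d A \<le> hausdorff_outer d B"
  unfolding hausdorff_outer_def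
  by (intro SUP_mono' INF_superset_mono) (auto simp: hausdorff_covers_def)

lemma hausdorff_outer_ge:
  "\<delta> > 0 \<Longrightarrow> (INF C\<in>hausdorff_covers \<delta> A. \<Sum>i. hausdorff_weight d (C i)) \<le> hausdorff_outer d A"
  unfolding hausdorff_outer_def by (intro SUP_upper) simp

lemma hausdorff_outer_countably_subadditive:
  fixes A :: "nat \<Rightarrow> 'a::metric_space set"
  shows "hausdorff_outer d (\<Union>i. A i) \<le> (\<Sum>i. hausdorff_outer d (A i))"
  unfolding hausdorff_outer_def [of d "\<Union>i. A i"]
proof (rule SUP_least)
  fix \<delta> :: real assume "\<delta> \<in> {0<..}"
  then have \<delta>: "\<delta> > 0" by simp
  let ?I = "\<lambda>A. INF C\<in>hausdorff_covers \<delta> A. \<Sum>i. hausdorff_weight d (C i)"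
  show "?I (\<Union>i. A i) \<le> (\<Sum>i. hausdorff_outer d (A i))"
  proof (cases "\<exists>i. hausdorff_outer d (A i) = \<infinity>")
    case True
    then obtain i where "hausdorff_outer d (A i) = \<infinity>" by auto
    moreover have "hausdorff_outer d (A i) \<le> (\<Sum>i. hausdorff_outer d (A i))"
      using sum_le_suminf [of "\<lambda>i. hausdorff_outer d (A i)" "{i}"] by simp
    ultimately show ?thesis by (simp add: top_unique)
  next
    case False
    show ?thesis
    proof (rule ennreal_le_epsilon)
      fix e :: real assume "e > 0"
      have "\<exists>C\<in>hausdorff_covers \<delta> (A i).
              (\<Sum>j. hausdorff_weight d (C j)) \<le> hausdorff_outer d (A i) + ennreal (e * (1/2) ^ Suc i)" for i
      proof -
        have "?I (A i) \<le> hausdorff_outer d (A i)"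
          by (rule hausdorff_outer_ge [OF \<delta>])
        also have "\<dots> < hausdorff_outer d (A i) + ennreal (e * (1/2) ^ Suc i)"
          using False \<open>e > 0\<close> by (auto simp: ennreal_add_left_cancel_less less_top ennreal_zero_less_mult_iff)
        finally show ?thesis unfolding INF_less_iff by (meson less_imp_le)
      qed
      then obtain C where C: "\<And>i. C i \<in> hausdorff_covers \<delta> (A i)"
        and le: "\<And>i. (\<Sum>j. hausdorff_weight d (C i j)) \<le> hausdorff_outer d (A i) + ennreal (e * (1/2) ^ Suc i)"
        by metis
      define D where "D k = case_prod C (prod_decode k)" for k
      have "D \<in> hausdorff_covers \<delta> (\<Union>i. A i)"
      proof -
        have "x \<in> (\<Union>k. D k)" if x: "x \<in> A i" for x i
        proof -
          obtain j where "x \<in> C i j" using C [of i] x by (auto simp: hausdorff_covers_def)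
          then have "x \<in> D (prod_encode (i, j))" by (simp add: D_def)
          then show ?thesis by blast
        qed
        then show ?thesis using C
          by (auto simp: hausdorff_covers_def D_def split: prod.splits)
      qed
      then have "?I (\<Union>i. A i) \<le> (\<Sum>k. hausdorff_weight d (D k))" by (rule INF_lower)
      also have "\<dots> = (\<Sum>k. (\<lambda>(i, j). hausdorff_weight d (C i j)) (prod_decode k))"
        by (simp add: D_def case_prod_unfold)
      also have "\<dots> = (\<Sum>i. \<Sum>j. hausdorff_weight d (C i j))"
        by (intro suminf_ennreal_2dimen) simp
      also have "\<dots> \<le> (\<Sum>i. hausdorff_outer d (A i) + ennreal (e * (1/2) ^ Suc i))"
        by (intro suminf_le le) auto
      also have "\<dots> = (\<Sum>i. hausdorff_outer d (A i)) + (\<Sum>i. ennreal (e * (1/2) ^ Suc i))"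
        by (simp add: suminf_add)
      also have "(\<Sum>i. ennreal (e * (1/2) ^ Suc i)) = ennreal e"
        using \<open>e > 0\<close> sums_mult [OF power_half_series, of e]
        by (intro suminf_ennreal_eq) auto
      finally show "?I (\<Union>i. A i) \<le> (\<Sum>i. hausdorff_outer d (A i)) + ennreal e" .
    qed
  qed
qed

lemma hausdorff_outer_space: "outer_measure_space UNIV (hausdorff_outer d)"
  by (auto simp: outer_measure_space_def positive_def increasing_def countably_subadditive_def
        hausdorff_outer_empty hausdorff_outer_mono hausdorff_outer_countably_subadditive)

lemma hausdorff_outer_Un: "hausdorff_outer d (A \<union> B) \<le> hausdorff_outer d A + hausdorff_outer d B"
proof -
  have "hausdorff_outer d (\<Union>i. binaryset A B i) \<le> (\<Sum>i. hausdorff_outer d (binaryset A B i))"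
    by (rule hausdorff_outer_countably_subadditive)
  then show ?thesis
    by (simp add: UN_binaryset_eq suminf_binaryset_eq hausdorff_outer_empty)
qed

lemma hausdorff_outer_separated:
  fixes A B :: "'a::metric_space set"
  assumes "r > 0" and sep: "\<And>x y. x \<in> A \<Longrightarrow> y \<in> B \<Longrightarrow> r \<le> dist x y"
  shows "hausdorff_outer d A + hausdorff_outer d B \<le> hausdorff_outer d (A \<union> B)"
proof -
  let ?I = "\<lambda>\<delta> A. INF C\<in>hausdorff_covers \<delta> A. \<Sum>i. hausdorff_weight d (C i)"
  have anti: "?I \<delta>' X \<le> ?I \<delta> X" if "\<delta> \<le> \<delta>'" for \<delta> \<delta>' and X :: "'a set"
    using that by (intro INF_superset_mono) (auto simp: hausdorff_covers_def intro: order_trans)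
  have key: "?I \<delta> A + ?I \<delta> B \<le> ?I \<delta> (A \<union> B)" if "0 < \<delta>" "\<delta> < r" for \<delta>
  proof (rule INF_greatest)
    fix C assume C: "C \<in> hausdorff_covers \<delta> (A \<union> B)"
    have bdd: "bounded (C i)" "diameter (C i) \<le> \<delta>" for i
      using C by (auto simp: hausdorff_covers_def)
    have sub: "(\<lambda>i. C i \<inter> X) \<in> hausdorff_covers \<delta> X" if "X \<subseteq> A \<union> B" for X
    proof -
      have "diameter (C i \<inter> X) \<le> \<delta>" for i
        using bdd [of i] diameter_subset [of "C i \<inter> X" "C i"] by auto
      then show ?thesis using C that by (auto simp: hausdorff_covers_def bounded_Int)
    qed
    have "?I \<delta> A + ?I \<delta> B \<le>
          (\<Sum>i. hausdorff_weight d (C i \<inter> A)) + (\<Sum>i. hausdorff_weight d (C i \<inter> B))"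
      by (intro add_mono INF_lower2 [OF sub]) auto
    also have "\<dots> = (\<Sum>i. hausdorff_weight d (C i \<inter> A) + hausdorff_weight d (C i \<inter> B))"
      by (simp add: suminf_add)
    also have "\<dots> \<le> (\<Sum>i. hausdorff_weight d (C i))"
    proof (intro suminf_le)
      fix i
      have "C i \<inter> A = {} \<or> C i \<inter> B = {}"
      proof (rule ccontr)
        assume "\<not> ?thesis"
        then obtain x y where xy: "x \<in> C i" "x \<in> A" "y \<in> C i" "y \<in> B" by auto
        then have "r \<le> diameter (C i)"
          using diameter_bounded_bound [OF bdd(1) [of i] xy(1,3)] sep [OF xy(2,4)] by linarith
        then show False using bdd(2) [of i] that by linarith
      qed
      then show "hausdorff_weight d (C i \<inter> A) + hausdorff_weight d (C i \<inter> B) \<le> hausdorff_weight d (C i)"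
        using hausdorff_weight_mono [OF _ bdd(1), of _ i] 
        by (auto simp: hausdorff_weight_def [of d "{}"])
    qed auto
    finally show "?I \<delta> A + ?I \<delta> B \<le> (\<Sum>i. hausdorff_weight d (C i))" .
  qed
  have le: "?I \<delta> A + ?I \<delta>' B \<le> hausdorff_outer d (A \<union> B)" if "0 < \<delta>" "0 < \<delta>'" for \<delta> \<delta>'
  proof -
    define t where "t = min (min \<delta> \<delta>') (r / 2)"
    have t: "0 < t" "t < r" "t \<le> \<delta>" "t \<le> \<delta>'" using that \<open>r > 0\<close> by (auto simp: t_def min_def)
    have "?I \<delta> A + ?I \<delta>' B \<le> ?I t A + ?I t B" using t by (intro add_mono anti)
    also have "\<dots> \<le> ?I t (A \<union> B)" using t by (intro key)
    also have "\<dots> \<le> hausdorff_outer d (A \<union> B)" using t by (intro hausdorff_outer_ge)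
    finally show ?thesis .
  qed
  show ?thesis
    unfolding hausdorff_outer_def [of d A] hausdorff_outer_def [of d B]
    by (subst ennreal_SUP_add_left [symmetric], force, rule SUP_least,
        subst ennreal_SUP_add_right, force, rule SUP_least) (use le in auto)
qed

lemma hausdorff_outer_closed:
  fixes F :: "'a::metric_space set"
  assumes "closed F"
  shows "hausdorff_outer d (A \<inter> F) + hausdorff_outer d (A - F) \<le> hausdorff_outer d A"
proof (cases "F = {} \<or> hausdorff_outer d A = \<infinity>")
  case True
  then show ?thesis by (auto simp: hausdorff_outer_empty)
next
  case False
  then have "F \<noteq> {}" and fin: "hausdorff_outer d A < \<infinity>" by (auto simp: less_top)
  define h where "h x = infdist x F" for x
  define P where "P k = {x\<in>A. 1 / real (Suc k) \<le> h x}" for k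
  define R where "R k = {x\<in>A. 1 / real (k + 2) \<le> h x \<and> h x < 1 / real (Suc k)}" for k
  have sep: "a - b \<le> dist x y" if "a \<le> h x" "h y \<le> b" for a b x y
    using infdist_triangle [of x F y] that by (simp add: h_def dist_commute)
  have shells: "(\<Sum>k<N. hausdorff_outer d (R (2 * k + e))) \<le> hausdorff_outer d A"
    for N e
  proof -
    have "(\<Sum>k<N. hausdorff_outer d (R (2 * k + e))) \<le> hausdorff_outer d (\<Union>k<N. R (2 * k + e))"
    proof (induction N)
      case (Suc N)
      let ?a = "1 / real (2 * N + e)" and ?b = "1 / real (2 * N + e + 1)"
      have "hausdorff_outer d (\<Union>k<N. R (2 * k + e)) + hausdorff_outer d (R (2 * N + e)) \<le>
            hausdorff_outer d ((\<Union>k<N. R (2 * k + e)) \<union> R (2 * N + e))"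
      proof (cases "N = 0")
        case False
        show ?thesis
        proof (rule hausdorff_outer_separated)
          show "0 < ?a - ?b" using False by (simp add: divide_strict_left_mono)
          fix x y assume "x \<in> (\<Union>k<N. R (2 * k + e))" and y: "y \<in> R (2 * N + e)"
          then obtain k where k: "k < N" "x \<in> R (2 * k + e)" by auto
          have "?a \<le> 1 / real (2 * k + e + 2)"
            using k False by (intro divide_left_mono) auto
          then have "?a \<le> h x" using k by (simp add: R_def)
          moreover have "h y \<le> ?b" using y by (simp add: R_def)
          ultimately show "?a - ?b \<le> dist x y" by (rule sep)
        qed
      qed (simp add: hausdorff_outer_empty)
      then show ?case using Suc
        by (simp add: lessThan_Suc Un_commute add.commute) (meson add_left_mono order_trans)
    qed (simp add: hausdorff_outer_empty)
    also have "\<dots> \<le> hausdorff_outer d A" by (rule hausdorff_outer_mono) (auto simp: R_def)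
    finally show ?thesis .
  qed
  have "(\<Sum>k<N. hausdorff_outer d (R k)) \<le> hausdorff_outer d A + hausdorff_outer d A" for N
  proof -
    have "(\<Sum>k<N. hausdorff_outer d (R k)) \<le> (\<Sum>k<2 * N. hausdorff_outer d (R k))"
      by (intro sum_mono2) auto
    also have "\<dots> = (\<Sum>k<N. hausdorff_outer d (R (2 * k + 0))) + (\<Sum>k<N. hausdorff_outer d (R (2 * k + 1)))"
      by (induction N) (auto simp: algebra_simps)
    also have "\<dots> \<le> hausdorff_outer d A + hausdorff_outer d A"
      by (intro add_mono shells)
    finally show ?thesis .
  qed
  then have "(\<Sum>k. hausdorff_outer d (R k)) \<le> hausdorff_outer d A + hausdorff_outer d A"
    by (intro suminf_le_const) auto
  also have "\<dots> < \<infinity>" using fin by simp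
  finally have Rfin: "(\<Sum>k. hausdorff_outer d (R k)) \<noteq> \<infinity>" by simp
  have tail: "(\<lambda>k. \<Sum>i. hausdorff_outer d (R (i + k))) \<longlonglongrightarrow> 0"
  proof -
    let ?S = "\<Sum>k. hausdorff_outer d (R k)"
    have eq: "(\<Sum>i. hausdorff_outer d (R (i + k))) = ?S - (\<Sum>i<k. hausdorff_outer d (R i))" for k
    proof -
      have S: "?S = (\<Sum>i. hausdorff_outer d (R (i + k))) + (\<Sum>i<k. hausdorff_outer d (R i))"
        by (rule suminf_offset) simp
      then have "(\<Sum>i<k. hausdorff_outer d (R i)) \<noteq> \<top>" using Rfin by auto
      with S show ?thesis by simp
    qed
    have "(\<lambda>k. ?S - (\<Sum>i<k. hausdorff_outer d (R i))) \<longlonglongrightarrow> ?S - ?S"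
      using Rfin by (intro tendsto_diff_ennreal tendsto_const summable_LIMSEQ) auto
    then show ?thesis using Rfin by (simp add: eq)
  qed
  have "hausdorff_outer d (A \<inter> F) + hausdorff_outer d (A - F) \<le>
        hausdorff_outer d A + (\<Sum>i. hausdorff_outer d (R (i + k)))" for k
  proof -
    have "A - F \<subseteq> P k \<union> (\<Union>i. R (i + k))"
    proof
      fix x assume x: "x \<in> A - F"
      then have "h x > 0"
        using \<open>closed F\<close> \<open>F \<noteq> {}\<close> by (auto simp: h_def infdist_pos_not_in_closed)
      show "x \<in> P k \<union> (\<Union>i. R (i + k))"
      proof (cases "1 / real (Suc k) \<le> h x")
        case True
        then show ?thesis using x by (simp add: P_def)
      next
        case False
        define m where "m = (LEAST m. 1 / real (Suc m) \<le> h x)"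
        have ex: "\<exists>m. 1 / real (Suc m) \<le> h x"
          using \<open>h x > 0\<close> nat_approx_posE [of "h x"] by (metis less_imp_le)
        have m: "1 / real (Suc m) \<le> h x" unfolding m_def by (rule LeastI_ex [OF ex])
        have "k < m"
        proof (rule ccontr)
          assume "\<not> k < m"
          then have "1 / real (Suc k) \<le> 1 / real (Suc m)" by (intro divide_left_mono) auto
          with m False show False by linarith
        qed
        then obtain j where j: "m = Suc j" "k \<le> j" by (cases m) auto
        then have "\<not> 1 / real (Suc j) \<le> h x" unfolding m_def
          using not_less_Least [of j "\<lambda>m. 1 / real (Suc m) \<le> h x"] by simp
        then have "x \<in> R j" using x m j by (simp add: R_def add.commute)
        then have "x \<in> R ((j - k) + k)" using j by simp
        then show ?thesis by blast
      qed
    qed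
    then have "hausdorff_outer d (A - F) \<le> hausdorff_outer d (P k \<union> (\<Union>i. R (i + k)))"
      by (rule hausdorff_outer_mono)
    also have "\<dots> \<le> hausdorff_outer d (P k) + hausdorff_outer d (\<Union>i. R (i + k))"
      by (rule hausdorff_outer_Un)
    also have "\<dots> \<le> hausdorff_outer d (P k) + (\<Sum>i. hausdorff_outer d (R (i + k)))"
      by (intro add_left_mono hausdorff_outer_countably_subadditive)
    finally have "hausdorff_outer d (A \<inter> F) + hausdorff_outer d (A - F) \<le>
      (hausdorff_outer d (A \<inter> F) + hausdorff_outer d (P k)) + (\<Sum>i. hausdorff_outer d (R (i + k)))"
      by (simp add: add.assoc add_left_mono)
    also have "hausdorff_outer d (A \<inter> F) + hausdorff_outer d (P k) \<le>
        hausdorff_outer d ((A \<inter> F) \<union> P k)"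
    proof (rule hausdorff_outer_separated)
      show "0 < 1 / real (Suc k) - 0" by simp
      fix x y assume "x \<in> A \<inter> F" "y \<in> P k"
      then show "1 / real (Suc k) - 0 \<le> dist x y"
        by (subst dist_commute, intro sep) (auto simp: P_def h_def)
    qed
    also have "\<dots> \<le> hausdorff_outer d A" by (rule hausdorff_outer_mono) (auto simp: P_def)
    finally show ?thesis by (simp add: add_right_mono)
  qed
  moreover have "(\<lambda>k. hausdorff_outer d A + (\<Sum>i. hausdorff_outer d (R (i + k)))) \<longlonglongrightarrow>
                 hausdorff_outer d A + 0"
    by (intro tendsto_add tendsto_const tail)
  ultimately show ?thesis
    by (intro LIMSEQ_le_const [where X = "\<lambda>k. hausdorff_outer d A + (\<Sum>i. hausdorff_outer d (R (i + k)))"]) auto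
qed

lemma measure_space_hausdorff: "measure_space UNIV (sets borel) (hausdorff_outer d)"
proof -
  let ?f = "hausdorff_outer d :: 'a set \<Rightarrow> ennreal"
  interpret U: sigma_algebra UNIV "UNIV :: 'a set set"
    using sigma_algebra_Pow [of "UNIV :: 'a set"] by simp
  let ?L = "lambda_system UNIV UNIV ?f"
  have L: "measure_space UNIV ?L ?f" by (rule U.caratheodory_lemma [OF hausdorff_outer_space])
  then interpret L: sigma_algebra UNIV ?L by (simp add: measure_space_def)
  have "F \<in> ?L" if "closed F" for F
  proof -
    have "?f (F \<inter> x) + ?f ((UNIV - F) \<inter> x) = ?f x" for x
    proof (rule antisym)
      have "(F \<inter> x) \<union> ((UNIV - F) \<inter> x) = x" by auto
      then show "?f x \<le> ?f (F \<inter> x) + ?f ((UNIV - F) \<inter> x)"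
        using hausdorff_outer_Un [of d "F \<inter> x" "(UNIV - F) \<inter> x"] by simp
      have "(UNIV - F) \<inter> x = x - F" by auto
      then show "?f (F \<inter> x) + ?f ((UNIV - F) \<inter> x) \<le> ?f x"
        using hausdorff_outer_closed [OF that, of d x] by (simp add: Int_commute)
    qed
    then show ?thesis by (simp add: lambda_system_def)
  qed
  then have "sigma_sets UNIV {F :: 'a set. closed F} \<subseteq> ?L"
    by (intro L.sigma_sets_subset) auto
  then have sub: "sets (borel :: 'a measure) \<subseteq> ?L"
    by (simp add: borel_eq_closed)
  have "countably_additive (sets (borel :: 'a measure)) ?f"
    using L sub by (auto simp: measure_space_def countably_additive_def)
  then show ?thesis
    by (simp add: measure_space_def positive_def hausdorff_outer_empty
          sets.sigma_algebra_axioms [of "borel :: 'a measure", simplified])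
qed

lemma sets_hausdorff [simp, measurable_cong]: "sets (hausdorff d) = sets borel"
  by (simp add: hausdorff_def sets.sigma_sets_eq [of borel, simplified])

lemma space_hausdorff [simp]: "space (hausdorff d) = UNIV"
  by (simp add: hausdorff_def space_measure_of_conv)

lemma emeasure_hausdorff: "A \<in> sets borel \<Longrightarrow> emeasure (hausdorff d) A = hausdorff_outer d A"
  unfolding hausdorff_def using measure_space_hausdorff [of d]
  by (subst emeasure_measure_of_sigma) (auto simp: measure_space_def)

section \<open>Triangulations\<close>

definition C2_on :: "'k::euclidean_space set \<Rightarrow> ('k \<Rightarrow> 'a::real_normed_vector) \<Rightarrow> bool" where
  "C2_on U g \<longleftrightarrow>
     (\<exists>D1 D2. (\<forall>b\<in>Basis. \<forall>x\<in>U. ((\<lambda>t. g (x + t *\<^sub>R b)) has_vector_derivative D1 b x) (at 0)) \<and>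
              (\<forall>b\<in>Basis. \<forall>c\<in>Basis. \<forall>x\<in>U.
                 ((\<lambda>t. D1 b (x + t *\<^sub>R c)) has_vector_derivative D2 b c x) (at 0)) \<and>
              (\<forall>b\<in>Basis. \<forall>c\<in>Basis. continuous_on U (D2 b c)))"

text \<open>A \<open>C\<^sup>2\<close> map on a closed simplex extends to a \<open>C\<^sup>2\<close> map on a neighbourhood. For an embedding
  the differential is moreover injective on the directions of the simplex (these are the
  vectors in \<open>span {q - p | q \<in> \<sigma>}\<close>).\<close>

definition C2_embedding_on ::
    "'k::euclidean_space set \<Rightarrow> ('k \<Rightarrow> 'a::real_normed_vector) \<Rightarrow> bool" where
  "C2_embedding_on \<sigma> \<phi> \<longleftrightarrow>
     inj_on \<phi> \<sigma> \<and>
     (\<exists>U g. open U \<and> \<sigma> \<subseteq> U \<and> C2_on U g \<and> (\<forall>x\<in>\<sigma>. g x = \<phi> x) \<and>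
            (\<forall>p\<in>\<sigma>. inj_on (frechet_derivative g (at p)) (span ((\<lambda>q. q - p) ` \<sigma>))))"

definition C2_triangulation ::
    "'k::euclidean_space set set \<Rightarrow> ('k \<Rightarrow> 'a::real_normed_vector) \<Rightarrow> 'a set \<Rightarrow> bool" where
  "C2_triangulation K \<phi> M \<longleftrightarrow>
     simplicial_complex K \<and> (\<exists>\<psi>. homeomorphism (\<Union>K) M \<phi> \<psi>) \<and> (\<forall>\<sigma>\<in>K. C2_embedding_on \<sigma> \<phi>)"

definition purely_dimensional :: "nat \<Rightarrow> 'k::euclidean_space set set \<Rightarrow> bool" where
  "purely_dimensional d K \<longleftrightarrow>
     (\<forall>\<sigma>\<in>K. (\<forall>\<tau>\<in>K. \<sigma> \<subseteq> \<tau> \<longrightarrow> \<tau> = \<sigma>) \<longrightarrow> int d simplex \<sigma>)"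

definition top_simplices :: "nat \<Rightarrow> 'k::euclidean_space set set \<Rightarrow> 'k set set" where
  "top_simplices d K = {\<sigma>\<in>K. int d simplex \<sigma>}"

text \<open>The intersection of all faces containing p is itself a face.\<close>

definition min_face :: "'k::euclidean_space set \<Rightarrow> 'k \<Rightarrow> 'k set" where
  "min_face \<sigma> p = \<Inter>{F. F face_of \<sigma> \<and> p \<in> F}"

text \<open>Derivatives at \<open>\<phi> p\<close> of the images of the segments from p to the points of F. When p is a
  relative interior point of F they span the tangent space of \<open>\<phi> ` F\<close> at \<open>\<phi> p\<close>.\<close>

definition tangent_vectors ::
    "('k::euclidean_space \<Rightarrow> 'a::real_normed_vector) \<Rightarrow> 'k set \<Rightarrow> 'k \<Rightarrow> 'a set" where
  "tangent_vectors \<phi> F p =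
     {u. \<exists>q\<in>F. ((\<lambda>t. \<phi> (p + t *\<^sub>R (q - p))) has_vector_derivative u) (at 0 within {0..1})}"

text \<open>The cone at the point \<open>x = \<phi> p\<close> of the curved simplex \<open>\<phi> ` \<sigma>\<close>.\<close>

definition normal_inward_cone ::
    "('k::euclidean_space \<Rightarrow> 'a::real_inner) \<Rightarrow> 'k set \<Rightarrow> 'k \<Rightarrow> 'a set" where
  "normal_inward_cone \<phi> \<sigma> p =
     {v. (\<forall>u\<in>tangent_vectors \<phi> (min_face \<sigma> p) p. orthogonal u v) \<and>
         (\<exists>\<epsilon>>0. \<phi> p + \<epsilon> *\<^sub>R v \<in> \<phi> ` \<sigma>)}"

text \<open>Infima are taken in the extended reals, so that an empty infimum is \<open>\<infinity>\<close>.\<close>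

definition spherical_distance :: "'a::real_inner set \<Rightarrow> 'a set \<Rightarrow> ereal" where
  "spherical_distance A B =
     (INF u\<in>A \<inter> sphere 0 1. INF v\<in>B \<inter> sphere 0 1. ereal (arccos (u \<bullet> v)))"

definition strata_separation_angle ::
    "nat \<Rightarrow> 'k::euclidean_space set set \<Rightarrow> ('k \<Rightarrow> 'a::real_inner) \<Rightarrow> ereal" where
  "strata_separation_angle d K \<phi> =
     Inf {spherical_distance (normal_inward_cone \<phi> \<sigma>\<^sub>1 p) (normal_inward_cone \<phi> \<sigma>\<^sub>2 p) | \<sigma>\<^sub>1 \<sigma>\<^sub>2 p.
            \<sigma>\<^sub>1 \<in> top_simplices d K \<and> \<sigma>\<^sub>2 \<in> top_simplices d K \<and> \<sigma>\<^sub>1 \<noteq> \<sigma>\<^sub>2 \<and>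
            p \<in> rel_interior (\<sigma>\<^sub>1 \<inter> \<sigma>\<^sub>2)}"

definition admissible_triangulation ::
    "nat \<Rightarrow> 'k::euclidean_space set set \<Rightarrow> ('k \<Rightarrow> 'a::real_inner) \<Rightarrow> 'a set \<Rightarrow> bool" where
  "admissible_triangulation d K \<phi> M \<longleftrightarrow>
     C2_triangulation K \<phi> M \<and> compact M \<and> purely_dimensional d K \<and>
     strata_separation_angle d K \<phi> > 0"

text \<open>A compact complex is finite, and a finite complex of dimension \<open>d \<le> D\<close> can be realised
  with affine simplices in dimension \<open>2 * D + 1\<close>. Hence complexes in
  \<open>\<real>\<^sup>D \<times> \<real>\<^sup>D \<times> \<real>\<close> represent all complexes that can triangulate a compact subset of
  \<open>\<real>\<^sup>D\<close>.\<close>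

type_synonym 'n complex_space = "(real^'n) \<times> (real^'n) \<times> real"

definition admissibly_triangulable :: "nat \<Rightarrow> (real^'n) set \<Rightarrow> bool" where
  "admissibly_triangulable d M \<longleftrightarrow>
     (\<exists>(K :: 'n complex_space set set) \<phi>. admissible_triangulation d K \<phi> M)"

section \<open>Densities\<close>

text \<open>A density on S is represented by its extension by 0.\<close>

definition prob_density_on :: "nat \<Rightarrow> 'a::metric_space set \<Rightarrow> ('a \<Rightarrow> real) \<Rightarrow> bool" where
  "prob_density_on d S f \<longleftrightarrow>
     f \<in> borel_measurable borel \<and> (\<forall>x. 0 \<le> f x) \<and> (\<forall>x. x \<notin> S \<longrightarrow> f x = 0) \<and>
     (\<integral>\<^sup>+x. ennreal (f x) \<partial>hausdorff d) = 1"

definition supp :: "('a::topological_space \<Rightarrow> real) \<Rightarrow> 'a set" where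
  "supp f = closure {x. f x \<noteq> 0}"

text \<open>If f has no zero on its support, the second alternative fails: then \<open>infdist\<close> to
  the empty set is 0 by convention, which would force f to vanish on the support.\<close>

definition good_density :: "nat \<Rightarrow> 'a::metric_space set \<Rightarrow> ('a \<Rightarrow> real) \<Rightarrow> bool" where
  "good_density d M f \<longleftrightarrow>
     prob_density_on d M f \<and> compact (supp f) \<and>
     ((INF x\<in>supp f. f x) > 0 \<or>
      (\<exists>cm cp q. cm > 0 \<and> cp > 0 \<and> q > 0 \<and>
         (\<forall>x\<in>supp f. let \<delta> = infdist x (f -` {0} \<inter> supp f)
                      in cm * \<delta> powr q \<le> f x \<and> f x \<le> cp * \<delta> powr q)))"

section \<open>Functionals of Poisson point processes\<close>

text \<open>\<open>H n X \<delta>\<close> is the value on the finite set X with control parameter n and metric \<open>\<delta>\<close>; the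
  value without explicit metric is \<open>H n X dist\<close>. The control parameter is real since
  control homogeneity replaces n by \<open>c * n\<close> for real c.\<close>

type_synonym 'n functional =
  "real \<Rightarrow> (real^'n) set \<Rightarrow> (real^'n \<Rightarrow> real^'n \<Rightarrow> real) \<Rightarrow> real"

definition mass :: "nat \<Rightarrow> ('a::metric_space \<Rightarrow> real) \<Rightarrow> ennreal" where
  "mass d g = (\<integral>\<^sup>+x. ennreal (g x) \<partial>hausdorff d)"

text \<open>The Poisson point process with intensity g of finite positive mass m: a Poisson
  distributed number N of points with mean m, and independent points distributed with
  density \<open>g / m\<close> of which the first N are retained.\<close>

definition poisson_space ::
    "nat \<Rightarrow> ('a::metric_space \<Rightarrow> real) \<Rightarrow> (nat \<times> (nat \<Rightarrow> 'a)) measure" where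
  "poisson_space d g =
     (let m = enn2real (mass d g)
      in measure_pmf (poisson_pmf m) \<Otimes>\<^sub>M
         (\<Pi>\<^sub>M i\<in>(UNIV :: nat set). density (hausdorff d) (\<lambda>x. ennreal (g x / m))))"

definition poisson_process :: "nat \<times> (nat \<Rightarrow> 'a) \<Rightarrow> 'a set" where
  "poisson_process = (\<lambda>(N, x). x ` {..<N})"

text \<open>The process of intensity 0 is empty. Integrability is required separately in
  \<open>has_expectations\<close>.\<close>

definition expected ::
    "nat \<Rightarrow> 'n::finite functional \<Rightarrow> real \<Rightarrow> (real^'n \<Rightarrow> real) \<Rightarrow> (real^'n \<Rightarrow> real^'n \<Rightarrow> real) \<Rightarrow> real" where
  "expected d H n g \<delta> =
     (if mass d g = 0 then H n {} \<delta>
      else (\<integral>\<omega>. H n (poisson_process \<omega>) \<delta> \<partial>poisson_space d g))"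

text \<open>Metrics on S are represented by functions that vanish outside of \<open>S \<times> S\<close>.\<close>

definition metric_on :: "'a set \<Rightarrow> ('a \<Rightarrow> 'a \<Rightarrow> real) \<Rightarrow> bool" where
  "metric_on S \<delta> \<longleftrightarrow> Metric_space S \<delta> \<and> (\<forall>x y. \<not> (x \<in> S \<and> y \<in> S) \<longrightarrow> \<delta> x y = 0)"

definition pullback_metric ::
    "'a set \<Rightarrow> ('a \<Rightarrow> 'b::metric_space) \<Rightarrow> 'a \<Rightarrow> 'a \<Rightarrow> real" where
  "pullback_metric S \<phi> x y = (if x \<in> S \<and> y \<in> S then dist (\<phi> x) (\<phi> y) else 0)"

definition distortions ::
    "'a set \<Rightarrow> ('a \<Rightarrow> 'a \<Rightarrow> real) \<Rightarrow> ('a \<Rightarrow> 'a \<Rightarrow> real) \<Rightarrow> real set" where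
  "distortions S \<delta>\<^sub>1 \<delta>\<^sub>2 =
     {t. t > 0 \<and> (\<forall>x\<in>S. \<forall>y\<in>S. inverse (1 + t) * \<delta>\<^sub>1 x y \<le> \<delta>\<^sub>2 x y \<and> \<delta>\<^sub>2 x y \<le> (1 + t) * \<delta>\<^sub>1 x y)}"

text \<open>Metrics comparable to the Euclidean one, that is, with a finite value of
  \<open>Inf (distortions S \<delta> dist)\<close>.\<close>

definition comparable_metric_on :: "'a::metric_space set \<Rightarrow> ('a \<Rightarrow> 'a \<Rightarrow> real) \<Rightarrow> bool" where
  "comparable_metric_on S \<delta> \<longleftrightarrow> metric_on S \<delta> \<and> distortions S \<delta> dist \<noteq> {}"

text \<open>The standing requirement that the expectations of the functional exist.\<close>

definition has_expectations :: "nat \<Rightarrow> 'n::finite functional \<Rightarrow> bool" where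
  "has_expectations d H \<longleftrightarrow>
     (\<forall>n>0. \<forall>g\<in>borel_measurable borel. (\<forall>x. 0 \<le> g x) \<and> 0 < mass d g \<and> mass d g < \<infinity> \<longrightarrow>
        integrable (poisson_space d g) (\<lambda>\<omega>. H n (poisson_process \<omega>) dist) \<and>
        (\<forall>\<sigma> \<delta>. int d simplex \<sigma> \<and> (\<forall>x. x \<notin> \<sigma> \<longrightarrow> g x = 0) \<and> comparable_metric_on \<sigma> \<delta> \<longrightarrow>
           integrable (poisson_space d g) (\<lambda>\<omega>. H n (poisson_process \<omega>) \<delta>)))"

text \<open>The meaning of the metric argument: the value on a subset X of an affine simplex with
  the metric induced by an embedding \<open>\<phi>\<close> of the simplex is the value on \<open>\<phi> ` X\<close> with
  the Euclidean metric. Without this the metric argument would be unrelated to the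
  values on curved simplices.\<close>

definition metric_compatible :: "nat \<Rightarrow> 'n::finite functional \<Rightarrow> bool" where
  "metric_compatible d H \<longleftrightarrow>
     (\<forall>n>0. \<forall>\<sigma> \<phi> X. int d simplex \<sigma> \<and> C2_embedding_on \<sigma> \<phi> \<and> finite X \<and> X \<subseteq> \<sigma> \<longrightarrow>
        H n X (pullback_metric \<sigma> \<phi>) = H n (\<phi> ` X) dist)"

section \<open>The conditions\<close>

definition rigidity :: "'n::finite functional \<Rightarrow> bool" where
  "rigidity H \<longleftrightarrow>
     (\<forall>n>0. \<forall>X x R. finite X \<and> rotation_matrix R \<longrightarrow>
        H n ((\<lambda>y. x + R *v y) ` X) dist = H n X dist)"

definition control_homogeneity :: "nat \<Rightarrow> 'n::finite functional \<Rightarrow> bool" where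
  "control_homogeneity d H \<longleftrightarrow>
     (\<forall>f c. prob_density_on d UNIV f \<and> c > 1 \<longrightarrow>
        ((\<lambda>n. expected d H (c * n) (\<lambda>x. n * f x) dist / expected d H n (\<lambda>x. n * f x) dist)
          \<longlongrightarrow> 1) at_top)"

text \<open>The space \<open>\<real>\<^sup>d\<close> is embedded in \<open>\<real>\<^sup>D\<close> by the choice of a set J of d coordinates.\<close>

definition cube :: "'n set \<Rightarrow> real \<Rightarrow> (real^'n) set" where
  "cube J \<epsilon> = {x. (\<forall>i\<in>J. 0 \<le> x $ i \<and> x $ i \<le> \<epsilon>) \<and> (\<forall>i. i \<notin> J \<longrightarrow> x $ i = 0)}"

definition scale_invariant_reference :: "'n set \<Rightarrow> 'n::finite functional \<Rightarrow> bool" where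
  "scale_invariant_reference J H \<longleftrightarrow>
     (\<exists>Hs::real. \<forall>\<epsilon>. 0 < \<epsilon> \<and> \<epsilon> \<le> 1 \<longrightarrow>
        ((\<lambda>n. 1 / n * expected (card J) H n
                 (\<lambda>x. n * (inverse (\<epsilon> ^ card J) * indicator (cube J \<epsilon>) x)) dist)
          \<longlongrightarrow> Hs) at_top)"

definition continuity :: "nat \<Rightarrow> 'n::finite functional \<Rightarrow> bool" where
  "continuity d H \<longleftrightarrow>
     (\<forall>f (fs :: nat \<Rightarrow> real^'n \<Rightarrow> real).
        prob_density_on d UNIV f \<and>
        (\<forall>i. fs i \<in> borel_measurable borel \<and> (\<forall>x. 0 \<le> fs i x)) \<and>
        (\<forall>i j x. i \<le> j \<longrightarrow> fs i x \<le> fs j x) \<and> (\<forall>x. (\<lambda>i. fs i x) \<longlonglongrightarrow> f x) \<longrightarrow>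
        (\<lambda>i. Limsup at_top (\<lambda>n::real. ereal (1 / n *
               \<bar>expected d H n (\<lambda>x. n * f x) dist - expected d H n (\<lambda>x. n * fs i x) dist\<bar>)))
          \<longlonglongrightarrow> 0)"

definition subcube :: "'n set \<Rightarrow> nat \<Rightarrow> ('n \<Rightarrow> nat) \<Rightarrow> (real^'n) set" where
  "subcube J m k =
     {x. (\<forall>i\<in>J. real (k i) / real m \<le> x $ i \<and> x $ i \<le> (real (k i) + 1) / real m) \<and>
         (\<forall>i. i \<notin> J \<longrightarrow> x $ i = 0)}"

text \<open>The first density is the uniform one for every choice of the weights c.\<close>

definition cube_additivity :: "'n set \<Rightarrow> 'n::finite functional \<Rightarrow> bool" where
  "cube_additivity J H \<longleftrightarrow>
     (\<forall>m\<ge>1. \<forall>c. let P = PiE J (\<lambda>_. {..<m}) in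
        (\<forall>k\<in>P. 0 \<le> c k) \<and> (\<Sum>k\<in>P. c k) = 1 \<longrightarrow>
        ((\<lambda>n. 1 / n *
            \<bar>expected (card J) H n (\<lambda>x. n * indicator (cube J 1) x) dist -
             (\<Sum>k\<in>P. expected (card J) H n
                (\<lambda>x. n * (c k * real m ^ card J * indicator (subcube J m k) x)) dist)\<bar>)
          \<longlongrightarrow> 0) at_top)"

definition simplex_additivity :: "nat \<Rightarrow> 'n::finite functional \<Rightarrow> bool" where
  "simplex_additivity d H \<longleftrightarrow>
     (\<forall>(K :: 'n complex_space set set) \<phi> M f.
        admissible_triangulation d K \<phi> M \<and> prob_density_on d M f \<longrightarrow>
        ((\<lambda>n. 1 / n *
            \<bar>expected d H n (\<lambda>x. n * f x) dist -
             (\<Sum>\<sigma>\<in>top_simplices d K. expected d H n (\<lambda>x. n * (f x * indicator (\<phi> ` \<sigma>) x)) dist)\<bar>)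
          \<longlongrightarrow> 0) at_top)"

definition metric_stability :: "nat \<Rightarrow> 'n::finite functional \<Rightarrow> bool" where
  "metric_stability d H \<longleftrightarrow>
     (\<forall>\<sigma> f. int d simplex \<sigma> \<and> prob_density_on d \<sigma> f \<longrightarrow>
        (\<exists>E :: real \<Rightarrow> real. (E \<longlongrightarrow> 0) (at_right 0) \<and>
           (\<forall>\<delta>. comparable_metric_on \<sigma> \<delta> \<longrightarrow>
              Limsup at_top (\<lambda>n::real. ereal (1 / n *
                \<bar>expected d H n (\<lambda>x. n * f x) \<delta> - expected d H n (\<lambda>x. n * f x) dist\<bar>))
              \<le> ereal (E (Inf (distortions \<sigma> \<delta> dist))))))"

end

theory Submission
 imports Defs
begin

text \<open>Disjoint curved simplices always form an admissible triangulation, so simplex additivity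
 together with continuity makes the normalised expectation \<open>h mu n\<close>, as a function of the
 intensity measure, finitely additive up to \<open>o(1)\<close> on the Borel subsets of a curved simplex.
 On flat pieces cube additivity and the reference limit determine it on cubes, hence for
 all densities. A small piece of a curved simplex is the image of a cube under a nearly isometric
 map that can be cut off outside of the cube. A gliding hump argument bounds the error by a multiple
 of the mass; tiling a unit cube with translated copies of one small curved cell and applying metric
 stability to the whole cube shows that the relative error of the cell is small.\<close>

text \<open>No hypothesis bounds the values, and control homogeneity speaks of quotients only.
  Continuity and additivity are assumed for probability densities, so passing to a piece of smaller
  mass costs a factor tending to 1, which is harmless only for bounded values. This is why
  additivity appears twice, before and after boundedness, which itself rests on a nested sequence of
  cells. The second obstacle: the function in metric stability depends on the simplex and on the
  density, so nothing is uniform as simplices shrink. Stability is therefore only ever used for one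
  fixed measure on one fixed simplex, into which small pieces are transplanted: infinitely many bad
  ones in the gliding hump, \<open>N ^ d\<close> copies of one cell in the tiling. A nearly
  isometric map is kept as a linear isometry plus a remainder of small Lipschitz constant; a cut-off
  of the remainder leaves an isometry near the boundary of the cube, at a loss independent of the
  size of the cube. The thin margin where the cut-off alters the map is why the bound by a multiple
  of the mass has to come before the tiling.\<close>

abbreviation evt :: "(real => bool) => bool" (binder "EVT " 10) where
 "evt P \<equiv> eventually P at_top"

section \<open>Hausdorff measure of Lipschitz images and of coordinate subspaces\<close>

lemma diameter_le_dist:
 fixes S :: "'a::metric_space set"
 assumes "0 <= r" "!!x y. x : S ==> y : S ==> dist x y <= r"
 shows "diameter S <= r"
 using assms by(auto simp: diameter_def intro!: cSUP_least)

text \<open>A cover of \<open>A\<close> by sets of diameter at most \<open>dl/C\<close>, each cut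
  down to \<open>A\<close>, is mapped to a cover of the image by sets of diameter at most
  \<open>dl\<close>, and every weight grows at most by \<open>C ^ d\<close>.\<close>

lemma hausdorff_lipschitz:
 fixes T :: "'a::metric_space => 'b::metric_space"
 assumes C: "C > 0" and lip: "!!x y. x : A ==> y : A ==> dist (T x) (T y) <= C*dist x y"
 shows "hausdorff_outer d (T ` A) <= ennreal (C ^ d)*hausdorff_outer d A"
 unfolding hausdorff_outer_def [of d "T ` A"]
proof (rule SUP_least)
 fix dl :: real assume "dl : {0<..}"
 hence dl: "dl > 0" by simp
 let ?I = "INF D\<in>hausdorff_covers dl (T ` A). \<Sum>i. hausdorff_weight d (D i)"
 have cd: "ennreal (C ^ d)*ennreal (1/C ^ d) = 1"
  using C by(simp add: ennreal_mult[symmetric])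
 have le: "ennreal (1/C ^ d)*?I <= (\<Sum>i. hausdorff_weight d (D i))"
  if D: "D : hausdorff_covers (dl/C) A" for D
 proof -
  have bdd: "bounded (D i Int A)" "diameter (D i Int A) <= dl/C" for i
  using D diameter_subset[of "D i Int A" "D i"] by(auto simp: hausdorff_covers_def intro: bounded_Int order_trans)
  have dT: "dist (T x) (T y) <= C*diameter (D i Int A)" if "x : D i Int A" "y : D i Int A" for x y i
  proof -
  have "dist (T x) (T y) <= C*dist x y" using that lip by auto
  also have "... <= C*diameter (D i Int A)"
  using diameter_bounded_bound[OF bdd(1) that] C by(intro mult_left_mono) auto
  finally show ?thesis .
  qed
  have bT: "bounded (T ` (D i Int A))" for i
  unfolding bounded_def
  proof (cases "D i Int A = {}")
  case False
  then obtain x where "x : D i Int A" by auto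
  thus "EX x e. ALL y:T ` (D i Int A). dist x y <= e" using dT by(metis imageE)
  qed auto
  have diT: "diameter (T ` (D i Int A)) <= C*diameter (D i Int A)" for i
  by(rule diameter_le_dist) (use dT bdd C in "auto intro!: mult_nonneg_nonneg diameter_ge_0")
  have cov: "(%i. T ` (D i Int A)) : hausdorff_covers dl (T ` A)"
  proof -
  have "diameter (T ` (D i Int A)) <= dl" for i
  proof -
  have "C*diameter (D i Int A) <= C*(dl/C)"
  using bdd C by(intro mult_left_mono) auto
  thus ?thesis using diT[of i] C by simp
  qed
  moreover have "T ` A <= (\<Union>i. T ` (D i Int A))"
  using D by(fastforce simp: hausdorff_covers_def)
  ultimately show ?thesis using bT by(simp add: hausdorff_covers_def)
  qed
  have w: "hausdorff_weight d (T ` (D i Int A)) <= ennreal (C ^ d)*hausdorff_weight d (D i)" for i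
  proof (cases "D i Int A = {}")
  case False
  have "diameter (T ` (D i Int A)) <= C*diameter (D i)"
  using diT[of i] diameter_subset[of "D i Int A" "D i"] D C
  by(smt (verit) Int_lower1 hausdorff_covers_def mem_Collect_eq mult_left_mono)
  hence "(diameter (T ` (D i Int A))/2) ^ d <= (C*diameter (D i)/2) ^ d"
  using bT by(intro power_mono divide_right_mono) (auto intro!: divide_nonneg_nonneg diameter_ge_0)
  also have "... = C ^ d*(diameter (D i)/2) ^ d" by(simp add: power_mult_distrib power_divide)
  finally have "unit_ball_vol (real d)*(diameter (T ` (D i Int A))/2) ^ d <=
  C ^ d*(unit_ball_vol (real d)*(diameter (D i)/2) ^ d)"
  by(metis mult.left_commute mult_left_mono of_nat_0_le_iff unit_ball_vol_nonneg)
  moreover have "D i ~= {}" "T ` (D i Int A) ~= {}" using False by auto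
  ultimately show ?thesis using C
  by(simp add: hausdorff_weight_def ennreal_mult'[symmetric] ennreal_leI)
  qed (simp add: hausdorff_weight_def)
  have "?I <= (\<Sum>i. hausdorff_weight d (T ` (D i Int A)))" by(rule INF_lower[OF cov])
  also have "... <= (\<Sum>i. ennreal (C ^ d)*hausdorff_weight d (D i))" by(intro suminf_le w) auto
  also have "... = ennreal (C ^ d)*(\<Sum>i. hausdorff_weight d (D i))" by simp
  finally have "ennreal (1/C ^ d)*?I <= ennreal (1/C ^ d)*(ennreal (C ^ d)*(\<Sum>i. hausdorff_weight d (D i)))"
  by(rule mult_left_mono) simp
  also have "... = (\<Sum>i. hausdorff_weight d (D i))"
  using cd by(simp add: mult.assoc[symmetric] mult.commute)
  finally show ?thesis .
 qed
 have "ennreal (1/C ^ d)*?I <= (INF D\<in>hausdorff_covers (dl/C) A. \<Sum>i. hausdorff_weight d (D i))"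
  by(rule INF_greatest) (rule le)
 also have "... <= hausdorff_outer d A" using dl C by(intro hausdorff_outer_ge) simp
 finally have "ennreal (C ^ d)*(ennreal (1/C ^ d)*?I) <= ennreal (C ^ d)*hausdorff_outer d A"
  by(rule mult_left_mono) simp
 thus "?I <= ennreal (C ^ d)*hausdorff_outer d A"
  using cd by(simp add: mult.assoc[symmetric])
qed

lemma hausdorff_isometric_image:
 fixes T :: "'a::metric_space => 'b::metric_space"
 assumes "!!x y. x : A ==> y : A ==> dist (T x) (T y) = dist x y"
 shows "hausdorff_outer d (T ` A) = hausdorff_outer d A"
proof (rule antisym)
 show "hausdorff_outer d (T ` A) <= hausdorff_outer d A"
  using hausdorff_lipschitz[of 1 A T d] assms by simp
 have inj: "inj_on T A" using assms by(metis dist_eq_0_iff inj_onI)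
 have "hausdorff_outer d (inv_into A T ` T ` A) <= ennreal (1 ^ d)*hausdorff_outer d (T ` A)"
  by(rule hausdorff_lipschitz) (use assms inj in "auto simp: inv_into_f_f")
 thus "hausdorff_outer d A <= hausdorff_outer d (T ` A)"
  using inj by(simp add: inv_into_image_cancel)
qed

lemma hausdorff_translation:
 fixes A :: "'a::real_normed_vector set"
 shows "hausdorff_outer d ((+) a ` A) = hausdorff_outer d A"
 by(rule hausdorff_isometric_image) simp

lemma dist_scaleR_same:
 fixes x y :: "'a::real_normed_vector" shows "dist (r *\<^sub>R x) (r *\<^sub>R y) = abs(r)*dist x y"
 by(simp add: dist_norm flip: scaleR_diff_right)

lemma hausdorff_scaleR:
 fixes A :: "'a::real_normed_vector set"
 assumes "r > 0"
 shows "hausdorff_outer d ((*\<^sub>R) r ` A) = ennreal (r ^ d)*hausdorff_outer d A"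
proof (rule antisym)
 show "hausdorff_outer d ((*\<^sub>R) r ` A) <= ennreal (r ^ d)*hausdorff_outer d A"
  by(rule hausdorff_lipschitz) (use assms in "simp_all add: dist_scaleR_same")
 have "A = (*\<^sub>R) (1/r) ` (*\<^sub>R) r ` A" using assms by(auto simp: image_image)
 hence "hausdorff_outer d A <= ennreal ((1/r) ^ d)*hausdorff_outer d ((*\<^sub>R) r ` A)"
  using hausdorff_lipschitz[of "1/r" "(*\<^sub>R) r ` A" "(*\<^sub>R) (1/r)" d] assms
  by(simp add: dist_scaleR_same)
 hence "ennreal (r ^ d)*hausdorff_outer d A <=
  ennreal (r ^ d)*(ennreal ((1/r) ^ d)*hausdorff_outer d ((*\<^sub>R) r ` A))"
  by(rule mult_left_mono) simp
 also have "... = hausdorff_outer d ((*\<^sub>R) r ` A)"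
  using assms by(simp add: mult.assoc[symmetric] ennreal_mult[symmetric] power_one_over)
 finally show "ennreal (r ^ d)*hausdorff_outer d A <= hausdorff_outer d ((*\<^sub>R) r ` A)" .
qed

text \<open>Finite families suffice for upper bounds: padding with empty sets costs nothing, since
  these have weight 0 even in dimension 0.\<close>

lemma hausdorff_le_finite_covers:
 fixes A :: "'a::metric_space set"
 assumes "!!dl. dl > 0 ==> EX I D. finite (I :: 'i set) & A <= (UN i:I. D i) &
  (ALL i:I. bounded (D i) & diameter (D i) <= dl) & (SUM i:I. hausdorff_weight d (D i)) <= c"
 shows "hausdorff_outer d A <= c"
 unfolding hausdorff_outer_def
proof (rule SUP_least)
 fix dl :: real assume "dl : {0<..}"
 hence dl: "dl > 0" by simp
 obtain I :: "'i set" and D where I: "finite I" "A <= (UN i:I. D i)"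
  "!!i. i : I ==> bounded (D i) & diameter (D i) <= dl" "(SUM i:I. hausdorff_weight d (D i)) <= c"
  using assms[OF dl] by blast
 obtain f where f: "bij_betw f {0..<card I} I" using ex_bij_betw_nat_finite[OF I(1)] by blast
 define C where "C k = (if k < card I then D (f k) else {})" for k
 have fI: "f k : I" if "k < card I" for k using f that by(auto simp: bij_betw_def)
 have "A <= (\<Union>k. C k)"
 proof
  fix x assume "x : A"
  then obtain i where i: "i : I" "x : D i" using I by auto
  then obtain k where "k < card I" "f k = i" using f unfolding bij_betw_def by(metis atLeastLessThan_iff imageE)
  hence "x : C k" using i by(simp add: C_def)
  thus "x : (\<Union>k. C k)" by blast
 qed
 hence "C : hausdorff_covers dl A" using I fI dl by(auto simp: hausdorff_covers_def C_def)
 hence "(INF C\<in>hausdorff_covers dl A. \<Sum>i. hausdorff_weight d (C i)) <= (\<Sum>k. hausdorff_weight d (C k))"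
  by(rule INF_lower)
 also have "... = (SUM k:{0..<card I}. hausdorff_weight d (C k))"
  by(rule suminf_finite) (auto simp: C_def hausdorff_weight_def)
 also have "... = (SUM k:{0..<card I}. hausdorff_weight d (D (f k)))" by(simp add: C_def)
 also have "... = (SUM i:I. hausdorff_weight d (D i))" by(rule sum.reindex_bij_betw[OF f])
 finally show "(INF C\<in>hausdorff_covers dl A. \<Sum>i. hausdorff_weight d (C i)) <= c" using I(4) by simp
qed

text \<open>The copy of d-dimensional space spanned by the coordinates in \<open>J\<close>. It
  contains the reference cubes, and all parameter simplices are taken in it.\<close>

definition plane :: "'n set => (real^'n) set" where
 "plane J = {x. ALL i. i ~: J --> x $ i = 0}"

lemma subspace_plane: "subspace (plane J)"
 by(auto simp: subspace_def plane_def)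

lemma dim_plane:
 fixes J :: "'n::finite set" shows "dim (plane J) = card J"
proof -
 have "plane J = {x. ALL b:Basis. b ~: (%i. axis i 1) ` J --> x \<bullet> b = 0}"
  by(auto simp: plane_def Basis_vec_def inner_axis axis_eq_axis image_iff)
 hence "dim (plane J) = card ((%i. axis i (1::real)) ` J)"
  using dim_substandard[of "(%i. axis i (1::real)) ` J"] by(auto simp: Basis_vec_def)
 also have "... = card J" by(intro card_image) (auto simp: inj_on_def axis_eq_axis)
 finally show ?thesis .
qed

text \<open>A cube of side \<open>2*R\<close> is cut into \<open>m ^ card J\<close> cubes of side
  \<open>2*R/m\<close>. Their diameters are at most \<open>CARD('n)\<close> times the side, so half
  the diameter is at most \<open>R*CARD('n)/m\<close>, and the powers of \<open>m\<close> cancel in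
  the sum of the weights.\<close>

lemma hausdorff_bounded_finite:
 fixes A :: "(real^'n::finite) set" and J :: "'n set"
 assumes "A <= plane J" "bounded A"
 shows "hausdorff_outer (card J) A < \<infinity>"
proof -
 let ?d = "card J" and ?D = "real CARD('n)"
 obtain R where R: "R > 0" "!!x. x : A ==> norm x < R" using assms(2) by(metis bounded_pos_less)
 define c where "c = unit_ball_vol (real ?d)*(R*?D) ^ ?d"
 have "hausdorff_outer ?d A <= ennreal c"
 proof (rule hausdorff_le_finite_covers)
  fix dl :: real assume dl: "dl > 0"
  obtain m :: nat where m: "m > 2*R*?D/dl" using reals_Archimedean2 by blast
  have "2*R*?D/dl > 0" using R dl by simp
  hence m0: "m > 0" using m by(metis less_trans of_nat_0_less_iff)
  define r where "r = 2*R/m"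
  define I where "I = PiE J (%_. {..<m})"
  define D where "D k = {x : plane J. ALL i:J. -R + real (k i)*r <= x $ i & x $ i <= -R + (real (k i) + 1)*r}" for k
  have r0: "r > 0" using R m0 by(simp add: r_def)
  have dd: "dist x y <= ?D*r" if "x : D k" "y : D k" for x y k
  proof -
  have "abs(x $ i - y $ i) <= r" for i
  using that r0 by(cases "i : J") (force simp: D_def plane_def algebra_simps abs_le_iff)+
  hence "(SUM i:UNIV. abs((x - y) $ i)) <= (SUM i:(UNIV::'n set). r)" by(intro sum_mono) auto
  thus ?thesis using norm_le_l1_cart[of "x - y"] by(simp add: dist_norm)
  qed
  have bD: "bounded (D k)" for k
  unfolding bounded_def by(cases "D k = {}") (use dd in blast)+
  have diam: "diameter (D k) <= ?D*r" for k
  by(rule diameter_le_dist) (use dd r0 in "auto simp: dist_norm")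
  have "r*?D <= dl" using m dl m0 by(simp add: r_def field_simps)
  hence diamdl: "diameter (D k) <= dl" for k using diam[of k] by(simp add: mult.commute)
  have cover: "A <= (UN k:I. D k)"
  proof
  fix x assume x: "x : A"
  define k where "k = restrict (%i. nat \<lfloor>(x $ i + R)/r\<rfloor>) J"
  have xi: "abs(x $ i) < R" for i
  using component_le_norm_cart[of x i] R(2)[OF x] by linarith
  have pos: "0 <= (x $ i + R)/r" for i using xi[of i] r0 by(auto intro!: divide_nonneg_pos)
  have lt: "(x $ i + R)/r < m" for i
  proof -
  have "(x $ i + R) < 2*R" using xi[of i] by linarith
  hence "(x $ i + R)/r < 2*R/r" using r0 by(simp add: divide_strict_right_mono)
  thus ?thesis using R m0 by(simp add: r_def)
  qed
  have "k : I"
  using pos lt unfolding I_def k_def by(auto simp: nat_less_iff floor_less_iff)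
  moreover have "x : D k"
  proof -
  have "-R + real (k i)*r <= x $ i & x $ i <= -R + (real (k i) + 1)*r" if i: "i : J" for i
  proof -
  have ki: "real (k i) = of_int \<lfloor>(x $ i + R)/r\<rfloor>" using pos[of i] i by(simp add: k_def)
  have "real (k i) <= (x $ i + R)/r" "(x $ i + R)/r <= real (k i) + 1"
  unfolding ki by linarith+
  thus ?thesis using r0 by(simp add: field_simps)
  qed
  thus ?thesis using x assms(1) by(auto simp: D_def)
  qed
  ultimately show "x : (UN k:I. D k)" by blast
  qed
  have w: "hausdorff_weight ?d (D k) <= ennreal (unit_ball_vol (real ?d)*(?D*r/2) ^ ?d)" for k
  using diam[of k] bD[of k] by(auto simp: hausdorff_weight_def intro!: ennreal_leI mult_left_mono power_mono diameter_ge_0)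
  have "finite I" by(simp add: I_def finite_PiE)
  have cI: "card I = m ^ ?d" by(simp add: I_def card_PiE)
  have "(SUM k:I. hausdorff_weight ?d (D k)) <= (SUM k:I. ennreal (unit_ball_vol (real ?d)*(?D*r/2) ^ ?d))"
  by(intro sum_mono w)
  also have "... = ennreal (real (m ^ ?d)*(unit_ball_vol (real ?d)*(?D*r/2) ^ ?d))"
  using r0 by(simp add: cI ennreal_mult ennreal_of_nat_eq_real_of_nat)
  also have "real (m ^ ?d)*(unit_ball_vol (real ?d)*(?D*r/2) ^ ?d) = c"
  proof -
  have "?D*r/2 = R*?D/m" by(simp add: r_def)
  thus ?thesis using m0 by(simp add: c_def power_divide)
  qed
  finally show "EX I D. finite (I :: ('n => nat) set) & A <= (UN i:I. D i) &
  (ALL i:I. bounded (D i) & diameter (D i) <= dl) & (SUM i:I. hausdorff_weight ?d (D i)) <= ennreal c"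
  using \<open>finite I\<close> cover bD diamdl by blast
 qed
 thus ?thesis by(simp add: le_less_trans)
qed

text \<open>A bounded flat piece has infinitely many disjoint translates of equal measure inside a
 bounded set.\<close>

lemma hausdorff_lowdim_0:
 fixes A :: "(real^'n::finite) set" and J :: "'n set"
 assumes A: "A <= plane J" "bounded A" and dim: "aff_dim A < int (card J)"
 shows "hausdorff_outer (card J) A = 0"
proof (cases "A = {}")
 case False
 then obtain a where a: "a : A" by auto
 let ?d = "card J" and ?V = "plane J"
 obtain R where R: "A <= cball 0 R" using A(2) by(metis bounded_iff mem_cball_0 subsetI)
 \<comment> \<open>\<open>A\<close> need not be Borel. The compact set \<open>F\<close> is, so
   countable additivity applies to its translates, and these are disjoint because \<open>v\<close>
   is transverse to the affine hull.\<close>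
 define F where "F = affine hull A Int cball 0 R"
 have affA: "affine hull A <= ?V"
  by(rule hull_minimal[where S=affine]) (use A(1) subspace_imp_affine[OF subspace_plane] in auto)
 define W where "W = (%x. x - a) ` (affine hull A)"
 have subW: "subspace W" unfolding W_def using a
  by(metis affine_affine_hull affine_diffs_subspace_subtract hull_inc)
 have "int (dim W) = aff_dim A"
  using aff_dim_eq_dim_subtract[of a "affine hull A"] a by(simp add: W_def hull_inc)
 hence "dim W < dim ?V" using dim by(simp add: dim_plane)
 have "~ ?V <= W" using \<open>dim W < dim ?V\<close> dim_subset leD by blast
 then obtain v where v: "v : ?V" "v ~: W" by auto
 have bF: "F : sets borel" by(simp add: F_def closed_Int)
 define T where "T k = (+) ((1/real (Suc k)) *\<^sub>R v) ` F" for k :: nat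
 have bT: "T k : sets borel" for k
  unfolding T_def by(intro borel_closed closed_translation) (simp add: F_def closed_Int)
 have disj: "disjoint_family T"
  unfolding disjoint_family_on_def
 proof (intro ballI impI, rule ccontr)
  fix k l :: nat assume "k ~= l" "T k Int T l ~= {}"
  then obtain x y where xy: "x : F" "y : F" "(1/real (Suc k)) *\<^sub>R v + x = (1/real (Suc l)) *\<^sub>R v + y"
  by(auto simp: T_def)
  define s where "s = 1/real (Suc k) - 1/real (Suc l)"
  have "s ~= 0" using \<open>k ~= l\<close> by(simp add: s_def)
  have "s *\<^sub>R v = y - x" using xy(3) by(simp add: s_def scaleR_diff_left algebra_simps)
  also have "... = (y - a) - (x - a)" by simp
  also have "... : W" by(rule subspace_diff[OF subW]) (use xy in "auto simp: W_def F_def")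
  finally have "(1/s) *\<^sub>R (s *\<^sub>R v) : W" by(rule subspace_scale[OF subW])
  thus False using \<open>s ~= 0\<close> v by simp
 qed
 have sub: "(\<Union>k. T k) <= ?V Int cball 0 (R + norm v)"
 proof
  fix z assume "z : (\<Union>k. T k)"
  then obtain k x where z: "x : F" "z = (1/real (Suc k)) *\<^sub>R v + x" by(auto simp: T_def)
  have "norm z <= norm ((1/real (Suc k)) *\<^sub>R v) + norm x" unfolding z(2) by(rule norm_triangle_ineq)
  also have "norm ((1/real (Suc k)) *\<^sub>R v) <= norm v" by(simp add: divide_le_eq algebra_simps)
  finally have "norm z <= R + norm v" using z by(simp add: F_def)
  moreover have "z : ?V" using z v affA
  by(auto simp: F_def intro!: subspace_add subspace_scale subspace_plane)
  ultimately show "z : ?V Int cball 0 (R + norm v)" by simp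
 qed
 have "(\<Sum>k. emeasure (hausdorff ?d) (T k)) = emeasure (hausdorff ?d) (\<Union>k. T k)"
  using bT disj by(intro suminf_emeasure) auto
 also have "... <= hausdorff_outer ?d (?V Int cball 0 (R + norm v))"
  using bT hausdorff_outer_mono[OF sub] by(subst emeasure_hausdorff) auto
 also have "... < \<infinity>" by(rule hausdorff_bounded_finite) auto
 finally have fin: "(\<Sum>k. emeasure (hausdorff ?d) (T k)) < \<infinity>" .
 have "emeasure (hausdorff ?d) (T k) = hausdorff_outer ?d F" for k
  using emeasure_hausdorff[OF bT] by(simp add: T_def hausdorff_translation)
 hence "(\<Sum>k::nat. hausdorff_outer ?d F) < \<infinity>" using fin by simp
 hence "hausdorff_outer ?d F = 0"
 proof (cases "hausdorff_outer ?d F")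
  case (real r)
  hence "summable (%k::nat. r)"
  using \<open>(\<Sum>k::nat. hausdorff_outer ?d F) < \<infinity>\<close> by(intro summable_suminf_not_top) auto
  thus ?thesis using real by(simp add: summable_const_iff)
 next
  case top
  hence "\<top> <= (\<Sum>k::nat. hausdorff_outer ?d F)"
  using sum_le_suminf[of "%k::nat. hausdorff_outer ?d F" "{0}"] by simp
  thus ?thesis using \<open>(\<Sum>k::nat. hausdorff_outer ?d F) < \<infinity>\<close> by(simp add: top_unique)
 qed
 moreover have "A <= F" using R hull_subset[of A affine] by(auto simp: F_def)
 ultimately show ?thesis using hausdorff_outer_mono[of A F ?d] by simp
qed (simp add: hausdorff_outer_empty)

section \<open>Twice continuously differentiable maps\<close>

text \<open>Total derivatives in place of the partial ones of \<open>C2_on\<close>, since sums,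
  products, compositions and glueing are then immediate. \<open>g'' h x k\<close> is the derivative
  at \<open>x\<close> in direction \<open>k\<close> of the directional derivative along
  \<open>h\<close>.\<close>

definition C2map :: "'a::euclidean_space set => ('a => 'b::real_normed_vector) => bool" where
 "C2map U g \<longleftrightarrow> (EX g' g''. (ALL x:U. (g has_derivative g' x) (at x)) &
  (ALL h. ALL x:U. ((%y. g' y h) has_derivative g'' h x) (at x)) &
  (ALL h k. continuous_on U (%x. g'' h x k)))"

lemma C2mapE:
 assumes "C2map U g"
 obtains g' g'' where "!!x. x : U ==> (g has_derivative g' x) (at x)"
  "!!h x. x : U ==> ((%y. g' y h) has_derivative g'' h x) (at x)"
  "!!h k. continuous_on U (%x. g'' h x k)"
  "!!h. continuous_on U (%x. g' x h)" "continuous_on U g"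
proof -
 obtain g' g'' where g: "!!x. x : U ==> (g has_derivative g' x) (at x)"
  "!!h x. x : U ==> ((%y. g' y h) has_derivative g'' h x) (at x)"
  "!!h k. continuous_on U (%x. g'' h x k)" using assms unfolding C2map_def by blast
 have "continuous_on U (%x. g' x h)" for h
  by(intro continuous_at_imp_continuous_on ballI) (use g(2) has_derivative_continuous in blast)
 moreover have "continuous_on U g"
  by(intro continuous_at_imp_continuous_on ballI) (use g(1) has_derivative_continuous in blast)
 ultimately show ?thesis using that g by blast
qed

text \<open>Telescoping along the coordinate directions: each step changes \<open>f\<close> by its
  length times a partial derivative that differs from the one at \<open>x\<close> by at most
  \<open>e\<close>. The last hypothesis keeps the whole path inside the ball.\<close>

lemma sum_steps_bound:
 fixes f :: "'a::euclidean_space => 'b::real_normed_vector"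
 assumes vd: "!!b z. b : Basis ==> z : ball x r ==>
  ((%t. f (z + t *\<^sub>R b)) has_vector_derivative D b z) (at 0)"
  and near: "!!b z. b : Basis ==> z : ball x r ==> norm (D b z - D b x) <= e"
  and "finite B" "B <= Basis" "dist x y + (SUM b:B. abs(c b)) < r"
 shows "norm (f (y + (SUM b:B. c b *\<^sub>R b)) - f y - (SUM b:B. c b *\<^sub>R D b x)) <= e*(SUM b:B. abs(c b))"
 using assms(3-5)
proof (induction B arbitrary: y rule: finite_induct)
 case (insert b B)
 define y' where "y' = y + c b *\<^sub>R b"
 have b: "b : Basis" using insert by auto
 hence nb: "norm b = 1" by simp
 have "dist x y' <= dist x y + abs(c b)"
  using dist_triangle[of x y' y] by(simp add: y'_def dist_norm nb)
 hence IH: "norm (f (y' + (SUM b:B. c b *\<^sub>R b)) - f y' - (SUM b:B. c b *\<^sub>R D b x)) <= e*(SUM b:B. abs(c b))"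
  using insert by(intro insert.IH) auto
 have "norm (f y' - f y - c b *\<^sub>R D b x) <= e*abs(c b)"
 proof -
  \<comment> \<open>Subtracting the linear approximation turns the step into a mean value inequality
    with derivative bounded by \<open>e\<close>.\<close>
  let ?phi = "%t. f (y + t *\<^sub>R b) - t *\<^sub>R D b x"
  let ?S = "closed_segment 0 (c b)"
  have inb: "y + t *\<^sub>R b : ball x r" if "t : ?S" for t
  proof -
  have "abs(t) <= abs(c b)" using that by(auto simp: closed_segment_eq_real_ivl split: if_splits)
  moreover have "dist x (y + t *\<^sub>R b) <= dist x y + abs(t)"
  using dist_triangle[of x "y + t *\<^sub>R b" y] by(simp add: dist_norm nb)
  moreover have "abs(c b) + dist x y < r"
  proof -
  have "0 <= (SUM b:B. abs(c b))" by(rule sum_nonneg) auto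
  moreover have "(SUM b:insert b B. abs(c b)) = abs(c b) + (SUM b:B. abs(c b))"
  using insert.hyps by simp
  ultimately show ?thesis using insert.prems(2) by linarith
  qed
  ultimately show ?thesis by simp
  qed
  have der: "(?phi has_derivative (%s. s *\<^sub>R (D b (y + t *\<^sub>R b) - D b x))) (at t within ?S)" if t: "t : ?S" for t
  proof -
  have "((%s. f ((y + t *\<^sub>R b) + s *\<^sub>R b)) has_vector_derivative D b (y + t *\<^sub>R b)) (at 0)"
  using vd[OF b inb[OF t]] .
  hence "((%s. f ((y + t *\<^sub>R b) + s *\<^sub>R b)) has_vector_derivative D b (y + t *\<^sub>R b)) (at (t - t))" by simp
  hence "((%s. f ((y + t *\<^sub>R b) + s *\<^sub>R b)) \<circ> (%s. s - t) has_vector_derivative 1 *\<^sub>R D b (y + t *\<^sub>R b)) (at t)"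
  by(intro vector_diff_chain_at) (auto intro!: derivative_eq_intros)
  hence "((%s. f (y + s *\<^sub>R b)) has_vector_derivative D b (y + t *\<^sub>R b)) (at t)"
  by(simp add: o_def algebra_simps)
  hence "((%s. f (y + s *\<^sub>R b)) has_derivative (%s. s *\<^sub>R D b (y + t *\<^sub>R b))) (at t)"
  by(simp add: has_vector_derivative_def)
  hence "(?phi has_derivative (%s. s *\<^sub>R D b (y + t *\<^sub>R b) - s *\<^sub>R D b x)) (at t)"
  by(intro has_derivative_diff) (auto intro!: derivative_eq_intros)
  thus ?thesis by(simp add: scaleR_diff_right has_derivative_at_withinI)
  qed
  have on: "onorm (%s. s *\<^sub>R (D b (y + t *\<^sub>R b) - D b x)) <= e" if t: "t : ?S" for t
  using near[OF b inb[OF t]] by(intro onorm_le) (metis mult.commute mult_left_mono norm_ge_zero norm_scaleR real_norm_def)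
  have "norm (?phi (c b) - ?phi 0) <= e*norm (c b - 0)"
  by(rule differentiable_bound[OF _ der on]) auto
  thus ?thesis by(simp add: y'_def algebra_simps)
 qed
 from norm_triangle_mono[OF IH this] have "norm ((f (y' + (SUM b:B. c b *\<^sub>R b)) - f y' - (SUM b:B. c b *\<^sub>R D b x)) + (f y' - f y - c b *\<^sub>R D b x))
  <= e*(SUM b:B. abs(c b)) + e*abs(c b)" .
 thus ?case using insert.hyps by(simp add: y'_def algebra_simps)
qed simp

lemma has_derivative_from_partials:
 fixes f :: "'a::euclidean_space => 'b::real_normed_vector"
 assumes U: "open U" and vd: "!!b z. b : Basis ==> z : U ==>
  ((%t. f (z + t *\<^sub>R b)) has_vector_derivative D b z) (at 0)"
  and cont: "!!b. b : Basis ==> continuous_on U (D b)" and x: "x : U"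
 shows "(f has_derivative (%h. SUM b:Basis. (h \<bullet> b) *\<^sub>R D b x)) (at x)"
 unfolding has_derivative_at_alt
proof (intro conjI allI impI)
 show "bounded_linear (%h. SUM b:Basis. (h \<bullet> b) *\<^sub>R D b x)"
  by(intro bounded_linear_sum bounded_linear_compose[OF bounded_linear_scaleR_left] bounded_linear_inner_left)
 fix e :: real assume e: "e > 0"
 let ?n = "real DIM('a)"
 have n: "?n > 0" by simp
 \<comment> \<open>The absolute values of the coordinates of \<open>y - x\<close> sum up to at most
   \<open>?n*norm (y - x)\<close>; this absorbs the factor.\<close>
 define e' where "e' = e/?n"
 have e': "e' > 0" using e n by(simp add: e'_def)
 have "EX r>0. ALL z:ball x r. z : U & norm (D b z - D b x) <= e'" if b: "b : Basis" for b
 proof -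
  have "(D b \<longlongrightarrow> D b x) (at x)"
  using continuous_on_interior[OF cont[OF b]] x U by(simp add: interior_open isCont_def)
  hence "\<forall>\<^sub>F z in nhds x. z : U & norm (D b z - D b x) <= e'"
  proof (intro eventually_conj)
  show "\<forall>\<^sub>F z in nhds x. z : U" using U x by(rule eventually_nhds_in_open)
  have "\<forall>\<^sub>F z in at x. dist (D b z) (D b x) < e'"
  using \<open>(D b \<longlongrightarrow> D b x) (at x)\<close> e' by(rule tendstoD)
  thus "\<forall>\<^sub>F z in nhds x. norm (D b z - D b x) <= e'"
  unfolding eventually_at_filter by(rule eventually_mono) (use e' in "auto simp: dist_norm less_imp_le")
  qed
  thus ?thesis unfolding eventually_nhds_metric by(auto simp: dist_commute)
 qed
 then obtain rr where rr: "!!b::'a. b : Basis ==> rr b > 0 & (ALL z:ball x (rr b). z : U & norm (D b z - D b x) <= e')"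
  by metis
 define r where "r = Min (rr ` Basis)"
 have r: "r > 0" "!!b. b : Basis ==> r <= rr b" using rr by(auto simp: r_def)
 show "EX d>0. ALL y. norm (y - x) < d --> norm (f y - f x - (SUM b:Basis. ((y - x) \<bullet> b) *\<^sub>R D b x)) <= e*norm (y - x)"
 proof (intro exI[of _ "r/?n"] conjI allI impI)
  show "r/?n > 0" using r n by simp
  fix y assume y: "norm (y - x) < r/?n"
  have s: "(SUM b:Basis. abs((y - x) \<bullet> b)) <= ?n*norm (y - x)"
  proof -
  have "(SUM b:Basis. abs((y - x) \<bullet> b)) <= (SUM b:(Basis::'a set). norm (y - x))"
  by(intro sum_mono Basis_le_norm)
  thus ?thesis by simp
  qed
  have "norm (f (x + (SUM b:Basis. ((y - x) \<bullet> b) *\<^sub>R b)) - f x - (SUM b:Basis. ((y - x) \<bullet> b) *\<^sub>R D b x))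
  <= e'*(SUM b:Basis. abs((y - x) \<bullet> b))"
  proof (rule sum_steps_bound)
  show "dist x x + (SUM b:Basis. abs((y - x) \<bullet> b)) < r" using s y n by(simp add: field_simps)
  next
  fix b z :: 'a assume bz: "b : Basis" "z : ball x r"
  hence "z : ball x (rr b)" using r(2)[of b] by auto
  thus "((%t. f (z + t *\<^sub>R b)) has_vector_derivative D b z) (at 0)" "norm (D b z - D b x) <= e'"
  using rr[OF bz(1)] vd bz by auto
  qed auto
  also have "... <= e'*(?n*norm (y - x))" using s e' by(intro mult_left_mono) auto
  also have "... = e*norm (y - x)" using n by(simp add: e'_def)
  finally show "norm (f y - f x - (SUM b:Basis. ((y - x) \<bullet> b) *\<^sub>R D b x)) <= e*norm (y - x)"
  by(simp add: euclidean_representation)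
 qed
qed

text \<open>Continuous partial derivatives give total differentiability. This is used for the first
  partial derivatives, which thereby become continuous, and then for \<open>g\<close>
  itself.\<close>

lemma C2_on_imp_C2map:
 assumes "open U" "C2_on U g" shows "C2map U g"
proof -
 obtain D1 D2 where D: "!!b x. b : Basis ==> x : U ==> ((%t. g (x + t *\<^sub>R b)) has_vector_derivative D1 b x) (at 0)"
  "!!b c x. b : Basis ==> c : Basis ==> x : U ==> ((%t. D1 b (x + t *\<^sub>R c)) has_vector_derivative D2 b c x) (at 0)"
  "!!b c. b : Basis ==> c : Basis ==> continuous_on U (D2 b c)"
  using assms(2) unfolding C2_on_def by blast
 have d2: "(D1 b has_derivative (%h. SUM c:Basis. (h \<bullet> c) *\<^sub>R D2 b c x)) (at x)" if "x : U" "b : Basis" for x b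
  by(rule has_derivative_from_partials[OF assms(1) D(2)[OF that(2)]]) (use that D in auto)
 have cont: "continuous_on U (D1 b)" if "b : Basis" for b
  by(intro continuous_at_imp_continuous_on ballI) (use d2 that has_derivative_continuous in blast)
 have d1: "(g has_derivative (%h. SUM b:Basis. (h \<bullet> b) *\<^sub>R D1 b x)) (at x)" if "x : U" for x
  by(rule has_derivative_from_partials[OF assms(1) D(1)]) (use that cont in auto)
 show ?thesis unfolding C2map_def
  by(rule exI[of _ "%x h. SUM b:Basis. (h \<bullet> b) *\<^sub>R D1 b x"],
  rule exI[of _ "%h x k. SUM b:Basis. (h \<bullet> b) *\<^sub>R (SUM c:Basis. (k \<bullet> c) *\<^sub>R D2 b c x)"])
  (use d1 d2 D(3) in "auto intro!: has_derivative_sum has_derivative_scaleR_right continuous_intros")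
qed

lemma has_derivative_line:
 assumes "(g has_derivative g') (at x)"
 shows "((%t. g (x + t *\<^sub>R b)) has_vector_derivative g' b) (at 0)"
proof -
 have "((%t. x + t *\<^sub>R b) has_vector_derivative b) (at 0)"
  by(auto intro!: derivative_eq_intros)
 moreover have "(g has_derivative g') (at (x + 0 *\<^sub>R b) within range (%t. x + t *\<^sub>R b))"
  using assms by(simp add: has_derivative_at_withinI)
 ultimately show ?thesis
  using vector_derivative_diff_chain_within[of "%t. x + t *\<^sub>R b" b 0 UNIV g g'] by(simp add: o_def)
qed

lemma C2map_imp_C2_on:
 assumes "C2map U g" shows "C2_on U g"
proof -
 obtain g' g'' where g: "!!x. x : U ==> (g has_derivative g' x) (at x)"
  "!!h x. x : U ==> ((%y. g' y h) has_derivative g'' h x) (at x)"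
  "!!h k. continuous_on U (%x. g'' h x k)" using assms by(rule C2mapE) blast
 show ?thesis unfolding C2_on_def
  by(rule exI[of _ "%b x. g' x b"], rule exI[of _ "%b c x. g'' b x c"])
  (use g in "auto intro: has_derivative_line")
qed

lemma C2map_subset: "C2map U g ==> V <= U ==> C2map V g"
 unfolding C2map_def
 apply (elim exE)
 subgoal for g' g''
  by(rule exI[of _ g'], rule exI[of _ g'']) (blast intro: continuous_on_subset)
 done

lemma C2map_linear: "bounded_linear g ==> C2map U g"
 unfolding C2map_def
 by(rule exI[of _ "%_. g"], rule exI[of _ "%_ _ _. 0"])
  (auto intro: bounded_linear_imp_has_derivative has_derivative_const)

lemma C2map_const: "C2map U (%_. c)"
 unfolding C2map_def
 by(rule exI[of _ "%_ _. 0"], rule exI[of _ "%_ _ _. 0"]) (auto intro: has_derivative_const)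

lemma C2map_add:
 assumes "C2map U f" "C2map U g"
 shows "C2map U (%x. f x + g x)"
proof -
 obtain f' f'' where f: "!!x. x : U ==> (f has_derivative f' x) (at x)"
  "!!h x. x : U ==> ((%y. f' y h) has_derivative f'' h x) (at x)"
  "!!h k. continuous_on U (%x. f'' h x k)" using assms(1) by(rule C2mapE) blast
 obtain g' g'' where g: "!!x. x : U ==> (g has_derivative g' x) (at x)"
  "!!h x. x : U ==> ((%y. g' y h) has_derivative g'' h x) (at x)"
  "!!h k. continuous_on U (%x. g'' h x k)" using assms(2) by(rule C2mapE) blast
 show ?thesis unfolding C2map_def
  by(rule exI[of _ "%x h. f' x h + g' x h"], rule exI[of _ "%h x k. f'' h x k + g'' h x k"])
  (use f g in "auto intro!: has_derivative_add continuous_on_add")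
qed

lemma C2map_sum:
 assumes "finite I" "!!i. i : I ==> C2map U (f i)"
 shows "C2map U (%x. SUM i:I. f i x)"
 using assms by(induction I rule: finite_induct) (auto intro: C2map_const C2map_add)

lemma C2map_scaleR:
 assumes "C2map U f" "C2map U g"
 shows "C2map U (%x. f x *\<^sub>R g x)"
proof -
 obtain f' f'' where f: "!!x. x : U ==> (f has_derivative f' x) (at x)"
  "!!h x. x : U ==> ((%y. f' y h) has_derivative f'' h x) (at x)"
  "!!h k. continuous_on U (%x. f'' h x k)" "!!h. continuous_on U (%x. f' x h)" "continuous_on U f"
  using assms(1) by(rule C2mapE) blast
 obtain g' g'' where g: "!!x. x : U ==> (g has_derivative g' x) (at x)"
  "!!h x. x : U ==> ((%y. g' y h) has_derivative g'' h x) (at x)"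
  "!!h k. continuous_on U (%x. g'' h x k)" "!!h. continuous_on U (%x. g' x h)" "continuous_on U g"
  using assms(2) by(rule C2mapE) blast
 show ?thesis unfolding C2map_def
 proof (rule exI[of _ "%x h. f x *\<^sub>R g' x h + f' x h *\<^sub>R g x"],
  rule exI[of _ "%h x k. (f x *\<^sub>R g'' h x k + f' x k *\<^sub>R g' x h) + (f' x h *\<^sub>R g' x k + f'' h x k *\<^sub>R g x)"],
  intro conjI allI ballI)
  fix x h assume x: "x : U"
  show "((%x. f x *\<^sub>R g x) has_derivative (%h. f x *\<^sub>R g' x h + f' x h *\<^sub>R g x)) (at x)"
  using x f g by(intro has_derivative_scaleR) auto
  show "((%y. f y *\<^sub>R g' y h + f' y h *\<^sub>R g y) has_derivative
  (%k. (f x *\<^sub>R g'' h x k + f' x k *\<^sub>R g' x h) + (f' x h *\<^sub>R g' x k + f'' h x k *\<^sub>R g x))) (at x)"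
  using x f g by(intro has_derivative_add has_derivative_scaleR) auto
 next
  fix h k
  show "continuous_on U (%x. (f x *\<^sub>R g'' h x k + f' x k *\<^sub>R g' x h) + (f' x h *\<^sub>R g' x k + f'' h x k *\<^sub>R g x))"
  using f g by(intro continuous_intros) auto
 qed
qed

lemma C2map_compose_affine:
 fixes g :: "'b::euclidean_space => 'c::real_normed_vector" and L :: "'a::euclidean_space => 'b"
 assumes "C2map U g" "bounded_linear L"
 shows "C2map ((%x. a + L x) -` U) (%x. g (a + L x))"
proof -
 obtain g' g'' where g: "!!x. x : U ==> (g has_derivative g' x) (at x)"
  "!!h x. x : U ==> ((%y. g' y h) has_derivative g'' h x) (at x)"
  "!!h k. continuous_on U (%x. g'' h x k)" using assms(1) by(rule C2mapE) blast
 have A: "((%x. a + L x) has_derivative L) (at x)" for x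
  using bounded_linear_imp_has_derivative[OF assms(2)] by(auto intro!: derivative_eq_intros)
 have cA: "continuous_on UNIV (%x. a + L x)"
  using assms(2) by(intro continuous_intros linear_continuous_on)
 show ?thesis unfolding C2map_def
 proof (rule exI[of _ "%x h. g' (a + L x) (L h)"], rule exI[of _ "%h x k. g'' (L h) (a + L x) (L k)"],
  intro conjI allI ballI)
  fix x h assume "x : (%x. a + L x) -` U"
  hence x: "a + L x : U" by simp
  show "((%x. g (a + L x)) has_derivative (%h. g' (a + L x) (L h))) (at x)"
  by(rule has_derivative_compose[OF A g(1)[OF x]])
  show "((%y. g' (a + L y) (L h)) has_derivative (%k. g'' (L h) (a + L x) (L k))) (at x)"
  by(rule has_derivative_compose[OF A g(2)[OF x]])
 next
  fix h k
  show "continuous_on ((%x. a + L x) -` U) (%x. g'' (L h) (a + L x) (L k))"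
  by(rule continuous_on_compose2[OF g(3)]) (auto intro: continuous_on_subset[OF cA])
 qed
qed

lemma C2map_compose_real:
 fixes u :: "'a::euclidean_space => real" and m m' m'' :: "real => real"
 assumes u: "C2map U u" and m: "!!v. (m has_real_derivative m' v) (at v)"
  "!!v. (m' has_real_derivative m'' v) (at v)" "continuous_on UNIV m''"
 shows "C2map U (%x. m (u x))"
proof -
 obtain f' f'' where f: "!!x. x : U ==> (u has_derivative f' x) (at x)"
  "!!h x. x : U ==> ((%y. f' y h) has_derivative f'' h x) (at x)"
  "!!h k. continuous_on U (%x. f'' h x k)" "!!h. continuous_on U (%x. f' x h)" "continuous_on U u"
  using u by(rule C2mapE) blast
 have c': "continuous_on UNIV m'" using m(2) by(meson DERIV_continuous continuous_at_imp_continuous_on)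
 show ?thesis unfolding C2map_def
 proof (rule exI[of _ "%x h. m' (u x)*f' x h"],
  rule exI[of _ "%h x k. m' (u x)*f'' h x k + (m'' (u x)*f' x k)*f' x h"], intro conjI allI ballI)
  fix x h assume x: "x : U"
  show "((%x. m (u x)) has_derivative (%h. m' (u x)*f' x h)) (at x)"
  using has_derivative_compose[OF f(1)[OF x]] m(1) by(auto simp: has_field_derivative_def)
  have "((%x. m' (u x)) has_derivative (%h. m'' (u x)*f' x h)) (at x)"
  using has_derivative_compose[OF f(1)[OF x]] m(2) by(auto simp: has_field_derivative_def)
  thus "((%y. m' (u y)*f' y h) has_derivative (%k. m' (u x)*f'' h x k + (m'' (u x)*f' x k)*f' x h)) (at x)"
  using f(2)[OF x] by(rule has_derivative_mult)
 next
  fix h k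
  show "continuous_on U (%x. m' (u x)*f'' h x k + (m'' (u x)*f' x k)*f' x h)"
  using f(3-5) by(intro continuous_intros continuous_on_compose2[OF c'] continuous_on_compose2[OF m(3)]) auto
 qed
qed

lemma C2map_transform:
 assumes "C2map U g" "open U" "!!x. x : U ==> f x = g x"
 shows "C2map U f"
proof -
 obtain g' g'' where g: "!!x. x : U ==> (g has_derivative g' x) (at x)"
  "!!h x. x : U ==> ((%y. g' y h) has_derivative g'' h x) (at x)"
  "!!h k. continuous_on U (%x. g'' h x k)" using assms(1) by(rule C2mapE) blast
 have "(f has_derivative g' x) (at x)" if "x : U" for x
  using has_derivative_transform_within_open[OF g(1)[OF that] assms(2) that] assms(3) by simp
 thus ?thesis unfolding C2map_def using g by blast
qed

text \<open>On the overlap the two derivatives agree by uniqueness, so they combine to one function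
  on the union; openness lets each second derivative be computed on one of the two sets.\<close>

lemma C2map_Un:
 assumes "C2map U g" "C2map V g" "open U" "open V"
 shows "C2map (U Un V) g"
proof -
 obtain f' f'' where f: "!!x. x : U ==> (g has_derivative f' x) (at x)"
  "!!h x. x : U ==> ((%y. f' y h) has_derivative f'' h x) (at x)"
  "!!h k. continuous_on U (%x. f'' h x k)" using assms(1) by(rule C2mapE) blast
 obtain g' g'' where g: "!!x. x : V ==> (g has_derivative g' x) (at x)"
  "!!h x. x : V ==> ((%y. g' y h) has_derivative g'' h x) (at x)"
  "!!h k. continuous_on V (%x. g'' h x k)" using assms(2) by(rule C2mapE) blast
 define h' where "h' x = (if x : U then f' x else g' x)" for x
 define h'' where "h'' h x = (if x : U then f'' h x else g'' h x)" for h x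
 have e1: "h' x = g' x" if "x : V" for x
  using has_derivative_unique[OF f(1) g(1)] that by(auto simp: h'_def)
 have d1: "(g has_derivative h' x) (at x)" if "x : U Un V" for x using f g that by(auto simp: h'_def)
 have dU: "((%y. h' y h) has_derivative f'' h x) (at x)" if "x : U" for x h
  by(rule has_derivative_transform_within_open[OF f(2)[OF that] assms(3) that]) (simp add: h'_def)
 have dV: "((%y. h' y h) has_derivative g'' h x) (at x)" if "x : V" for x h
  by(rule has_derivative_transform_within_open[OF g(2)[OF that] assms(4) that]) (simp add: e1)
 have e2: "h'' h x = g'' h x" if "x : V" for x h
  using has_derivative_unique[OF dU dV] that by(auto simp: h''_def)
 have d2: "((%y. h' y h) has_derivative h'' h x) (at x)" if "x : U Un V" for x h
  using dU dV that by(auto simp: h''_def)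
 have "continuous_on (U Un V) (%x. h'' h x k)" for h k
 proof (rule continuous_on_open_Un[OF assms(3,4)])
  show "continuous_on U (%x. h'' h x k)" using f(3) by(rule continuous_on_eq) (simp add: h''_def)
  show "continuous_on V (%x. h'' h x k)" using g(3) by(rule continuous_on_eq) (simp add: e2)
 qed
 thus ?thesis unfolding C2map_def using d1 d2 by blast
qed

text \<open>Compactness bounds the derivative in each basis direction, and convexity makes the mean
  value inequality available.\<close>

lemma C2map_lipschitz:
 fixes g :: "'a::euclidean_space => 'b::real_normed_vector"
 assumes g: "C2map U g" and s: "s <= U" "compact s" "convex s"
 obtains C where "C > 0" "!!x y. x : s ==> y : s ==> dist (g x) (g y) <= C*dist x y"
proof -
 obtain g' where g': "!!x. x : U ==> (g has_derivative g' x) (at x)" "!!h. continuous_on U (%x. g' x h)"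
  using g by(rule C2mapE) blast
 have "EX B. ALL x:s. norm (g' x b) <= B" for b
 proof -
  have "compact ((%x. g' x b) ` s)" using s g'(2) by(intro compact_continuous_image continuous_on_subset[OF g'(2)])
  thus ?thesis using compact_imp_bounded bounded_iff by(metis imageI)
 qed
 then obtain B where B: "!!b x. x : s ==> norm (g' x b) <= B b" by metis
 define C where "C = (SUM b:(Basis::'a set). abs(B b)) + 1"
 have "0 <= (SUM b:(Basis::'a set). abs(B b))" by(rule sum_nonneg) auto
 hence C: "C > 0" unfolding C_def by linarith
 have on: "onorm (g' x) <= C" if x: "x : s" for x
 proof (rule onorm_le)
  fix h
  have lin: "linear (g' x)" using g'(1) x s has_derivative_linear by blast
  have "g' x h = g' x (SUM b:Basis. (h \<bullet> b) *\<^sub>R b)" by(simp add: euclidean_representation)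
  also have "... = (SUM b:Basis. (h \<bullet> b) *\<^sub>R g' x b)" by(simp add: linear_sum[OF lin] linear_scale[OF lin])
  finally have "norm (g' x h) <= (SUM b:Basis. norm ((h \<bullet> b) *\<^sub>R g' x b))" by(metis norm_sum)
  also have "... <= (SUM b:(Basis::'a set). norm h*abs(B b))"
  using B[OF x] by(intro sum_mono) (auto intro!: mult_mono Basis_le_norm order_trans[OF _ abs_ge_self])
  also have "... <= C*norm h" by(simp add: C_def sum_distrib_left[symmetric] algebra_simps)
  finally show "norm (g' x h) <= C*norm h" .
 qed
 have "dist (g x) (g y) <= C*dist x y" if "x : s" "y : s" for x y
  using differentiable_bound[of s g g' C x y] s g'(1) on that
  by(auto simp: dist_norm intro: has_derivative_at_withinI)
 thus ?thesis using that C by blast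
qed

lemma C2_embedding_onE:
 assumes "C2_embedding_on s phi"
 obtains U g where "open U" "s <= U" "C2map U g" "!!x. x : s ==> g x = phi x" "inj_on phi s"
  "!!p. p : s ==> inj_on (frechet_derivative g (at p)) (span ((%q. q - p) ` s))"
 using assms C2_on_imp_C2map unfolding C2_embedding_on_def by metis

lemma C2_embedding_on_subset:
 assumes "C2_embedding_on s phi" "t <= s" shows "C2_embedding_on t phi"
proof -
 obtain U g where g: "open U" "s <= U" "C2_on U g" "ALL x:s. g x = phi x" "inj_on phi s"
  "!!p. p : s ==> inj_on (frechet_derivative g (at p)) (span ((%q. q - p) ` s))"
  using assms(1) unfolding C2_embedding_on_def by blast
 have "inj_on (frechet_derivative g (at p)) (span ((%q. q - p) ` t))" if "p : t" for p
  by(rule inj_on_subset[OF g(6)[of p]]) (use that assms(2) in "auto intro!: span_mono")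
 thus ?thesis unfolding C2_embedding_on_def using g assms(2) by(meson inj_on_subset subset_eq)
qed

lemma C2_embedding_on_continuous:
 assumes "C2_embedding_on s phi" shows "continuous_on s phi"
proof -
 obtain U g where g: "s <= U" "C2map U g" "!!x. x : s ==> g x = phi x"
  using assms by(rule C2_embedding_onE) blast
 have "continuous_on U g" using g(2) by(rule C2mapE) blast
 thus ?thesis using g by(metis continuous_on_cong continuous_on_subset)
qed

lemma C2_embedding_on_lipschitz:
 assumes "C2_embedding_on s phi" "compact s" "convex s"
 obtains C where "C > 0" "!!x y. x : s ==> y : s ==> dist (phi x) (phi y) <= C*dist x y"
proof -
 obtain U g where g: "s <= U" "C2map U g" "!!x. x : s ==> g x = phi x"
  using assms(1) by(rule C2_embedding_onE) blast
 obtain C where "C > 0" "!!x y. x : s ==> y : s ==> dist (g x) (g y) <= C*dist x y"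
  using C2map_lipschitz[OF g(2,1) assms(2,3)] by blast
 thus ?thesis using that[of C] g(3) by simp
qed

text \<open>Injectivity is asked for on the span of the differences of points of \<open>t\<close>,
  so that \<open>L\<close> may be a projection from a larger space.\<close>

lemma C2_embedding_on_compose_affine:
 fixes phi :: "'b::euclidean_space => 'c::real_normed_vector" and L :: "'a::euclidean_space => 'b"
 assumes phi: "C2_embedding_on s phi" and L: "linear L" and im: "(%x. a + L x) ` t <= s"
  and inj: "inj_on L (span ((%(p, q). q - p) ` (t \<times> t)))"
 shows "C2_embedding_on t (%x. phi (a + L x))"
proof -
 obtain U g where g: "open U" "s <= U" "C2map U g" "!!x. x : s ==> g x = phi x" "inj_on phi s"
  "!!p. p : s ==> inj_on (frechet_derivative g (at p)) (span ((%q. q - p) ` s))"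
  using phi by(rule C2_embedding_onE) blast
 have bl: "bounded_linear L" using L by(simp add: linear_conv_bounded_linear)
 let ?A = "%x. a + L x"
 have cA: "continuous_on UNIV ?A" using bl by(intro continuous_intros linear_continuous_on)
 show ?thesis unfolding C2_embedding_on_def
 proof (intro conjI exI[of _ "?A -` U"] exI[of _ "%x. g (?A x)"] ballI)
  show "inj_on (%x. phi (?A x)) t"
  proof (rule inj_onI)
  fix x y assume xy: "x : t" "y : t" "phi (?A x) = phi (?A y)"
  hence "?A x = ?A y" using g(5) im by(meson image_subset_iff inj_onD)
  hence "L (y - x) = L 0" using L by(simp add: linear_diff linear_0)
  moreover have "y - x : span ((%(p, q). q - p) ` (t \<times> t))" using xy by(intro span_base) force
  ultimately have "y - x = 0" using inj span_0 by(metis inj_onD)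
  thus "x = y" by simp
  qed
  show "open (?A -` U)" using cA g(1) open_vimage by blast
  show "t <= ?A -` U" using im g(2) by auto
  show "C2_on (?A -` U) (%x. g (?A x))"
  by(rule C2map_imp_C2_on[OF C2map_compose_affine[OF g(3) bl]])
  fix p assume p: "p : t"
  thus "g (?A p) = phi (?A p)" using g(4) im by auto
  have ps: "?A p : s" using p im by auto
  obtain g' where g': "(g has_derivative g') (at (?A p))"
  using g(2,3) ps by(metis subsetD C2mapE)
  have e1: "frechet_derivative g (at (?A p)) = g'" using frechet_derivative_at[OF g'] by simp
  have "(?A has_derivative L) (at p)"
  using bounded_linear_imp_has_derivative[OF bl] by(auto intro!: derivative_eq_intros)
  hence "((%x. g (?A x)) has_derivative (%h. g' (L h))) (at p)"
  using g' by(rule has_derivative_compose)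
  hence e2: "frechet_derivative (%x. g (?A x)) (at p) = (%h. g' (L h))"
  using frechet_derivative_at by metis
  have "L ` span ((%q. q - p) ` t) = span (L ` (%q. q - p) ` t)" using L by(metis span_linear_image)
  also have "... <= span ((%q. q - ?A p) ` s)"
  using im by(intro span_mono) (auto simp: linear_diff[OF L] image_iff; force simp: algebra_simps)
  finally have sub: "L ` span ((%q. q - p) ` t) <= span ((%q. q - ?A p) ` s)" .
  have "inj_on L (span ((%q. q - p) ` t))"
  by(rule inj_on_subset[OF inj]) (use p in "intro span_mono; force")
  moreover have "inj_on g' (L ` span ((%q. q - p) ` t))"
  using g(6)[OF ps] sub e1 by(metis inj_on_subset)
  ultimately have "inj_on (g' \<circ> L) (span ((%q. q - p) ` t))" by(rule comp_inj_on)
  thus "inj_on (frechet_derivative (%x. g (?A x)) (at p)) (span ((%q. q - p) ` t))"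
  by(simp add: e2 o_def)
 qed
qed

section \<open>Poisson processes as functions of the intensity measure\<close>

text \<open>The law of \<open>poisson_space\<close> expressed through the intensity measure alone,
  so that it can be transported along maps and compared for densities that agree almost
  everywhere.\<close>

definition poisson_law :: "'a measure => (nat \<times> (nat => 'a)) measure" where
 "poisson_law mu = measure_pmf (poisson_pmf (measure mu UNIV)) \<Otimes>\<^sub>M
  (\<Pi>\<^sub>M i\<in>(UNIV :: nat set). density mu (%_. ennreal (1/measure mu UNIV)))"

definition poisson_mean ::
  "'n::finite functional => real => (real^'n) measure => (real^'n => real^'n => real) => real" where
 "poisson_mean H n mu dl = (if emeasure mu UNIV = 0 then H n {} dl
  else (\<integral>om. H n (poisson_process om) dl \<partial>poisson_law mu))"

lemma mass_eq_emeasure: "g : borel_measurable borel ==>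
  mass d g = emeasure (density (hausdorff d) (%x. ennreal (g x))) UNIV"
 by(simp add: mass_def emeasure_density)

lemma poisson_space_eq_law:
 assumes [measurable]: "g : borel_measurable borel" and "!!x. 0 <= g x"
 shows "poisson_space d g = poisson_law (density (hausdorff d) (%x. ennreal (g x)))"
proof -
 let ?mu = "density (hausdorff d) (%x. ennreal (g x))"
 have m: "enn2real (mass d g) = measure ?mu UNIV" by(simp add: mass_eq_emeasure measure_def)
 have "density ?mu (%_. ennreal (1/measure ?mu UNIV)) =
  density (hausdorff d) (%x. ennreal (g x)*ennreal (1/measure ?mu UNIV))"
  by(rule density_density_eq) auto
 also have "... = density (hausdorff d) (%x. ennreal (g x/measure ?mu UNIV))"
  using assms(2) by(simp add: ennreal_mult'[symmetric])
 finally show ?thesis unfolding poisson_space_def poisson_law_def Let_def m by simp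
qed

lemma expected_eq_poisson_mean:
 assumes "g : borel_measurable borel" "!!x. 0 <= g x"
 shows "expected d H n g dl = poisson_mean H n (density (hausdorff d) (%x. ennreal (g x))) dl"
 using assms by(simp add: expected_def poisson_mean_def mass_eq_emeasure poisson_space_eq_law)

text \<open>Both measures agree on cylinders over finitely many indices, which determine a finite
  measure on the product.\<close>

lemma PiM_distr_UNIV:
 assumes "prob_space M" and [measurable]: "T : measurable M N"
 shows "(\<Pi>\<^sub>M i\<in>(UNIV :: 'i set). distr M N T) =
  distr (\<Pi>\<^sub>M i\<in>(UNIV :: 'i set). M) (\<Pi>\<^sub>M i\<in>(UNIV :: 'i set). N) (%x i. T (x i))"
proof (rule measure_eqI_PiM_infinite)
 interpret M: prob_space M by fact
 interpret D: prob_space "distr M N T" by(rule M.prob_space_distr) simp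
 interpret PM: product_prob_space "%_. M" "UNIV :: 'i set" ..
 interpret PD: product_prob_space "%_. distr M N T" "UNIV :: 'i set" ..
 show "sets (\<Pi>\<^sub>M i\<in>(UNIV :: 'i set). distr M N T) = sets (\<Pi>\<^sub>M i\<in>(UNIV :: 'i set). distr M N T)" ..
 show "sets (distr (\<Pi>\<^sub>M i\<in>(UNIV :: 'i set). M) (\<Pi>\<^sub>M i\<in>(UNIV :: 'i set). N) (%x i. T (x i))) =
  sets (\<Pi>\<^sub>M i\<in>(UNIV :: 'i set). distr M N T)"
  by(simp, rule sets_PiM_cong) auto
 show "finite_measure (\<Pi>\<^sub>M i\<in>(UNIV :: 'i set). distr M N T)"
  by standard (use PD.P.emeasure_space_1 in auto)
 fix A and K :: "'i set"
 assume K: "finite K" "K <= UNIV" and A': "!!i. i : K ==> A i : sets (distr M N T)"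
 hence A[measurable]: "!!i. i : K ==> A i : sets N" by simp
 have mT[measurable]: "(%x i. T (x i)) : measurable (\<Pi>\<^sub>M i\<in>(UNIV :: 'i set). M) (\<Pi>\<^sub>M i\<in>(UNIV :: 'i set). N)"
  by(rule measurable_PiM_single') (auto simp: space_PiM dest: measurable_space[OF assms(2)])
 have e: "prod_emb UNIV (%_. distr M N T) K (Pi\<^sub>E K A) = prod_emb UNIV (%_. N) K (Pi\<^sub>E K A)"
  by(simp add: prod_emb_def)
 have pre: "(%x i. T (x i)) -` prod_emb UNIV (%_. N) K (Pi\<^sub>E K A) Int space (\<Pi>\<^sub>M i\<in>(UNIV :: 'i set). M) =
  prod_emb UNIV (%_. M) K (\<Pi>\<^sub>E i\<in>K. T -` A i Int space M)"
  using measurable_space[OF assms(2)]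
  by(auto simp: prod_emb_def space_PiM PiE_iff extensional_def restrict_def Pi_iff)
 have "emeasure (\<Pi>\<^sub>M i\<in>(UNIV :: 'i set). distr M N T) (prod_emb UNIV (%_. distr M N T) K (Pi\<^sub>E K A)) =
  (\<Prod>i\<in>K. emeasure M (T -` A i Int space M))"
  using K A by(subst PD.emeasure_PiM_emb) (auto simp: emeasure_distr)
 also have "... = emeasure (\<Pi>\<^sub>M i\<in>(UNIV :: 'i set). M) (prod_emb UNIV (%_. M) K (\<Pi>\<^sub>E i\<in>K. T -` A i Int space M))"
  using K A by(subst PM.emeasure_PiM_emb) auto
 also have "... = emeasure (distr (\<Pi>\<^sub>M i\<in>(UNIV :: 'i set). M) (\<Pi>\<^sub>M i\<in>(UNIV :: 'i set). N) (%x i. T (x i)))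
  (prod_emb UNIV (%_. distr M N T) K (Pi\<^sub>E K A))"
  unfolding e pre[symmetric] using K A by(intro emeasure_distr[symmetric] mT sets_PiM_I) auto
 finally show "emeasure (\<Pi>\<^sub>M i\<in>(UNIV :: 'i set). distr M N T) (prod_emb UNIV (%_. distr M N T) K (Pi\<^sub>E K A)) =
  emeasure (distr (\<Pi>\<^sub>M i\<in>(UNIV :: 'i set). M) (\<Pi>\<^sub>M i\<in>(UNIV :: 'i set). N) (%x i. T (x i)))
  (prod_emb UNIV (%_. distr M N T) K (Pi\<^sub>E K A))" .
qed

lemma prob_space_normalized:
 assumes "sets mu = sets borel" "emeasure mu UNIV ~= 0" "emeasure mu UNIV ~= \<infinity>"
 shows "prob_space (density mu (%_. ennreal (1/measure mu UNIV)))"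
proof (rule prob_spaceI)
 have sp: "space mu = UNIV" using sets_eq_imp_space_eq[OF assms(1)] by simp
 have "emeasure mu UNIV = ennreal (measure mu UNIV)" using assms(3) by(simp add: emeasure_eq_ennreal_measure)
 moreover hence "measure mu UNIV > 0" using assms(2) by(simp add: zero_less_iff_neq_zero less_le)
 ultimately show "emeasure (density mu (%_. ennreal (1/measure mu UNIV))) (space (density mu (%_. ennreal (1/measure mu UNIV)))) = 1"
  using sp assms(1) by(simp add: emeasure_density_const ennreal_mult'[symmetric])
qed

text \<open>The mapping theorem for Poisson processes in sampled form: the total mass, hence the law
  of the number of points, is unchanged, and the points are mapped one by one.\<close>

lemma poisson_law_distr:
 fixes mu :: "'a::topological_space measure" and T :: "'a => 'b::topological_space"
 assumes mu: "sets mu = sets borel" "emeasure mu UNIV ~= 0" "emeasure mu UNIV ~= \<infinity>"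
  and T: "T : borel \<rightarrow>\<^sub>M borel"
 shows "poisson_law (distr mu borel T) =
  distr (poisson_law mu) (count_space UNIV \<Otimes>\<^sub>M (\<Pi>\<^sub>M i\<in>(UNIV :: nat set). borel)) (%(N, x). (N, %i. T (x i)))"
proof -
 have sp: "space mu = UNIV" using sets_eq_imp_space_eq[OF mu(1)] by simp
 let ?m = "measure mu UNIV"
 let ?q = "density mu (%_. ennreal (1/?m))"
 have Tm: "T : mu \<rightarrow>\<^sub>M borel" using T mu(1) by(simp cong: measurable_cong_sets)
 hence Tq: "T : ?q \<rightarrow>\<^sub>M borel" by simp
 have m: "measure (distr mu borel T) UNIV = ?m" using Tm sp by(subst measure_distr) auto
 have q: "density (distr mu borel T) (%_. ennreal (1/?m)) = distr ?q borel T"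
  using Tm by(subst density_distr) auto
 have ps: "prob_space ?q" by(rule prob_space_normalized[OF mu])
 have mT: "(%x i. T (x i)) : measurable (\<Pi>\<^sub>M i\<in>(UNIV :: nat set). ?q) (\<Pi>\<^sub>M i\<in>(UNIV :: nat set). borel)"
  by(rule measurable_PiM_single') (use Tq in "auto simp: space_PiM")
 have ps2: "prob_space (\<Pi>\<^sub>M i\<in>(UNIV :: nat set). ?q)" using ps by(intro prob_space_PiM)
 have "poisson_law (distr mu borel T) =
  distr (measure_pmf (poisson_pmf ?m)) (count_space UNIV) id \<Otimes>\<^sub>M
  distr (\<Pi>\<^sub>M i\<in>(UNIV :: nat set). ?q) (\<Pi>\<^sub>M i\<in>(UNIV :: nat set). borel) (%x i. T (x i))"
  unfolding poisson_law_def m q PiM_distr_UNIV[OF ps Tq]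
  by(intro arg_cong2[where f="(\<Otimes>\<^sub>M)"] refl measure_eqI) (auto simp: emeasure_distr)
 also have "... = distr (poisson_law mu) (count_space UNIV \<Otimes>\<^sub>M (\<Pi>\<^sub>M i\<in>(UNIV :: nat set). borel)) (%(N, x). (id N, %i. T (x i)))"
  unfolding poisson_law_def
  by(rule pair_measure_distr)
  (use mT prob_space.prob_space_distr[OF ps2 mT] in "auto intro: prob_space_imp_sigma_finite")
 finally show ?thesis by simp
qed

lemma AE_poisson_law:
 fixes mu :: "'a::topological_space measure"
 assumes mu: "sets mu = sets borel" "emeasure mu UNIV ~= 0" "emeasure mu UNIV ~= \<infinity>"
  and ae: "AE x in mu. x : s" and s: "s : sets borel"
 shows "AE om in poisson_law mu. ALL i. snd om i : s"
proof -
 let ?q = "density mu (%_. ennreal (1/measure mu UNIV))"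
 let ?P = "\<Pi>\<^sub>M i\<in>(UNIV :: nat set). ?q"
 have ps: "prob_space ?q" by(rule prob_space_normalized[OF mu])
 interpret P: prob_space ?P using ps by(intro prob_space_PiM)
 have "AE x in ?q. x : s" using ae by(simp add: AE_density)
 hence "AE x in ?P. ALL i. x i : s"
  using ps by(auto simp: AE_all_countable intro!: AE_PiM_component)
 then obtain N where N: "{x : space ?P. ~ (ALL i. x i : s)} <= N" "emeasure ?P N = 0" "N : sets ?P"
  by(auto elim!: AE_E)
 show ?thesis unfolding poisson_law_def
 proof (rule AE_I[where N="UNIV \<times> N"])
  show "{x : space (measure_pmf (poisson_pmf (measure mu UNIV)) \<Otimes>\<^sub>M ?P). ~ (ALL i. snd x i : s)} <= UNIV \<times> N"
  proof
  fix x assume "x : {x : space (measure_pmf (poisson_pmf (measure mu UNIV)) \<Otimes>\<^sub>M ?P). ~ (ALL i. snd x i : s)}"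
  hence "snd x : {x : space ?P. ~ (ALL i. x i : s)}" by(auto simp: space_pair_measure)
  thus "x : UNIV \<times> N" using N(1) by(cases x) auto
  qed
  show "emeasure (measure_pmf (poisson_pmf (measure mu UNIV)) \<Otimes>\<^sub>M ?P) (UNIV \<times> N) = 0"
  using N by(subst P.emeasure_pair_measure_Times) auto
  show "UNIV \<times> N : sets (measure_pmf (poisson_pmf (measure mu UNIV)) \<Otimes>\<^sub>M ?P)"
  using N by auto
 qed
qed

text \<open>All points lie in \<open>s\<close> almost surely, so the identity between the two
  functionals is asked for on subsets of \<open>s\<close>. The metric may change from
  \<open>dl\<close> to \<open>dl'\<close>, which is how a pullback metric on a flat simplex is
  exchanged for the Euclidean one on its image. Integrability supplies the measurability that the
  change of variables requires.\<close>

lemma poisson_mean_distr: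
 fixes H :: "'n::finite functional"
 assumes mu: "sets mu = sets borel" "emeasure mu UNIV ~= \<infinity>" and T: "T : borel \<rightarrow>\<^sub>M borel"
  and ae: "AE x in mu. x : s" and s: "s : sets borel"
  and H: "!!X. finite X ==> X <= s ==> H n X dl = H n (T ` X) dl'"
  and int: "emeasure mu UNIV ~= 0 ==> integrable (poisson_law mu) (%om. H n (poisson_process om) dl)"
  "emeasure mu UNIV ~= 0 ==>
  integrable (poisson_law (distr mu borel T)) (%om. H n (poisson_process om) dl')"
 shows "poisson_mean H n (distr mu borel T) dl' = poisson_mean H n mu dl"
proof -
 have sp: "space mu = UNIV" using sets_eq_imp_space_eq[OF mu(1)] by simp
 have Tm: "T : mu \<rightarrow>\<^sub>M borel" using T mu(1) by(simp cong: measurable_cong_sets)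
 have e: "emeasure (distr mu borel T) UNIV = emeasure mu UNIV" using Tm sp by(subst emeasure_distr) auto
 show ?thesis
 proof (cases "emeasure mu UNIV = 0")
  case True
  thus ?thesis using H[of "{}"] by(simp add: poisson_mean_def e)
 next
  case False
  let ?F = "%(N::nat, x). (N, %i::nat. T (x i))"
  let ?B = "count_space UNIV \<Otimes>\<^sub>M (\<Pi>\<^sub>M i\<in>(UNIV :: nat set). borel) :: (nat \<times> (nat => real^'n)) measure"
  have sets: "sets (poisson_law mu) = sets ?B"
  unfolding poisson_law_def
  by(intro sets_pair_measure_cong sets_PiM_cong) (auto simp: mu)
  have F: "?F : poisson_law mu \<rightarrow>\<^sub>M ?B"
  proof -
  have [measurable]: "T : borel \<rightarrow>\<^sub>M borel" by fact
  have "(%om. %i. T (snd om i)) : ?B \<rightarrow>\<^sub>M (\<Pi>\<^sub>M i\<in>(UNIV :: nat set). borel)"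
  by(rule measurable_PiM_single') (auto simp: space_PiM)
  hence "(%om. (fst om, %i. T (snd om i))) : ?B \<rightarrow>\<^sub>M ?B" by measurable
  hence "?F : ?B \<rightarrow>\<^sub>M ?B" by(simp add: case_prod_beta')
  thus ?thesis by(simp add: measurable_cong_sets[OF sets refl])
  qed
  have law: "poisson_law (distr mu borel T) = distr (poisson_law mu) ?B ?F"
  by(rule poisson_law_distr[OF mu(1) False mu(2) T])
  have meas: "(%om. H n (poisson_process om) dl') : borel_measurable ?B"
  using borel_measurable_integrable[OF int(2)[OF False]] unfolding law by simp
  have "poisson_mean H n (distr mu borel T) dl' = (\<integral>om. H n (poisson_process (?F om)) dl' \<partial>poisson_law mu)"
  using False by(simp add: poisson_mean_def e law integral_distr[OF F meas])
  also have "... = (\<integral>om. H n (poisson_process om) dl \<partial>poisson_law mu)"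
  proof (rule integral_cong_AE)
  show "(%om. H n (poisson_process (?F om)) dl') : borel_measurable (poisson_law mu)"
  using measurable_compose[OF F meas] by simp
  show "(%om. H n (poisson_process om) dl) : borel_measurable (poisson_law mu)"
  by(rule borel_measurable_integrable[OF int(1)[OF False]])
  show "AE om in poisson_law mu. H n (poisson_process (?F om)) dl' = H n (poisson_process om) dl"
  using AE_poisson_law[OF mu(1) False mu(2) ae s]
  proof (rule AE_mp, intro AE_I2 impI)
  fix om :: "nat \<times> (nat => real^'n)" assume om: "ALL i. snd om i : s"
  have "poisson_process (?F om) = T ` poisson_process om"
  by(cases om) (auto simp: poisson_process_def image_image)
  thus "H n (poisson_process (?F om)) dl' = H n (poisson_process om) dl"
  proof -
  have "finite (poisson_process om)" "poisson_process om <= s"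
  using om by(cases om; auto simp: poisson_process_def)+
  thus ?thesis using H[of "poisson_process om"] \<open>poisson_process (?F om) = T ` poisson_process om\<close> by simp
  qed
  qed
  qed
  finally show ?thesis using False by(simp add: poisson_mean_def)
 qed
qed

section \<open>Measures with a density with respect to Hausdorff measure\<close>

text \<open>Mass at most 1 instead of exactly 1, so that restrictions to pieces and weights with
  values in the unit interval stay in the class.\<close>

definition subdens :: "nat => 'a::metric_space measure => bool" where
 "subdens d mu \<longleftrightarrow> emeasure mu UNIV <= 1 &
  (EX g:borel_measurable borel. (ALL x. 0 <= g x) & mu = density (hausdorff d) (%x. ennreal (g x)))"

lemma subdensE:
 assumes "subdens d mu"
 obtains g where "g : borel_measurable borel" "!!x. 0 <= g x"
  "mu = density (hausdorff d) (%x. ennreal (g x))" "emeasure mu UNIV <= 1"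
 using assms unfolding subdens_def by blast

lemma subdens_sets:
 "subdens d mu ==> sets mu = sets borel"
 by(auto elim!: subdensE)

lemma subdens_space:
 "subdens d mu ==> space mu = UNIV"
 by(auto elim!: subdensE)

lemma subdens_finite:
 assumes "subdens d mu" shows "finite_measure mu"
 using assms subdens_space[OF assms]
 by(intro finite_measureI) (auto simp: subdens_def top_unique)

lemma subdens_density:
 assumes mu: "subdens d mu" and [measurable]: "u : borel_measurable borel" and u: "!!x. 0 <= u x"
  and le: "emeasure (density mu (%x. ennreal (u x))) UNIV <= 1"
 shows "subdens d (density mu (%x. ennreal (u x)))"
proof -
 obtain g where g: "g : borel_measurable borel" "!!x. 0 <= g x" "mu = density (hausdorff d) (%x. ennreal (g x))"
  using mu by(rule subdensE) blast
 have [measurable]: "g : borel_measurable borel" by fact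
 have "density mu (%x. ennreal (u x)) = density (hausdorff d) (%x. ennreal (g x)*ennreal (u x))"
  unfolding g(3) by(rule density_density_eq) auto
 also have "... = density (hausdorff d) (%x. ennreal (g x*u x))"
  using g(2) u by(simp add: ennreal_mult)
 finally show ?thesis unfolding subdens_def
  using le g(2) u by(intro conjI bexI[of _ "%x. g x*u x"]) auto
qed

lemma emeasure_density_le:
 assumes "sets mu = sets borel" "u : borel_measurable borel" "!!x. u x <= (1::ennreal)"
 shows "emeasure (density mu u) UNIV <= emeasure mu UNIV"
proof -
 have sp: "space mu = UNIV" using sets_eq_imp_space_eq[OF assms(1)] by simp
 have "u : borel_measurable mu" using assms by(simp cong: measurable_cong_sets)
 hence "emeasure (density mu u) UNIV = (\<integral>\<^sup>+x. u x \<partial>mu)"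
  using assms(1) by(subst emeasure_density) auto
 also have "... <= (\<integral>\<^sup>+x. 1 \<partial>mu)" using assms(3) by(intro nn_integral_mono) auto
 finally show ?thesis using sp by simp
qed

lemma subdens_density_le1:
 assumes mu: "subdens d mu" and "u : borel_measurable borel" and "!!x. 0 <= u x" "!!x. u x <= 1"
 shows "subdens d (density mu (%x. ennreal (u x)))"
 using assms emeasure_density_le[OF subdens_sets[OF mu], of "%x. ennreal (u x)"]
 by(intro subdens_density[OF mu]) (auto simp: subdens_def)

lemma subdens_null:
 assumes "subdens d mu" "A : sets borel" "hausdorff_outer d A = 0"
 shows "emeasure mu A = 0"
proof -
 obtain g where g: "g : borel_measurable borel" "mu = density (hausdorff d) (%x. ennreal (g x))"
  using assms(1) by(rule subdensE) blast
 have "A : null_sets (hausdorff d)" using assms by(auto simp: null_sets_def emeasure_hausdorff)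
 hence "A : null_sets mu" unfolding g(2) using g(1) by(intro absolutely_continuousI_density[unfolded absolutely_continuous_def, THEN subsetD]) auto
 thus ?thesis by auto
qed

text \<open>The inverse of \<open>T\<close> is Lipschitz on \<open>X\<close>, so preimages of
  Hausdorff null sets are null, and the image measure is absolutely continuous. The Radon-Nikodym
  theorem then provides the density.\<close>

lemma subdens_distr:
 fixes T :: "'a::metric_space => 'b::metric_space"
 assumes mu: "subdens d mu" and T[measurable]: "T : borel \<rightarrow>\<^sub>M borel"
  and X: "X : sets borel" "emeasure mu (- X) = 0"
  and C: "C > 0" "!!x y. x : X ==> y : X ==> dist x y <= C*dist (T x) (T y)"
  and TX[measurable]: "T ` X : sets borel" and fin: "hausdorff_outer d (T ` X) < \<infinity>"
 shows "subdens d (distr mu borel T)"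
proof -
 note sets = subdens_sets[OF mu] and sp = subdens_space[OF mu]
 have Tm: "T : mu \<rightarrow>\<^sub>M borel" using T sets by(simp cong: measurable_cong_sets)
 \<comment> \<open>Hausdorff measure of dimension below that of the space need not be sigma-finite;
   its restriction to the image of \<open>X\<close> is finite.\<close>
 define B where "B = density (hausdorff d) (indicator (T ` X) :: 'b => ennreal)"
 have B: "emeasure B A = hausdorff_outer d (A Int T ` X)" if "A : sets borel" for A
  unfolding B_def using that TX by(subst emeasure_restricted) (auto simp: emeasure_hausdorff Int_commute)
 have sB: "sets B = sets borel" "space B = UNIV" by(auto simp: B_def)
 interpret B: finite_measure B
  using B[of UNIV] fin sB by(intro finite_measureI) auto
 have inj: "inj_on T X"
 proof (rule inj_onI)
  fix x y assume "x : X" "y : X" "T x = T y"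
  thus "x = y" using C(2)[of x y] by simp
 qed
 have ac: "absolutely_continuous B (distr mu borel T)"
  unfolding absolutely_continuous_def
 proof
  fix A assume "A : null_sets B"
  hence A: "A : sets borel" "hausdorff_outer d (A Int T ` X) = 0" using B sB by(auto simp: null_sets_def)
  let ?P = "T -` A Int X"
  have P: "T -` A : sets borel" using A(1) measurable_sets[OF T] by simp
  have "hausdorff_outer d (inv_into X T ` T ` ?P) <= ennreal (C ^ d)*hausdorff_outer d (T ` ?P)"
  by(rule hausdorff_lipschitz) (use C inj in auto)
  moreover have "inv_into X T ` T ` ?P = ?P" using inj by(intro inv_into_image_cancel) auto
  moreover have "hausdorff_outer d (T ` ?P) <= hausdorff_outer d (A Int T ` X)"
  by(rule hausdorff_outer_mono) auto
  ultimately have "hausdorff_outer d ?P = 0" using A(2) by simp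
  hence 1: "emeasure mu ?P = 0" using P X(1) by(intro subdens_null[OF mu]) auto
  have "emeasure mu (T -` A) <= emeasure mu (?P Un - X)"
  using P X(1) sets by(intro emeasure_mono) auto
  also have "... <= emeasure mu ?P + emeasure mu (- X)"
  using P X(1) sets by(intro emeasure_subadditive) auto
  finally have "emeasure mu (T -` A) = 0" using 1 X(2) by simp
  thus "A : null_sets (distr mu borel T)"
  using A(1) Tm sp by(auto simp: null_sets_def emeasure_distr)
 qed
 obtain f where f[measurable]: "f : borel_measurable B" and fd: "density B f = distr mu borel T"
  using B.Radon_Nikodym[OF ac] sB by auto
 have fb[measurable]: "f : borel_measurable borel" using f sB by(simp cong: measurable_cong_sets)
 have em: "emeasure (distr mu borel T) UNIV <= 1"
  using mu Tm sp by(subst emeasure_distr) (auto simp: subdens_def)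
 have "(\<integral>\<^sup>+x. f x \<partial>B) ~= \<infinity>"
 proof -
  have "(\<integral>\<^sup>+x. f x \<partial>B) = emeasure (density B f) UNIV" using sB by(simp add: emeasure_density)
  thus ?thesis using em unfolding fd by(auto simp: top_unique)
 qed
 hence "AE x in B. f x ~= \<infinity>" by(intro nn_integral_PInf_AE) auto
 hence fin': "AE x in hausdorff d. x : T ` X --> f x ~= \<infinity>"
  unfolding B_def using TX by(subst (asm) AE_density) (auto simp: indicator_def elim!: eventually_mono)
 define g where "g x = indicator (T ` X) x*enn2real (f x)" for x
 have gm: "g : borel_measurable borel" unfolding g_def by measurable
 have "distr mu borel T = density (hausdorff d) (%x. indicator (T ` X) x*f x)"
  unfolding fd[symmetric] B_def by(rule density_density_eq) auto
 also have "... = density (hausdorff d) (%x. ennreal (g x))"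
  by(rule density_cong) (use fin' gm in "auto simp: g_def indicator_def less_top elim!: eventually_mono")
 finally show ?thesis unfolding subdens_def using em gm
  by(intro conjI bexI[of _ g]) (auto simp: g_def)
qed

lemma C2_embedding_on_cong:
 assumes "!!x. x : s ==> f x = g x" shows "C2_embedding_on s f \<longleftrightarrow> C2_embedding_on s g"
proof -
 have "inj_on f s = inj_on g s" using assms by(rule inj_on_cong)
 moreover have "(ALL x:s. k x = f x) = (ALL x:s. k x = g x)" for k using assms by simp
 ultimately show ?thesis unfolding C2_embedding_on_def by simp
qed

section \<open>Simplices\<close>

lemma simplex_linear_image:
 assumes "n simplex S" "linear L" "linear L'" "!!x. x : S ==> L' (L x) = x"
 shows "n simplex (L ` S)"
proof -
 obtain C where C: "~ affine_dependent C" "int (card C) = n + 1" "S = convex hull C"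
  using assms(1) unfolding simplex_def by blast
 have CS: "C <= S" using C(3) hull_subset by metis
 have fin: "finite C" using C(1) by(rule aff_independent_finite)
 have inj: "inj_on L C" using assms(4) CS by(metis inj_onI subsetD)
 have "L' ` L ` C = C" using assms(4) CS by(force simp: image_image)
 hence "aff_dim C <= aff_dim (L ` C)" using aff_dim_linear_image_le[OF assms(3), of "L ` C"] by simp
 moreover have "aff_dim (L ` C) <= aff_dim C" by(rule aff_dim_linear_image_le[OF assms(2)])
 ultimately have "~ affine_dependent (L ` C)"
  using C(1) fin inj by(simp add: affine_independent_iff_card card_image)
 moreover have "L ` S = convex hull (L ` C)" using C(3) assms(2) by(simp add: convex_hull_linear_image)
 ultimately show ?thesis unfolding simplex_def using C(2) inj by(auto simp: card_image)
qed

lemma simplex_translation: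
 assumes "n simplex S" shows "n simplex ((+) a ` S)"
proof -
 obtain C where C: "~ affine_dependent C" "int (card C) = n + 1" "S = convex hull C"
  using assms(1) unfolding simplex_def by blast
 have "~ affine_dependent ((+) a ` C)" using C(1) affine_dependent_translation_eq[of C a] by simp
 moreover have "(+) a ` S = convex hull ((+) a ` C)" using C(3) by(simp add: convex_hull_translation)
 ultimately show ?thesis unfolding simplex_def using C(2) by(auto simp: card_image)
qed

lemma simplex_scaleR:
 assumes "n simplex S" "c ~= 0" shows "n simplex ((*\<^sub>R) c ` S)"
 by(rule simplex_linear_image[where L'="(*\<^sub>R) (1/c)"]) (use assms in auto)

lemma face_of_simplex:
 assumes "n simplex S" "F face_of S" shows "EX m. m simplex F"
proof -
 obtain C where C: "~ affine_dependent C" "S = convex hull C"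
  using assms(1) unfolding simplex_def by blast
 obtain c where c: "c <= C" "F = convex hull c"
  using assms(2) C face_of_convex_hull_affine_independent by metis
 have "~ affine_dependent c" using C(1) c(1) affine_independent_subset by blast
 hence "(int (card c) - 1) simplex F" unfolding simplex_def using c(2) by(intro exI[of _ c]) auto
 thus ?thesis ..
qed

lemma simplex_affine_hull_plane:
 fixes J :: "'n::finite set"
 assumes "int (card J) simplex s" "s <= plane J"
 shows "affine hull s = plane J"
proof (rule affine_dim_equal)
 show "affine hull s <= plane J"
  by(rule hull_minimal[where S=affine]) (use assms subspace_imp_affine[OF subspace_plane] in auto)
 have "s ~= {}" using assms(1) by auto
 thus "affine hull s ~= {}" by simp
 show "aff_dim (affine hull s) = aff_dim (plane J)"
  using aff_dim_simplex[OF assms(1)] by(simp add: aff_dim_subspace subspace_plane dim_plane)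
qed (auto intro: subspace_imp_affine subspace_plane)

text \<open>Homothetic copies about a point of the relative interior, with ratio
  \<open>1 - e l\<close> increasing to 1, exhaust the relative interior.\<close>

lemma simplex_shrinking:
 fixes tau :: "'a::euclidean_space set"
 assumes tau: "n simplex tau" and ne: "tau ~= {}"
 obtains T where "incseq T" "!!l::nat. n simplex (T l)" "(\<Union>l. T l) = rel_interior tau"
proof -
 have conv: "convex tau" using tau by(rule convex_simplex)
 obtain c where c: "c : rel_interior tau" using conv ne rel_interior_eq_empty by blast
 hence ctau: "c : tau" using rel_interior_subset by blast
 \<comment> \<open>The shift by 2 keeps \<open>e l\<close> strictly between 0 and 1 also for
   \<open>l = 0\<close>.\<close>
 define e where "e l = 1/real (l + 2)" for l
 have e: "0 < e l" "e l < 1" for l by(auto simp: e_def)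
 define T where "T l = (%x. x - e l *\<^sub>R (x - c)) ` tau" for l
 have T_alt: "T l = (+) (e l *\<^sub>R c) ` (*\<^sub>R) (1 - e l) ` tau" for l
  unfolding T_def image_image by(rule image_cong) (auto simp: algebra_simps)
 have 1: "n simplex (T l)" for l
  unfolding T_alt by(intro simplex_translation simplex_scaleR tau) (use e[of l] in simp)
 have 2: "T l <= rel_interior tau" for l
  unfolding T_def using rel_interior_convex_shrink[OF conv c] e[of l] by auto
 have mem: "y : T l" if "c + (1/(1 - e l)) *\<^sub>R (y - c) : tau" for y l
 proof -
  have "y = (c + (1/(1 - e l)) *\<^sub>R (y - c)) - e l *\<^sub>R ((c + (1/(1 - e l)) *\<^sub>R (y - c)) - c)"
  proof -
  define k where "k = 1/(1 - e l)"
  have "k - e l*k = 1" using e[of l] by(simp add: k_def field_simps)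
  moreover have "(c + k *\<^sub>R (y - c)) - e l *\<^sub>R ((c + k *\<^sub>R (y - c)) - c) = c + (k - e l*k) *\<^sub>R (y - c)"
  by(simp add: algebra_simps)
  ultimately show ?thesis by(simp add: k_def)
  qed
  thus ?thesis unfolding T_def using that by blast
 qed
 have 3: "T l <= T m" if "l <= m" for l m
 proof
  fix y assume "y : T l"
  then obtain x where x: "x : tau" "y = x - e l *\<^sub>R (x - c)" unfolding T_def by blast
  have em: "e m <= e l" using that by(simp add: e_def frac_le)
  define r where "r = (1 - e l)/(1 - e m)"
  have r: "0 <= r" "r <= 1" using e[of l] e[of m] em by(auto simp: r_def)
  have "c + (1/(1 - e m)) *\<^sub>R (y - c) = (1 - r) *\<^sub>R c + r *\<^sub>R x"
  proof -
  have "y - c = (1 - e l) *\<^sub>R (x - c)" using x(2) by(simp add: algebra_simps)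
  hence "c + (1/(1 - e m)) *\<^sub>R (y - c) = c + r *\<^sub>R (x - c)" by(simp add: r_def)
  thus ?thesis by(simp add: algebra_simps)
  qed
  also have "... : tau" using conv ctau x(1) r by(simp add: convex_alt)
  finally show "y : T m" by(rule mem)
 qed
 have 4: "y : (\<Union>l. T l)" if y: "y : rel_interior tau" for y
 proof -
  obtain eps where eps: "eps > 0" "cball y eps Int affine hull tau <= tau"
  using y by(auto simp: mem_rel_interior_cball)
  \<comment> \<open>The candidate \<open>?z\<close> for the preimage of \<open>y\<close> lies on the
    ray from \<open>c\<close> through \<open>y\<close>, beyond \<open>y\<close> by
    \<open>norm (y - c)/(l + 1)\<close>; this \<open>l\<close> keeps it in the neighbourhood of
    radius \<open>eps\<close>.\<close>
  obtain l :: nat where l: "norm (y - c)/eps < real l" using reals_Archimedean2 by blast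
  let ?z = "c + (1/(1 - e l)) *\<^sub>R (y - c)"
  have k: "1/(1 - e l) = 1 + 1/(real l + 1)" by(simp add: e_def field_simps)
  have "?z - y = (1/(real l + 1)) *\<^sub>R (y - c)" unfolding k by(simp add: algebra_simps)
  hence "norm (?z - y) = norm (y - c)/(real l + 1)" by simp
  also have "... <= eps" using l eps(1) by(simp add: field_simps)
  finally have "?z : cball y eps" by(simp add: dist_norm norm_minus_commute)
  moreover have "?z : affine hull tau"
  proof -
  have "?z = (1 - 1/(1 - e l)) *\<^sub>R c + (1/(1 - e l)) *\<^sub>R y" by(simp add: algebra_simps)
  moreover have "c : affine hull tau" "y : affine hull tau"
  using ctau subsetD[OF rel_interior_subset y] by(simp_all add: hull_inc)
  ultimately show ?thesis using affine_affine_hull by(metis affine_alt)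
  qed
  ultimately have "?z : tau" using eps(2) by blast
  thus ?thesis using mem by blast
 qed
 have "(\<Union>l. T l) = rel_interior tau" using 2 4 by blast
 moreover have "incseq T" using 3 by(auto simp: incseq_def)
 ultimately show ?thesis using that 1 by blast
qed

lemma hausdorff_UN_null:
 assumes "finite I" "!!i. i : I ==> hausdorff_outer d (A i) = 0"
 shows "hausdorff_outer d (UN i:I. A i) = 0"
 using assms
proof (induction I rule: finite_induct)
 case (insert i I)
 thus ?case using hausdorff_outer_Un[of d "A i" "UN i:I. A i"] by simp
qed (simp add: hausdorff_outer_empty)

lemma hausdorff_null_subset: "A <= B ==> hausdorff_outer d B = 0 ==> hausdorff_outer d A = 0"
 using hausdorff_outer_mono[of A B d] by simp

lemma hausdorff_simplex_boundary:
 fixes J :: "'n::finite set"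
 assumes "int (card J) simplex tau" "tau <= plane J"
 shows "hausdorff_outer (card J) (tau - rel_interior tau) = 0"
proof -
 have poly: "polyhedron tau" "polytope tau" using assms(1) simplex_imp_polyhedron simplex_imp_polytope by auto
 have "tau - rel_interior tau = \<Union>{F. F facet_of tau}"
  using rel_frontier_of_polyhedron[OF poly(1)] closed_simplex[OF assms(1)] by(simp add: rel_frontier_def)
 moreover have "hausdorff_outer (card J) (UN F:{F. F facet_of tau}. F) = 0"
 proof (rule hausdorff_UN_null)
  show "finite {F. F facet_of tau}" using finite_polyhedron_facets poly(1) by blast
  fix F assume "F : {F. F facet_of tau}"
  hence F: "F <= tau" "aff_dim F = aff_dim tau - 1" by(auto simp: facet_of_def face_of_imp_subset)
  show "hausdorff_outer (card J) F = 0"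
  by(rule hausdorff_lowdim_0)
  (use F assms aff_dim_simplex[OF assms(1)] compact_imp_bounded[OF compact_simplex[OF assms(1)]] bounded_subset in auto)
 qed
 ultimately show ?thesis by simp
qed

text \<open>Two simplices of a triangulation meet in a common face, so the relative interiors of
  distinct ones are disjoint. What these miss lies in finitely many boundaries of smaller
  dimension.\<close>

lemma simplex_fine_subdivision:
 fixes J :: "'n::finite set"
 assumes tau: "int (card J) simplex tau" "tau <= plane J" and "e > 0"
 obtains TT where "finite TT" "!!t. t : TT ==> int (card J) simplex t" "!!t. t : TT ==> t <= tau"
  "!!t. t : TT ==> diameter t < e" "!!t. t : TT ==> rel_interior t <= rel_interior tau"
  "!!t t'. t : TT ==> t' : TT ==> t ~= t' ==> rel_interior t Int rel_interior t' = {}"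
  "hausdorff_outer (card J) (tau - (UN t:TT. rel_interior t)) = 0"
proof -
 have c: "convex tau" using tau(1) by(rule convex_simplex)
 obtain TT where T: "triangulation TT" "!!k. k : TT ==> diameter k < e"
  "!!k. k : TT ==> aff_dim k = int (card J)" "\<Union>TT = \<Union>{tau}"
  by(rule fine_triangular_subdivision_of_cell_complex[of e "{tau}" "int (card J)"])
  (use assms simplex_imp_polytope aff_dim_simplex face_of_refl[OF c] in auto)
 have fin: "finite TT" using T(1) by(simp add: triangulation_def)
 have simp: "int (card J) simplex t" if "t : TT" for t
  using T(1,3) that unfolding triangulation_def by(metis aff_dim_simplex)
 have sub: "t <= tau" if "t : TT" for t using T(4) that by auto
 have ri: "rel_interior t <= rel_interior tau" if "t : TT" for t
  by(rule subset_rel_interior[OF sub[OF that]])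
  (metis simplex_affine_hull_plane simp[OF that] sub[OF that] tau order_trans)
 have disj: "rel_interior t Int rel_interior t' = {}" if t: "t : TT" "t' : TT" "t ~= t'" for t t'
 proof -
  have f: "t Int t' face_of t" "t Int t' face_of t'"
  using T(1) t unfolding triangulation_def by(metis Int_commute)+
  have "t Int t' ~= t | t Int t' ~= t'" using t by auto
  hence "(t Int t') Int rel_interior t = {} | (t Int t') Int rel_interior t' = {}"
  using f face_of_disjoint_rel_interior by blast
  thus ?thesis using rel_interior_subset[of t] rel_interior_subset[of t'] by auto
 qed
 have "hausdorff_outer (card J) (UN t:TT. t - rel_interior t) = 0"
  using fin simp sub tau by(intro hausdorff_UN_null hausdorff_simplex_boundary) auto
 hence "hausdorff_outer (card J) (tau - (UN t:TT. rel_interior t)) = 0"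
  by(rule hausdorff_null_subset[rotated]) (use T(4) in auto)
 thus ?thesis using that[of TT] fin simp sub T(2) ri disj by blast
qed

section \<open>Curved simplices\<close>

text \<open>The parameter simplex is fixed to lie in \<open>plane J\<close>, so that flat and curved
  pieces are compared within one model space.\<close>

definition csimplex :: "'n set => (real^'n::finite) set => bool" where
 "csimplex J S \<longleftrightarrow> (EX s Phi. int (card J) simplex s & s <= plane J &
  C2_embedding_on s Phi & S = Phi ` s)"

text \<open>Closed simplices cannot partition a simplex, but images of relatively open ones do up to
  a null set. As increasing unions of curved simplices they are reached by continuity, while
  additivity applies to the disjoint compact stages.\<close>

definition cell :: "'n set => (real^'n::finite) set => bool" where
 "cell J R \<longleftrightarrow> (EX T. incseq T & (\<forall>l::nat. csimplex J (T l)) & R = (\<Union>l. T l))"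

lemma csimplexE:
 assumes "csimplex J S"
 obtains s Phi where "int (card J) simplex s" "s <= plane J" "C2_embedding_on s Phi" "S = Phi ` s"
 using assms unfolding csimplex_def by(elim exE conjE)

lemma csimplex_compact: "csimplex J S ==> compact S"
 unfolding csimplex_def
 using compact_continuous_image C2_embedding_on_continuous compact_simplex by metis

lemma csimplex_borel: "csimplex J S ==> S : sets borel"
 by(intro borel_closed compact_imp_closed csimplex_compact)

lemma cell_borel: "cell J R ==> R : sets borel"
 unfolding cell_def using csimplex_borel by fast

lemma cell_rel_interior:
 fixes J :: "'n::finite set"
 assumes "int (card J) simplex t" "t <= s" "s <= plane J" "C2_embedding_on s Phi"
 shows "cell J (Phi ` rel_interior t)"
proof -
 have "t ~= {}" using assms(1) by auto
 then obtain T where T: "incseq T" "!!l::nat. int (card J) simplex (T l)" "(\<Union>l. T l) = rel_interior t"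
  using simplex_shrinking[OF assms(1)] by blast
 have sub: "T l <= s" for l using T(3) rel_interior_subset[of t] assms(2) by blast
 have "csimplex J (Phi ` T l)" for l
  unfolding csimplex_def
  by(intro exI conjI, rule T(2), use sub assms(3) in blast, rule C2_embedding_on_subset[OF assms(4) sub], rule refl)
 moreover have "incseq (%l. Phi ` T l)" using T(1) by(auto simp: incseq_def)
 moreover have "Phi ` rel_interior t = (\<Union>l. Phi ` T l)" unfolding T(3)[symmetric] by(rule image_UN)
 ultimately show ?thesis unfolding cell_def by blast
qed

lemma C2_embedding_image_null:
 fixes Phi :: "'k::euclidean_space => 'b::real_normed_vector"
 assumes "C2_embedding_on s Phi" "compact s" "convex s" "N <= s" "hausdorff_outer d N = 0"
 shows "hausdorff_outer d (Phi ` N) = 0"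
proof -
 obtain C where C: "C > 0" "!!x y. x : s ==> y : s ==> dist (Phi x) (Phi y) <= C*dist x y"
  using C2_embedding_on_lipschitz[OF assms(1-3)] by blast
 have "hausdorff_outer d (Phi ` N) <= ennreal (C ^ d)*hausdorff_outer d N"
  by(rule hausdorff_lipschitz) (use C assms(4) in auto)
 thus ?thesis using assms(5) by simp
qed

lemma csimplex_cells:
 fixes J :: "'n::finite set"
 assumes tau: "int (card J) simplex tau" "tau <= plane J" "C2_embedding_on tau Phi" and e: "e > 0"
 obtains TT where "finite TT" "!!t. t : TT ==> int (card J) simplex t" "!!t. t : TT ==> t <= tau"
  "!!t. t : TT ==> diameter t < e" "!!t. t : TT ==> rel_interior t <= rel_interior tau"
  "!!t. t : TT ==> cell J (Phi ` rel_interior t)" "disjoint ((%t. Phi ` rel_interior t) ` TT)"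
  "inj_on (%t. Phi ` rel_interior t) TT"
  "hausdorff_outer (card J) (Phi ` tau - (UN t:TT. Phi ` rel_interior t)) = 0"
proof -
 obtain TT where T: "finite TT" "!!t. t : TT ==> int (card J) simplex t" "!!t. t : TT ==> t <= tau"
  "!!t. t : TT ==> diameter t < e" "!!t. t : TT ==> rel_interior t <= rel_interior tau"
  "!!t t'. t : TT ==> t' : TT ==> t ~= t' ==> rel_interior t Int rel_interior t' = {}"
  "hausdorff_outer (card J) (tau - (UN t:TT. rel_interior t)) = 0"
  using simplex_fine_subdivision[OF tau(1,2) e] by blast
 have inj: "inj_on Phi tau" using tau(3) by(rule C2_embedding_onE)
 have ri: "rel_interior t <= tau" if "t : TT" for t using T(3)[OF that] rel_interior_subset by blast
 have ne: "rel_interior t ~= {}" if "t : TT" for t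
 proof -
  have "t ~= {}" using T(2)[OF that] by auto
  thus ?thesis using rel_interior_eq_empty[OF convex_simplex[OF T(2)[OF that]]] by simp
 qed
 have disj: "Phi ` rel_interior t Int Phi ` rel_interior t' = {}" if "t : TT" "t' : TT" "t ~= t'" for t t'
  using inj_on_image_Int[OF inj ri ri, of t t'] T(6)[of t t'] that by auto
 have "hausdorff_outer (card J) (Phi ` (tau - (UN t:TT. rel_interior t))) = 0"
  by(rule C2_embedding_image_null[OF tau(3)]) (use T(7) tau compact_simplex convex_simplex in auto)
 hence null: "hausdorff_outer (card J) (Phi ` tau - (UN t:TT. Phi ` rel_interior t)) = 0"
  by(rule hausdorff_null_subset[rotated]) auto
 show ?thesis
 proof (rule that[of TT])
  show "cell J (Phi ` rel_interior t)" if "t : TT" for t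
  by(rule cell_rel_interior[OF T(2)[OF that] T(3)[OF that] tau(2,3)])
  show "disjoint ((%t. Phi ` rel_interior t) ` TT)"
  unfolding disjoint_def
  proof (intro ballI impI)
  fix A B assume "A : (%t. Phi ` rel_interior t) ` TT" "B : (%t. Phi ` rel_interior t) ` TT" "A ~= B"
  then obtain t t' where "t : TT" "t' : TT" "A = Phi ` rel_interior t" "B = Phi ` rel_interior t'" "t ~= t'" by blast
  thus "A Int B = {}" using disj by simp
  qed
  show "inj_on (%t. Phi ` rel_interior t) TT"
  proof (rule inj_onI, rule ccontr)
  fix t t' assume t: "t : TT" "t' : TT" "Phi ` rel_interior t = Phi ` rel_interior t'" "t ~= t'"
  show False using disj[OF t(1,2,4)] t(3) ne[OF t(1)] by auto
  qed
 qed (use T null in auto)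
qed

text \<open>Disjoint simplices are placed at different heights of the complex space; as no two of them
 meet, the strata separation angle is an infimum over the empty set.\<close>

lemma disjoint_triangulation:
 fixes J :: "'n::finite set"
 assumes fin: "finite \<S>" and cs: "!!S. S : \<S> ==> csimplex J S" and disj: "disjoint \<S>"
 obtains K :: "'n complex_space set set" and phi where "admissible_triangulation (card J) K phi (\<Union>\<S>)"
  "bij_betw (%sg. phi ` sg) (top_simplices (card J) K) \<S>"
proof -
 let ?d = "int (card J)"
 have "ALL S:\<S>. \<exists>(s :: (real^'n) set) Phi. ?d simplex s & C2_embedding_on s Phi & S = Phi ` s"
 proof
  fix S assume "S : \<S>"
  then obtain s :: "(real^'n) set" and Phi where "?d simplex s" "C2_embedding_on s Phi" "S = Phi ` s"
  by(elim csimplexE[OF cs])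
  thus "\<exists>(s :: (real^'n) set) Phi. ?d simplex s & C2_embedding_on s Phi & S = Phi ` s"
  by(intro exI conjI)
 qed
 from bchoice[OF this] obtain s :: "(real^'n) set => (real^'n) set"
  where "ALL S:\<S>. EX Phi. ?d simplex s S & C2_embedding_on (s S) Phi & S = Phi ` s S" by(elim exE)
 from bchoice[OF this] obtain Phi
  where all: "ALL S:\<S>. ?d simplex s S & C2_embedding_on (s S) (Phi S) & S = Phi S ` s S" by(elim exE)
 have s: "?d simplex s S" and Phi: "C2_embedding_on (s S) (Phi S)" "Phi S ` s S = S" if "S : \<S>" for S
  using bspec[OF all that] by blast+
 obtain nn f where f: "f ` \<S> = {i::nat. i < nn}" "inj_on f \<S>" using finite_imp_inj_to_nat_seg[OF fin] by blast
 define \<iota> where "\<iota> S x = ((x, 0, real (f S)) :: 'n complex_space)" for S and x :: "real^'n"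
 define emb where "emb x = ((x, 0, 0) :: 'n complex_space)" for x :: "real^'n"
 have emb: "linear emb" by(auto simp: emb_def linear_iff)
 have \<iota>_alt: "\<iota> S x = (0, 0, real (f S)) + emb x" for S x by(simp add: \<iota>_def emb_def)
 \<comment> \<open>One map for all simplices: the height of \<open>z\<close> identifies the simplex
   and thereby the parametrisation to be applied to the first component.\<close>
 define phi where "phi z = Phi (inv_into \<S> f (nat \<lfloor>snd (snd z)\<rfloor>)) (fst z)" for z :: "'n complex_space"
 have phi\<iota>: "phi (\<iota> S x) = Phi S x" if "S : \<S>" for S x using that f(2) by(simp add: phi_def \<iota>_def inv_into_f_f)
 define sg where "sg S = \<iota> S ` s S" for S
 have sg_simplex: "?d simplex (sg S)" if "S : \<S>" for S
 proof -
  have "linear (fst :: 'n complex_space => real^'n)" by(rule linear_fst)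
  hence "?d simplex (emb ` s S)"
  by(intro simplex_linear_image[OF s[OF that] emb]) (auto simp: emb_def)
  hence "?d simplex ((+) (0, 0, real (f S)) ` emb ` s S)" by(rule simplex_translation)
  thus ?thesis unfolding sg_def image_image \<iota>_alt .
 qed
 have sg_disj: "sg S Int sg S' = {}" if "S : \<S>" "S' : \<S>" "S ~= S'" for S S'
  using that f(2) by(auto simp: sg_def \<iota>_def inj_on_def)
 have phisg: "phi ` sg S = S" if "S : \<S>" for S
 proof -
  have "phi ` sg S = Phi S ` s S" using that by(simp add: sg_def image_image phi\<iota>)
  thus ?thesis using Phi(2)[OF that] by simp
 qed
 define K where "K = (UN S:\<S>. {F. F face_of sg S})"
 have KE: "EX S:\<S>. F face_of sg S" if "F : K" for F using that by(auto simp: K_def)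
 have sgK: "sg S : K" if "S : \<S>" for S
  using that face_of_refl[OF convex_simplex[OF sg_simplex[OF that]]] by(auto simp: K_def)
 have UK: "\<Union>K = (UN S:\<S>. sg S)" 
 proof
  show "\<Union>K <= (UN S:\<S>. sg S)" unfolding K_def using face_of_imp_subset by fast
  show "(UN S:\<S>. sg S) <= \<Union>K" using sgK by blast
 qed
 have embsg: "C2_embedding_on (sg S) phi" if S: "S : \<S>" for S
 proof -
  have "C2_embedding_on (sg S) (%z. Phi S (0 + fst z))"
  proof (rule C2_embedding_on_compose_affine[OF Phi(1)[OF S] linear_fst])
  show "(%z. 0 + fst z) ` sg S <= s S" by(auto simp: sg_def \<iota>_def)
  have "span ((%(p, q). q - p) ` (sg S \<times> sg S)) <= range emb"
  proof (rule span_minimal)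
  show "subspace (range emb)" by(rule linear_subspace_image[OF emb subspace_UNIV])
  have "\<iota> S y - \<iota> S x = emb (y - x)" for x y
  by(simp add: \<iota>_def emb_def zero_prod_def)
  thus "(%(p, q). q - p) ` (sg S \<times> sg S) <= range emb" by(auto simp: sg_def)
  qed
  moreover have "inj_on fst (range emb)" by(auto simp: inj_on_def emb_def)
  ultimately show "inj_on fst (span ((%(p, q). q - p) ` (sg S \<times> sg S)))" by(rule inj_on_subset[rotated])
  qed
  moreover have "phi z = Phi S (0 + fst z)" if z: "z : sg S" for z
  proof -
  obtain x where x: "z = \<iota> S x" using z unfolding sg_def by blast
  have "fst z = x" unfolding x by(simp add: \<iota>_def)
  thus ?thesis using phi\<iota>[OF S, of x] x by simp
  qed
  ultimately show ?thesis using C2_embedding_on_cong[of "sg S" phi "%z. Phi S (0 + fst z)"] by blast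
 qed
 have simp: "simplicial_complex K"
  unfolding simplicial_complex_def
 proof (intro conjI ballI allI impI)
  show "finite K" unfolding K_def
  using fin sg_simplex by(auto intro!: finite_polytope_faces simplex_imp_polytope)
  show "EX n. n simplex F" if FK: "F : K" for F
  proof -
  obtain S where "S : \<S>" "F face_of sg S" using KE[OF FK] by blast
  thus ?thesis using face_of_simplex[OF sg_simplex] by blast
  qed
  show "F : K" if FG: "G : K & F face_of G" for F G
  proof -
  obtain S where S: "S : \<S>" "G face_of sg S" using KE[OF conjunct1[OF FG]] by blast
  have "F face_of sg S" by(rule face_of_trans[OF conjunct2[OF FG] S(2)])
  thus ?thesis using S(1) by(auto simp: K_def)
  qed
  show "F Int G face_of F" if FG: "F : K & G : K" for F G
  proof -
  obtain S S' where S: "S : \<S>" "F face_of sg S" "S' : \<S>" "G face_of sg S'"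
  using KE[OF conjunct1[OF FG]] KE[OF conjunct2[OF FG]] by blast
  show ?thesis
  proof (cases "S = S'")
  case True
  hence "F Int G face_of sg S" using S by(simp add: face_of_Int)
  thus ?thesis by(rule face_of_subset[OF _ Int_lower1 face_of_imp_subset[OF S(2)]])
  next
  case False
  hence "F Int G = {}" using sg_disj[OF S(1,3)] face_of_imp_subset[OF S(2)] face_of_imp_subset[OF S(4)] by auto
  thus ?thesis by simp
  qed
  qed
 qed
 have top: "top_simplices (card J) K = sg ` \<S>"
 proof
  show "sg ` \<S> <= top_simplices (card J) K" using sgK sg_simplex by(auto simp: top_simplices_def)
  show "top_simplices (card J) K <= sg ` \<S>"
  proof
  fix F assume F: "F : top_simplices (card J) K"
  hence FK: "F : K" and Fd: "?d simplex F" by(simp_all add: top_simplices_def)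
  obtain S where S: "S : \<S>" "F face_of sg S" using KE[OF FK] by blast
  have "aff_dim F = aff_dim (sg S)" by(simp add: aff_dim_simplex[OF Fd] aff_dim_simplex[OF sg_simplex[OF S(1)]])
  hence "F = sg S"
  using face_of_aff_dim_lt[OF convex_simplex[OF sg_simplex[OF S(1)]] S(2)] by auto
  thus "F : sg ` \<S>" using S by auto
  qed
 qed
 have injphi: "inj_on phi (\<Union>K)"
 proof (rule inj_onI)
  fix x y assume "x : \<Union>K" "y : \<Union>K" and xy: "phi x = phi y"
  then obtain S S' where S: "S : \<S>" "x : sg S" "S' : \<S>" "y : sg S'" using UK by blast
  have "phi x : S" "phi y : S'" using S phisg by blast+
  hence ne: "S Int S' ~= {}" using xy by auto
  have SS: "S = S'"
  proof (rule ccontr)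
  assume "S ~= S'"
  thus False using disjointD[OF disj S(1,3)] ne by simp
  qed
  have "inj_on phi (sg S)" using embsg[OF S(1)] by(rule C2_embedding_onE)
  thus "x = y" by(rule inj_onD[OF _ xy S(2)]) (use S(4) SS in simp)
 qed
 have comp: "compact (sg S)" if "S : \<S>" for S using sg_simplex[OF that] by(rule compact_simplex)
 have cont: "continuous_on (\<Union>K) phi" unfolding UK
  using fin comp embsg by(intro continuous_on_closed_Union) (auto intro: compact_imp_closed C2_embedding_on_continuous)
 have "compact (\<Union>K)" unfolding UK using fin comp by auto
 moreover have im: "phi ` \<Union>K = \<Union>\<S>" unfolding UK using phisg by(auto simp: image_UN)
 ultimately have homeo: "\<exists>\<psi>. homeomorphism (\<Union>K) (\<Union>\<S>) phi \<psi>"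
  using homeomorphism_compact[OF _ cont _ injphi] by simp
 have pure: "purely_dimensional (card J) K"
  unfolding purely_dimensional_def
 proof (intro ballI impI)
  fix F assume F: "F : K" and max: "ALL G:K. F <= G --> G = F"
  obtain S where S: "S : \<S>" "F face_of sg S" using KE[OF F] by blast
  have "sg S = F" using max sgK[OF S(1)] face_of_imp_subset[OF S(2)] by simp
  thus "?d simplex F" using sg_simplex[OF S(1)] by simp
 qed
 have angle: "strata_separation_angle (card J) K phi > 0"
 proof -
  have none: "{spherical_distance (normal_inward_cone phi sg\<^sub>1 p) (normal_inward_cone phi sg\<^sub>2 p) |sg\<^sub>1 sg\<^sub>2 p.
  sg\<^sub>1 : top_simplices (card J) K & sg\<^sub>2 : top_simplices (card J) K & sg\<^sub>1 ~= sg\<^sub>2 & p : rel_interior (sg\<^sub>1 Int sg\<^sub>2)} = {}"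
  proof -
  have False if "sg\<^sub>1 : sg ` \<S>" "sg\<^sub>2 : sg ` \<S>" "sg\<^sub>1 ~= sg\<^sub>2" "p : rel_interior (sg\<^sub>1 Int sg\<^sub>2)" for sg\<^sub>1 sg\<^sub>2 p
  proof -
  have "sg\<^sub>1 Int sg\<^sub>2 = {}" using that(1-3) sg_disj by blast
  thus False using that(4) by simp
  qed
  thus ?thesis unfolding top by blast
  qed
  show ?thesis unfolding strata_separation_angle_def none by(simp add: top_ereal_def)
 qed
 have "ALL F:K. C2_embedding_on F phi"
 proof
  fix F assume "F : K"
  then obtain S where S: "S : \<S>" "F face_of sg S" using KE by blast
  show "C2_embedding_on F phi" by(rule C2_embedding_on_subset[OF embsg[OF S(1)] face_of_imp_subset[OF S(2)]])
 qed
 moreover have "compact (\<Union>\<S>)" by(rule compact_Union[OF fin csimplex_compact[OF cs]])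
 ultimately have adm: "admissible_triangulation (card J) K phi (\<Union>\<S>)"
  unfolding admissible_triangulation_def C2_triangulation_def using simp homeo pure angle by blast
 have "bij_betw (%sg. phi ` sg) (sg ` \<S>) \<S>"
  unfolding bij_betw_def inj_on_def using phisg by(auto simp: image_image)
 thus ?thesis using that[OF adm] top by simp
qed


text \<open>The simplex over an affine basis of the plane is moved so that a relative interior point
  becomes the origin, and is then dilated.\<close>

lemma simplex_over_ball:
 fixes J :: "'n::finite set"
 obtains s where "int (card J) simplex s" "s <= plane J" "plane J Int cball 0 R <= s"
proof -
 let ?V = "plane J"
 obtain B where B: "B <= ?V" "~ affine_dependent B" "affine hull ?V = affine hull B"
  using affine_basis_exists[of ?V] by blast
 have affV: "affine hull ?V = ?V" using subspace_imp_affine[OF subspace_plane] by(simp add: affine_hull_eq)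
 have "aff_dim B = int (card J)"
  using B(3) aff_dim_affine_hull[of B] aff_dim_affine_hull[of ?V]
  by(simp add: aff_dim_subspace subspace_plane dim_plane)
 hence s0: "int (card J) simplex (convex hull B)"
  using B(2) by(intro simplex_convex_hull) (simp add: affine_independent_iff_card)
 have sub: "convex hull B <= ?V"
  using B(1) subspace_imp_convex[OF subspace_plane] by(rule hull_minimal)
 have "convex hull B ~= {}" using s0 by auto
 then obtain c where c: "c : rel_interior (convex hull B)"
  using rel_interior_eq_empty[OF convex_convex_hull, of B] by blast
 obtain e where e: "e > 0" "cball c e Int affine hull (convex hull B) <= convex hull B"
  using c by(auto simp: mem_rel_interior_cball)
 have aff: "affine hull (convex hull B) = ?V" using B(3) affV by simp
 have cV: "c : ?V" using c rel_interior_subset sub by blast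
 \<comment> \<open>The dilation takes the ball of radius \<open>e\<close> to radius
   \<open>abs(R) + 1\<close>; the summand 1 keeps \<open>k\<close> positive for every
   \<open>R\<close>.\<close>
 define k where "k = (abs(R) + 1)/e"
 have k: "k > 0" using e by(simp add: k_def add_nonneg_pos)
 define s where "s = (*\<^sub>R) k ` (+) (- c) ` (convex hull B)"
 show ?thesis
 proof (rule that[of s])
  show "int (card J) simplex s"
  unfolding s_def using k by(intro simplex_scaleR simplex_translation s0) simp
  show "s <= ?V"
  proof
  fix y assume "y : s"
  then obtain x where "x : convex hull B" "y = k *\<^sub>R (- c + x)" by(auto simp: s_def)
  thus "y : ?V" using sub cV
  by(auto intro!: subspace_scale subspace_diff subspace_plane)
  qed
  show "?V Int cball 0 R <= s"
  proof
  fix y assume y: "y : ?V Int cball 0 R"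
  define x where "x = c + (1/k) *\<^sub>R y"
  have "norm y <= abs(R) + 1" using y by auto
  hence "norm y <= k*e" using e by(simp add: k_def)
  hence "norm ((1/k) *\<^sub>R y) <= e" using k by(simp add: field_simps)
  hence "x : cball c e" by(simp add: x_def dist_norm)
  moreover have "x : ?V" unfolding x_def using cV y
  by(intro subspace_add subspace_scale subspace_plane) auto
  ultimately have "x : convex hull B" using e(2) aff by blast
  moreover have "y = k *\<^sub>R (- c + x)" using k by(simp add: x_def)
  ultimately show "y : s" unfolding s_def by blast
  qed
 qed
qed

lemma C2_embedding_on_affine:
 fixes L :: "'a::euclidean_space => 'b::euclidean_space"
 assumes "linear L" "inj_on L V" "s <= V" "subspace V"
 shows "C2_embedding_on s (%x. a + L x)"
proof -
 have inj: "inj_on L (span V)" using assms(2,4) by(simp add: span_eq_iff[THEN iffD2])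
 have bl: "bounded_linear L" using assms(1) by(simp add: linear_conv_bounded_linear)
 have der: "((%x. a + L x) has_derivative L) (at p)" for p
  using bounded_linear_imp_has_derivative[OF bl] by(auto intro!: derivative_eq_intros)
 have "frechet_derivative (%x. a + L x) (at p) = L" for p using frechet_derivative_at[OF der] by simp
 moreover have "span ((%q. q - p) ` s) <= span V" if "p : s" for p
  using assms(3,4) that by(intro span_minimal) (auto intro: span_base subspace_diff)
 moreover have "C2_on UNIV (%x. a + L x)"
  by(intro C2map_imp_C2_on C2map_add C2map_const C2map_linear bl)
 moreover have "inj_on (%x. a + L x) s"
  using inj_on_subset[OF assms(2,3)] by(auto simp: inj_on_def)
 ultimately show ?thesis unfolding C2_embedding_on_def
  by(intro conjI exI[of _ UNIV] exI[of _ "%x. a + L x"]) (auto intro: inj_on_subset[OF inj])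
qed

section \<open>Reweighted measures\<close>

definition wgt :: "'a measure => ('a => real) => 'a measure" where
 "wgt mu u = density mu (%x. ennreal (u x))"

lemma sets_wgt [simp]: "sets (wgt mu u) = sets mu" by(simp add: wgt_def)
lemma space_wgt [simp]: "space (wgt mu u) = space mu" by(simp add: wgt_def)

lemma borel_measurable_cong_sets: "sets mu = sets borel ==> u : borel_measurable borel ==> u : borel_measurable mu"
 by(simp cong: measurable_cong_sets)

lemma em_wgt:
 assumes "sets mu = sets borel" "u : borel_measurable borel" "A : sets borel"
 shows "emeasure (wgt mu u) A = (\<integral>\<^sup>+x. ennreal (u x)*indicator A x \<partial>mu)"
 unfolding wgt_def using assms by(intro emeasure_density) (auto cong: measurable_cong_sets)

lemma wgt_wgt:
 assumes "sets mu = sets borel" "u : borel_measurable borel" "v : borel_measurable borel" "!!x. 0 <= u x" "!!x. 0 <= v x"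
 shows "wgt (wgt mu u) v = wgt mu (%x. u x * v x)"
 unfolding wgt_def using assms
 by(subst density_density_eq) (auto simp: ennreal_mult cong: measurable_cong_sets)

lemma wgt_cong_AE:
 assumes "sets mu = sets borel" "u : borel_measurable borel" "v : borel_measurable borel" "AE x in mu. u x = v x"
 shows "wgt mu u = wgt mu v"
 unfolding wgt_def using assms by(intro density_cong) (auto cong: measurable_cong_sets elim!: eventually_mono)

lemma em_wgt_on:
 assumes "sets mu = sets borel" "A : sets borel" "B : sets borel"
 shows "emeasure (wgt mu (indicator A)) B = emeasure mu (A Int B)"
proof -
 have "wgt mu (indicator A) = density mu (indicator A)"
  unfolding wgt_def by(simp add: ennreal_indicator)
 thus ?thesis using assms by(simp add: emeasure_restricted)
qed

lemma em_wgt_const: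
 assumes "sets mu = sets borel" "A : sets borel"
 shows "emeasure (wgt mu (%_. p)) A = ennreal p*emeasure mu A"
 unfolding wgt_def using assms by(simp add: emeasure_density_const)

lemma wgt_1: "wgt mu (%_. 1) = mu"
 unfolding wgt_def by(simp add: density_1)

lemma wgt_AE_1:
 assumes "sets mu = sets borel" "u : borel_measurable borel" "AE x in mu. u x = 1"
 shows "wgt mu u = mu"
 using wgt_cong_AE[of mu u "%_. 1"] assms by(simp add: wgt_1)

lemma wgt_full:
 assumes "sets mu = sets borel" "A : sets borel" "emeasure mu (- A) = 0"
 shows "wgt mu (indicator A) = mu"
proof (rule wgt_AE_1)
 have "- A : null_sets mu" using assms by(auto simp: null_sets_def)
 hence "AE x in mu. x ~: - A" by(rule AE_not_in)
 thus "AE x in mu. indicator A x = (1::real)" by(auto elim!: eventually_mono)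
qed (use assms in auto)

lemma wgt_wgt_on:
 assumes "sets mu = sets borel" "A : sets borel" "B : sets borel"
 shows "wgt (wgt mu (indicator A)) (indicator B) = wgt mu (indicator (A Int B))"
proof -
 have "(%x. indicator A x*indicator B x) = (indicator (A Int B) :: 'a => real)"
  by(auto simp: indicator_def fun_eq_iff)
 thus ?thesis using assms by(subst wgt_wgt) auto
qed

lemma wgt_commute:
 assumes "sets mu = sets borel" "u : borel_measurable borel" "v : borel_measurable borel" "!!x. 0 <= u x" "!!x. 0 <= v x"
 shows "wgt (wgt mu u) v = wgt (wgt mu v) u"
 using assms by(simp add: wgt_wgt mult.commute)

lemma eventually_rescale:
 assumes "p > 0" "eventually P (at_top :: real filter)" shows "eventually (%n. P (p*n)) at_top"
proof -
 have "filterlim (%n::real. p*n) at_top at_top"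
  using assms(1) by(intro filterlim_tendsto_pos_mult_at_top[OF tendsto_const]) (auto intro: filterlim_ident)
 thus ?thesis using assms(2) by(rule eventually_compose_filterlim[rotated])
qed

lemma tendsto_rescale:
 assumes "p > 0" "(f \<longlongrightarrow> l) (at_top :: real filter)" shows "((%n. f (p*n)) \<longlongrightarrow> l) at_top"
proof -
 have "filterlim (%n::real. p*n) at_top at_top"
  using assms(1) by(intro filterlim_tendsto_pos_mult_at_top[OF tendsto_const]) (auto intro: filterlim_ident)
 with assms(2) show ?thesis by(rule filterlim_compose)
qed

lemma tendsto_1_bounds:
 assumes "(rho \<longlongrightarrow> (1::real)) F" shows "\<forall>\<^sub>F n in F. 1/2 <= rho n & rho n <= 2"
proof -
 have "\<forall>\<^sub>F n in F. dist (rho n) 1 < 1/2" using assms by(rule tendstoD) simp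
 thus ?thesis by(rule eventually_mono) (unfold dist_real_def, arith)
qed

section \<open>The functional as a function of the intensity measure\<close>

text \<open>\<open>nontrivial\<close> is a case assumption, not a property of \<open>H\<close>. In
  the opposite case no triangulated space carries a probability density, and the theorem is
  vacuous.\<close>

locale poisson_functional =
 fixes H :: "'n::finite functional" and J :: "'n set" and d :: nat
 assumes card_J: "card J = d"
  and expectations: "has_expectations d H"
  and compatible: "metric_compatible d H"
  and rigid: "rigidity H"
  and homogeneous: "control_homogeneity d H"
  and reference: "scale_invariant_reference J H"
  and continuous: "continuity d H"
  and additive_cubes: "cube_additivity J H"
  and additive: "simplex_additivity d H"
  and stable: "metric_stability d H"
  and nontrivial: "hausdorff_outer d (cube J 1) > 0"
begin

abbreviation SD :: "(real^'n) measure => bool" where "SD \<equiv> subdens d"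
abbreviation V :: "(real^'n) set" where "V \<equiv> plane J"

text \<open>The parameter \<open>n\<close> enters twice, as control parameter and as factor of the
  intensity. Rescaling \<open>mu\<close> shifts one against the other, and control homogeneity is
  what realigns them.\<close>

definition h :: "(real^'n) measure => real => real" where
 "h mu n = 1/n*poisson_mean H n (wgt mu (%_. n)) dist"

lemma SD_sets: "SD mu ==> sets mu = sets borel" by(rule subdens_sets)
lemma SD_space: "SD mu ==> space mu = UNIV" by(rule subdens_space)
lemma SD_le1: "SD mu ==> emeasure mu UNIV <= 1" by(simp add: subdens_def)

lemma SD_emeasure: assumes "SD mu" shows "emeasure mu A = ennreal (measure mu A)"
 using subdens_finite[OF assms] by(simp add: finite_measure.emeasure_eq_measure)

lemma SD_measure_le1: "SD mu ==> measure mu UNIV <= 1"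
 using SD_le1[of mu] by(simp add: SD_emeasure)

lemma SD_wgt:
 "SD mu ==> u : borel_measurable borel ==> (!!x. 0 <= u x) ==> (!!x. u x <= 1) ==> SD (wgt mu u)"
 unfolding wgt_def by(rule subdens_density_le1)

lemma SD_restrict: "SD mu ==> A : sets borel ==> SD (wgt mu (indicator A))"
 by(rule SD_wgt) (auto simp: indicator_def)

lemma SD_wgt_mass:
 "SD mu ==> u : borel_measurable borel ==> (!!x. 0 <= u x) ==> emeasure (wgt mu u) UNIV <= 1 ==> SD (wgt mu u)"
 unfolding wgt_def by(rule subdens_density)

lemma SD_scale: "SD mu ==> 0 <= p ==> p*measure mu UNIV <= 1 ==> SD (wgt mu (%_. p))"
 by(rule SD_wgt_mass)
  (auto simp: em_wgt_const SD_sets SD_emeasure ennreal_mult'[symmetric] ennreal_le_1)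

lemma h_expected:
 assumes [measurable]: "g : borel_measurable borel" and g: "!!x. 0 <= g x" and n: "0 <= n"
 shows "1/n*expected d H n (%x. n*g x) dist = h (density (hausdorff d) (%x. ennreal (g x))) n"
proof -
 have "wgt (density (hausdorff d) (%x. ennreal (g x))) (%_. n) = density (hausdorff d) (%x. ennreal (g x)*ennreal n)"
  unfolding wgt_def by(rule density_density_eq) auto
 also have "... = density (hausdorff d) (%x. ennreal (n*g x))"
  using g n by(simp add: ennreal_mult mult.commute)
 finally show ?thesis unfolding h_def using g n by(simp add: expected_eq_poisson_mean)
qed

lemma wgt_density:
 assumes "g : borel_measurable borel" "!!x. 0 <= g x" "u : borel_measurable borel" "!!x. 0 <= u x"
 shows "wgt (density (hausdorff d) (%x. ennreal (g x))) u = density (hausdorff d) (%x. ennreal (g x*u x))"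
 unfolding wgt_def using assms by(subst density_density_eq) (auto simp: ennreal_mult)

lemma prob_density_on_iff:
 assumes "g : borel_measurable borel" "!!x. 0 <= g x" "emeasure (density (hausdorff d) (%x. ennreal (g x))) UNIV = 1"
 shows "prob_density_on d UNIV g"
 using assms by(simp add: prob_density_on_def mass_eq_emeasure[symmetric] mass_def)

text \<open>The left side has intensity \<open>p*n\<close> times that of \<open>q\<close> but
  control parameter \<open>n\<close>. Control homogeneity with \<open>c = 1/p\<close>, read at
  \<open>p*n\<close>, replaces the control parameter by \<open>p*n\<close> at the price of a factor
  tending to 1.\<close>

lemma h_scale_prob:
 assumes q: "SD q" "emeasure q UNIV = 1" and p: "0 < p" "p <= 1"
 shows "EX rho. (rho \<longlongrightarrow> 1) at_top & (EVT n. h (wgt q (%_. p)) n = p*rho n*h q (p*n))"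
proof (cases "p = 1")
 case True
 thus ?thesis by(intro exI[of _ "%_. 1"]) (simp add: wgt_1)
next
 case False
 obtain g where g: "g : borel_measurable borel" "!!x. 0 <= g x" "q = density (hausdorff d) (%x. ennreal (g x))"
  using q(1) by(rule subdensE) blast
 have "1/p > 1" using p False by simp
 moreover have "prob_density_on d UNIV g" using prob_density_on_iff g q(2) by blast
 ultimately have R: "((%n. expected d H (1/p*n) (%x. n*g x) dist/expected d H n (%x. n*g x) dist) \<longlongrightarrow> 1) at_top"
  using homogeneous unfolding control_homogeneity_def by blast
 define R where "R n = expected d H (1/p*n) (%x. n*g x) dist/expected d H n (%x. n*g x) dist" for n
 have R': "(R \<longlongrightarrow> 1) at_top" using R unfolding R_def .
 \<comment> \<open>As division by zero yields 0, a quotient close to 1 guarantees a nonzero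
   denominator; the cancellation below depends on this.\<close>
 have "EVT n. R n ~= 0" using tendsto_1_bounds[OF R'] by(rule eventually_mono) auto
 hence "EVT n. R (p*n) ~= 0" using p(1) by(rule eventually_rescale[rotated])
 moreover have "EVT n. (n::real) > 0" by(rule eventually_gt_at_top)
 ultimately have "EVT n. h (wgt q (%_. p)) n = p*R (p*n)*h q (p*n)"
 proof eventually_elim
  case (elim n)
  have "h (wgt q (%_. p)) n = 1/n*expected d H n (%x. n*(g x*p)) dist"
  unfolding g(3) using g p elim by(subst h_expected) (auto simp: wgt_density)
  also have "... = 1/n*expected d H n (%x. p*n*g x) dist" by(simp add: mult_ac)
  finally have 1: "h (wgt q (%_. p)) n = 1/n*expected d H n (%x. p*n*g x) dist" .
  have 2: "h q (p*n) = 1/(p*n)*expected d H (p*n) (%x. p*n*g x) dist"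
  unfolding g(3) using g p elim by(subst h_expected) auto
  have "expected d H (p*n) (%x. p*n*g x) dist ~= 0" using elim by(auto simp: R_def)
  thus ?case unfolding 1 2 R_def using p elim by simp
 qed
 thus ?thesis using tendsto_rescale[OF p(1) R'] by blast
qed

lemma normalize:
 assumes mu: "SD mu" "emeasure mu UNIV ~= 0"
 obtains q m where "SD q" "emeasure q UNIV = 1" "0 < m" "m <= 1" "mu = wgt q (%_. m)"
  "q = wgt mu (%_. 1/m)" "m = measure mu UNIV"
proof -
 define m where "m = measure mu UNIV"
 have m: "0 < m" using mu by(auto simp: m_def SD_emeasure zero_less_measure_iff less_le)
 have m1: "m <= 1" unfolding m_def by(rule SD_measure_le1[OF mu(1)])
 have s: "sets mu = sets borel" by(rule SD_sets[OF mu(1)])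
 have "SD (wgt mu (%_. 1/m))" using mu(1) m by(intro SD_scale) (auto simp: m_def)
 moreover have "emeasure (wgt mu (%_. 1/m)) UNIV = 1"
  using m s by(simp add: em_wgt_const SD_emeasure[OF mu(1)] m_def[symmetric] ennreal_mult'[symmetric])
 moreover have "mu = wgt (wgt mu (%_. 1/m)) (%_. m)"
  using m s by(simp add: wgt_wgt wgt_1)
 ultimately show ?thesis using that m m1 m_def by blast
qed

text \<open>Both measures are multiples of one probability measure \<open>q\<close>;
  \<open>rho\<close> is the quotient of the factors that arise in comparing them with
  \<open>q\<close>.\<close>

lemma h_scale_pos:
 assumes mu: "SD mu" "emeasure mu UNIV ~= 0" and p: "0 < p" "SD (wgt mu (%_. p))"
 shows "EX rho. (rho \<longlongrightarrow> 1) at_top & (EVT n. h (wgt mu (%_. p)) n = p*rho n*h mu (p*n))"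
proof -
 obtain q m where q: "SD q" "emeasure q UNIV = 1" "0 < m" "m <= 1" "mu = wgt q (%_. m)"
  by(rule normalize[OF mu]) blast
 have e: "wgt mu (%_. p) = wgt q (%_. m*p)"
  unfolding q(5) using q p by(simp add: wgt_wgt SD_sets)
 have "emeasure (wgt q (%_. m*p)) UNIV <= 1" using p(2) SD_le1 e by metis
 hence mp: "m*p <= 1" using q by(simp add: em_wgt_const SD_sets ennreal_le_1)
 obtain rho1 where r1: "(rho1 \<longlongrightarrow> 1) at_top"
  "EVT n. h (wgt q (%_. m*p)) n = (m*p)*rho1 n*h q ((m*p)*n)"
  using h_scale_prob[OF q(1,2), of "m*p"] q(3) p(1) mp by auto
 obtain rho2 where r2: "(rho2 \<longlongrightarrow> 1) at_top" "EVT n. h mu n = m*rho2 n*h q (m*n)"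
  using h_scale_prob[OF q(1,2), of m] q(3,4,5) by auto
 have t: "((%n. rho2 (p*n)) \<longlongrightarrow> 1) at_top" by(rule tendsto_rescale[OF p(1) r2(1)])
 have "((%n. rho1 n/rho2 (p*n)) \<longlongrightarrow> 1/1) at_top" by(rule tendsto_divide[OF r1(1) t]) simp
 moreover have "EVT n. h (wgt mu (%_. p)) n = p*(rho1 n/rho2 (p*n))*h mu (p*n)"
  using r1(2) eventually_rescale[OF p(1) r2(2)] tendsto_1_bounds[OF t]
 proof eventually_elim
  case (elim n)
  hence "rho2 (p*n) ~= 0" by auto
  thus ?case unfolding e elim(1) elim(2) by(simp add: mult_ac)
 qed
 ultimately show ?thesis by auto
qed

text \<open>Continuity of the functional asks for monotone convergence at every point. The weights
  are set to 1 on the exceptional null set, which does not change the measures.\<close>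

lemma h_continuous_prob:
 assumes mu: "SD mu" "emeasure mu UNIV = 1" and v: "!!i. v i : borel_measurable borel" "!!i x. 0 <= v i x"
  "!!i x. v i x <= 1" "!!i j x. i <= j ==> v i x <= v j x" and lim: "AE x in mu. (%i. v i x) \<longlonglongrightarrow> 1"
  and eps: "eps > 0"
 shows "EX i0. ALL i>=i0. EVT n. abs(h mu n - h (wgt mu (v i)) n) < eps"
proof -
 note s = SD_sets[OF mu(1)]
 obtain g where g: "g : borel_measurable borel" "!!x. 0 <= g x" "mu = density (hausdorff d) (%x. ennreal (g x))"
  using mu(1) by(rule subdensE) blast
 obtain N where N: "{x : space mu. ~ (%i. v i x) \<longlonglongrightarrow> 1} <= N" "emeasure mu N = 0" "N : sets mu"
  using lim by(rule AE_E)
 have [measurable]: "N : sets borel" "!!i. v i : borel_measurable borel" "g : borel_measurable borel"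
  using N(3) s v(1) g(1) by auto
 define w where "w i x = (if x : N then 1 else v i x)" for i x
 have w[measurable]: "w i : borel_measurable borel" for i unfolding w_def by measurable
 have w01: "0 <= w i x" "w i x <= 1" for i x using v by(auto simp: w_def)
 have rw: "wgt mu (v i) = wgt mu (w i)" for i
 proof (rule wgt_cong_AE[OF s v(1) w])
  have "AE x in mu. x ~: N" using N by(intro AE_not_in) (auto simp: null_sets_def)
  thus "AE x in mu. v i x = w i x" by(rule eventually_mono) (simp add: w_def)
 qed
 define fs where "fs i x = g x*w i x" for i x
 have fsm: "fs i : borel_measurable borel" for i unfolding fs_def by measurable
 have fs0: "0 <= fs i x" for i x using g(2) w01(1) by(simp add: fs_def)
 have lim': "(%i. fs i x) \<longlonglongrightarrow> g x" for x
 proof -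
  have "(%i. w i x) \<longlonglongrightarrow> 1" using N(1) SD_space[OF mu(1)] by(cases "x : N") (auto simp: w_def)
  hence "(%i. g x*w i x) \<longlonglongrightarrow> g x*1" by(rule tendsto_mult_left)
  thus ?thesis by(simp add: fs_def)
 qed
 have "prob_density_on d UNIV g" using prob_density_on_iff g mu(2) by blast
 moreover have "ALL i. fs i : borel_measurable borel & (ALL x. 0 <= fs i x)"
 proof (intro allI conjI)
  show "fs i : borel_measurable borel" for i unfolding fs_def by measurable
  show "0 <= fs i x" for i x using g(2) w01(1) by(simp add: fs_def)
 qed
 moreover have "ALL i j x. i <= j --> fs i x <= fs j x"
  using v(4) g(2) by(auto simp: fs_def w_def intro!: mult_left_mono)
 ultimately have "(%i. Limsup at_top (%n::real. ereal (1/n *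
  abs(expected d H n (%x. n*g x) dist - expected d H n (%x. n*fs i x) dist)))) \<longlonglongrightarrow> 0"
  using continuous lim' unfolding continuity_def by blast
 hence "\<forall>\<^sub>F i in sequentially. Limsup at_top (%n::real. ereal (1/n *
  abs(expected d H n (%x. n*g x) dist - expected d H n (%x. n*fs i x) dist))) < ereal eps"
  by(rule order_tendstoD(2)) (use eps in simp)
 then obtain i0 where i0: "!!i. i >= i0 ==> Limsup at_top (%n::real. ereal (1/n *
  abs(expected d H n (%x. n*g x) dist - expected d H n (%x. n*fs i x) dist))) < ereal eps"
  unfolding eventually_sequentially by blast
 show ?thesis
 proof (intro exI[of _ i0] allI impI)
  fix i assume "i0 <= i"
  from Limsup_lessD[OF i0[OF this]]
  have "EVT n. 1/n*abs(expected d H n (%x. n*g x) dist - expected d H n (%x. n*fs i x) dist) < eps" by simp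
  moreover have "EVT n. (n::real) > 0" by(rule eventually_gt_at_top)
  ultimately show "EVT n. abs(h mu n - h (wgt mu (v i)) n) < eps"
  proof eventually_elim
  case (elim n)
  have 1: "h mu n = 1/n*expected d H n (%x. n*g x) dist"
  unfolding g(3) using g elim by(subst h_expected) auto
  have 2: "h (wgt mu (v i)) n = 1/n*expected d H n (%x. n*fs i x) dist"
  proof -
  have "wgt mu (v i) = density (hausdorff d) (%x. ennreal (fs i x))"
  unfolding rw fs_def unfolding g(3) by(rule wgt_density[OF g(1,2) w w01(1)])
  thus ?thesis using h_expected[OF fsm fs0, of n i] elim by simp
  qed
  have "abs(h mu n - h (wgt mu (v i)) n) = 1/n*abs(expected d H n (%x. n*g x) dist - expected d H n (%x. n*fs i x) dist)"
  unfolding 1 2 right_diff_distrib[symmetric] abs_mult using elim(2) by simp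
  thus ?case using elim by simp
  qed
 qed
qed

lemma csimplex_nonempty: "csimplex J S ==> S ~= {}"
 by(elim csimplexE) (auto simp: image_is_empty)

text \<open>Disjoint curved simplices triangulate their union admissibly, so simplex additivity
  applies once the density has been changed to 0 off the union.\<close>

lemma h_additive_prob:
 assumes mu: "SD mu" "emeasure mu UNIV = 1" and I: "finite I" and S: "!!i. i : I ==> csimplex J (S i)"
  and disj: "disjoint_family_on S I" and full: "emeasure mu (- (UN i:I. S i)) = 0"
 shows "((%n. h mu n - (SUM i:I. h (wgt mu (indicator (S i))) n)) \<longlongrightarrow> 0) at_top"
proof -
 have inj: "inj_on S I"
  using disj csimplex_nonempty[OF S] unfolding disjoint_family_on_def inj_on_def by(metis Int_absorb)
 have "disjoint (S ` I)" using disj by(rule disjoint_family_on_disjoint_image)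
 then obtain K :: "'n complex_space set set" and phi where
  K: "admissible_triangulation (card J) K phi (\<Union>(S ` I))" "bij_betw (%sg. phi ` sg) (top_simplices (card J) K) (S ` I)"
  using disjoint_triangulation[of "S ` I" J] I S by auto
 let ?M = "\<Union>(S ` I)"
 have SB[measurable]: "S i : sets borel" if "i : I" for i using S that csimplex_borel by blast
 have MB[measurable]: "?M : sets borel" using I SB by auto
 obtain g where g: "g : borel_measurable borel" "!!x. 0 <= g x" "mu = density (hausdorff d) (%x. ennreal (g x))"
  using mu(1) by(rule subdensE) blast
 have [measurable]: "g : borel_measurable borel" by(rule g)
 define f where "f x = g x*indicator ?M x" for x
 have f[measurable]: "f : borel_measurable borel" unfolding f_def by measurable
 have f0: "0 <= f x" for x using g(2) by(simp add: f_def)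
 have muf: "mu = density (hausdorff d) (%x. ennreal (f x))"
 proof -
  have "mu = wgt mu (indicator ?M)"
  using SD_sets[OF mu(1)] full MB by(intro wgt_full[symmetric]) auto
  also have "... = density (hausdorff d) (%x. ennreal (f x))"
  unfolding g(3) f_def using g MB by(subst wgt_density) auto
  finally show ?thesis .
 qed
 have pd: "prob_density_on d ?M f"
  using prob_density_on_iff[OF f f0] mu(2) muf unfolding prob_density_on_def by(auto simp: f_def)
 have lim: "((%n. 1/n * \<bar>expected d H n (%x. n*f x) dist -
  (SUM sg:top_simplices d K. expected d H n (%x. n*(f x*indicator (phi ` sg) x)) dist)\<bar>) \<longlongrightarrow> 0) at_top"
  using additive K(1) pd unfolding simplex_additivity_def card_J by blast
 have sum: "(SUM sg:top_simplices d K. expected d H n (%x. n*(f x*indicator (phi ` sg) x)) dist) =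
  (SUM i:I. expected d H n (%x. n*(f x*indicator (S i) x)) dist)" for n
  using sum.reindex_bij_betw[OF K(2), of "%A. expected d H n (%x. n*(f x*indicator A x)) dist"] inj
  by(simp add: card_J sum.reindex)
 have "EVT n. 1/n * \<bar>expected d H n (%x. n*f x) dist -
  (SUM sg:top_simplices d K. expected d H n (%x. n*(f x*indicator (phi ` sg) x)) dist)\<bar> =
  abs(h mu n - (SUM i:I. h (wgt mu (indicator (S i))) n))"
  using eventually_gt_at_top[of "0::real"]
 proof eventually_elim
  case (elim n)
  have 1: "h mu n = 1/n*expected d H n (%x. n*f x) dist"
  using f f0 elim by(subst muf, subst h_expected) auto
  have 2: "h (wgt mu (indicator (S i))) n = 1/n*expected d H n (%x. n*(f x*indicator (S i) x)) dist" if "i : I" for i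
  using f f0 elim SB[OF that]
  by(subst muf, subst h_expected) (auto simp: wgt_density)
  have "abs(h mu n - (SUM i:I. h (wgt mu (indicator (S i))) n)) =
  abs(1/n*(expected d H n (%x. n*f x) dist - (SUM i:I. expected d H n (%x. n*(f x*indicator (S i) x)) dist)))"
  unfolding 1 by(simp add: 2 right_diff_distrib sum_distrib_left cong: sum.cong)
  thus ?case using elim by(simp add: sum abs_mult)
 qed
 hence "((%n. abs(h mu n - (SUM i:I. h (wgt mu (indicator (S i))) n))) \<longlongrightarrow> 0) at_top"
  using lim by(simp cong: filterlim_cong add: filterlim_cong[OF refl refl])
 thus ?thesis by(rule tendsto_rabs_zero_cancel)
qed

end

section \<open>Null measures; continuity and additivity up to factors tending to 1\<close>

context poisson_functional
begin

definition uniform :: "real => (real^'n) set => (real^'n) measure" where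
 "uniform kap A = density (hausdorff d) (%x. ennreal (kap*indicator A x))"

lemma emeasure_uniform:
 assumes "A : sets borel" "B : sets borel" "0 <= kap"
 shows "emeasure (uniform kap A) B = ennreal kap*hausdorff_outer d (A Int B)"
proof -
 have "emeasure (uniform kap A) B = (\<integral>\<^sup>+x. ennreal kap*indicator (A Int B) x \<partial>hausdorff d)"
  unfolding uniform_def using assms
  by(subst emeasure_density) (auto intro!: nn_integral_cong simp: indicator_def)
 also have "... = ennreal kap*hausdorff_outer d (A Int B)"
  using assms by(subst nn_integral_cmult_indicator) (auto simp: emeasure_hausdorff)
 finally show ?thesis .
qed

lemma SD_uniform:
 assumes "A : sets borel" "0 <= kap" "ennreal kap*hausdorff_outer d A <= 1"
 shows "SD (uniform kap A)"
proof -
 have "emeasure (uniform kap A) UNIV <= 1" using assms by(simp add: emeasure_uniform)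
 moreover have "(%x. kap*indicator A x) : borel_measurable borel" using assms(1) by measurable
 ultimately show ?thesis unfolding subdens_def
  using assms(2) by(intro conjI bexI[of _ "%x. kap*indicator A x"]) (auto simp: uniform_def)
qed

lemma wgt_uniform_indicator:
 assumes "A : sets borel" "B : sets borel" "0 <= kap"
 shows "wgt (uniform kap A) (indicator B) = uniform kap (A Int B)"
proof -
 have "(%x. ennreal (kap*indicator A x*indicator B x)) = (%x. ennreal (kap*indicator (A Int B) x))"
  by(auto simp: indicator_def fun_eq_iff)
 thus ?thesis unfolding uniform_def using assms
  by(subst wgt_density) auto
qed

lemma wgt_uniform_const:
 assumes "A : sets borel" "0 <= kap" "0 <= p"
 shows "wgt (uniform kap A) (%_. p) = uniform (p*kap) A"
 unfolding uniform_def using assms by(subst wgt_density) (auto simp: mult_ac)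

lemma h_null_eq:
 assumes "SD mu" "emeasure mu UNIV = 0" shows "h mu n = 1/n*H n {} dist"
 using assms by(simp add: h_def poisson_mean_def em_wgt_const SD_sets)

lemma cube_bounded: "cube J 1 <= V Int cball 0 (real CARD('n))"
proof
 fix x assume x: "x : cube J 1"
 have "abs(x $ i) <= 1" for i using x by(cases "i : J") (auto simp: cube_def)
 hence "(SUM i:UNIV. abs(x $ i)) <= (SUM i:(UNIV::'n set). 1)" by(intro sum_mono) auto
 hence "norm x <= real CARD('n)" using norm_le_l1_cart[of x] by simp
 moreover have "x : V" using x by(auto simp: cube_def plane_def)
 ultimately show "x : V Int cball 0 (real CARD('n))" by simp
qed

lemma hausdorff_outer_finite: "A <= V ==> bounded A ==> hausdorff_outer d A < \<infinity>"
 using hausdorff_bounded_finite[of A J] card_J by simp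

text \<open>All null measures give the same value. Additivity for a probability measure on a flat
  simplex, decomposed over that simplex and a disjoint translate of it, leaves exactly the value of
  a null measure as the error term.\<close>

lemma h_null:
 assumes "SD mu" "emeasure mu UNIV = 0" shows "(h mu \<longlongrightarrow> 0) at_top"
proof -
 obtain s where s: "int (card J) simplex s" "s <= V" "V Int cball 0 (real CARD('n)) <= s"
  by(rule simplex_over_ball)
 have bs: "bounded s" by(rule compact_imp_bounded[OF compact_simplex[OF s(1)]])
 have sb: "s : sets borel" by(rule borel_closed[OF closed_simplex[OF s(1)]])
 have "hausdorff_outer d (cube J 1) <= hausdorff_outer d s"
  by(rule hausdorff_outer_mono) (use cube_bounded s(3) in blast)
 hence pos: "0 < hausdorff_outer d s" using nontrivial by(rule less_le_trans[rotated])
 define c where "c = enn2real (hausdorff_outer d s)"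
 have fin: "hausdorff_outer d s < \<infinity>" by(rule hausdorff_outer_finite[OF s(2) bs])
 have c: "hausdorff_outer d s = ennreal c" "c > 0"
  using fin pos by(auto simp: c_def enn2real_positive_iff less_top)
 define q where "q = uniform (1/c) s"
 have q1: "ennreal (1/c)*hausdorff_outer d s = 1"
  using c(2) unfolding c(1) by(simp add: ennreal_mult'[symmetric])
 have q: "SD q" unfolding q_def using sb c(2) q1 by(intro SD_uniform) auto
 have qU: "emeasure q UNIV = 1" unfolding q_def using sb c(2) q1 by(simp add: emeasure_uniform)
 obtain R where R: "R > 0" "!!x. x : s ==> norm x < R" using bs by(metis bounded_pos_less)
 obtain i :: 'n where True by simp
 \<comment> \<open>The simplex lies in the open ball of radius \<open>R\<close>, so a shift by
   \<open>2*R\<close> makes it disjoint from itself. The direction may leave the plane, which covers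
   \<open>d = 0\<close> as well.\<close>
 define a :: "real^'n" where "a = (2*R) *\<^sub>R axis i 1"
 have na: "norm a = 2*R" using R(1) by(simp add: a_def)
 define S where "S b = (if b then (%x. a + id x) ` s else s)" for b
 have cs: "csimplex J (S b)" for b
 proof -
  have "C2_embedding_on s (%x. a + id x)" for a :: "real^'n"
  by(rule C2_embedding_on_affine[of _ V]) (use s(2) subspace_plane linear_id in "auto simp: id_def")
  from this[of a] this[of 0] have "C2_embedding_on s (%x. a + id x)" "C2_embedding_on s (%x. x)" by simp_all
  thus ?thesis unfolding csimplex_def S_def using s(1,2) by(cases b) force+
 qed
 have dj: "s Int (%x. a + id x) ` s = {}"
 proof -
  have False if "x : s" "y : s" "x = a + y" for x y
  proof -
  have "norm a = norm (x - y)" using that(3) by simp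
  also have "... <= norm x + norm y" by(rule norm_triangle_ineq4)
  also have "... < 2*R" using R(2)[OF that(1)] R(2)[OF that(2)] by simp
  finally show False using na by simp
  qed
  thus ?thesis by auto
 qed
 have SB: "S b : sets borel" for b using cs csimplex_borel by blast
 have full: "emeasure q (- s) = 0"
  unfolding q_def using sb c(2) by(simp add: emeasure_uniform hausdorff_outer_empty)
 have "((%n. h q n - (SUM b:UNIV. h (wgt q (indicator (S b))) n)) \<longlongrightarrow> 0) at_top"
 proof (rule h_additive_prob[OF q qU])
  show "disjoint_family_on S UNIV" using dj by(auto simp: disjoint_family_on_def S_def)
  have "emeasure q (- (\<Union>b. S b)) <= emeasure q (- s)"
  using SB sb by(intro emeasure_mono) (auto simp: S_def SD_sets[OF q])
  thus "emeasure q (- (UN b:UNIV. S b)) = 0" using full by simp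
 qed (use cs in auto)
 moreover have "wgt q (indicator (S False)) = q"
  using full sb by(simp add: S_def wgt_full SD_sets[OF q])
 moreover define z where "z = wgt q (indicator (S True))"
 ultimately have "((%n. - h z n) \<longlongrightarrow> 0) at_top" by(simp add: UNIV_bool)
 hence "(h z \<longlongrightarrow> 0) at_top" using tendsto_minus_cancel_left[of "h z" 0 at_top] by simp
 moreover have "h z = h mu"
 proof
  fix n
  have "S True <= - s" using dj by(auto simp: S_def)
  hence "emeasure q (S True) <= emeasure q (- s)" using sb by(intro emeasure_mono) (auto simp: SD_sets[OF q])
  hence "emeasure z UNIV = 0" using full SB by(simp add: z_def em_wgt_on SD_sets[OF q])
  moreover have "SD z" unfolding z_def by(rule SD_restrict[OF q SB])
  ultimately show "h z n = h mu n" using h_null_eq assms by simp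
 qed
 ultimately show ?thesis by simp
qed

lemma ev_abs_le:
 "(f \<longlongrightarrow> (0::real)) F ==> eps > 0 ==> \<forall>\<^sub>F n in F. abs(f n) <= eps"
 by(drule tendstoD[of _ _ _ eps]) (auto elim!: eventually_mono)

text \<open>Continuity holds for the normalised measure \<open>q\<close>. Both \<open>mu\<close> and
  its reweighting are compared with the corresponding measure for \<open>q\<close>, and
  \<open>rho\<close> is the quotient of the two factors. If the reweighted measure is null there is
  no factor to form; then both values are small.\<close>

lemma h_continuous_approx:
 assumes mu: "SD mu" and v: "!!i. v i : borel_measurable borel" "!!i x. 0 <= v i x"
  "!!i x. v i x <= 1" "!!i j x. i <= j ==> v i x <= v j x" and lim: "AE x in mu. (%i. v i x) \<longlonglongrightarrow> 1"
  and eps: "eps > 0"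
 shows "EX i0. ALL i>=i0. EX rho. (rho \<longlongrightarrow> 1) at_top & (EVT n. abs(h (wgt mu (v i)) n - rho n*h mu n) <= eps)"
proof -
 note s = SD_sets[OF mu]
 have SDi: "SD (wgt mu (v i))" for i using SD_wgt[OF mu] v by blast
 have both_small: "EX rho. (rho \<longlongrightarrow> 1) at_top & (EVT n. abs(a n - rho n*b n) <= eps)"
  if "EVT n. abs(a n) <= eps/2" "EVT n. abs(b n) <= eps/2" for a b :: "real => real"
 proof (intro exI[of _ "%_. 1"] conjI)
  show "EVT n. abs(a n - 1*b n) <= eps" using that
  proof eventually_elim
  case (elim n)
  thus ?case using abs_triangle_ineq4[of "a n" "b n"] by simp
  qed
 qed simp
 have le: "emeasure (wgt mu (v i)) UNIV <= emeasure mu UNIV" for i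
  unfolding wgt_def using v s by(intro emeasure_density_le) (auto simp: ennreal_le_1)
 show ?thesis
 proof (cases "emeasure mu UNIV = 0")
  case True
  have "EX rho. (rho \<longlongrightarrow> 1) at_top & (EVT n. abs(h (wgt mu (v i)) n - rho n*h mu n) <= eps)" for i
  using le[of i] True eps by(intro both_small ev_abs_le h_null SDi mu) auto
  thus ?thesis by blast
 next
  case False
  obtain q m where q: "SD q" "emeasure q UNIV = 1" "0 < m" "m <= 1" "mu = wgt q (%_. m)" "q = wgt mu (%_. 1/m)"
  by(rule normalize[OF mu False]) blast
  have "AE x in q. (%i. v i x) \<longlonglongrightarrow> 1"
  using lim unfolding q(6) wgt_def by(subst AE_density) (auto elim!: eventually_mono)
  \<comment> \<open>The null case dictates the 8: two errors of \<open>eps/8\<close>, doubled by the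
    factor \<open>m*rho1 n\<close>, have to stay below \<open>eps/2\<close>.\<close>
  hence "EX i0. ALL i>=i0. EVT n. abs(h q n - h (wgt q (v i)) n) < eps/8"
  by(intro h_continuous_prob[where v = v, OF q(1,2)]) (use v eps in "simp_all")
  then obtain i0 where i0: "!!i. i >= i0 ==> EVT n. abs(h q n - h (wgt q (v i)) n) < eps/8"
  by blast
  show ?thesis
  proof (intro exI[of _ i0] allI impI)
  fix i assume i: "i0 <= i"
  have SDq: "SD (wgt q (v i))" using SD_wgt[OF q(1)] v by blast
  have e: "wgt mu (v i) = wgt (wgt q (v i)) (%_. m)"
  unfolding q(5) using q(1,3) v by(intro wgt_commute) (auto simp: SD_sets)
  have E: "EVT n. abs(h q (m*n) - h (wgt q (v i)) (m*n)) < eps/8"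
  by(rule eventually_rescale[OF q(3) i0[OF i]])
  obtain rho1 where r1: "(rho1 \<longlongrightarrow> 1) at_top" "EVT n. h mu n = m*rho1 n*h q (m*n)"
  using h_scale_prob[OF q(1,2), of m] q(3,4,5) by auto
  show "EX rho. (rho \<longlongrightarrow> 1) at_top & (EVT n. abs(h (wgt mu (v i)) n - rho n*h mu n) <= eps)"
  proof (cases "emeasure (wgt q (v i)) UNIV = 0")
  case True
  have "emeasure (wgt mu (v i)) UNIV = 0"
  unfolding e by(subst em_wgt_const[OF SD_sets[OF SDq]]) (use True in auto)
  hence small1: "EVT n. abs(h (wgt mu (v i)) n) <= eps/2"
  using eps by(intro ev_abs_le h_null SDi) auto
  have "EVT n. abs(h (wgt q (v i)) n) <= eps/8"
  using eps True by(intro ev_abs_le h_null SDq) auto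
  from eventually_rescale[OF q(3) this] r1(2) E tendsto_1_bounds[OF r1(1)]
  have "EVT n. abs(h mu n) <= eps/2"
  proof eventually_elim
  case (elim n)
  have "abs(h mu n) = (m*rho1 n)*abs(h q (m*n))" using elim q(1-4) by(simp add: abs_mult)
  also have "abs(h q (m*n)) <= eps/4" using elim(1,3) by linarith
  hence "(m*rho1 n)*abs(h q (m*n)) <= (1*2)*(eps/4)"
  using elim q(1-4) eps by(intro mult_mono) auto
  finally show ?case by simp
  qed
  with small1 show ?thesis by(rule both_small)
  next
  case False
  obtain rho2 where r2: "(rho2 \<longlongrightarrow> 1) at_top"
  "EVT n. h (wgt mu (v i)) n = m*rho2 n*h (wgt q (v i)) (m*n)"
  using h_scale_pos[OF SDq False q(3)] SDi[of i] unfolding e by blast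
  have t: "((%n. rho2 n/rho1 n) \<longlongrightarrow> 1/1) at_top" by(rule tendsto_divide[OF r2(1) r1(1)]) simp
  have "EVT n. abs(h (wgt mu (v i)) n - rho2 n/rho1 n*h mu n) <= eps"
  using r1(2) r2(2) E tendsto_1_bounds[OF r1(1)] tendsto_1_bounds[OF r2(1)]
  proof eventually_elim
  case (elim n)
  have "h (wgt mu (v i)) n - rho2 n/rho1 n*h mu n = (m*rho2 n)*(h (wgt q (v i)) (m*n) - h q (m*n))"
  unfolding elim(1) elim(2) using elim(4) by(simp add: algebra_simps)
  hence "abs(h (wgt mu (v i)) n - rho2 n/rho1 n*h mu n) = (m*rho2 n)*abs(h q (m*n) - h (wgt q (v i)) (m*n))"
  using elim(5) q(3) by(simp add: abs_mult abs_minus_commute)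
  also have "... <= (1*2)*(eps/8)" using elim q(1-4) eps by(intro mult_mono) auto
  finally show ?case using eps by simp
  qed
  thus ?thesis using t by auto
  qed
  qed
 qed
qed

text \<open>Additivity holds for \<open>q\<close>; each piece of \<open>mu\<close> is
  \<open>m\<close> times a piece of \<open>q\<close>, with a factor of its own from control
  homogeneity. Dividing by the factor of \<open>mu\<close> leaves one \<open>rho i\<close> per
  piece.\<close>

lemma h_additive_approx:
 assumes mu: "SD mu" and I: "finite I" and S: "!!i. i : I ==> csimplex J (S i)"
  and disj: "disjoint_family_on S I" and full: "emeasure mu (- (UN i:I. S i)) = 0"
 shows "EX rho. (ALL i. (rho i \<longlongrightarrow> 1) at_top) &
  ((%n. h mu n - (SUM i:I. rho i n*h (wgt mu (indicator (S i))) n)) \<longlongrightarrow> 0) at_top"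
proof -
 note s = SD_sets[OF mu]
 have SB[simp]: "S i : sets borel" if "i : I" for i using S that csimplex_borel by blast
 show ?thesis
 proof (cases "emeasure mu UNIV = 0")
  case True
  have "emeasure (wgt mu (indicator (S i))) UNIV = 0" if "i : I" for i
  proof -
  have "emeasure mu (S i) <= emeasure mu UNIV" using SB[OF that] s by(intro emeasure_mono) auto
  thus ?thesis using True SB[OF that] s by(simp add: em_wgt_on)
  qed
  hence z: "(h (wgt mu (indicator (S i))) \<longlongrightarrow> 0) at_top" if "i : I" for i
  using that mu by(intro h_null SD_restrict) auto
  have "((%n. h mu n - (SUM i:I. 1*h (wgt mu (indicator (S i))) n)) \<longlongrightarrow> 0 - (SUM i:I. 1*0)) at_top"
  using h_null[OF mu True] z by(intro tendsto_intros) auto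
  thus ?thesis by(intro exI[of _ "%_ _. 1"]) simp
 next
  case False
  obtain q m where q: "SD q" "emeasure q UNIV = 1" "0 < m" "m <= 1" "mu = wgt q (%_. m)" "q = wgt mu (%_. 1/m)"
  by(rule normalize[OF mu False]) blast
  have "(UN i:I. S i) : sets borel" using I SB by(rule sets.finite_UN)
  hence "- (UN i:I. S i) : sets borel" by(simp only: borel_comp)
  hence "emeasure q (- (UN i:I. S i)) = ennreal (1/m)*emeasure mu (- (UN i:I. S i))"
  by(subst q(6)) (rule em_wgt_const[OF s])
  hence "emeasure q (- (UN i:I. S i)) = 0" unfolding full by simp
  hence lim: "((%n. h q n - (SUM i:I. h (wgt q (indicator (S i))) n)) \<longlongrightarrow> 0) at_top"
  using h_additive_prob[OF q(1,2) I S disj] by simp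
  obtain rho0 where r0: "(rho0 \<longlongrightarrow> 1) at_top" "EVT n. h mu n = m*rho0 n*h q (m*n)"
  using h_scale_prob[OF q(1,2), of m] q(3,4,5) by auto
  have "EX rho. (rho \<longlongrightarrow> 1) at_top & ((%n. m*rho0 n*h (wgt q (indicator (S i))) (m*n) -
  rho n*h (wgt mu (indicator (S i))) n) \<longlongrightarrow> 0) at_top" if i: "i : I" for i
  proof -
  have SDq: "SD (wgt q (indicator (S i)))" using q(1) i by(intro SD_restrict) auto
  have SDi: "SD (wgt mu (indicator (S i)))" using mu i by(intro SD_restrict) auto
  have e: "wgt mu (indicator (S i)) = wgt (wgt q (indicator (S i))) (%_. m)"
  unfolding q(5) by(rule wgt_commute) (use q(1,3) SB[OF i] in "simp_all add: SD_sets")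
  show ?thesis
  proof (cases "emeasure (wgt q (indicator (S i))) UNIV = 0")
  case True
  have "emeasure (wgt mu (indicator (S i))) UNIV = 0"
  unfolding e by(subst em_wgt_const[OF SD_sets[OF SDq]]) (use True in auto)
  hence 1: "(h (wgt mu (indicator (S i))) \<longlongrightarrow> 0) at_top" by(rule h_null[OF SDi])
  have 2: "((%n. h (wgt q (indicator (S i))) (m*n)) \<longlongrightarrow> 0) at_top"
  by(rule tendsto_rescale[OF q(3) h_null[OF SDq True]])
  have "((%n. m*rho0 n*h (wgt q (indicator (S i))) (m*n) -
  1*h (wgt mu (indicator (S i))) n) \<longlongrightarrow> m*1*0 - 1*0) at_top"
  using 1 2 r0(1) by(intro tendsto_intros)
  thus ?thesis by(intro exI[of _ "%_. 1"]) simp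
  next
  case False
  obtain sg where r2: "(sg \<longlongrightarrow> 1) at_top"
  "EVT n. h (wgt mu (indicator (S i))) n = m * sg n*h (wgt q (indicator (S i))) (m*n)"
  using h_scale_pos[OF SDq False q(3)] SDi unfolding e by blast
  have t: "((%n. rho0 n/sg n) \<longlongrightarrow> 1/1) at_top" by(rule tendsto_divide[OF r0(1) r2(1)]) simp
  have "EVT n. m*rho0 n*h (wgt q (indicator (S i))) (m*n) -
  rho0 n/sg n*h (wgt mu (indicator (S i))) n = 0"
  using r2(2) tendsto_1_bounds[OF r2(1)]
  proof eventually_elim
  case (elim n)
  hence "sg n ~= 0" by auto
  thus ?case unfolding elim(1) by simp
  qed
  hence "((%n. m*rho0 n*h (wgt q (indicator (S i))) (m*n) -
  rho0 n/sg n*h (wgt mu (indicator (S i))) n) \<longlongrightarrow> 0) at_top" by(rule tendsto_eventually)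
  thus ?thesis using t by(intro exI[of _ "%n. rho0 n/sg n"]) simp
  qed
  qed
  hence "ALL i:I. EX rho. (rho \<longlongrightarrow> 1) at_top & ((%n. m*rho0 n*h (wgt q (indicator (S i))) (m*n) -
  rho n*h (wgt mu (indicator (S i))) n) \<longlongrightarrow> 0) at_top" by blast
  from bchoice[OF this] obtain rho' where r'': "ALL i:I. (rho' i \<longlongrightarrow> 1) at_top &
  ((%n. m*rho0 n*h (wgt q (indicator (S i))) (m*n) -
  rho' i n*h (wgt mu (indicator (S i))) n) \<longlongrightarrow> 0) at_top" by(elim exE)
  have r': "(rho' i \<longlongrightarrow> 1) at_top" "((%n. m*rho0 n*h (wgt q (indicator (S i))) (m*n) -
  rho' i n*h (wgt mu (indicator (S i))) n) \<longlongrightarrow> 0) at_top" if "i : I" for i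
  using bspec[OF r'' that] by simp_all
  define rho where "rho i = (if i : I then rho' i else (%_. 1))" for i
  have r: "(rho i \<longlongrightarrow> 1) at_top" for i using r'(1) by(auto simp: rho_def)
  have "((%n. m*rho0 n*(h q (m*n) - (SUM i:I. h (wgt q (indicator (S i))) (m*n))) +
  (SUM i:I. m*rho0 n*h (wgt q (indicator (S i))) (m*n) - rho' i n*h (wgt mu (indicator (S i))) n))
  \<longlongrightarrow> m*1*0 + (SUM i:I. 0)) at_top"
  using tendsto_rescale[OF q(3) lim] r0(1) r'(2) by(intro tendsto_intros)
  moreover have "EVT n. m*rho0 n*(h q (m*n) - (SUM i:I. h (wgt q (indicator (S i))) (m*n))) +
  (SUM i:I. m*rho0 n*h (wgt q (indicator (S i))) (m*n) - rho' i n*h (wgt mu (indicator (S i))) n) =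
  h mu n - (SUM i:I. rho i n*h (wgt mu (indicator (S i))) n)"
  using r0(2) by eventually_elim (simp add: rho_def sum_subtractf right_diff_distrib sum_distrib_left)
  ultimately have "((%n. h mu n - (SUM i:I. rho i n*h (wgt mu (indicator (S i))) n)) \<longlongrightarrow>
  m*1*0 + (SUM i:I. 0)) at_top"
  by(rule Lim_transform_eventually)
  hence "((%n. h mu n - (SUM i:I. rho i n*h (wgt mu (indicator (S i))) n)) \<longlongrightarrow> 0) at_top"
  by simp
  thus ?thesis using r by blast
 qed
qed

text \<open>Additivity over cells holds only up to factors tending to 1, because the control parameter
 has to be adjusted to the mass and no bound on the values is available yet.\<close>

lemma h_cells_approx:
 assumes mu: "SD mu" and D: "finite D" "!!R. R : D ==> cell J R" "disjoint D"
  and full: "emeasure mu (- \<Union>D) = 0" and eps: "eps > 0"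
 shows "EX rho. (ALL R. (rho R \<longlongrightarrow> 1) at_top) &
  (EVT n. abs(h mu n - (SUM R:D. rho R n*h (wgt mu (indicator R)) n)) <= eps)"
proof -
 note s = SD_sets[OF mu]
 have "ALL R:D. EX T. incseq T & (\<forall>l::nat. csimplex J (T l)) & R = (\<Union>l. T l)"
  using D(2) unfolding cell_def by blast
 from bchoice[OF this] obtain T where T: "ALL R:D. incseq (T R) & (\<forall>l::nat. csimplex J (T R l)) & R = (\<Union>l. T R l)"
  by(elim exE)
 have Tinc: "T R l <= T R k" if "R : D" "l <= k" for R l k using T that by(auto simp: incseq_def)
 have Tcs: "csimplex J (T R l)" if "R : D" for R l using T that by blast
 have TU: "(\<Union>l. T R l) = R" if "R : D" for R using T that by metis
 have TB: "T R l : sets borel" if "R : D" for R l using csimplex_borel[OF Tcs[OF that]] .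
 have RB: "R : sets borel" if "R : D" for R using cell_borel[OF D(2)[OF that]] .
 define N where "N = real (card D) + 1"
 have N: "N > 0" by(simp add: N_def)
 \<comment> \<open>There are \<open>N - 1\<close> cells. Each contributes at most
   \<open>2*dl\<close>, the two global approximations \<open>dl\<close> each, together
   \<open>2*dl*N\<close>; dividing by \<open>rho0 n >= 1/2\<close> doubles this to
   \<open>eps/2\<close>.\<close>
 define dl where "dl = eps/(8*N)"
 have dl: "dl > 0" using eps N by(simp add: dl_def)
 have one: "EX i0. ALL l>=i0. EX rho. (rho \<longlongrightarrow> 1) at_top &
  (EVT n. abs(h (wgt (wgt mu (indicator R)) (indicator (T R l))) n - rho n*h (wgt mu (indicator R)) n) <= dl)"
  if R: "R : D" for R
 proof (rule h_continuous_approx[OF SD_restrict[OF mu RB[OF R]] _ _ _ _ _ dl])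
  show "(indicator (T R l) :: _ => real) : borel_measurable borel" for l using TB[OF R] by simp
  show "indicator (T R l) x <= (indicator (T R k) x :: real)" if "l <= k" for l k x
  using Tinc[OF R that] by(auto simp: indicator_def)
  have "emeasure (wgt mu (indicator R)) (- R) = 0"
  using RB[OF R] s by(subst em_wgt_on) auto
  hence "- R : null_sets (wgt mu (indicator R))" using RB[OF R] s by(auto simp: null_sets_def)
  hence "AE x in wgt mu (indicator R). x ~: - R" by(rule AE_not_in)
  thus "AE x in wgt mu (indicator R). (%l. indicator (T R l) x :: real) \<longlonglongrightarrow> 1"
  proof (rule eventually_mono)
  fix x assume "x ~: - R"
  then obtain l where l: "x : T R l" using TU[OF R] by blast
  hence "ALL k>=l. x : T R k" using Tinc[OF R] by blast
  hence "\<forall>\<^sub>F k in sequentially. indicator (T R k) x = (1::real)"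
  unfolding eventually_sequentially by(intro exI[of _ l]) auto
  thus "(%l. indicator (T R l) x :: real) \<longlonglongrightarrow> 1" by(rule tendsto_eventually)
  qed
 qed auto
 \<comment> \<open>At each stage the simplices inside the cells are compact and disjoint, so
   additivity applies to the restriction of \<open>mu\<close> to their union, which increases to
   almost everything.\<close>
 define W where "W l = (UN R:D. T R l)" for l
 have WB: "W l : sets borel" for l unfolding W_def using D(1) TB by(intro sets.finite_UN) auto
 have UB: "\<Union>D : sets borel" using D(1) RB by(intro sets.finite_Union) auto
 have two: "EX i0. ALL l>=i0. EX rho. (rho \<longlongrightarrow> 1) at_top &
  (EVT n. abs(h (wgt mu (indicator (W l))) n - rho n*h mu n) <= dl)"
 proof (rule h_continuous_approx[OF mu _ _ _ _ _ dl])
  show "(indicator (W l) :: _ => real) : borel_measurable borel" for l using WB by simp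
  show "indicator (W l) x <= (indicator (W k) x :: real)" if "l <= k" for l k x
  using Tinc that by(fastforce simp: indicator_def W_def)
  have "- \<Union>D : null_sets mu" using UB s full by(auto simp: null_sets_def)
  hence "AE x in mu. x ~: - \<Union>D" by(rule AE_not_in)
  thus "AE x in mu. (%l. indicator (W l) x :: real) \<longlonglongrightarrow> 1"
  proof (rule eventually_mono)
  fix x assume "x ~: - \<Union>D"
  then obtain R where R: "R : D" "x : R" by blast
  then obtain l where l: "x : T R l" using TU[OF R(1)] by blast
  hence "ALL k>=l. x : W k" using Tinc[OF R(1)] R(1) unfolding W_def by blast
  hence "\<forall>\<^sub>F k in sequentially. indicator (W k) x = (1::real)"
  unfolding eventually_sequentially by(intro exI[of _ l]) auto
  thus "(%l. indicator (W l) x :: real) \<longlonglongrightarrow> 1" by(rule tendsto_eventually)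
  qed
 qed auto
 have "ALL R:D. EX i0. ALL l>=i0. EX rho. (rho \<longlongrightarrow> 1) at_top &
  (EVT n. abs(h (wgt (wgt mu (indicator R)) (indicator (T R l))) n - rho n*h (wgt mu (indicator R)) n) <= dl)"
  using one by blast
 from bchoice[OF this] obtain i1 where i1: "ALL R:D. ALL l>=i1 R. EX rho. (rho \<longlongrightarrow> 1) at_top &
  (EVT n. abs(h (wgt (wgt mu (indicator R)) (indicator (T R l))) n - rho n*h (wgt mu (indicator R)) n) <= dl)"
  by(elim exE)
 obtain i2 where i2: "ALL l>=i2. EX rho. (rho \<longlongrightarrow> 1) at_top &
  (EVT n. abs(h (wgt mu (indicator (W l))) n - rho n*h mu n) <= dl)" using two by(elim exE)
 define l where "l = Max (insert i2 (i1 ` D))"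
 have l: "i2 <= l" "!!R. R : D ==> i1 R <= l" using D(1) by(auto simp: l_def)
 have TR: "wgt (wgt mu (indicator R)) (indicator (T R l)) = wgt mu (indicator (T R l))" if R: "R : D" for R
 proof -
  have "R Int T R l = T R l" using TU[OF R] by blast
  thus ?thesis using s RB[OF R] TB[OF R] by(simp add: wgt_wgt_on)
 qed
 have "ALL R:D. EX rho. (rho \<longlongrightarrow> 1) at_top &
  (EVT n. abs(h (wgt mu (indicator (T R l))) n - rho n*h (wgt mu (indicator R)) n) <= dl)"
 proof
  fix R assume R: "R : D"
  show "EX rho. (rho \<longlongrightarrow> 1) at_top & (EVT n. abs(h (wgt mu (indicator (T R l))) n - rho n*h (wgt mu (indicator R)) n) <= dl)"
  using i1[rule_format, OF R l(2)[OF R]] unfolding TR[OF R] .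
 qed
 from bchoice[OF this] obtain sg where sg: "ALL R:D. (sg R \<longlongrightarrow> 1) at_top &
  (EVT n. abs(h (wgt mu (indicator (T R l))) n - sg R n*h (wgt mu (indicator R)) n) <= dl)" by(elim exE)
 obtain rho0 where r0: "(rho0 \<longlongrightarrow> 1) at_top"
  "EVT n. abs(h (wgt mu (indicator (W l))) n - rho0 n*h mu n) <= dl" using i2 l(1) by blast
 let ?mul = "wgt mu (indicator (W l))"
 have dT: "disjoint_family_on (%R. T R l) D"
  unfolding disjoint_family_on_def
 proof (intro ballI impI)
  fix R R' assume R: "R : D" "R' : D" "R ~= R'"
  have "T R l <= R" "T R' l <= R'" using TU R by blast+
  thus "T R l Int T R' l = {}" using disjointD[OF D(3) R] by blast
 qed
 have "emeasure ?mul (- W l) = 0" using WB s by(subst em_wgt_on) auto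
 then obtain rho1 where r1: "ALL R. (rho1 R \<longlongrightarrow> 1) at_top"
  "((%n. h ?mul n - (SUM R:D. rho1 R n*h (wgt ?mul (indicator (T R l))) n)) \<longlongrightarrow> 0) at_top"
  using h_additive_approx[OF SD_restrict[OF mu WB] D(1) Tcs dT] unfolding W_def by blast
 have TW: "wgt ?mul (indicator (T R l)) = wgt mu (indicator (T R l))" if R: "R : D" for R
 proof -
  have "W l Int T R l = T R l" using R unfolding W_def by blast
  thus ?thesis using s WB TB[OF R] by(simp add: wgt_wgt_on)
 qed
 have e1: "EVT n. abs(h ?mul n - (SUM R:D. rho1 R n*h (wgt mu (indicator (T R l))) n)) <= dl"
  using ev_abs_le[OF r1(2) dl] by(simp add: TW cong: sum.cong)
 \<comment> \<open>Three factors combine: additivity over the compact stage, approximation within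
   the cell, and approximation of \<open>mu\<close> by its restriction to
   \<open>W l\<close>.\<close>
 define rho where "rho R n = (if R : D then rho1 R n * sg R n/rho0 n else 1)" for R n
 have t: "(rho R \<longlongrightarrow> 1) at_top" for R
 proof (cases "R : D")
  case True
  have "((%n. rho1 R n * sg R n/rho0 n) \<longlongrightarrow> 1*1/1) at_top"
  using r1(1) sg True r0(1) by(intro tendsto_intros) auto
  thus ?thesis using True by(simp add: rho_def[abs_def])
 qed (simp add: rho_def[abs_def])
 have ev: "EVT n. ALL R:D. abs(h (wgt mu (indicator (T R l))) n - sg R n*h (wgt mu (indicator R)) n) <= dl"
  using D(1) sg by(intro eventually_ball_finite) auto
 have evr: "EVT n. ALL R:D. 1/2 <= rho1 R n & rho1 R n <= 2"
  by(intro eventually_ball_finite[OF D(1)] ballI tendsto_1_bounds) (use r1(1) in blast)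
 have "EVT n. abs(h mu n - (SUM R:D. rho R n*h (wgt mu (indicator R)) n)) <= eps"
  using r0(2) e1 ev evr tendsto_1_bounds[OF r0(1)]
 proof eventually_elim
  case (elim n)
  let ?a = "%R. h (wgt mu (indicator (T R l))) n" and ?b = "%R. h (wgt mu (indicator R)) n"
  have "abs((SUM R:D. rho1 R n*?a R) - (SUM R:D. rho1 R n * sg R n*?b R)) = abs(SUM R:D. rho1 R n*(?a R - sg R n*?b R))"
  by(simp add: sum_subtractf[symmetric] algebra_simps)
  also have "... <= (SUM R:D. abs(rho1 R n*(?a R - sg R n*?b R)))" by(rule sum_abs)
  also have "... <= (SUM R:D. 2*dl)"
  proof (rule sum_mono)
  fix R assume R: "R : D"
  have "abs(rho1 R n*(?a R - sg R n*?b R)) = rho1 R n*abs(?a R - sg R n*?b R)"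
  using bspec[OF elim(4) R] by(simp add: abs_mult)
  also have "... <= 2*dl" using bspec[OF elim(4) R] bspec[OF elim(3) R] by(intro mult_mono) auto
  finally show "abs(rho1 R n*(?a R - sg R n*?b R)) <= 2*dl" .
  qed
  also have "... = 2*dl*(N - 1)" by(simp add: N_def)
  finally have x: "abs((SUM R:D. rho1 R n*?a R) - (SUM R:D. rho1 R n * sg R n*?b R)) <= 2*dl*(N - 1)" .
  have "abs(rho0 n*h mu n - (SUM R:D. rho1 R n * sg R n*?b R)) <= dl + dl + 2*dl*(N - 1)"
  using elim(1,2) x by linarith
  hence y: "abs(rho0 n*h mu n - (SUM R:D. rho1 R n * sg R n*?b R)) <= 2*dl*N" by(simp add: algebra_simps)
  have p: "rho0 n >= 1/2" using elim by simp
  have "(SUM R:D. rho R n*?b R) = (SUM R:D. rho1 R n * sg R n*?b R)/rho0 n"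
  by(simp add: rho_def sum_divide_distrib)
  hence "h mu n - (SUM R:D. rho R n*?b R) = (rho0 n*h mu n - (SUM R:D. rho1 R n * sg R n*?b R))/rho0 n"
  using p by(simp add: field_simps)
  hence "abs(h mu n - (SUM R:D. rho R n*?b R)) = abs(rho0 n*h mu n - (SUM R:D. rho1 R n * sg R n*?b R))/rho0 n"
  using p by(simp add: abs_divide)
  also have "... <= (2*dl*N)/(1/2)" using y p dl N by(intro frac_le) auto
  also have "... <= eps" using N eps by(simp add: dl_def)
  finally show ?case .
 qed
 thus ?thesis using t by blast
qed

end

section \<open>Boundedness of the normalised expectations\<close>

context poisson_functional
begin

text \<open>A single curved simplex provides the nested subdivisions on which boundedness rests; all
  later estimates are made for such measures.\<close>

definition carried :: "(real^'n) set => (real^'n) measure => bool" where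
 "carried S mu \<longleftrightarrow> csimplex J S & SD mu & emeasure mu (- S) = 0"

lemma carr_SD: "carried S mu ==> SD mu" by(simp add: carried_def)
lemma carried_borel: "carried S mu ==> S : sets borel"
 using csimplex_borel[of J S] by(simp add: carried_def)
lemma carried_sets: "carried S mu ==> sets mu = sets borel" by(simp add: carried_def SD_sets)

lemma carried_wgt:
 assumes "carried S mu" "SD (wgt mu u)" "u : borel_measurable borel"
 shows "carried S (wgt mu u)"
proof -
 have S: "- S : sets borel" using carried_borel[OF assms(1)] by auto
 have "- S : null_sets mu" using assms(1) S carried_sets[OF assms(1)] by(auto simp: null_sets_def carried_def)
 hence "AE x in mu. x ~: - S" by(rule AE_not_in)
 hence "(\<integral>\<^sup>+x. ennreal (u x)*indicator (- S) x \<partial>mu) = (\<integral>\<^sup>+x. 0 \<partial>mu)"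
  by(intro nn_integral_cong_AE) (auto elim!: eventually_mono simp: indicator_def)
 hence "emeasure (wgt mu u) (- S) = 0"
  using em_wgt[OF carried_sets[OF assms(1)] assms(3) S] by simp
 thus ?thesis using assms by(simp add: carried_def)
qed

lemma carried_restrict: "carried S mu ==> A : sets borel ==> carried S (wgt mu (indicator A))"
 by(intro carried_wgt SD_restrict carr_SD) auto

lemma carried_scale: "carried S mu ==> SD (wgt mu (%_. p)) ==> carried S (wgt mu (%_. p))"
 by(intro carried_wgt) auto

lemma SD_null: "SD mu ==> A : sets borel ==> hausdorff_outer d A = 0 ==> emeasure mu A = 0"
 by(rule subdens_null)

lemma emeasure_null_cover:
 assumes "sets mu = sets borel" "A : sets borel" "B : sets borel" "C : sets borel"
  "A <= B Un C" "emeasure mu B = 0" "emeasure mu C = 0"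
 shows "emeasure mu A = 0"
proof -
 have "emeasure mu A <= emeasure mu (B Un C)" using assms by(intro emeasure_mono) auto
 also have "... <= emeasure mu B + emeasure mu C" using assms by(intro emeasure_subadditive) auto
 finally show ?thesis using assms by simp
qed

lemma hausdorff_singleton:
 assumes "0 < d" shows "hausdorff_outer d {y :: real^'n} = 0"
proof -
 have "hausdorff_outer (card J) {0 :: real^'n} = 0"
  by(rule hausdorff_lowdim_0) (use assms card_J in "auto simp: plane_def")
 thus ?thesis using hausdorff_translation[of d y "{0}"] card_J by simp
qed

text \<open>For each index some member of the finite set attains the maximum, so one fixed member
  does so frequently along \<open>F\<close>. The filter is refined to the indices where it does;
  refinements play the part of subsequences.\<close>

lemma argmax_subfilter:
 fixes X :: "'b => real => real"
 assumes "finite D" "D ~= {}" "F ~= bot"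
 obtains c F' where "c : D" "F' <= F" "F' ~= bot" "!!c'. c' : D ==> \<forall>\<^sub>F n in F'. abs(X c' n) <= abs(X c n)"
proof -
 let ?m = "%c n. \<forall>c'\<in>D. abs(X c' n) <= abs(X c n)"
 have ex: "EX c:D. ?m c n" for n
 proof -
  let ?M = "Max ((%c. abs(X c n)) ` D)"
  have "?M : (%c. abs(X c n)) ` D" using assms by(intro Max_in) auto
  then obtain c where c: "c : D" "?M = abs(X c n)" by blast
  have "abs(X c' n) <= ?M" if "c' : D" for c' using assms that by(intro Max_ge) auto
  thus ?thesis using c by auto
 qed
 have "EX c:D. ~ (\<forall>\<^sub>F n in F. ~ ?m c n)"
 proof (rule ccontr)
  assume "~ ?thesis"
  hence "\<forall>\<^sub>F n in F. ALL c:D. ~ ?m c n" using assms(1) by(intro eventually_ball_finite) auto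
  hence "\<forall>\<^sub>F n in F. False" by(rule eventually_mono) (use ex in blast)
  thus False using assms(3) by(simp add: eventually_False)
 qed
 then obtain c where c: "c : D" "~ (\<forall>\<^sub>F n in F. ~ ?m c n)" by blast
 define F' where "F' = inf F (principal {n. ?m c n})"
 have "F' ~= bot" using c(2) unfolding F'_def by(simp add: trivial_limit_def eventually_inf_principal)
 moreover have "\<forall>\<^sub>F n in F'. ?m c n" unfolding F'_def eventually_inf_principal by simp
 hence "\<forall>\<^sub>F n in F'. abs(X c' n) <= abs(X c n)" if "c' : D" for c'
  by(rule eventually_mono) (use that in blast)
 ultimately show ?thesis using that[of c F'] c(1) by(simp add: F'_def)
qed

text \<open>If the values were unbounded, there would be a nested sequence of cells, each of which
 dominates all other cells of its generation along a filter. Removing a small one of them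
 changes the value by an unbounded amount, which contradicts continuity.\<close>

lemma h_bounded:
 assumes d: "0 < d" and mu: "carried S mu"
 shows "EX C. EVT n. abs(h mu n) <= C"
proof (cases "emeasure mu UNIV = 0")
 case True
 thus ?thesis using ev_abs_le[OF h_null[OF carr_SD[OF mu] True], of 1] by auto
next
 case False
 obtain q m where q: "SD q" "emeasure q UNIV = 1" "0 < m" "m <= 1" "mu = wgt q (%_. m)" "q = wgt mu (%_. 1/m)"
  by(rule normalize[OF carr_SD[OF mu] False]) blast
 have qS: "carried S q" using carried_scale[OF mu] q(1) unfolding q(6) by blast
 note sq = SD_sets[OF q(1)]
 obtain s Phi where s: "int (card J) simplex s" "s <= V" "C2_embedding_on s Phi" "S = Phi ` s"
  using qS unfolding carried_def by(elim conjE csimplexE)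
 have inj: "inj_on Phi s" using s(3) by(rule C2_embedding_onE)
 define R where "R t = Phi ` rel_interior t" for t
 define X where "X c n = h (wgt q (indicator c)) n" for c n
 have SB: "- S : sets borel" using carried_borel[OF qS] by auto
 have "EX C. EVT n. abs(h q n) <= C"
 proof (rule ccontr)
  assume unb: "~ ?thesis"
  \<comment> \<open>Along this filter both \<open>n\<close> and \<open>abs(h q n)\<close> tend to
    infinity. It is proper exactly because the values are not eventually bounded.\<close>
  define F0 where "F0 = inf at_top (filtercomap (%n. abs(h q n)) at_top)"
  have F0: "F0 ~= bot"
  proof
  assume "F0 = bot"
  hence "\<forall>\<^sub>F n in F0. False" by simp
  then obtain P Q where PQ: "eventually P at_top" "eventually Q (filtercomap (%n. abs(h q n)) at_top)" "!!n. P n ==> Q n ==> False"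
  unfolding F0_def eventually_inf by auto
  obtain C where C: "!!n. abs(h q n) >= C ==> Q n"
  using PQ(2) unfolding eventually_filtercomap_at_top_linorder by blast
  have "EVT n. abs(h q n) <= C" using PQ(1) by(rule eventually_mono) (use PQ(3) C in force)
  thus False using unb by blast
  qed
  have F0lim: "filterlim (%n. abs(h q n)) at_top F0"
  unfolding F0_def filterlim_iff_le_filtercomap by simp
  \<comment> \<open>A state consists of a partition \<open>D\<close> into cells up to a null set, a
    distinguished cell \<open>R t\<close> of it, and a filter along which the value of that cell is
    unbounded and dominates the values of all cells of \<open>D\<close> up to a constant.
    \<open>Q\<close> demands that the next distinguished cell is contained in the present one and is
    small.\<close>
  define P where "P = (%(i::nat) (D, t, F). int (card J) simplex t & t <= s & finite D & disjoint D &
  (ALL c:D. cell J c) & emeasure q (- \<Union>D) = 0 & R t : D & F <= at_top & F ~= bot &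
  filterlim (%n. abs(X (R t) n)) at_top F & (EX C. ALL c:D. \<forall>\<^sub>F n in F. abs(X c n) <= C*abs(X (R t) n)))"
  define Q where "Q = (%(i::nat) (D :: (real^'n) set set, t :: (real^'n) set, F :: real filter)
  (D' :: (real^'n) set set, t', F' :: real filter). rel_interior t' <= rel_interior t & diameter t' < 1/(real i + 1))"
  have cellR: "cell J (R t)" if "int (card J) simplex t" "t <= s" for t
  unfolding R_def by(rule cell_rel_interior[OF that s(2,3)])
  have "EX x. P 0 x"
  proof (rule exI[of _ "({R s}, s, F0)"])
  have RB: "R s : sets borel" by(rule cell_borel[OF cellR[OF s(1)]]) simp
  have bd: "hausdorff_outer d (Phi ` (s - rel_interior s)) = 0"
  using hausdorff_simplex_boundary[OF s(1,2)] card_J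
  by(intro C2_embedding_image_null[OF s(3)]) (auto simp: compact_simplex[OF s(1)] convex_simplex[OF s(1)])
  have "hausdorff_outer d (S - R s) = 0"
  by(rule hausdorff_null_subset[OF _ bd]) (auto simp: s(4) R_def)
  hence "emeasure q (S - R s) = 0" using RB carried_borel[OF qS] by(intro SD_null[OF q(1)]) auto
  moreover have "emeasure q (- S) = 0" using qS by(simp add: carried_def)
  ultimately have nul: "emeasure q (- R s) = 0"
  proof (intro emeasure_null_cover[OF sq, of "- R s" "S - R s" "- S"])
  show "- R s : sets borel" using RB by(simp only: borel_comp)
  show "S - R s : sets borel" using RB carried_borel[OF qS] by(rule sets.Diff[rotated])
  show "- R s <= (S - R s) Un - S" by blast
  qed (use SB in simp_all)
  have "X (R s) = h q" unfolding X_def using wgt_full[OF sq RB nul] by simp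
  moreover have "F0 <= at_top" unfolding F0_def by simp
  moreover have "EX C. ALL c:{R s}. \<forall>\<^sub>F n in F0. abs(X c n) <= C*abs(X (R s) n)"
  by(rule exI[of _ 1]) simp
  moreover have "cell J (R s)" by(rule cellR[OF s(1) subset_refl])
  ultimately show "P 0 ({R s}, s, F0)" unfolding P_def prod.case using s(1) nul F0 F0lim
  by(simp add: disjoint_def)
  qed
  moreover have "EX y. P (Suc i) y & Q i x y" if Px: "P i x" for i x
  proof -
  obtain D t F where x: "x = (D, t, F)" by(cases x)
  have t: "int (card J) simplex t" "t <= s" and D: "finite D" "disjoint D" "!!c. c : D ==> cell J c"
  "emeasure q (- \<Union>D) = 0" "R t : D" and F: "F <= at_top" "F ~= bot"
  "filterlim (%n. abs(X (R t) n)) at_top F"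
  using Px unfolding P_def x by auto
  obtain C where C: "!!c. c : D ==> \<forall>\<^sub>F n in F. abs(X c n) <= C*abs(X (R t) n)"
  using Px unfolding P_def x by auto
  have i_pos: "0 < 1/(real i + 1)" by simp
  obtain TT where T: "finite TT" "!!t'. t' : TT ==> int (card J) simplex t'" "!!t'. t' : TT ==> t' <= t"
  "!!t'. t' : TT ==> diameter t' < 1/(real i + 1)" "!!t'. t' : TT ==> rel_interior t' <= rel_interior t"
  "!!t'. t' : TT ==> cell J (R t')" "disjoint (R ` TT)" "hausdorff_outer (card J) (Phi ` t - (\<Union>t'\<in>TT. R t')) = 0"
  unfolding R_def
  by(rule csimplex_cells[OF t(1) subset_trans[OF t(2) s(2)] C2_embedding_on_subset[OF s(3) t(2)] i_pos]) blast
  let ?D = "R ` TT"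
  have RtB: "R t : sets borel" by(rule cell_borel[OF D(3)[OF D(5)]])
  have UB: "\<Union>?D : sets borel" using T(1) cell_borel[OF T(6)] by(intro sets.finite_UN) auto
  have sub: "c <= R t" if "c : ?D" for c using that T(5) unfolding R_def by blast
  have "hausdorff_outer d (R t - \<Union>?D) = 0"
  proof (rule hausdorff_null_subset)
  have "R t <= Phi ` t" unfolding R_def by(intro image_mono rel_interior_subset)
  thus "R t - \<Union>?D <= Phi ` t - (\<Union>t'\<in>TT. R t')" by blast
  show "hausdorff_outer d (Phi ` t - (\<Union>t'\<in>TT. R t')) = 0" using T(8) card_J by simp
  qed
  hence nD: "emeasure q (R t - \<Union>?D) = 0" using RtB UB by(intro SD_null[OF q(1)]) auto
  let ?q = "wgt q (indicator (R t))"
  have "emeasure ?q (- \<Union>?D) = 0"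
  proof -
  have "R t Int - \<Union>?D = R t - \<Union>?D" by blast
  moreover have "- \<Union>?D : sets borel" using UB by(simp only: borel_comp)
  ultimately show ?thesis using nD em_wgt_on[OF sq RtB] by metis
  qed
  then obtain rho where rho: "ALL R. (rho R \<longlongrightarrow> 1) at_top"
  "EVT n. abs(h ?q n - (SUM c:?D. rho c n*h (wgt ?q (indicator c)) n)) <= 1"
  using h_cells_approx[OF SD_restrict[OF q(1) RtB], of ?D 1] T(1,6,7) by auto
  have rr: "h (wgt ?q (indicator c)) n = X c n" if c: "c : ?D" for c n
  proof -
  have "R t Int c = c" using sub[OF c] by blast
  moreover have "c : sets borel" using c cell_borel[OF T(6)] by blast
  ultimately show ?thesis using sq RtB by(simp add: X_def wgt_wgt_on)
  qed
  have "EVT n. ALL c:?D. 1/2 <= rho c n & rho c n <= 2"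
  by(intro eventually_ball_finite ballI tendsto_1_bounds) (use T(1) rho(1) in auto)
  with rho(2) have "EVT n. abs(X (R t) n) <= 1 + 2*(SUM c:?D. abs(X c n))"
  proof eventually_elim
  case (elim n)
  have "abs(SUM c:?D. rho c n*X c n) <= (SUM c:?D. abs(rho c n*X c n))" by(rule sum_abs)
  also have "... <= (SUM c:?D. 2*abs(X c n))"
  proof (rule sum_mono)
  fix c assume "c : ?D"
  hence "abs(rho c n) <= 2" using elim(2) by force
  thus "abs(rho c n*X c n) <= 2*abs(X c n)" by(simp add: abs_mult mult_right_mono)
  qed
  also have "... = 2*(SUM c:?D. abs(X c n))" by(simp add: sum_distrib_left)
  finally have "abs(SUM c:?D. rho c n*X c n) <= 2*(SUM c:?D. abs(X c n))" .
  moreover have "(SUM c:?D. rho c n*h (wgt ?q (indicator c)) n) = (SUM c:?D. rho c n*X c n)"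
  by(intro sum.cong) (auto simp: rr)
  ultimately show ?case using elim(1) unfolding X_def[of "R t"] by linarith
  qed
  hence bnd: "\<forall>\<^sub>F n in F. abs(X (R t) n) <= 1 + 2*(SUM c:?D. abs(X c n))" by(rule filter_leD[OF F(1)])
  have ne: "?D ~= {}"
  proof
  assume "?D = {}"
  hence "\<forall>\<^sub>F n in F. abs(X (R t) n) <= 1" using bnd by simp
  moreover have "\<forall>\<^sub>F n in F. 2 <= abs(X (R t) n)" using F(3) by(simp add: filterlim_at_top)
  ultimately have "\<forall>\<^sub>F n in F. False" by eventually_elim simp
  thus False using F(2) by(simp add: eventually_False)
  qed
  obtain c F' where c: "c : ?D" "F' <= F" "F' ~= bot" "!!c'. c' : ?D ==> \<forall>\<^sub>F n in F'. abs(X c' n) <= abs(X c n)"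
  by(rule argmax_subfilter[of ?D F X]) (use T(1) ne F(2) in auto)
  obtain t' where t': "t' : TT" "c = R t'" using c(1) by blast
  define N where "N = real (card ?D)"
  have N: "N >= 1"
  proof -
  have "card ?D > 0" using ne T(1) by(simp add: card_gt_0_iff)
  thus ?thesis unfolding N_def by linarith
  qed
  have all: "\<forall>\<^sub>F n in F'. \<forall>c'\<in>?D. abs(X c' n) <= abs(X c n)" using T(1) c(4) by(intro eventually_ball_finite) auto
  \<comment> \<open>The old value is at most \<open>1 + 2*N\<close> times the largest new one, so
    unboundedness passes to the selected new cell.\<close>
  from all filter_leD[OF c(2) bnd] have low: "\<forall>\<^sub>F n in F'. abs(X (R t) n) <= 1 + 2*N*abs(X c n)"
  proof eventually_elim
  case (elim n)
  have "(\<Sum>c'\<in>?D. abs(X c' n)) <= (\<Sum>c'\<in>?D. abs(X c n))" using elim(1) by(intro sum_mono) blast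
  thus ?case using elim(2) by(simp add: N_def)
  qed
  have lim': "filterlim (%n. abs(X c n)) at_top F'"
  unfolding filterlim_at_top
  proof
  fix Z :: real
  have "\<forall>\<^sub>F n in F'. 1 + 2*N*Z <= abs(X (R t) n)"
  using F(3) c(2) unfolding filterlim_at_top by(meson filter_leD)
  with low show "\<forall>\<^sub>F n in F'. Z <= abs(X c n)"
  proof eventually_elim
  case (elim n)
  hence "2*N*Z <= 2*N*abs(X c n)" by linarith
  thus ?case using N by(simp add: mult_le_cancel_left_pos)
  qed
  qed
  have "\<forall>\<^sub>F n in F'. 1 <= abs(X c n)" using lim' by(simp add: filterlim_at_top)
  with low have dom: "\<forall>\<^sub>F n in F'. abs(X (R t) n) <= 3*N*abs(X c n)"
  proof eventually_elim
  case (elim n)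
  have "1 <= N*abs(X c n)" using mult_mono[OF N elim(2)] N by simp
  thus ?case using elim(1) by(simp add: algebra_simps)
  qed
  \<comment> \<open>Only the distinguished cell is subdivided. The older cells were dominated by it
    and are therefore dominated by the new one, with a larger constant.\<close>
  define D' where "D' = (D - {R t}) Un ?D"
  have DB: "\<Union>D : sets borel" "\<Union>D' : sets borel"
  proof -
  have "cell J c" if "c : D'" for c using that D(3) T(6) unfolding D'_def by blast
  hence "D' <= sets borel" "D <= sets borel" using cell_borel D(3) by blast+
  moreover have "finite D'" using D(1) T(1) by(simp add: D'_def)
  ultimately show "\<Union>D : sets borel" "\<Union>D' : sets borel" using D(1) by(simp_all add: sets.finite_Union)
  qed
  have "emeasure q (- \<Union>D') = 0"
  proof (rule emeasure_null_cover[OF sq, of _ "- \<Union>D" "R t - \<Union>?D"])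
  show "- \<Union>D' <= - \<Union>D Un (R t - \<Union>?D)" unfolding D'_def by blast
  qed (use DB RtB UB nD D(4) in auto)
  moreover have "disjoint D'"
  unfolding disjoint_def
  proof (intro ballI impI)
  fix A B assume A: "A : D'" and B: "B : D'" and ne: "A ~= B"
  have mixed: "A Int B = {}" if "A : D - {R t}" "B : ?D" for A B
  using disjointD[OF D(2), of A "R t"] that D(5) sub[OF that(2)] by blast
  show "A Int B = {}"
  using A B ne disjointD[OF D(2), of A B] disjointD[OF T(7), of A B] mixed[of A B] mixed[of B A]
  unfolding D'_def by blast
  qed
  moreover have "EX C. \<forall>c'\<in>D'. \<forall>\<^sub>F n in F'. abs(X c' n) <= C*abs(X c n)"
  proof (intro exI ballI)
  fix c' assume c': "c' : D'"
  show "\<forall>\<^sub>F n in F'. abs(X c' n) <= (abs(C)*(3*N) + 1)*abs(X c n)"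
  proof (cases "c' : ?D")
  case True
  from c(4)[OF this] show ?thesis
  proof eventually_elim
  case (elim n)
  have "0 <= abs(C)*(3*N)*abs(X c n)" using N by simp
  thus ?case using elim by(simp add: algebra_simps)
  qed
  next
  case False
  hence "c' : D" using c' by(auto simp: D'_def)
  from filter_leD[OF c(2) C[OF this]] dom show ?thesis
  proof eventually_elim
  case (elim n)
  have "C*abs(X (R t) n) <= abs(C)*abs(X (R t) n)" by(intro mult_right_mono) auto
  also have "... <= abs(C)*(3*N*abs(X c n))" using elim(2) by(intro mult_left_mono) auto
  finally show ?case using elim(1) by(simp add: algebra_simps)
  qed
  qed
  qed
  moreover have "finite D'" "!!c. c : D' ==> cell J c" "R t' : D'"
  using D(1,3) T(1,6) t' unfolding D'_def by auto
  ultimately have "P (Suc i) (D', t', F')"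
  unfolding P_def using T(2)[OF t'(1)] T(3)[OF t'(1)] t(2) c(2,3) F(1) lim' t'(2) by auto
  moreover have "Q i x (D', t', F')" unfolding Q_def x using T(4,5) t'(1) by auto
  ultimately show ?thesis by blast
  qed
  ultimately obtain f where f: "!!i. P i (f i)" "!!i. Q i (f i) (f (Suc i))"
  using dependent_nat_choice[of P Q] by blast
  define Ds where "Ds i = fst (f i)" for i
  define ts where "ts i = fst (snd (f i))" for i
  define Fs where "Fs i = snd (snd (f i))" for i
  have fi: "f i = (Ds i, ts i, Fs i)" for i by(simp add: Ds_def ts_def Fs_def)
  have t: "int (card J) simplex ts i" "ts i <= s" and D: "finite (Ds i)" "disjoint (Ds i)" "!!c. c : Ds i ==> cell J c"
  "emeasure q (- \<Union>(Ds i)) = 0" "R (ts i) : Ds i" and Fl: "Fs i <= at_top" "Fs i ~= bot"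
  "filterlim (%n. abs(X (R (ts i)) n)) at_top (Fs i)" for i
  using f(1)[of i] unfolding P_def fi by auto
  have CC: "EX C. ALL c:Ds i. \<forall>\<^sub>F n in Fs i. abs(X c n) <= C*abs(X (R (ts i)) n)" for i
  using f(1)[of i] unfolding P_def fi by auto
  have nest: "rel_interior (ts (Suc i)) <= rel_interior (ts i)" and diam: "diameter (ts (Suc i)) < 1/(real i + 1)" for i
  using f(2)[of i] unfolding Q_def fi by auto
  have RB: "R (ts i) : sets borel" for i by(rule cell_borel[OF D(3)[OF D(5)]])
  have dec: "R (ts j) <= R (ts i)" if "i <= j" for i j
  using that
  proof (induction j rule: dec_induct)
  case (step k)
  thus ?case using nest[of k] unfolding R_def by blast
  qed simp
  have single: "y1 = y2" if y: "y1 : (\<Inter>i. R (ts i))" "y2 : (\<Inter>i. R (ts i))" for y1 y2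
  proof -
  have yR: "y1 : R (ts i)" "y2 : R (ts i)" for i using y by(simp_all add: INT_iff)
  obtain x1 where x1: "x1 : rel_interior (ts 0)" "y1 = Phi x1" using yR(1)[of 0] unfolding R_def by(elim imageE)
  obtain x2 where x2: "x2 : rel_interior (ts 0)" "y2 = Phi x2" using yR(2)[of 0] unfolding R_def by(elim imageE)
  note x = x1 x2
  have ri0: "rel_interior (ts 0) <= s" using t(2)[of 0] rel_interior_subset[of "ts 0"] by(rule subset_trans[rotated])
  have xs: "x1 : s" "x2 : s" using subsetD[OF ri0] x by simp_all
  have xi: "x1 : ts i" "x2 : ts i" for i
  proof -
  have ri: "rel_interior (ts i) <= ts i" by(rule rel_interior_subset)
  obtain z1 where z1: "z1 : rel_interior (ts i)" "y1 = Phi z1" using yR(1)[of i] unfolding R_def by(elim imageE)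
  obtain z2 where z2: "z2 : rel_interior (ts i)" "y2 = Phi z2" using yR(2)[of i] unfolding R_def by(elim imageE)
  have z: "z1 : ts i" "y1 = Phi z1" "z2 : ts i" "y2 = Phi z2" using z1 z2 subsetD[OF ri] by simp_all
  have "z1 : s" "z2 : s" using subsetD[OF t(2)[of i]] z(1,3) by simp_all
  hence "z1 = x1" "z2 = x2"
  using inj_onD[OF inj, of z1 x1] inj_onD[OF inj, of z2 x2] xs z(2,4) x(2,4) by simp_all
  thus "x1 : ts i" "x2 : ts i" using z by auto
  qed
  have "dist x1 x2 < 1/(real i + 1)" for i
  proof -
  have "dist x1 x2 <= diameter (ts (Suc i))"
  by(rule diameter_bounded_bound[OF compact_imp_bounded[OF compact_simplex[OF t(1)]] xi])
  thus ?thesis using diam[of i] by simp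
  qed
  have "~ 0 < dist x1 x2"
  proof
  assume "0 < dist x1 x2"
  then obtain i where "1/real (Suc i) < dist x1 x2" by(rule nat_approx_posE)
  thus False using \<open>!!i. dist x1 x2 < 1/(real i + 1)\<close>[of i] by(simp add: add.commute)
  qed
  thus ?thesis using x by simp
  qed
  have inter: "emeasure q (\<Inter>i. R (ts i)) = 0"
  proof (cases "(\<Inter>i. R (ts i)) = {}")
  case False
  then obtain y where y: "y : (\<Inter>i. R (ts i))" unfolding ex_in_conv[symmetric] by(elim exE)
  have "(\<Inter>i. R (ts i)) <= {y}"
  proof
  fix z assume "z : (\<Inter>i. R (ts i))"
  hence "z = y" using y by(rule single)
  thus "z : {y}" by(simp only: singleton_iff)
  qed
  moreover have "{y} <= (\<Inter>i. R (ts i))" using y by(rule insert_subsetI) (rule empty_subsetI)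
  ultimately have "(\<Inter>i. R (ts i)) = {y}" by(rule subset_antisym)
  thus ?thesis using SD_null[OF q(1), of "{y}"] hausdorff_singleton[OF d, of y] by simp
  qed simp
  \<comment> \<open>The distinguished cells are nested with diameters of their parameter simplices
    tending to 0, so they have at most one common point; as points are null, these weights increase
    to 1 almost everywhere.\<close>
  define v where "v i = (indicator (- R (ts i)) :: _ => real)" for i
  have "EX i0. ALL i>=i0. EVT n. abs(h q n - h (wgt q (v i)) n) < 1"
  proof (rule h_continuous_prob[OF q(1,2)])
  show "v i : borel_measurable borel" for i unfolding v_def
  by(rule borel_measurable_indicator) (use RB[of i] in "simp only: borel_comp")
  show "v i x <= v j x" if "i <= j" for i j x using dec[OF that] unfolding v_def by(auto simp: indicator_def)
  have "(\<Inter>i. R (ts i)) : null_sets q" using inter RB sq by(auto simp: null_sets_def)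
  hence "AE x in q. x ~: (\<Inter>i. R (ts i))" by(rule AE_not_in)
  thus "AE x in q. (%i. v i x) \<longlonglongrightarrow> 1"
  proof (rule eventually_mono)
  fix x assume "x ~: (\<Inter>i. R (ts i))"
  then obtain i where i: "x ~: R (ts i)" by auto
  have "ALL j>=i. x ~: R (ts j)" using subsetD[OF dec] i by metis
  hence "\<forall>\<^sub>F j in sequentially. v j x = 1"
  unfolding eventually_sequentially v_def by(intro exI[of _ i]) auto
  thus "(%i. v i x) \<longlonglongrightarrow> 1" by(rule tendsto_eventually)
  qed
  qed (auto simp: v_def indicator_def)
  then obtain i where i: "EVT n. abs(h q n - h (wgt q (v i)) n) < 1" by blast
  let ?R = "R (ts i)" and ?D = "Ds i - {R (ts i)}"
  have qv: "wgt q (v i) = wgt q (indicator (- ?R))" by(simp add: v_def)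
  have cB: "c : sets borel" if "c : Ds i" for c by(rule cell_borel[OF D(3)[OF that]])
  \<comment> \<open>\<open>q\<close> is decomposed over all cells, and below its restriction off
    \<open>?R\<close> over all cells but \<open>?R\<close>. Comparing the two isolates the value of
    \<open>?R\<close>.\<close>
  obtain rho where rho: "ALL R. (rho R \<longlongrightarrow> 1) at_top"
  "EVT n. abs(h q n - (SUM c:Ds i. rho c n*h (wgt q (indicator c)) n)) <= 1"
  using h_cells_approx[OF q(1), of "Ds i" 1] D(1)[of i] D(2)[of i] D(3)[of _ i] D(4)[of i] by simp blast
  have Dsub: "Ds i <= sets borel" "?D <= sets borel" using cB by auto
  have DU: "\<Union>(Ds i) : sets borel" "\<Union>?D : sets borel"
  using sets.finite_Union[OF D(1) Dsub(1)] sets.finite_Union[OF finite_Diff[OF D(1)] Dsub(2)] by simp_all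
  have DC: "- \<Union>(Ds i) : sets borel" "- \<Union>?D : sets borel" "- ?R : sets borel"
  using DU RB[of i] by(simp_all only: borel_comp)
  have "emeasure (wgt q (indicator (- ?R))) (- \<Union>?D) = 0"
  proof -
  have "emeasure q (- ?R Int - \<Union>?D) <= emeasure q (- \<Union>(Ds i))"
  proof (rule emeasure_mono)
  show "- ?R Int - \<Union>?D <= - \<Union>(Ds i)" by blast
  show "- \<Union>(Ds i) : sets q" using DC(1) sq by simp
  qed
  thus ?thesis using D(4)[of i] unfolding em_wgt_on[OF sq DC(3,2)] by simp
  qed
  moreover have "disjoint ?D" using D(2)[of i] unfolding disjoint_def by simp
  ultimately obtain rho' where rho': "ALL R. (rho' R \<longlongrightarrow> 1) at_top"
  "EVT n. abs(h (wgt q (indicator (- ?R))) n - (SUM c:?D. rho' c n*h (wgt (wgt q (indicator (- ?R))) (indicator c)) n)) <= 1"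
  using h_cells_approx[OF SD_restrict[OF q(1) DC(3)], of ?D 1] D(1)[of i] D(3)[of _ i] by simp blast
  have rr: "h (wgt (wgt q (indicator (- ?R))) (indicator c)) n = X c n" if c: "c : ?D" for c n
  proof -
  have "- ?R Int c = c" using disjointD[OF D(2)[of i], of c ?R] c D(5)[of i] by blast
  moreover have "c : sets borel" using cB[of c] c by simp
  ultimately show ?thesis unfolding X_def using wgt_wgt_on[OF sq DC(3), of c] by simp
  qed
  obtain C where C: "!!c. c : Ds i ==> \<forall>\<^sub>F n in Fs i. abs(X c n) <= C*abs(X ?R n)" using CC[of i] by blast
  define N where "N = real (card ?D) + 1"
  \<comment> \<open>The two decompositions carry different factors for the same cell, which differ
    by at most \<open>dl\<close> eventually. The other values sum up to at most
    \<open>N*(abs(C) + 1)*abs(X ?R n)\<close>, so their total contribution is at most a quarter of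
    \<open>abs(X ?R n)\<close>.\<close>
  define dl where "dl = 1/(4*N*(abs(C) + 1))"
  have N: "N > 0" by(simp add: N_def)
  have dl: "dl > 0" using N by(simp add: dl_def)
  have close: "EVT n. abs(rho c n - rho' c n) <= dl" for c
  proof (rule ev_abs_le[OF _ dl])
  have "((%n. rho c n - rho' c n) \<longlongrightarrow> 1 - 1) at_top" using rho(1) rho'(1) by(intro tendsto_diff) auto
  thus "((%n. rho c n - rho' c n) \<longlongrightarrow> 0) at_top" by simp
  qed
  have "EVT n. ALL c:?D. abs(rho c n - rho' c n) <= dl"
  using D(1)[of i] close by(intro eventually_ball_finite) auto
  with i rho(2) rho'(2) tendsto_1_bounds[OF spec[OF rho(1), of ?R]]
  \<comment> \<open>The 3 collects one unit each from continuity and from the two decompositions;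
    the 2 comes from \<open>rho ?R n >= 1/2\<close>.\<close>
  have "EVT n. abs(X ?R n) <= 2*(3 + dl*(SUM c:?D. abs(X c n)))"
  proof eventually_elim
  case (elim n)
  have s1: "(SUM c:Ds i. rho c n*h (wgt q (indicator c)) n) = rho ?R n*X ?R n + (SUM c:?D. rho c n*X c n)"
  using sum.remove[OF D(1)[of i] D(5)[of i], of "%c. rho c n*X c n"] by(simp add: X_def)
  have s2: "(SUM c:?D. rho' c n*h (wgt (wgt q (indicator (- ?R))) (indicator c)) n) = (SUM c:?D. rho' c n*X c n)"
  by(intro sum.cong) (auto simp: rr)
  have "abs((SUM c:?D. rho c n*X c n) - (SUM c:?D. rho' c n*X c n)) = abs(SUM c:?D. (rho c n - rho' c n)*X c n)"
  by(simp add: sum_subtractf[symmetric] algebra_simps)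
  also have "... <= (SUM c:?D. abs((rho c n - rho' c n)*X c n))" by(rule sum_abs)
  also have "... <= (SUM c:?D. dl*abs(X c n))"
  using elim(5) by(intro sum_mono) (auto simp: abs_mult intro!: mult_right_mono)
  also have "... = dl*(SUM c:?D. abs(X c n))" by(simp add: sum_distrib_left)
  finally have s3: "abs((SUM c:?D. rho c n*X c n) - (SUM c:?D. rho' c n*X c n)) <= dl*(SUM c:?D. abs(X c n))" .
  have "abs(rho ?R n*X ?R n) <= 3 + dl*(SUM c:?D. abs(X c n))"
  using elim(1,2,3) s3 unfolding s1 s2 qv by linarith
  moreover have "1/2*abs(X ?R n) <= abs(rho ?R n*X ?R n)"
  using elim(4) unfolding abs_mult by(intro mult_right_mono) auto
  ultimately show ?case by argo
  qed
  from filter_leD[OF Fl(1)[of i] this]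
  have b1: "\<forall>\<^sub>F n in Fs i. abs(X ?R n) <= 2*(3 + dl*(SUM c:?D. abs(X c n)))" .
  have "\<forall>\<^sub>F n in Fs i. ALL c:?D. abs(X c n) <= C*abs(X ?R n)" using D(1)[of i] C by(intro eventually_ball_finite) auto
  with b1 have "\<forall>\<^sub>F n in Fs i. abs(X ?R n) <= 12"
  proof eventually_elim
  case (elim n)
  have "(SUM c:?D. abs(X c n)) <= (SUM c:?D. (abs(C) + 1)*abs(X ?R n))"
  proof (rule sum_mono)
  fix c assume "c : ?D"
  hence "abs(X c n) <= C*abs(X ?R n)" using elim(2) by blast
  also have "... <= (abs(C) + 1)*abs(X ?R n)" by(intro mult_right_mono) auto
  finally show "abs(X c n) <= (abs(C) + 1)*abs(X ?R n)" .
  qed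
  also have "... <= N*((abs(C) + 1)*abs(X ?R n))" by(simp add: N_def mult_right_mono)
  finally have "dl*(SUM c:?D. abs(X c n)) <= dl*(N*((abs(C) + 1)*abs(X ?R n)))"
  using dl by(intro mult_left_mono) auto
  also have "... = abs(X ?R n)/4"
  proof -
  have gen: "1/(4*M*a)*(M*(a*x)) = x/4" if "a ~= 0" "M ~= 0" for a M x :: real
  using that by simp
  show ?thesis unfolding dl_def by(rule gen) (use N in auto)
  qed
  finally have le: "dl*(SUM c:?D. abs(X c n)) <= abs(X ?R n)/4" .
  have "x <= 12" if "z <= x/4" "x <= 2*(3 + z)" for x z :: real using that by simp
  from this[OF le elim(1)] show ?case .
  qed
  moreover have "\<forall>\<^sub>F n in Fs i. 13 <= abs(X ?R n)" using Fl(3)[of i] by(simp add: filterlim_at_top)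
  ultimately have "\<forall>\<^sub>F n in Fs i. False" by eventually_elim simp
  thus False using Fl(2)[of i] by(simp add: eventually_False)
 qed
 then obtain C where C: "EVT n. abs(h q n) <= C" by blast
 obtain rho where r: "(rho \<longlongrightarrow> 1) at_top" "EVT n. h mu n = m*rho n*h q (m*n)"
  using h_scale_prob[OF q(1,2), of m] q(3,4,5) by auto
 from r(2) tendsto_1_bounds[OF r(1)] eventually_rescale[OF q(3) C]
 have "EVT n. abs(h mu n) <= 2*C"
 proof eventually_elim
  case (elim n)
  have "abs(h mu n) = (m*rho n)*abs(h q (m*n))" using elim q(3) by(simp add: abs_mult)
  also have "... <= (1*2)*C" using elim q(3,4) by(intro mult_mono) auto
  finally show ?case by simp
 qed
 thus ?thesis by blast
qed

end

section \<open>Asymptotic additivity over Borel sets\<close>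

lemma tendsto_0I:
 assumes "!!eps. eps > 0 ==> \<forall>\<^sub>F n in F. abs(f n) <= (eps::real)" shows "(f \<longlongrightarrow> 0) F"
proof (rule tendstoI)
 fix e :: real assume "e > 0"
 hence "\<forall>\<^sub>F n in F. abs(f n) <= e/2" by(intro assms) simp
 thus "\<forall>\<^sub>F n in F. dist (f n) 0 < e" by(rule eventually_mono) (use \<open>e > 0\<close> in auto)
qed

text \<open>For bounded values a factor tending to 1 amounts to an arbitrarily small additive error;
  this removes the factors from the earlier approximate statements.\<close>

lemma bounded_near_multiple:
 fixes a b :: "real => real"
 assumes C: "EVT n. abs(b n) <= C" and rho: "(rho \<longlongrightarrow> 1) at_top"
  and ab: "EVT n. abs(a n - rho n*b n) <= eps" and e: "eps' > 0"
 shows "EVT n. abs(a n - b n) <= eps + eps'"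
proof -
 have "((%n. rho n - 1) \<longlongrightarrow> 1 - 1) at_top" using rho by(intro tendsto_intros)
 hence "EVT n. abs(rho n - 1) <= eps'/(abs(C) + 1)"
  using e by(auto dest: tendstoD[of _ _ _ "eps'/(abs(C) + 1)"] elim!: eventually_mono)
 with C ab show ?thesis
 proof eventually_elim
  case (elim n)
  have "abs((rho n - 1)*b n) <= eps'/(abs(C) + 1)*(abs(C) + 1)"
  unfolding abs_mult using elim e by(intro mult_mono) auto
  also have "... = eps'" by simp
  finally have "abs(rho n*b n - b n) <= eps'" by(simp add: algebra_simps)
  thus ?case using elim(2) by linarith
 qed
qed

text \<open>Boundedness uses that points are null, hence \<open>0 < d\<close>. Dimension 0 is
  settled near the end by translating and scaling a single atom.\<close>

locale positive_dimension = poisson_functional H J d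
 for H :: "'n::finite functional" and J d +
 assumes d_pos: "0 < d"
begin

lemma h_scale:
 assumes mu: "carried S mu" and p: "0 < p" "SD (wgt mu (%_. p))"
 shows "((%n. h (wgt mu (%_. p)) n - p*h mu (p*n)) \<longlongrightarrow> 0) at_top"
proof (cases "emeasure mu UNIV = 0")
 case True
 have 1: "emeasure (wgt mu (%_. p)) UNIV = 0"
  using True carried_sets[OF mu] by(simp add: em_wgt_const)
 have "((%n. h (wgt mu (%_. p)) n - p*h mu (p*n)) \<longlongrightarrow> 0 - p*0) at_top"
  by(intro tendsto_intros h_null[OF p(2) 1] tendsto_rescale[OF p(1) h_null[OF carr_SD[OF mu] True]])
 thus ?thesis by simp
next
 case False
 obtain rho where r: "(rho \<longlongrightarrow> 1) at_top" "EVT n. h (wgt mu (%_. p)) n = p*rho n*h mu (p*n)"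
  using h_scale_pos[OF carr_SD[OF mu] False p] by blast
 obtain C where C: "EVT n. abs(h mu n) <= C" using h_bounded[OF d_pos mu] by blast
 have C': "EVT n. abs(p*h mu (p*n)) <= p*C"
  using eventually_rescale[OF p(1) C] by(rule eventually_mono) (use p(1) in "simp add: abs_mult")
 have "EVT n. abs(h (wgt mu (%_. p)) n - rho n*(p*h mu (p*n))) <= 0"
  using r(2) by(rule eventually_mono) simp
 from bounded_near_multiple[OF C' r(1) this] show ?thesis
  by(intro tendsto_0I) simp
qed

lemma h_continuous:
 assumes mu: "carried S mu" and v: "!!i. v i : borel_measurable borel" "!!i x. 0 <= v i x"
  "!!i x. v i x <= 1" "!!i j x. i <= j ==> v i x <= v j x" and lim: "AE x in mu. (%i. v i x) \<longlonglongrightarrow> 1"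
  and eps: "eps > 0"
 shows "EX i0. ALL i>=i0. EVT n. abs(h (wgt mu (v i)) n - h mu n) <= eps"
proof -
 have "EX i0. ALL i>=i0. EX rho. (rho \<longlongrightarrow> 1) at_top & (EVT n. abs(h (wgt mu (v i)) n - rho n*h mu n) <= eps/2)"
  by(rule h_continuous_approx[where v = v, OF carr_SD[OF mu]]) (use v lim eps in simp_all)
 then obtain i0 where i0: "!!i. i >= i0 ==> EX rho. (rho \<longlongrightarrow> 1) at_top & (EVT n. abs(h (wgt mu (v i)) n - rho n*h mu n) <= eps/2)"
  by blast
 obtain C where C: "EVT n. abs(h mu n) <= C" using h_bounded[OF d_pos mu] by blast
 show ?thesis
 proof (intro exI[of _ i0] allI impI)
  fix i assume "i0 <= i"
  then obtain rho where rho: "(rho \<longlongrightarrow> 1) at_top" "EVT n. abs(h (wgt mu (v i)) n - rho n*h mu n) <= eps/2"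
  using i0 by blast
  from bounded_near_multiple[OF C rho, of "eps/2"] eps
  show "EVT n. abs(h (wgt mu (v i)) n - h mu n) <= eps" by simp
 qed
qed

lemma AE_indicator_limit:
 assumes s: "sets mu = sets borel" and A: "!!i. A i : sets borel" "incseq A"
  and full: "emeasure mu (- (\<Union>i. A i)) = 0"
 shows "AE x in mu. (%i. indicator (A i) x :: real) \<longlonglongrightarrow> 1"
proof -
 have "(\<Union>i. A i) : sets borel" using A(1) by auto
 hence "- (\<Union>i. A i) : null_sets mu" using s full by(simp add: null_sets_def borel_comp del: Compl_UN)
 hence "AE x in mu. x ~: - (\<Union>i. A i)" by(rule AE_not_in)
 thus ?thesis
 proof (rule eventually_mono)
  fix x assume "x ~: - (\<Union>i. A i)"
  then obtain i where i: "x : A i" by blast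
  hence "ALL j>=i. x : A j" using A(2) unfolding incseq_def by blast
  hence "\<forall>\<^sub>F j in sequentially. indicator (A j) x = (1::real)"
  unfolding eventually_sequentially by(intro exI[of _ i]) auto
  thus "(%i. indicator (A i) x :: real) \<longlonglongrightarrow> 1" by(rule tendsto_eventually)
 qed
qed

lemma h_continuous_sets:
 assumes mu: "carried S mu" and A: "!!i. A i : sets borel" "incseq A"
  and full: "emeasure mu (- (\<Union>i. A i)) = 0" and eps: "eps > 0"
 shows "EX i0. ALL i>=i0. EVT n. abs(h (wgt mu (indicator (A i))) n - h mu n) <= eps"
proof (rule h_continuous[OF mu _ _ _ _ _ eps])
 show "(indicator (A i) :: _ => real) : borel_measurable borel" for i using A(1) by simp
 show "indicator (A i) x <= (indicator (A j) x :: real)" if "i <= j" for i j x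
  using A(2) that unfolding incseq_def by(auto simp: indicator_def)
 show "AE x in mu. (%i. indicator (A i) x :: real) \<longlonglongrightarrow> 1"
  by(rule AE_indicator_limit[OF carried_sets[OF mu] A full])
qed auto

lemma h_cells:
 assumes mu: "carried S mu" and D: "finite D" "!!R. R : D ==> cell J R" "disjoint D"
  and full: "emeasure mu (- \<Union>D) = 0"
 shows "((%n. h mu n - (SUM R:D. h (wgt mu (indicator R)) n)) \<longlongrightarrow> 0) at_top"
proof (rule tendsto_0I)
 fix eps :: real assume eps: "eps > 0"
 let ?X = "%R n. h (wgt mu (indicator R)) n"
 obtain rho where rho: "ALL R. (rho R \<longlongrightarrow> 1) at_top" "EVT n. abs(h mu n - (SUM R:D. rho R n*?X R n)) <= eps/2"
  using h_cells_approx[OF carr_SD[OF mu] D full, of "eps/2"] eps by auto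
 have "((%n. rho R n*?X R n - ?X R n) \<longlongrightarrow> 0) at_top" if R: "R : D" for R
 proof (rule tendsto_0I)
  fix e :: real assume e: "e > 0"
  obtain C where C: "EVT n. abs(?X R n) <= C"
  using h_bounded[OF d_pos carried_restrict[OF mu cell_borel[OF D(2)[OF R]]]] by blast
  have "EVT n. abs(rho R n*?X R n - rho R n*?X R n) <= 0" by simp
  from bounded_near_multiple[OF C spec[OF rho(1)] this e] show "EVT n. abs(rho R n*?X R n - ?X R n) <= e" by simp
 qed
 hence "((%n. SUM R:D. rho R n*?X R n - ?X R n) \<longlongrightarrow> (SUM R:D. 0)) at_top" by(intro tendsto_sum)
 hence "EVT n. abs(SUM R:D. rho R n*?X R n - ?X R n) <= eps/2"
  using eps by(intro ev_abs_le) auto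
 with rho(2) show "EVT n. abs(h mu n - (SUM R:D. ?X R n)) <= eps"
 proof eventually_elim
  case (elim n)
  thus ?case unfolding sum_subtractf by linarith
 qed
qed

text \<open>The preimages of \<open>A\<close> and \<open>B\<close> in the parameter simplex have
  positive distance. Cells of smaller diameter meet at most one of the two sets, so additivity is
  trivial on each cell and is summed up over the cells.\<close>

lemma h_compact_additive:
 assumes mu: "carried S mu" and A: "compact A" "A <= S" and B: "compact B" "B <= S" and AB: "A Int B = {}"
 shows "((%n. h (wgt mu (indicator (A Un B))) n - h (wgt mu (indicator A)) n - h (wgt mu (indicator B)) n) \<longlongrightarrow> 0) at_top"
proof -
 note sm = carried_sets[OF mu]
 obtain s Phi where s: "int (card J) simplex s" "s <= V" "C2_embedding_on s Phi" "S = Phi ` s"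
  using mu unfolding carried_def by(elim conjE csimplexE)
 have cs: "compact s" by(rule compact_simplex[OF s(1)])
 have cont: "continuous_on s Phi" by(rule C2_embedding_on_continuous[OF s(3)])
 have clos: "compact (s Int Phi -` K)" if "compact K" for K
 proof -
  have "closedin (top_of_set s) (s Int Phi -` K)"
  using cont compact_imp_closed[OF that] by(rule continuous_closedin_preimage)
  thus ?thesis using closedin_compact[OF cs] by blast
 qed
 have "s Int Phi -` A Int (s Int Phi -` B) = {}" using AB by blast
 then obtain e where e: "e > 0" "!!x y. x : s Int Phi -` A ==> y : s Int Phi -` B ==> e <= dist x y"
  using separate_compact_closed[OF clos[OF A(1)] compact_imp_closed[OF clos[OF B(1)]]] by blast
 obtain TT where T: "finite TT" "!!t. t : TT ==> int (card J) simplex t" "!!t. t : TT ==> t <= s"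
  "!!t. t : TT ==> diameter t < e" "!!t. t : TT ==> cell J (Phi ` rel_interior t)"
  "disjoint ((%t. Phi ` rel_interior t) ` TT)"
  "hausdorff_outer (card J) (Phi ` s - (UN t:TT. Phi ` rel_interior t)) = 0"
  by(rule csimplex_cells[OF s(1-3) e(1)]) blast
 define D where "D = (%t. Phi ` rel_interior t) ` TT"
 have D: "finite D" "!!R. R : D ==> cell J R" "disjoint D" using T(1,5,6) by(auto simp: D_def)
 have DB: "\<Union>D : sets borel" using D(1) cell_borel[OF D(2)] by(intro sets.finite_Union) auto
 have SB: "S : sets borel" by(rule carried_borel[OF mu])
 have null: "emeasure nu (- \<Union>D) = 0" if nu: "carried S nu" for nu
 proof (rule emeasure_null_cover[OF carried_sets[OF nu], of "- \<Union>D" "S - \<Union>D" "- S"])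
  show "emeasure nu (- S) = 0" using nu by(simp add: carried_def)
  have "hausdorff_outer d (S - \<Union>D) = 0" using T(7) card_J by(simp add: D_def s(4))
  thus "emeasure nu (S - \<Union>D) = 0" using SB DB by(intro SD_null[OF carr_SD[OF nu]]) auto
  show "- \<Union>D : sets borel" using DB by(simp only: borel_comp)
  show "- S : sets borel" using SB by(simp only: borel_comp)
  show "S - \<Union>D : sets borel" using SB DB by(rule sets.Diff)
  show "- \<Union>D <= (S - \<Union>D) Un - S" by blast
 qed
 have KB: "A : sets borel" "B : sets borel" "A Un B : sets borel"
  using A(1) B(1) by(auto intro: borel_closed compact_imp_closed)
 have cells: "((%n. h (wgt mu (indicator K)) n - (SUM R:D. h (wgt mu (indicator (K Int R))) n)) \<longlongrightarrow> 0) at_top"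
  if K: "K : sets borel" for K
 proof -
  have "((%n. h (wgt mu (indicator K)) n - (SUM R:D. h (wgt (wgt mu (indicator K)) (indicator R)) n)) \<longlongrightarrow> 0) at_top"
  by(rule h_cells[OF carried_restrict[OF mu K] D null[OF carried_restrict[OF mu K]]])
  moreover have "wgt (wgt mu (indicator K)) (indicator R) = wgt mu (indicator (K Int R))" if "R : D" for R
  by(rule wgt_wgt_on[OF sm K cell_borel[OF D(2)[OF that]]])
  ultimately show ?thesis by(simp cong: sum.cong)
 qed
 have empty: "(h (wgt mu (indicator {})) \<longlongrightarrow> 0) at_top"
  by(rule h_null) (auto intro: SD_restrict carr_SD[OF mu] simp: em_wgt_on[OF sm])
 have each: "((%n. h (wgt mu (indicator ((A Un B) Int R))) n - h (wgt mu (indicator (A Int R))) n - h (wgt mu (indicator (B Int R))) n) \<longlongrightarrow> 0) at_top"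
  if R: "R : D" for R
 proof -
  obtain t where t: "t : TT" "R = Phi ` rel_interior t" using R by(auto simp: D_def)
  have "A Int R = {} | B Int R = {}"
  proof (rule ccontr)
  assume "~ ?thesis"
  then obtain x y where xy: "x : rel_interior t" "Phi x : A" "y : rel_interior t" "Phi y : B" unfolding t(2) by blast
  have "x : t" "y : t" using xy rel_interior_subset by blast+
  moreover hence "x : s" "y : s" using T(3)[OF t(1)] by blast+
  ultimately have "e <= dist x y" "dist x y <= diameter t"
  using e(2)[of x y] xy diameter_bounded_bound[OF compact_imp_bounded[OF compact_simplex[OF T(2)[OF t(1)]]]] by auto
  thus False using T(4)[OF t(1)] by simp
  qed
  thus ?thesis
  proof
  assume "A Int R = {}"
  hence "(A Un B) Int R = B Int R" "A Int R = {}" by blast+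
  thus ?thesis using tendsto_minus[OF empty] by simp
  next
  assume "B Int R = {}"
  hence "(A Un B) Int R = A Int R" "B Int R = {}" by blast+
  thus ?thesis using tendsto_minus[OF empty] by simp
  qed
 qed
 let ?f = "%K n. h (wgt mu (indicator K)) n"
 have "((%n. (?f (A Un B) n - (SUM R:D. ?f ((A Un B) Int R) n)) - (?f A n - (SUM R:D. ?f (A Int R) n)) - (?f B n - (SUM R:D. ?f (B Int R) n))
  + (SUM R:D. ?f ((A Un B) Int R) n - ?f (A Int R) n - ?f (B Int R) n)) \<longlongrightarrow> 0 - 0 - 0 + (SUM R:D. 0)) at_top"
  by(intro tendsto_add tendsto_diff cells KB tendsto_sum each)
 thus ?thesis by(simp add: sum_subtractf sum.distrib algebra_simps)
qed

text \<open>Inner regularity gives compact sets of almost full measure; finite unions make them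
  increase, the form in which continuity can be applied.\<close>

lemma inner_compact_sequence:
 fixes mu :: "(real^'n) measure"
 assumes s: "sets mu = sets borel" and fin: "emeasure mu UNIV < \<infinity>" and A: "A : sets borel"
 obtains K where "!!i::nat. compact (K i)" "incseq K" "!!i. K i <= A" "emeasure mu (A - (\<Union>i. K i)) = 0"
proof -
 have sp: "space mu = UNIV" using sets_eq_imp_space_eq[OF s] by simp
 have "EX K. K <= A & compact K & emeasure mu A <= emeasure mu K + ennreal (1/real (Suc i))" for i
 proof -
  have "emeasure mu A ~= \<infinity>" using fin emeasure_mono[of A UNIV mu] s by(auto simp: top_unique)
  have SUP: "emeasure mu A = (SUP K\<in>{K. K <= A & compact K}. emeasure mu K)"
  using inner_regular[OF s _ A] fin sp by auto
  show ?thesis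
  proof (cases "emeasure mu A = 0")
  case True
  thus ?thesis by(intro exI[of _ "{}"]) auto
  next
  case False
  hence "emeasure mu A - ennreal (1/real (Suc i)) < emeasure mu A"
  using \<open>emeasure mu A ~= \<infinity>\<close> by(intro ennreal_between) (auto simp: zero_less_iff_neq_zero less_top)
  hence "emeasure mu A - ennreal (1/real (Suc i)) < (SUP K\<in>{K. K <= A & compact K}. emeasure mu K)"
  unfolding SUP[symmetric] .
  then obtain K where K: "K <= A" "compact K" "emeasure mu A - ennreal (1/real (Suc i)) < emeasure mu K"
  unfolding less_SUP_iff by blast
  hence "emeasure mu A <= emeasure mu K + ennreal (1/real (Suc i))"
  using less_imp_le[OF K(3)] \<open>emeasure mu A ~= \<infinity>\<close> by(auto simp: ennreal_minus_le_iff add.commute)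
  thus ?thesis using K by blast
  qed
 qed
 then obtain L where L: "!!i. L i <= A" "!!i. compact (L i)" "!!i. emeasure mu A <= emeasure mu (L i) + ennreal (1/real (Suc i))"
  by metis
 define K where "K i = (\<Union>j\<le>i. L j)" for i
 have cK: "compact (K i)" for i unfolding K_def using L(2) by(intro compact_UN) auto
 have LB: "L i : sets borel" for i using L(2) by(intro borel_closed compact_imp_closed)
 have KB: "K i : sets borel" for i using cK by(intro borel_closed compact_imp_closed)
 have UB: "(\<Union>i. K i) : sets borel" using KB by auto
 have "emeasure mu (A - (\<Union>i. K i)) <= ennreal (1/real (Suc i))" for i
 proof -
  have finL: "emeasure mu (L i) ~= \<top>"
  using fin emeasure_mono[of "L i" UNIV mu] s by(auto simp: top_unique)
  have "emeasure mu (A - (\<Union>i. K i)) <= emeasure mu (A - L i)"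
  using A UB LB s by(intro emeasure_mono) (auto simp: K_def)
  also have "... = emeasure mu A - emeasure mu (L i)"
  using A LB s L(1) fin emeasure_mono[of "L i" UNIV mu] by(intro emeasure_Diff) (auto simp: top_unique)
  also have "... <= ennreal (1/real (Suc i))"
  unfolding ennreal_minus_le_iff using L(3)[of i] finL by(simp add: add.commute)
  finally show ?thesis .
 qed
 note le = this
 have "emeasure mu (A - (\<Union>i. K i)) <= 0"
 proof (rule ennreal_le_epsilon)
  fix e :: real assume "0 < e"
  then obtain i where "1/real (Suc i) < e" by(rule nat_approx_posE)
  hence "ennreal (1/real (Suc i)) <= ennreal e" by(intro ennreal_leI) simp
  with le[of i] have "emeasure mu (A - (\<Union>i. K i)) <= ennreal e" by(rule order_trans)
  thus "emeasure mu (A - (\<Union>i. K i)) <= 0 + ennreal e" by simp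
 qed
 hence "emeasure mu (A - (\<Union>i. K i)) = 0" by simp
 moreover have "incseq K" unfolding K_def incseq_def by fastforce
 moreover have "K i <= A" for i using L(1) by(auto simp: K_def)
 ultimately show ?thesis using that[of K] cK by simp
qed

text \<open>Compact subsets exhaust \<open>A\<close> and \<open>B\<close> up to null sets.
  Continuity moves each of the three terms by at most \<open>eps/4\<close>, and compact additivity
  costs the fourth quarter.\<close>

lemma h_Borel_additive:
 assumes mu: "carried S mu" and A: "A : sets borel" and B: "B : sets borel" and AB: "A Int B = {}"
 shows "((%n. h (wgt mu (indicator (A Un B))) n - h (wgt mu (indicator A)) n - h (wgt mu (indicator B)) n) \<longlongrightarrow> 0) at_top"
proof (rule tendsto_0I)
 fix eps :: real assume eps: "eps > 0"
 note s = carried_sets[OF mu]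
 have SB: "S : sets borel" by(rule carried_borel[OF mu])
 have SS: "emeasure mu (- S) = 0" using mu by(simp add: carried_def)
 have fin: "emeasure mu UNIV < \<infinity>" using SD_emeasure[OF carr_SD[OF mu]] by simp
 obtain K where K: "!!i::nat. compact (K i)" "incseq K" "!!i. K i <= A Int S" "emeasure mu (A Int S - (\<Union>i. K i)) = 0"
  using inner_compact_sequence[OF s fin, of "A Int S"] A SB by auto
 obtain L where L: "!!i::nat. compact (L i)" "incseq L" "!!i. L i <= B Int S" "emeasure mu (B Int S - (\<Union>i. L i)) = 0"
  using inner_compact_sequence[OF s fin, of "B Int S"] B SB by auto
 have KB: "K i : sets borel" "L i : sets borel" for i using K(1) L(1) by(auto intro!: borel_closed compact_imp_closed)
 have gen: "EX i0. ALL i>=i0. EVT n. abs(h (wgt mu (indicator (W i))) n - h (wgt mu (indicator C)) n) <= eps/4"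
  if C: "C : sets borel" and W: "!!i. W i : sets borel" "incseq W" "!!i. W i <= C" "emeasure mu (C Int S - (\<Union>i. W i)) = 0" for C W
 proof -
  have WU: "(\<Union>i. W i) : sets borel" using W(1) by auto
  have "emeasure (wgt mu (indicator C)) (- (\<Union>i. W i)) = emeasure mu (C Int - (\<Union>i. W i))"
  by(rule em_wgt_on[OF s C]) (use WU in "simp only: borel_comp")
  also have "... = 0"
  by(rule emeasure_null_cover[OF s, of _ "C Int S - (\<Union>i. W i)" "- S"])
  (use C SB WU W(4) SS borel_comp in "auto simp del: Compl_UN")
  finally have "EX i0. ALL i>=i0. EVT n. abs(h (wgt (wgt mu (indicator C)) (indicator (W i))) n - h (wgt mu (indicator C)) n) <= eps/4"
  using eps by(intro h_continuous_sets[OF carried_restrict[OF mu C] W(1,2)]) auto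
  moreover have "wgt (wgt mu (indicator C)) (indicator (W i)) = wgt mu (indicator (W i))" for i
  proof -
  have "C Int W i = W i" using W(3) by blast
  thus ?thesis using wgt_wgt_on[OF s C W(1)] by simp
  qed
  ultimately show ?thesis by simp
 qed
 obtain i1 where i1: "!!i. i >= i1 ==> EVT n. abs(h (wgt mu (indicator (K i))) n - h (wgt mu (indicator A)) n) <= eps/4"
  using gen[OF A KB(1) K(2) _ K(4)[folded Int_assoc]] K(3) by blast
 obtain i2 where i2: "!!i. i >= i2 ==> EVT n. abs(h (wgt mu (indicator (L i))) n - h (wgt mu (indicator B)) n) <= eps/4"
  using gen[OF B KB(2) L(2) _ L(4)[folded Int_assoc]] L(3) by blast
 have "EX i0. ALL i>=i0. EVT n. abs(h (wgt mu (indicator (K i Un L i))) n - h (wgt mu (indicator (A Un B))) n) <= eps/4"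
 proof (rule gen)
  show "A Un B : sets borel" using A B by auto
  show "K i Un L i : sets borel" for i using KB by auto
  show "incseq (%i. K i Un L i)" using K(2) L(2) by(fastforce simp: incseq_def)
  show "K i Un L i <= A Un B" for i using K(3) L(3) by blast
  have UK: "(\<Union>i. K i) : sets borel" "(\<Union>i. L i) : sets borel" "(\<Union>i. K i Un L i) : sets borel" using KB by auto
  show "emeasure mu ((A Un B) Int S - (\<Union>i. K i Un L i)) = 0"
  by(rule emeasure_null_cover[OF s _ _ _ _ K(4) L(4)]) (use A B SB UK in auto)
 qed
 then obtain i3 where i3: "!!i. i >= i3 ==> EVT n. abs(h (wgt mu (indicator (K i Un L i))) n - h (wgt mu (indicator (A Un B))) n) <= eps/4"
  by blast
 define i where "i = max i1 (max i2 i3)"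
 have i: "i >= i1" "i >= i2" "i >= i3" by(auto simp: i_def)
 have "K i Int L i = {}" "K i <= S" "L i <= S" using K(3) L(3) AB by blast+
 hence "((%n. h (wgt mu (indicator (K i Un L i))) n - h (wgt mu (indicator (K i))) n - h (wgt mu (indicator (L i))) n) \<longlongrightarrow> 0) at_top"
  by(intro h_compact_additive[OF mu K(1) _ L(1)])
 hence "EVT n. abs(h (wgt mu (indicator (K i Un L i))) n - h (wgt mu (indicator (K i))) n - h (wgt mu (indicator (L i))) n) <= eps/4"
  using eps by(intro ev_abs_le) auto
 with i1[OF i(1)] i2[OF i(2)] i3[OF i(3)]
 show "EVT n. abs(h (wgt mu (indicator (A Un B))) n - h (wgt mu (indicator A)) n - h (wgt mu (indicator B)) n) <= eps"
  by eventually_elim linarith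
qed

end

section \<open>Translation invariance, pullback metrics and metric stability for a fixed
  measure\<close>

lemma C2_embedding_on_shift:
 fixes Phi :: "'k::euclidean_space => 'b::real_normed_vector"
 assumes "C2_embedding_on s Phi" shows "C2_embedding_on s (%x. a + Phi x)"
proof -
 obtain U g where g: "open U" "s <= U" "C2map U g" "!!x. x : s ==> g x = Phi x" "inj_on Phi s"
  "!!p. p : s ==> inj_on (frechet_derivative g (at p)) (span ((%q. q - p) ` s))"
  using assms by(rule C2_embedding_onE) blast
 have tw: "C2map U (%x. a + g x)" by(intro C2map_add C2map_const g(3))
 obtain g' g'' where g': "!!x. x : U ==> (g has_derivative g' x) (at x)"
  "!!h x. x : U ==> ((%y. g' y h) has_derivative g'' h x) (at x)"
  "!!h k. continuous_on U (%x. g'' h x k)" "!!h. continuous_on U (%x. g' x h)" "continuous_on U g"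
  using g(3) by(rule C2mapE) blast
 have "frechet_derivative (%x. a + g x) (at p) = frechet_derivative g (at p)" if "p : s" for p
 proof -
  have "((%x. a + g x) has_derivative (%h. 0 + g' p h)) (at p)"
  using that g(2) by(intro has_derivative_add has_derivative_const g'(1)) auto
  hence "((%x. a + g x) has_derivative g' p) (at p)" by simp
  moreover have "(g has_derivative g' p) (at p)" using that g(2) by(intro g'(1)) auto
  ultimately show ?thesis by(metis frechet_derivative_at)
 qed
 moreover have "inj_on (%x. a + Phi x) s" using g(5) by(auto simp: inj_on_def)
 ultimately show ?thesis unfolding C2_embedding_on_def
  by(intro conjI exI[of _ U] exI[of _ "%x. a + g x"] ballI) (use g C2map_imp_C2_on[OF tw] in auto)
qed

lemma csimplex_translation:
 assumes "csimplex J S" shows "csimplex J ((+) a ` S)"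
proof -
 obtain s Phi where s: "int (card J) simplex s" "s <= plane J" "C2_embedding_on s Phi" "S = Phi ` s"
  using assms by(rule csimplexE)
 have "(+) a ` S = (%x. a + Phi x) ` s" unfolding s(4) by(simp add: image_image)
 thus ?thesis unfolding csimplex_def using s C2_embedding_on_shift[OF s(3)] by blast
qed

lemma csimplex_hausdorff_finite:
 fixes J :: "'n::finite set" and S :: "(real^'n) set"
 assumes "csimplex J S" shows "hausdorff_outer (card J) S < \<infinity>"
proof -
 obtain s Phi where s: "int (card J) simplex s" "s <= plane J" "C2_embedding_on s Phi" "S = Phi ` s"
  using assms by(rule csimplexE)
 obtain C where C: "C > 0" "!!x y. x : s ==> y : s ==> dist (Phi x) (Phi y) <= C*dist x y"
  using C2_embedding_on_lipschitz[OF s(3) compact_simplex[OF s(1)] convex_simplex[OF s(1)]] by blast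
 have "hausdorff_outer (card J) (Phi ` s) <= ennreal (C ^ card J)*hausdorff_outer (card J) s"
  by(rule hausdorff_lipschitz) (use C in auto)
 also have "... < \<infinity>"
  using hausdorff_bounded_finite[OF s(2) compact_imp_bounded[OF compact_simplex[OF s(1)]]]
  by(simp add: ennreal_mult_less_top)
 finally show ?thesis unfolding s(4) .
qed

lemma wgt_distr:
 assumes "sets mu = sets borel" "T : borel \<rightarrow>\<^sub>M borel" "u : borel_measurable borel"
 shows "wgt (distr mu borel T) u = distr (wgt mu (%x. u (T x))) borel T"
 unfolding wgt_def
 by(rule density_distr) (use assms in "auto cong: measurable_cong_sets")

lemma measure_distr_UNIV:
 assumes "sets mu = sets borel" "T : borel \<rightarrow>\<^sub>M borel"
 shows "measure (distr mu borel T) UNIV = measure mu UNIV"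
proof -
 have "T : mu \<rightarrow>\<^sub>M borel" using assms by(simp cong: measurable_cong_sets)
 thus ?thesis using sets_eq_imp_space_eq[OF assms(1)] by(subst measure_distr) auto
qed

lemma measure_wgt_on:
 assumes "sets mu = sets borel" "A : sets borel"
 shows "measure (wgt mu (indicator A)) UNIV = measure mu A"
 using assms by(simp add: measure_def em_wgt_on)

lemma measure_wgt_const:
 assumes "sets mu = sets borel" "0 <= p"
 shows "measure (wgt mu (%_. p)) UNIV = p*measure mu UNIV"
 using assms by(simp add: measure_def em_wgt_const enn2real_mult)

lemma metric_on_pullback:
 assumes "inj_on Phi s" shows "metric_on s (pullback_metric s Phi)"
 unfolding metric_on_def
proof (intro conjI)
 show "Metric_space s (pullback_metric s Phi)"
  by standard (use assms in "auto simp: pullback_metric_def inj_on_def dist_commute intro: dist_triangle")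
qed (auto simp: pullback_metric_def)

text \<open>The factor 2 stems from \<open>1 <= (1 + 2*t)*(1 - t)\<close>, which is where
  \<open>t <= 1/2\<close> is used.\<close>

lemma distortion_pullback:
 assumes t: "0 < t" "t <= 1/2" and Phi: "!!x y. x : s ==> y : s ==> abs(dist (Phi x) (Phi y) - dist x y) <= t*dist x y"
 shows "2*t : distortions s (pullback_metric s Phi) dist"
proof -
 have "inverse (1 + 2*t)*D <= E & E <= (1 + 2*t)*D" if DE: "abs(D - E) <= t*E" "0 <= E" for D E :: real
 proof
  have "D <= (1 + t)*E" "(1 - t)*E <= D" using DE(1) by(auto simp: algebra_simps abs_le_iff)
  have "D <= (1 + 2*t)*E" using \<open>D <= (1 + t)*E\<close> DE t by(simp add: algebra_simps)
  thus "inverse (1 + 2*t)*D <= E" using t by(simp add: field_simps)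
  have "1 <= (1 + 2*t)*(1 - t)" using t by(simp add: algebra_simps)
  hence "1*E <= ((1 + 2*t)*(1 - t))*E" using DE by(intro mult_right_mono) auto
  also have "... = (1 + 2*t)*((1 - t)*E)" by simp
  also have "... <= (1 + 2*t)*D" using t \<open>(1 - t)*E <= D\<close> by(intro mult_left_mono) auto
  finally show "E <= (1 + 2*t)*D" by simp
 qed
 thus ?thesis using t Phi by(auto simp: distortions_def pullback_metric_def)
qed

context poisson_functional
begin

definition ref_value :: real where
 "ref_value = (SOME L. ((%n. h (uniform 1 (cube J 1)) n) \<longlongrightarrow> L) at_top)"

lemma cube_borel: "cube J r : sets borel"
proof -
 have "cube J r = (\<Inter>i\<in>J. {x. 0 <= x $ i} Int {x. x $ i <= r}) Int (\<Inter>i\<in>- J. {x. x $ i = 0})"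
  by(auto simp: cube_def)
 also have "closed ..."
  by(intro closed_Int closed_INT ballI closed_Collect_le closed_Collect_eq continuous_intros)
 finally have "closed (cube J r)" .
 thus ?thesis by simp
qed

lemma reference_limit: "((%n. h (uniform 1 (cube J 1)) n) \<longlongrightarrow> ref_value) at_top"
proof -
 obtain L where L: "!!eps. 0 < eps & eps <= 1 ==> ((%n. 1/n*expected (card J) H n
  (%x. n*(inverse (eps ^ card J)*indicator (cube J eps) x)) dist) \<longlongrightarrow> L) at_top"
  using reference unfolding scale_invariant_reference_def by blast
 have "((%n. 1/n*expected d H n (%x. n*indicator (cube J 1) x) dist) \<longlongrightarrow> L) at_top"
  using L[of 1] card_J by simp
 moreover have "EVT n. 1/n*expected d H n (%x. n*indicator (cube J 1) x) dist = h (uniform 1 (cube J 1)) n"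
  using eventually_ge_at_top[of 0]
  by eventually_elim (subst h_expected, use cube_borel[of 1] in "auto simp: uniform_def")
 ultimately have "((%n. h (uniform 1 (cube J 1)) n) \<longlongrightarrow> L) at_top"
  by(rule Lim_transform_eventually)
 thus ?thesis unfolding ref_value_def by(rule someI)
qed

lemma integrable_functional:
 assumes mu: "SD mu" "emeasure (wgt mu (%_. n)) UNIV ~= 0" and n: "n > 0"
 shows "integrable (poisson_law (wgt mu (%_. n))) (%om. H n (poisson_process om) dist)"
  and "int d simplex s ==> emeasure mu (- s) = 0 ==> comparable_metric_on s dl ==>
  integrable (poisson_law (wgt mu (%_. n))) (%om. H n (poisson_process om) dl)"
proof -
 obtain g where g[measurable]: "g : borel_measurable borel" and g0: "!!x. 0 <= g x" and ge: "mu = density (hausdorff d) (%x. ennreal (g x))"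
  using mu(1) by(rule subdensE) blast
 have fin: "emeasure (wgt mu (%_. n)) UNIV < \<infinity>"
  using SD_emeasure[OF mu(1)] SD_sets[OF mu(1)] by(simp add: em_wgt_const ennreal_mult_less_top)
 have gen: "poisson_law (wgt mu (%_. n)) = poisson_space d f & 0 < mass d f & mass d f < \<infinity>"
  if f: "f : borel_measurable borel" "!!x. 0 <= f x" "wgt mu (%_. n) = density (hausdorff d) (%x. ennreal (f x))" for f
  using mu(2) fin unfolding f(3) by(simp add: poisson_space_eq_law[OF f(1,2)] mass_eq_emeasure[OF f(1)] zero_less_iff_neq_zero)
 have r: "wgt mu (%_. n) = density (hausdorff d) (%x. ennreal (g x*n))"
  unfolding ge using n g0 by(subst wgt_density) auto
 have E: "integrable (poisson_space d f) (%om. H n (poisson_process om) dist) &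
  (ALL sg dl. int d simplex sg & (ALL x. x ~: sg --> f x = 0) & comparable_metric_on sg dl -->
  integrable (poisson_space d f) (%om. H n (poisson_process om) dl))"
  if "f : borel_measurable borel" "ALL x. 0 <= f x" "0 < mass d f" "mass d f < \<infinity>" for f
  using expectations n that unfolding has_expectations_def by blast
 have nn: "0 <= g x*n" for x using g0 n by simp
 show "integrable (poisson_law (wgt mu (%_. n))) (%om. H n (poisson_process om) dist)"
  using gen[of "%x. g x*n"] E[of "%x. g x*n"] r nn by simp
 assume s: "int d simplex s" "emeasure mu (- s) = 0" "comparable_metric_on s dl"
 have sB[measurable]: "s : sets borel" using compact_simplex[OF s(1)] by(simp add: borel_closed compact_imp_closed)
 \<comment> \<open>For a metric on \<open>s\<close> the expectation hypothesis asks for a density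
   that vanishes everywhere off \<open>s\<close>; cutting the density off does not change the
   measure.\<close>
 have "mu = wgt mu (indicator s)"
  by(rule wgt_full[symmetric]) (use s sB SD_sets[OF mu(1)] in auto)
 hence "wgt mu (%_. n) = wgt (wgt mu (indicator s)) (%_. n)" by simp
 also have "... = wgt mu (%x. indicator s x*n)"
  using n SD_sets[OF mu(1)] sB by(subst wgt_wgt) auto
 also have "... = density (hausdorff d) (%x. ennreal (g x*(indicator s x*n)))"
  unfolding ge using n g0 by(subst wgt_density) auto
 finally have r2: "wgt mu (%_. n) = density (hausdorff d) (%x. ennreal (g x*(indicator s x*n)))" .
 have nn: "0 <= g x*(indicator s x*n)" for x using g0 n by simp
 have m: "(%x. g x*(indicator s x*n)) : borel_measurable borel" by measurable
 from E[OF m] gen[OF m nn r2] nn s show "integrable (poisson_law (wgt mu (%_. n))) (%om. H n (poisson_process om) dl)"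
  by(auto simp: indicator_def)
qed

lemma shift_meas: "(+) (a :: real^'n) : borel \<rightarrow>\<^sub>M borel"
 by(intro borel_measurable_continuous_onI continuous_intros)

lemma wgt_const_distr:
 "SD mu ==> T : borel \<rightarrow>\<^sub>M borel ==> wgt (distr mu borel T) (%_. p) = distr (wgt mu (%_. p)) borel T"
 by(subst wgt_distr) (auto simp: SD_sets)

lemma h_translation:
 assumes mu: "SD mu" "SD (distr mu borel ((+) a))" and n: "n > 0"
 shows "h (distr mu borel ((+) a)) n = h mu n"
proof -
 let ?mu = "wgt mu (%_. n)"
 note r = wgt_const_distr[OF mu(1) shift_meas, of a n]
 have fin: "emeasure ?mu UNIV ~= \<infinity>"
  using SD_emeasure[OF mu(1)] SD_sets[OF mu(1)] by(simp add: em_wgt_const ennreal_mult_eq_top_iff)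
 have e: "emeasure (distr ?mu borel ((+) a)) UNIV = emeasure ?mu UNIV"
  using shift_meas[of a] SD_sets[OF mu(1)] SD_space[OF mu(1)]
  by(subst emeasure_distr) (auto cong: measurable_cong_sets)
 have "poisson_mean H n (distr ?mu borel ((+) a)) dist = poisson_mean H n ?mu dist"
 proof (rule poisson_mean_distr[where s = UNIV])
  fix X :: "(real^'n) set" assume X: "finite X"
  have "rotation_matrix (mat 1 :: real^'n^'n)" by(simp add: rotation_matrix_def orthogonal_matrix_id)
  hence "H n ((%y. a + mat 1 *v y) ` X) dist = H n X dist"
  using rigid n X unfolding rigidity_def by blast
  thus "H n X dist = H n ((+) a ` X) dist" by simp
 next
  show "integrable (poisson_law ?mu) (%om. H n (poisson_process om) dist)" if "emeasure ?mu UNIV ~= 0"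
  by(rule integrable_functional(1)[OF mu(1) that n])
  show "integrable (poisson_law (distr ?mu borel ((+) a))) (%om. H n (poisson_process om) dist)" if "emeasure ?mu UNIV ~= 0"
  unfolding r[symmetric] by(rule integrable_functional(1)[OF mu(2) _ n]) (use that e r in simp)
 qed (use fin SD_sets[OF mu(1)] shift_meas in auto)
 thus ?thesis unfolding h_def r by simp
qed

lemma carried_translation:
 assumes mu: "carried S mu" shows "carried ((+) a ` S) (distr mu borel ((+) a))"
proof -
 have S: "csimplex J S" "emeasure mu (- S) = 0" using mu by(auto simp: carried_def)
 have S': "csimplex J ((+) a ` S)" by(rule csimplex_translation[OF S(1)])
 have B: "(+) a ` S : sets borel" by(rule csimplex_borel[OF S'])
 have vim: "(+) a -` (- (+) a ` S) = - S" by auto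
 have "SD (distr mu borel ((+) a))"
  by(rule subdens_distr[OF carr_SD[OF mu] shift_meas carried_borel[OF mu] S(2), where C = 1])
  (use B csimplex_hausdorff_finite[OF S'] card_J in auto)
 moreover have "emeasure (distr mu borel ((+) a)) (- (+) a ` S) = 0"
  using B shift_meas[of a] carried_sets[OF mu] SD_space[OF carr_SD[OF mu]] S(2)
  by(subst emeasure_distr) (auto simp: vim borel_comp cong: measurable_cong_sets)
 ultimately show ?thesis using S' by(simp add: carried_def)
qed

text \<open>Moves the embedding from the point process into the metric: the curved image with the
  Euclidean metric becomes the flat simplex with the pullback metric, and only in this form can
  metric stability see it.\<close>

lemma h_embed:
 assumes s: "int d simplex s" and mu: "SD mu" "emeasure mu (- s) = 0" and Phi: "Phi : borel \<rightarrow>\<^sub>M borel" "C2_embedding_on s Phi"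
  "SD (distr mu borel Phi)" and dist: "distortions s (pullback_metric s Phi) dist ~= {}" and n: "n > 0"
 shows "h (distr mu borel Phi) n = 1/n*poisson_mean H n (wgt mu (%_. n)) (pullback_metric s Phi)"
proof -
 let ?mu = "wgt mu (%_. n)"
 note r = wgt_const_distr[OF mu(1) Phi(1), of n]
 have sB: "s : sets borel" using compact_simplex[OF s] by(simp add: borel_closed compact_imp_closed)
 have fin: "emeasure ?mu UNIV ~= \<infinity>"
  using SD_emeasure[OF mu(1)] SD_sets[OF mu(1)] by(simp add: em_wgt_const ennreal_mult_eq_top_iff)
 have e: "emeasure (distr ?mu borel Phi) UNIV = emeasure ?mu UNIV"
  using Phi(1) SD_sets[OF mu(1)] SD_space[OF mu(1)] by(subst emeasure_distr) (auto cong: measurable_cong_sets)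
 have inj: "inj_on Phi s" using Phi(2) by(rule C2_embedding_onE)
 have cm: "comparable_metric_on s (pullback_metric s Phi)"
  unfolding comparable_metric_on_def using metric_on_pullback[OF inj] dist by blast
 have "emeasure ?mu (- s) = 0" using mu(2) SD_sets[OF mu(1)] sB by(subst em_wgt_const) (auto simp: borel_comp)
 hence ae: "AE x in ?mu. x : s"
  using SD_sets[OF mu(1)] SD_space[OF mu(1)] sB by(intro AE_I[of _ _ "- s"]) (auto simp: borel_comp)
 have "poisson_mean H n (distr ?mu borel Phi) dist = poisson_mean H n ?mu (pullback_metric s Phi)"
 proof (rule poisson_mean_distr[where s = s])
  show "H n X (pullback_metric s Phi) = H n (Phi ` X) dist" if "finite X" "X <= s" for X
  using compatible n that s Phi(2) unfolding metric_compatible_def by blast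
  show "integrable (poisson_law ?mu) (%om. H n (poisson_process om) (pullback_metric s Phi))" if "emeasure ?mu UNIV ~= 0"
  by(rule integrable_functional(2)[OF mu(1) that n s mu(2) cm])
  show "integrable (poisson_law (distr ?mu borel Phi)) (%om. H n (poisson_process om) dist)" if "emeasure ?mu UNIV ~= 0"
  unfolding r[symmetric] by(rule integrable_functional(1)[OF Phi(3) _ n]) (use that e r in simp)
 qed (use fin SD_sets[OF mu(1)] Phi(1) sB ae in auto)
 thus ?thesis unfolding h_def r by simp
qed

text \<open>The bound on the error of an infimum distortion 0 is not controlled by metric stability;
 then the embedding is isometric and nothing has to be shown.\<close>

lemma stability_prob:
 assumes s: "int d simplex s" "s <= V" and q: "SD q" "emeasure q UNIV = 1" "emeasure q (- s) = 0" and eps: "eps > 0"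
 obtains t where "0 < t" "!!Phi. Phi : borel \<rightarrow>\<^sub>M borel ==> C2_embedding_on s Phi ==> SD (distr q borel Phi) ==>
  (!!x y. x : s ==> y : s ==> abs(dist (Phi x) (Phi y) - dist x y) <= t*dist x y) ==>
  EVT n. abs(h (distr q borel Phi) n - h q n) <= eps"
proof -
 have sB[measurable]: "s : sets borel" using compact_simplex[OF s(1)] by(simp add: borel_closed compact_imp_closed)
 obtain g where g[measurable]: "g : borel_measurable borel" and g0: "!!x. 0 <= g x" and ge: "q = density (hausdorff d) (%x. ennreal (g x))"
  using q(1) by(rule subdensE) blast
 define f where "f x = g x*indicator s x" for x
 have f[measurable]: "f : borel_measurable borel" unfolding f_def by measurable
 have f0: "0 <= f x" for x using g0 by(simp add: f_def)
 have "wgt q (indicator s) = density (hausdorff d) (%x. ennreal (f x))"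
  unfolding ge f_def by(rule wgt_density) (use g0 in auto)
 hence fe: "q = density (hausdorff d) (%x. ennreal (f x))"
  using wgt_full[OF SD_sets[OF q(1)] sB q(3)] by simp
 have "prob_density_on d s f"
  using prob_density_on_iff[OF f f0] q(2) fe by(auto simp: prob_density_on_def f_def)
 then obtain E where E: "(E \<longlongrightarrow> 0) (at_right 0)" "!!dl. comparable_metric_on s dl ==> Limsup at_top (%n::real. ereal (1/n *
  abs(expected d H n (%x. n*f x) dl - expected d H n (%x. n*f x) dist)))
  <= ereal (E (Inf (distortions s dl dist)))"
  using stable s(1) unfolding metric_stability_def by blast
 have "\<forall>\<^sub>F u in at_right 0. dist (E u) 0 < eps" using E(1) eps by(rule tendstoD)
 then obtain eta where eta: "0 < eta" "!!u. 0 < u ==> u < eta ==> abs(E u) < eps"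
  unfolding eventually_at_right_field by auto
 \<comment> \<open>A map that changes distances by a factor between \<open>1 - t\<close> and
   \<open>1 + t\<close> has distortion at most \<open>2*t\<close>, which has to stay below
   \<open>eta\<close>.\<close>
 define t where "t = min (1/2) (eta/3)"
 have t: "0 < t" "t <= 1/2" "2*t < eta" using eta(1) by(auto simp: t_def min_def)
 show ?thesis
 proof (rule that[OF t(1)])
  fix Phi :: "real^'n => real^'n"
  assume Phi: "Phi : borel \<rightarrow>\<^sub>M borel" "C2_embedding_on s Phi" "SD (distr q borel Phi)"
  and flat: "!!x y. x : s ==> y : s ==> abs(dist (Phi x) (Phi y) - dist x y) <= t*dist x y"
  let ?dl = "pullback_metric s Phi"
  have mem: "2*t : distortions s ?dl dist" by(rule distortion_pullback[OF t(1,2) flat])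
  hence ne: "distortions s ?dl dist ~= {}" by blast
  have bdd: "bdd_below (distortions s ?dl dist)" by(rule bdd_belowI[of _ 0]) (auto simp: distortions_def)
  define I where "I = Inf (distortions s ?dl dist)"
  have I: "0 <= I" "I <= 2*t"
  unfolding I_def using ne mem bdd by(auto intro!: cInf_greatest cInf_lower simp: distortions_def)
  have inj: "inj_on Phi s" using Phi(2) by(rule C2_embedding_onE)
  have cm: "comparable_metric_on s ?dl"
  unfolding comparable_metric_on_def using metric_on_pullback[OF inj] ne by blast
  show "EVT n. abs(h (distr q borel Phi) n - h q n) <= eps"
  proof (cases "I = 0")
  case True
  have iso: "dist (Phi x) (Phi y) = dist x y" if xy: "x : s" "y : s" for x y
  proof -
  have b: "dist (Phi x) (Phi y) <= (1 + e)*dist x y & dist x y <= (1 + e)*dist (Phi x) (Phi y)" if e: "e > 0" for e :: real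
  proof -
  have "EX u:distortions s ?dl dist. u < e"
  using cInf_less_iff[OF ne bdd, of e] True e by(simp add: I_def)
  then obtain u where u: "0 < u" "u < e" "inverse (1 + u)*dist (Phi x) (Phi y) <= dist x y" "dist x y <= (1 + u)*dist (Phi x) (Phi y)"
  using xy by(auto simp: distortions_def pullback_metric_def)
  have "dist (Phi x) (Phi y) <= (1 + u)*dist x y" using u by(simp add: field_simps)
  also have "... <= (1 + e)*dist x y" using u by(intro mult_right_mono) auto
  finally have 1: "dist (Phi x) (Phi y) <= (1 + e)*dist x y" .
  have "(1 + u)*dist (Phi x) (Phi y) <= (1 + e)*dist (Phi x) (Phi y)" using u by(intro mult_right_mono) auto
  thus ?thesis using 1 u(4) by linarith
  qed
  have lim: "A <= B" if "!!e. e > 0 ==> A <= (1 + e)*B" for A B :: real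
  proof (rule tendsto_lowerbound[of "%e. (1 + e)*B" "B" "at_right 0"])
  have "((%e. (1 + e)*B) \<longlongrightarrow> (1 + 0)*B) (at_right 0)" by(intro tendsto_intros)
  thus "((%e. (1 + e)*B) \<longlongrightarrow> B) (at_right 0)" by simp
  show "\<forall>\<^sub>F e in at_right 0. A <= (1 + e)*B" using that by(auto simp: eventually_at_right_field intro: exI[of _ 1])
  qed auto
  show ?thesis
  proof (rule antisym)
  show "dist (Phi x) (Phi y) <= dist x y" by(rule lim) (rule conjunct1[OF b])
  show "dist x y <= dist (Phi x) (Phi y)" by(rule lim) (rule conjunct2[OF b])
  qed
  qed
  have "C2_embedding_on s (%x. 0 + id x)"
  by(rule C2_embedding_on_affine[where V = UNIV]) (auto simp: linear_id linear_ident)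
  hence idC: "C2_embedding_on s (%x. x)" by simp
  \<comment> \<open>\<open>dist\<close> is not this metric, as it does not vanish off
    \<open>s\<close>. Hence the detour: the identity has the same pullback metric as the isometric
    \<open>Phi\<close>, so \<open>h_embed\<close> gives both the same value.\<close>
  have pe: "pullback_metric s (%x. x) = ?dl"
  by(auto simp: pullback_metric_def fun_eq_iff iso)
  have dq: "distr q borel (%x. x) = q" using SD_sets[OF q(1)] by(intro distr_id2) simp
  have "h (distr q borel Phi) n = h q n" if n: "n > 0" for n
  proof -
  have "(%x::real^'n. x) : borel \<rightarrow>\<^sub>M borel" by simp
  moreover have "SD (distr q borel (%x. x))" unfolding dq by(rule q(1))
  moreover have "distortions s (pullback_metric s (%x. x)) dist ~= {}" unfolding pe by(rule ne)
  ultimately have "h (distr q borel (%x. x)) n = 1/n*poisson_mean H n (wgt q (%_. n)) (pullback_metric s (%x. x))"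
  by(intro h_embed[OF s(1) q(1,3) _ idC _ _ n])
  thus ?thesis unfolding dq pe h_embed[OF s(1) q(1,3) Phi ne n] by(rule sym)
  qed
  thus ?thesis using eps by(auto intro!: eventually_mono[OF eventually_gt_at_top[of 0]])
  next
  case False
  have "abs(E I) < eps" using False I t by(intro eta(2)) auto
  hence "ereal (E I) < ereal eps" by auto
  with E(2)[OF cm] have "Limsup at_top (%n::real. ereal (1/n *
  abs(expected d H n (%x. n*f x) ?dl - expected d H n (%x. n*f x) dist))) < ereal eps"
  unfolding I_def by(rule le_less_trans)
  from Limsup_lessD[OF this]
  show ?thesis using eventually_gt_at_top[of 0]
  proof eventually_elim
  case (elim n)
  have nf: "(%x. n*f x) : borel_measurable borel" "!!x. 0 <= n*f x" using elim f0 by auto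
  have r: "wgt q (%_. n) = density (hausdorff d) (%x. ennreal (n*f x))"
  unfolding fe using elim f0 by(subst wgt_density) (auto simp: mult.commute)
  have 1: "h (distr q borel Phi) n = 1/n*expected d H n (%x. n*f x) ?dl"
  using h_embed[OF s(1) q(1,3) Phi ne] elim r expected_eq_poisson_mean[OF nf] by simp
  have 2: "h q n = 1/n*expected d H n (%x. n*f x) dist"
  unfolding h_def r expected_eq_poisson_mean[OF nf] ..
  have "h (distr q borel Phi) n - h q n = 1/n*(expected d H n (%x. n*f x) ?dl - expected d H n (%x. n*f x) dist)"
  unfolding 1 2 by(simp only: right_diff_distrib)
  hence "abs(h (distr q borel Phi) n - h q n) = 1/n*abs(expected d H n (%x. n*f x) ?dl - expected d H n (%x. n*f x) dist)"
  using elim by(simp only: abs_mult) simp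
  thus ?case using elim by simp
  qed
  qed
 qed
qed

text \<open>The limit per unit of mass. The quotient makes the argument independent of the value of
  the Hausdorff measure of the unit cube.\<close>

definition H0 :: real where "H0 = ref_value/enn2real (hausdorff_outer d (cube J 1))"

text \<open>The upper limit of the deviation of \<open>h mu n\<close> from its expected limit is at
  most \<open>e\<close>; for \<open>e = 0\<close> this is convergence. Such bounds add over disjoint
  pieces and scale with the mass, which makes them the bookkeeping device for everything that
  follows.\<close>

definition bd :: "(real^'n) measure => real => bool" where
 "bd mu e \<longleftrightarrow> (ALL eps>0. EVT n. abs(h mu n - H0*measure mu UNIV) <= e + eps)"

lemma bd_mono: "bd mu e ==> e <= e' ==> bd mu e'"
 unfolding bd_def by(fastforce elim!: eventually_mono)

lemma bd_closed: assumes "!!eps. eps > 0 ==> bd mu (e + eps)" shows "bd mu e"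
 unfolding bd_def
proof (intro allI impI)
 fix eps :: real assume "eps > 0"
 hence "EVT n. abs(h mu n - H0*measure mu UNIV) <= e + eps/2 + eps/2"
  using assms[of "eps/2"] unfolding bd_def by(auto dest!: spec[of _ "eps/2"])
 thus "EVT n. abs(h mu n - H0*measure mu UNIV) <= e + eps" by(simp only: add.assoc field_sum_of_halves)
qed

lemma bd_0_iff: "bd mu 0 \<longleftrightarrow> (h mu \<longlongrightarrow> H0*measure mu UNIV) at_top"
proof
 assume "bd mu 0"
 thus "(h mu \<longlongrightarrow> H0*measure mu UNIV) at_top"
  by(intro LIM_zero_cancel[of "h mu"] tendsto_0I) (auto simp: bd_def)
next
 assume "(h mu \<longlongrightarrow> H0*measure mu UNIV) at_top"
 hence "((%n. h mu n - H0*measure mu UNIV) \<longlongrightarrow> 0) at_top" by(rule LIM_zero)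
 thus "bd mu 0" unfolding bd_def using ev_abs_le by auto
qed

lemma bd_null: "SD mu ==> emeasure mu UNIV = 0 ==> bd mu 0"
 unfolding bd_0_iff using h_null[of mu] by(simp add: measure_def)

lemma bd_near:
 assumes "bd mu e" "EVT n. abs(h nu n - h mu n) <= eps" "measure nu UNIV = measure mu UNIV"
 shows "bd nu (e + eps)"
 unfolding bd_def
proof (intro allI impI)
 fix eps' :: real assume "eps' > 0"
 hence "EVT n. abs(h mu n - H0*measure mu UNIV) <= e + eps'" using assms(1) by(auto simp: bd_def)
 with assms(2) show "EVT n. abs(h nu n - H0*measure nu UNIV) <= e + eps + eps'"
  by eventually_elim (use assms(3) in auto)
qed

lemma bd_translation:
 assumes "SD mu" "SD (distr mu borel ((+) a))" shows "bd (distr mu borel ((+) a)) e \<longleftrightarrow> bd mu e"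
proof -
 have "(EVT n. abs(h (distr mu borel ((+) a)) n - M) <= c) \<longleftrightarrow> (EVT n. abs(h mu n - M) <= c)" for M c
  by(rule eventually_cong[OF eventually_gt_at_top[of 0]]) (simp add: h_translation[OF assms])
 thus ?thesis unfolding bd_def
  by(simp add: measure_distr_UNIV[OF SD_sets[OF assms(1)] shift_meas])
qed

end

section \<open>Calculus of asymptotic errors\<close>

context positive_dimension
begin

text \<open>Asymptotic additivity and additivity of the mass determine any one of the three
  deviations from the other two.\<close>

lemma
 assumes mu: "carried S mu" and AB: "A : sets borel" "B : sets borel" "A Int B = {}" and bB: "bd (wgt mu (indicator B)) b"
 shows bd_Un: "bd (wgt mu (indicator A)) a ==> bd (wgt mu (indicator (A Un B))) (a + b)"
  and bd_Diff: "bd (wgt mu (indicator (A Un B))) a ==> bd (wgt mu (indicator A)) (a + b)"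
proof -
 let ?h = "%A n. h (wgt mu (indicator A)) n" and ?m = "%A. measure (wgt mu (indicator A)) UNIV"
 have m: "?m (A Un B) = ?m A + ?m B"
  using AB carried_sets[OF mu] SD_emeasure[OF carr_SD[OF mu]]
  by(simp add: measure_wgt_on) (subst measure_Un3, auto simp: fmeasurable_def)
 have e1: "EVT n. abs(?h (A Un B) n - ?h A n - ?h B n) <= eps/3" if "eps > 0" for eps
  using h_Borel_additive[OF mu AB] that by(intro ev_abs_le) auto
 have e2: "EVT n. abs(?h X n - H0*?m X) <= c + eps/3" if "eps > 0" "bd (wgt mu (indicator X)) c" for eps X c
  using that unfolding bd_def by auto
 show "bd (wgt mu (indicator (A Un B))) (a + b)" if a: "bd (wgt mu (indicator A)) a"
  unfolding bd_def
 proof (intro allI impI)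
  fix eps :: real assume e: "eps > 0"
  show "EVT n. abs(?h (A Un B) n - H0*?m (A Un B)) <= a + b + eps"
  using e1[OF e] e2[OF e a] e2[OF e bB] unfolding m distrib_left by eventually_elim linarith
 qed
 show "bd (wgt mu (indicator A)) (a + b)" if a: "bd (wgt mu (indicator (A Un B))) a"
  unfolding bd_def
 proof (intro allI impI)
  fix eps :: real assume e: "eps > 0"
  show "EVT n. abs(?h A n - H0*?m A) <= a + b + eps"
  using e1[OF e] e2[OF e a] e2[OF e bB] unfolding m distrib_left by eventually_elim linarith
 qed
qed

lemma SD_restrict_empty: "SD mu ==> bd (wgt mu (indicator {})) 0"
 by(rule bd_null[OF SD_restrict]) (auto simp: em_wgt_on SD_sets)

lemma bd_UN:
 assumes mu: "carried S mu" and "finite I" "!!i. i : I ==> A i : sets borel" "disjoint_family_on A I"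
  and "!!i. i : I ==> bd (wgt mu (indicator (A i))) (e i)"
 shows "bd (wgt mu (indicator (UN i:I. A i))) (SUM i:I. e i)"
 using assms(2-)
proof (induction I)
 case empty
 thus ?case using SD_restrict_empty[OF carr_SD[OF mu]] by(simp only: UN_empty sum.empty)
next
 case (insert i I)
 have "A i Int (UN j:I. A j) = {}" using insert(2,5) by(auto simp: disjoint_family_on_def)
 moreover have "bd (wgt mu (indicator (UN j:I. A j))) (SUM j:I. e j)"
  using insert by(intro insert.IH) (auto simp: disjoint_family_on_def)
 ultimately have "bd (wgt mu (indicator (A i Un (UN j:I. A j)))) (e i + (SUM j:I. e j))"
  by(intro bd_Un[OF mu]) (use insert in auto)
 thus ?case using insert(1,2) by simp
qed

lemma bd_scale:
 assumes mu: "carried S mu" and p: "0 < p" "SD (wgt mu (%_. p))" and b: "bd mu e"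
 shows "bd (wgt mu (%_. p)) (p*e)"
 unfolding bd_def
proof (intro allI impI)
 fix eps :: real assume e: "eps > 0"
 have "EVT n. abs(h (wgt mu (%_. p)) n - p*h mu (p*n)) <= eps/2"
  using h_scale[OF mu p] e by(intro ev_abs_le) auto
 moreover have "EVT n. abs(h mu (p*n) - H0*measure mu UNIV) <= e + eps/(2*p)"
  using b e p by(intro eventually_rescale[OF p(1)]) (auto simp: bd_def)
 ultimately show "EVT n. abs(h (wgt mu (%_. p)) n - H0*measure (wgt mu (%_. p)) UNIV) <= p*e + eps"
 proof eventually_elim
  case (elim n)
  have "abs(p*(h mu (p*n) - H0*measure mu UNIV)) <= p*(e + eps/(2*p))"
  unfolding abs_mult using elim(2) p(1) by simp
  also have "... = p*e + eps/2" using p(1) by(simp add: field_simps)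
  finally have "abs(p*h mu (p*n) - H0*(p*measure mu UNIV)) <= p*e + eps/2" by(simp add: algebra_simps)
  from add_mono[OF elim(1) this]
  have "abs(h (wgt mu (%_. p)) n - p*h mu (p*n)) + abs(p*h mu (p*n) - H0*(p*measure mu UNIV)) <= p*e + eps" by simp
  moreover have "abs(x - z) <= abs(x - y) + abs(y - z)" for x y z :: real by linarith
  ultimately have "abs(h (wgt mu (%_. p)) n - H0*(p*measure mu UNIV)) <= p*e + eps"
  by(rule order_trans[rotated])
  moreover have "measure (wgt mu (%_. p)) UNIV = p*measure mu UNIV"
  using p(1) by(simp add: measure_wgt_const carried_sets[OF mu])
  ultimately show ?case by(simp only:)
 qed
qed

lemma bd_scale_iff:
 assumes mu: "carried S mu" and p: "0 < p" "SD (wgt mu (%_. p))"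
 shows "bd (wgt mu (%_. p)) (p*e) \<longleftrightarrow> bd mu e"
proof
 assume b: "bd (wgt mu (%_. p)) (p*e)"
 have "wgt (wgt mu (%_. p)) (%_. 1/p) = mu"
  using p carried_sets[OF mu] by(simp add: wgt_wgt wgt_1)
 thus "bd mu e" using bd_scale[OF carried_scale[OF mu p(2)], of "1/p" "p*e"] b p carr_SD[OF mu] by simp
qed (rule bd_scale[OF assms])

text \<open>Along \<open>v i\<close> the masses converge by dominated convergence and the values by
  continuity, so a common bound on the deviations survives.\<close>

lemma bd_limit:
 assumes mu: "carried S mu" and v: "!!i. v i : borel_measurable borel" "!!i x. 0 <= v i x"
  "!!i x. v i x <= 1" "!!i j x. i <= j ==> v i x <= v j x" and lim: "AE x in mu. (%i. v i x) \<longlonglongrightarrow> 1"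
  and b: "!!i. bd (wgt mu (v i)) e"
 shows "bd mu e"
proof (rule bd_closed)
 fix eps :: real assume e: "eps > 0"
 note s = carried_sets[OF mu]
 have vm: "v i : borel_measurable mu" for i by(rule borel_measurable_cong_sets[OF s v(1)])
 have "(%i. \<integral>\<^sup>+x. ennreal (v i x) \<partial>mu) \<longlonglongrightarrow> (\<integral>\<^sup>+x. ennreal 1 \<partial>mu)"
 proof (rule nn_integral_dominated_convergence[where w = "%_. 1"])
  show "AE x in mu. (%i. ennreal (v i x)) \<longlonglongrightarrow> ennreal 1"
  using lim by(rule eventually_mono) (rule tendsto_ennrealI)
  show "(\<integral>\<^sup>+x. 1 \<partial>mu) < \<infinity>" using SD_emeasure[OF carr_SD[OF mu]] by simp
 qed (use vm v(3) in "auto simp: ennreal_le_1")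
 hence "(%i. emeasure (wgt mu (v i)) UNIV) \<longlonglongrightarrow> emeasure mu UNIV"
  using v(1) s SD_space[OF carr_SD[OF mu]] by(simp add: em_wgt)
 hence "(%i. measure (wgt mu (v i)) UNIV) \<longlonglongrightarrow> measure mu UNIV"
  unfolding measure_def using SD_emeasure[OF carr_SD[OF mu]] by(intro tendsto_enn2real) auto
 hence "(%i. H0*measure (wgt mu (v i)) UNIV - H0*measure mu UNIV) \<longlonglongrightarrow> H0*measure mu UNIV - H0*measure mu UNIV"
  by(intro tendsto_intros)
 hence "\<forall>\<^sub>F i in sequentially. abs(H0*measure (wgt mu (v i)) UNIV - H0*measure mu UNIV) <= eps/2"
  using e by(intro ev_abs_le) auto
 then obtain i1 where i1: "!!i. i >= i1 ==> abs(H0*measure (wgt mu (v i)) UNIV - H0*measure mu UNIV) <= eps/2"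
  unfolding eventually_sequentially by blast
 have "EX i0. ALL i>=i0. EVT n. abs(h (wgt mu (v i)) n - h mu n) <= eps/2"
  by(rule h_continuous[where v = v, OF mu]) (use v lim e in simp_all)
 then obtain i0 where i0: "!!i. i >= i0 ==> EVT n. abs(h (wgt mu (v i)) n - h mu n) <= eps/2"
  by blast
 define i where "i = max i0 i1"
 have i: "abs(H0*measure (wgt mu (v i)) UNIV - H0*measure mu UNIV) <= eps/2"
  "EVT n. abs(h (wgt mu (v i)) n - h mu n) <= eps/2"
  using i0[of i] i1[of i] by(simp_all add: i_def)
 show "bd mu (e + eps)" unfolding bd_def
 proof (intro allI impI)
  fix eps' :: real assume "eps' > 0"
  hence "EVT n. abs(h (wgt mu (v i)) n - H0*measure (wgt mu (v i)) UNIV) <= e + eps'"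
  using b[of i] by(auto simp: bd_def)
  with i(2) show "EVT n. abs(h mu n - H0*measure mu UNIV) <= e + eps + eps'"
  by eventually_elim (use i(1) in linarith)
 qed
qed

end

section \<open>Half-open cubes and the grids formed by them\<close>

definition hcube :: "'n set => real^'n => real => (real^'n) set" where
 "hcube J a r = {y. (ALL i:J. a $ i <= y $ i & y $ i < a $ i + r) & (ALL i. i ~: J --> y $ i = 0)}"

text \<open>The cell around \<open>z\<close> of the grid of mesh \<open>1/N\<close>. With integer
  parts, disjointness of distinct cells and dyadic refinement are immediate.\<close>

definition gcell :: "'n set => nat => real^'n => (real^'n) set" where
 "gcell J N z = {y. (ALL i:J. \<lfloor>real N*y $ i\<rfloor> = \<lfloor>real N*z $ i\<rfloor>) & (ALL i. i ~: J --> y $ i = 0)}"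

definition grid_corner :: "'n set => nat => real^'n => real^'n" where
 "grid_corner J N z = (\<chi> i. if i : J then real_of_int \<lfloor>real N*z $ i\<rfloor> / real N else 0)"

lemma grid_corner_in: "grid_corner J N z : plane J"
 by(auto simp: grid_corner_def plane_def)

lemma gcell_eq:
 assumes "N > 0" shows "gcell J N z = hcube J (grid_corner J N z) (1/real N)"
proof -
 have "(\<lfloor>real N*y\<rfloor> = k) \<longleftrightarrow> real_of_int k/real N <= y & y < real_of_int k/real N + 1/real N" for y k
  using assms by(simp add: floor_eq_iff field_simps)
 thus ?thesis by(auto simp: gcell_def hcube_def grid_corner_def)
qed

lemma hcube_diameter:
 fixes a :: "real^'n::finite"
 assumes "x : hcube J a r" "y : hcube J a r" "0 <= r"
 shows "dist x y <= real CARD('n)*r"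
proof -
 have "abs((x - y) $ i) <= r" for i
 proof (cases "i : J")
  case True
  hence "a $ i <= x $ i" "x $ i < a $ i + r" "a $ i <= y $ i" "y $ i < a $ i + r"
  using assms by(auto simp: hcube_def)
  thus ?thesis by(simp add: abs_le_iff)
 qed (use assms in "auto simp: hcube_def")
 hence "(SUM i:UNIV. abs((x - y) $ i)) <= (SUM i:(UNIV :: 'n set). r)" by(intro sum_mono)
 moreover have "norm (x - y) <= (SUM i:UNIV. abs((x - y) $ i))" by(rule norm_le_l1_cart)
 ultimately show ?thesis by(simp add: dist_norm)
qed

lemma hcube_bounded: "bounded (hcube J (a :: real^'n::finite) r)"
proof (rule bounded_subset[OF bounded_cbox])
 show "hcube J a r <= cbox (\<chi> i. if i : J then a $ i else 0) (\<chi> i. if i : J then a $ i + r else 0)"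
  by(auto simp: hcube_def mem_box_cart less_imp_le)
qed

lemma hcube_subset: "hcube J a r <= plane J"
 by(auto simp: hcube_def plane_def)

lemma coord_measurable: "(%y :: real^'n::finite. y $ i) : borel_measurable borel"
 by(intro borel_measurable_continuous_onI continuous_intros)

lemma hcb: "hcube J (a :: real^'n::finite) r : sets borel"
proof -
 note coord_measurable[measurable]
 have "hcube J a r = {y : space borel. (ALL i:J. a $ i <= y $ i & y $ i < a $ i + r) & (ALL i:- J. y $ i = 0)}"
  by(auto simp: hcube_def)
 also have "... : sets borel" by measurable
 finally show ?thesis .
qed

lemma gcell_borel: "N > 0 ==> gcell J N (z :: real^'n::finite) : sets borel"
 by(simp add: gcell_eq hcb)

lemma gcell_self: "z : plane J ==> z : gcell J N z"
 by(auto simp: gcell_def plane_def)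

lemma gcell_eqI: "y : gcell J N z ==> gcell J N y = gcell J N z"
 by(auto simp: gcell_def)

lemma floor_div_two_power:
 assumes "\<lfloor>real (2 ^ Suc j)*x\<rfloor> = \<lfloor>real (2 ^ Suc j)*y\<rfloor>" shows "\<lfloor>real (2 ^ j)*x\<rfloor> = \<lfloor>real (2 ^ j)*y\<rfloor>"
proof -
 have "\<lfloor>real (2 ^ j)*x\<rfloor> = \<lfloor>real (2 ^ Suc j)*x\<rfloor> div 2" for x :: real
  using floor_divide_real_eq_div[of 2 "real (2 ^ Suc j)*x"] by simp
 thus ?thesis using assms by simp
qed

lemma gcell_refine: "gcell J (2 ^ Suc j) z <= gcell J (2 ^ j) z"
 unfolding gcell_def by(auto dest!: floor_div_two_power simp del: of_nat_power power_Suc)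

lemma gcells_finite:
 fixes B :: "(real^'n::finite) set"
 assumes "bounded B" shows "finite (gcell J N ` B)"
proof -
 obtain M where M: "!!y. y : B ==> norm y <= M" using assms unfolding bounded_iff by blast
 let ?I = "{- \<lceil>real N*abs(M)\<rceil> - 1 .. \<lceil>real N*abs(M)\<rceil> + 1}"
 have "gcell J N ` B <= (%k. {y. (ALL i:J. \<lfloor>real N*y $ i\<rfloor> = k i) & (ALL i. i ~: J --> y $ i = 0)}) ` (PiE UNIV (%_. ?I))"
 proof
  fix c assume "c : gcell J N ` B"
  then obtain y where y: "y : B" "c = gcell J N y" by blast
  have "\<lfloor>real N*y $ i\<rfloor> : ?I" for i
  proof -
  have "abs(y $ i) <= abs(M)" using M[OF y(1)] component_le_norm_cart[of y i] by linarith
  hence "abs(real N*y $ i) <= real N*abs(M)" by(simp add: abs_mult mult_left_mono)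
  thus ?thesis by(simp only: atLeastAtMost_iff) linarith
  qed
  thus "c : (%k. {y. (ALL i:J. \<lfloor>real N*y $ i\<rfloor> = k i) & (ALL i. i ~: J --> y $ i = 0)}) ` (PiE UNIV (%_. ?I))"
  unfolding y(2) gcell_def by(intro image_eqI[of _ _ "%i. \<lfloor>real N*y $ i\<rfloor>"]) auto
 qed
 thus ?thesis by(rule finite_subset) (intro finite_imageI finite_PiE, auto)
qed

text \<open>The box has integer corners, so a cell of any grid of mesh \<open>1/N\<close> that meets
  it is contained in it.\<close>

lemma hcube_int_grid:
 assumes B: "B = hcube J (\<chi> i. if i : J then - real R else 0) (2*real R)" and N: "N > 0" and z: "z : B"
 shows "gcell J N z <= B"
proof
 fix y assume y: "y : gcell J N z"
 have "- real R <= y $ i & y $ i < - real R + 2*real R" if i: "i : J" for i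
 proof -
  have fl: "\<lfloor>real N*y $ i\<rfloor> = \<lfloor>real N*z $ i\<rfloor>" using y i by(simp add: gcell_def)
  have z': "- real R <= z $ i" "z $ i < real R" using z i by(auto simp: B hcube_def)
  have "real N*(- real R) <= real N*z $ i" using z' by(intro mult_left_mono) auto
  hence 1: "- (int N*int R) <= \<lfloor>real N*z $ i\<rfloor>" by(simp add: le_floor_iff)
  have "real N*z $ i < real N*real R" using z' N by(intro mult_strict_left_mono) auto
  hence 2: "\<lfloor>real N*z $ i\<rfloor> < int N*int R" by(simp add: floor_less_iff)
  have "real N*(- real R) <= real N*y $ i" using 1 unfolding fl[symmetric] by(simp add: le_floor_iff)
  moreover have "real N*y $ i < real N*real R" using 2 unfolding fl[symmetric] by(simp add: floor_less_iff)
  ultimately have "- real R <= y $ i" "y $ i < real R"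
  using mult_le_cancel_left_pos[of "real N" "- real R" "y $ i"] mult_less_cancel_left_pos[of "real N" "y $ i" "real R"] N by auto
  thus ?thesis by simp
 qed
 thus "y : B" using y by(auto simp: B hcube_def gcell_def)
qed

lemma simplex_curved:
 fixes J :: "'n::finite set"
 assumes "int (card J) simplex s" "s <= plane J" shows "csimplex J s"
proof -
 have "C2_embedding_on s (%x. 0 + (%x. x) x)"
  by(rule C2_embedding_on_affine[where V = UNIV]) (auto simp: linear_id linear_ident)
 thus ?thesis unfolding csimplex_def using assms by(intro exI[of _ s] exI[of _ "%x. x"]) auto
qed

section \<open>Uniform measures on cubes\<close>

context poisson_functional
begin

lemma uniform_cong_null:
 assumes "A : sets borel" "B : sets borel" "A <= B" "hausdorff_outer d (B - A) = 0" "0 <= kap"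
 shows "uniform kap B = uniform kap A"
proof (rule measure_eqI)
 show "sets (uniform kap B) = sets (uniform kap A)" by(simp add: uniform_def)
 fix C assume "C : sets (uniform kap B)"
 hence C: "C : sets borel" by(simp add: uniform_def)
 have "hausdorff_outer d (B Int C) <= hausdorff_outer d (A Int C Un (B - A))" by(rule hausdorff_outer_mono) auto
 also have "... <= hausdorff_outer d (A Int C)" using hausdorff_outer_Un[of d "A Int C" "B - A"] assms(4) by simp
 finally have "hausdorff_outer d (B Int C) <= hausdorff_outer d (A Int C)" .
 moreover have "hausdorff_outer d (A Int C) <= hausdorff_outer d (B Int C)"
  using assms(3) by(intro hausdorff_outer_mono) auto
 ultimately have "hausdorff_outer d (B Int C) = hausdorff_outer d (A Int C)" by(rule antisym)
 thus "emeasure (uniform kap B) C = emeasure (uniform kap A) C" using assms C by(simp add: emeasure_uniform)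
qed

lemma translation_borel: "A : sets borel ==> (+) (a :: real^'n) ` A : sets borel"
proof -
 assume A: "A : sets borel"
 have "(+) a ` A = (+) (- a) -` A Int space borel" by(auto simp: image_iff) (metis add.commute diff_add_cancel uminus_add_conv_diff)
 thus ?thesis using measurable_sets[OF shift_meas A] by simp
qed

lemma uniform_translation:
 assumes A: "A : sets borel" and k: "0 <= kap"
 shows "distr (uniform kap A) borel ((+) a) = uniform kap ((+) a ` A)"
proof (rule measure_eqI)
 fix C assume "C : sets (distr (uniform kap A) borel ((+) a))"
 hence C: "C : sets borel" by simp
 have vB: "(+) a -` C : sets borel" using measurable_sets[OF shift_meas C, of a] by simp
 have e: "(+) a ` A Int C = (+) a ` (A Int (+) a -` C)" by auto
 have m: "(+) a : uniform kap A \<rightarrow>\<^sub>M borel" "space (uniform kap A) = UNIV"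
  using shift_meas[of a] by(simp_all add: uniform_def cong: measurable_cong_sets)
 have "emeasure (distr (uniform kap A) borel ((+) a)) C = emeasure (uniform kap A) ((+) a -` C)"
  using m C by(subst emeasure_distr) auto
 also have "... = ennreal kap*hausdorff_outer d (A Int (+) a -` C)" by(rule emeasure_uniform[OF A vB k])
 also have "... = ennreal kap*hausdorff_outer d ((+) a ` A Int C)" unfolding e hausdorff_translation ..
 also have "... = emeasure (uniform kap ((+) a ` A)) C" by(rule emeasure_uniform[OF translation_borel[OF A] C k, symmetric])
 finally show "emeasure (distr (uniform kap A) borel ((+) a)) C = emeasure (uniform kap ((+) a ` A)) C" .
qed (simp add: uniform_def)

lemma slice_null:
 assumes "i : J" "bounded A" "A <= V Int {y. y $ i = c}"
 shows "hausdorff_outer d A = 0"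
proof -
 have e: "{y :: real^'n. y $ i = c} = {y. axis i 1 \<bullet> y = c}" by(simp add: inner_axis')
 have "axis i (c + 1) : V" using assms(1) by(auto simp: plane_def axis_def)
 moreover have "axis i (c + 1) ~: {y. axis i 1 \<bullet> y = c}" by(simp add: inner_axis')
 ultimately have "~ V <= {y. axis i 1 \<bullet> y = c}" by(metis subsetD)
 moreover have "aff_dim V = int (card J)" by(simp add: aff_dim_subspace subspace_plane dim_plane)
 ultimately have "aff_dim (V Int {y. axis i 1 \<bullet> y = c}) < int (card J)"
  using aff_dim_affine_Int_hyperplane[OF subspace_imp_affine[OF subspace_plane], of J "axis i 1" c] by auto
 hence "aff_dim A < int (card J)"
  using aff_dim_subset[of A "V Int {y. y $ i = c}"] assms(3) unfolding e by linarith
 moreover have "A <= V" using assms(3) by blast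
 ultimately show ?thesis using hausdorff_lowdim_0[OF _ assms(2), of J] card_J by simp
qed

definition cvol :: real where "cvol = enn2real (hausdorff_outer d (cube J 1))"

lemma cvol: "0 < cvol" "hausdorff_outer d (cube J 1) = ennreal cvol"
proof -
 have f: "hausdorff_outer d (cube J 1) < \<infinity>"
  using cube_bounded by(intro hausdorff_outer_finite) (auto intro: bounded_subset[OF bounded_cball])
 thus "hausdorff_outer d (cube J 1) = ennreal cvol" by(simp add: cvol_def less_top)
 show "0 < cvol" unfolding cvol_def using f nontrivial by(simp add: enn2real_positive_iff)
qed

lemma ref_value_eq: "ref_value = H0*cvol"
 using cvol(1) unfolding H0_def cvol_def[symmetric] by simp

text \<open>The closed counterpart of \<open>hcube\<close>: cube additivity and the reference limit
  speak of closed cubes, the grid of half-open ones, and they differ by null sets.\<close>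

definition solid :: "real^'n => real => (real^'n) set" where
 "solid a r = {y. (ALL i:J. a $ i <= y $ i & y $ i <= a $ i + r) & (ALL i. i ~: J --> y $ i = 0)}"

lemma solid_eq: assumes "a : V" "0 < r" shows "solid a r = (+) a ` ((*\<^sub>R) r ` cube J 1)"
proof
 show "solid a r <= (+) a ` ((*\<^sub>R) r ` cube J 1)"
 proof
  fix y assume y: "y : solid a r"
  have "(1/r) *\<^sub>R (y - a) : cube J 1"
  using y assms by(auto simp: solid_def cube_def plane_def field_simps)
  moreover have "y = a + r *\<^sub>R ((1/r) *\<^sub>R (y - a))" using assms by simp
  ultimately show "y : (+) a ` ((*\<^sub>R) r ` cube J 1)" by blast
 qed
 show "(+) a ` ((*\<^sub>R) r ` cube J 1) <= solid a r"
  using assms by(auto simp: solid_def cube_def plane_def mult_left_le)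
qed

lemma solid_borel: assumes "a : V" "0 < r" shows "solid a r : sets borel"
proof -
 have "compact (cube J 1)"
 proof -
  have "closed (cube J 1)" unfolding cube_def Ball_def
  by(intro closed_Collect_conj closed_Collect_all closed_Collect_imp closed_Collect_le closed_Collect_eq open_Collect_const continuous_intros)
  moreover have "bounded (cube J 1)" using cube_bounded by(auto intro: bounded_subset[OF bounded_cball])
  ultimately show ?thesis by(simp add: compact_eq_bounded_closed)
 qed
 hence "compact (solid a r)" unfolding solid_eq[OF assms]
  by(intro compact_translation compact_scaling)
 thus ?thesis by(intro borel_closed compact_imp_closed)
qed

lemma hausdorff_solid: "a : V ==> 0 < r ==> hausdorff_outer d (solid a r) = ennreal (r ^ d*cvol)"
 using cvol by(simp add: solid_eq hausdorff_translation hausdorff_scaleR ennreal_mult)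

lemma solid_minus_hcube_null:
 assumes "a : V" "0 < r" shows "hausdorff_outer d (solid a r - hcube J a r) = 0"
proof -
 have "solid a r - hcube J a r <= (UN i:J. solid a r Int {y. y $ i = a $ i + r})"
  by(auto simp: solid_def hcube_def less_le)
 moreover have "hausdorff_outer d (UN i:J. solid a r Int {y. y $ i = a $ i + r}) = 0"
 proof (rule hausdorff_UN_null)
  fix i assume "i : J"
  thus "hausdorff_outer d (solid a r Int {y. y $ i = a $ i + r}) = 0"
  proof (rule slice_null)
  have "solid a r <= hcube J a (2*r)" using assms by(auto simp: solid_def hcube_def)
  thus "bounded (solid a r Int {y. y $ i = a $ i + r})"
  using bounded_subset[OF hcube_bounded] by blast
  qed (auto simp: solid_def plane_def)
 qed simp
 ultimately show ?thesis by(rule hausdorff_null_subset)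
qed

lemma hcube_subset_solid: "hcube J a r <= solid a r" by(auto simp: hcube_def solid_def)

lemma hausdorff_hcube:
 assumes "a : V" "0 < r" shows "hausdorff_outer d (hcube J a r) = ennreal (r ^ d*cvol)"
proof (rule antisym)
 show "hausdorff_outer d (hcube J a r) <= ennreal (r ^ d*cvol)"
  using hausdorff_outer_mono[OF hcube_subset_solid] hausdorff_solid[OF assms] by metis
 have "solid a r = hcube J a r Un (solid a r - hcube J a r)" using hcube_subset_solid by blast
 hence "hausdorff_outer d (solid a r) <= hausdorff_outer d (hcube J a r) + hausdorff_outer d (solid a r - hcube J a r)"
  using hausdorff_outer_Un by metis
 thus "ennreal (r ^ d*cvol) <= hausdorff_outer d (hcube J a r)"
  using hausdorff_solid[OF assms] solid_minus_hcube_null[OF assms] by simp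
qed

lemma uniform_solid: "a : V ==> 0 < r ==> 0 <= kap ==> uniform kap (solid a r) = uniform kap (hcube J a r)"
 by(intro uniform_cong_null hcb solid_borel hcube_subset_solid solid_minus_hcube_null)

lemma solid_translation: "a : V ==> 0 < r ==> (+) a ` solid 0 r = solid a r"
 by(subst (1 2) solid_eq) (auto simp: plane_def)

lemma SD_uniform_hcube:
 assumes "a : V" "0 < r" "0 <= kap" "kap*(r ^ d*cvol) <= 1"
 shows "SD (uniform kap (hcube J a r))" "measure (uniform kap (hcube J a r)) UNIV = kap*(r ^ d*cvol)"
proof -
 have e: "ennreal kap*hausdorff_outer d (hcube J a r) = ennreal (kap*(r ^ d*cvol))"
  using assms cvol(1) by(simp add: hausdorff_hcube ennreal_mult)
 thus "SD (uniform kap (hcube J a r))" using assms by(intro SD_uniform hcb) (auto simp: ennreal_le_1)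
 show "measure (uniform kap (hcube J a r)) UNIV = kap*(r ^ d*cvol)"
  unfolding measure_def using e assms cvol(1) by(simp add: emeasure_uniform hcb)
qed

text \<open>Cube additivity with equal weights splits the unit cube into \<open>m ^ d\<close>
  translates of one small cube, whose limit is thus \<open>ref_value/real m ^ d\<close>. The
  condition on \<open>cvol\<close> gives the small cube mass at most 1; the unit cube enters through
  its limit only.\<close>

lemma bd_small_cube:
 assumes m: "m > 0" "cvol/real m ^ d <= 1" and a: "a : V"
 shows "bd (uniform 1 (hcube J a (1/real m))) 0"
proof -
 let ?r = "1/real m" and ?P = "PiE J (%_. {..<m})"
 have r: "0 < ?r" "1*(?r ^ d*cvol) <= 1" using m by(auto simp: power_one_over field_simps)
 have V0: "0 : V" by(simp add: plane_def)
 have SDc: "SD (uniform 1 (solid b ?r))" if "b : V" for b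
  using SD_uniform_hcube(1)[OF that r(1) _ r(2)] that r(1) by(simp add: uniform_solid)
 have tr: "distr (uniform 1 (solid 0 ?r)) borel ((+) b) = uniform 1 (solid b ?r)" if "b : V" for b
  using uniform_translation[OF solid_borel[OF V0 r(1)], of 1 b] solid_translation[OF that r(1)] by simp
 have he: "h (uniform 1 (solid b ?r)) n = h (uniform 1 (solid 0 ?r)) n" if "b : V" "n > 0" for b n
  using h_translation[OF SDc[OF V0], of b n] SDc[OF that(1)] tr[OF that(1)] that(2) by simp
 define b where "b k = (\<chi> i. if i : J then real (k i)/real m else 0)" for k :: "'n => nat"
 have bV: "b k : V" for k by(simp add: b_def plane_def)
 have sub: "subcube J m k = solid (b k) ?r" for k
  using m by(auto simp: subcube_def solid_def b_def add_divide_distrib)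
 have "card ?P = m ^ d" using card_J by(simp add: card_funcsetE)
 hence P: "real (card ?P) = real m ^ d" by simp
 let ?c = "%_::'n => nat. 1/real m ^ d"
 have "(ALL k:?P. 0 <= ?c k) & (SUM k:?P. ?c k) = 1" using m P by simp
 hence A: "((%n. 1/n *
  \<bar>expected (card J) H n (%x. n*indicator (cube J 1) x) dist -
  (SUM k:?P. expected (card J) H n
  (%x. n*(?c k*real m ^ card J*indicator (subcube J m k) x)) dist)\<bar>) \<longlongrightarrow> 0) at_top"
  using additive_cubes m(1) unfolding cube_additivity_def Let_def by(auto dest!: spec[of _ m] spec[of _ ?c])
 have "EVT n. 1/n *
  \<bar>expected (card J) H n (%x. n*indicator (cube J 1) x) dist -
  (SUM k:?P. expected (card J) H n
  (%x. n*(?c k*real m ^ card J*indicator (subcube J m k) x)) dist)\<bar> =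
  abs(h (uniform 1 (cube J 1)) n - real m ^ d*h (uniform 1 (solid 0 ?r)) n)"
  using eventually_gt_at_top[of 0]
 proof eventually_elim
  case (elim n)
  have c: "?c k*real m ^ card J = 1" for k using m card_J by simp
  have 1: "1/n*expected d H n (%x. n*indicator (cube J 1) x) dist = h (uniform 1 (cube J 1)) n"
  using elim cube_borel[of 1] by(subst h_expected) (auto simp: uniform_def)
  have 2: "1/n*expected d H n (%x. n*indicator (subcube J m k) x) dist = h (uniform 1 (solid 0 ?r)) n" for k
  using elim solid_borel[OF bV r(1)] he[OF bV elim] unfolding sub
  by(subst h_expected) (auto simp: uniform_def)
  let ?E = "expected d H n (%x. n*indicator (cube J 1) x) dist" and ?F = "%k. expected d H n (%x. n*indicator (subcube J m k) x) dist"
  have "1/n*abs(?E - (SUM k:?P. ?F k)) = abs(1/n*(?E - (SUM k:?P. ?F k)))" using elim by(simp add: abs_mult)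
  also have "1/n*(?E - (SUM k:?P. ?F k)) = 1/n*?E - (SUM k:?P. 1/n*?F k)"
  by(simp only: right_diff_distrib sum_distrib_left)
  also have "... = h (uniform 1 (cube J 1)) n - real m ^ d*h (uniform 1 (solid 0 ?r)) n"
  unfolding 1 2 sum_constant P ..
  finally show ?case unfolding card_J c[unfolded card_J] mult_1_left .
 qed
 from Lim_transform_eventually[OF A this]
 have "((%n. h (uniform 1 (cube J 1)) n - real m ^ d*h (uniform 1 (solid 0 ?r)) n) \<longlongrightarrow> 0) at_top"
  by(rule tendsto_rabs_zero_cancel)
 hence "((%n. (h (uniform 1 (cube J 1)) n - (h (uniform 1 (cube J 1)) n - real m ^ d*h (uniform 1 (solid 0 ?r)) n))/real m ^ d) \<longlongrightarrow> (ref_value - 0)/real m ^ d) at_top"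
  using m by(intro tendsto_divide tendsto_diff tendsto_const reference_limit) auto
 hence lim: "((%n. h (uniform 1 (solid 0 ?r)) n) \<longlongrightarrow> ref_value/real m ^ d) at_top"
  using m by simp
 have "measure (uniform 1 (solid 0 ?r)) UNIV = cvol/real m ^ d"
  using SD_uniform_hcube(2)[OF V0 r(1) _ r(2)] uniform_solid[OF V0 r(1), of 1] by(simp add: power_one_over)
 hence "bd (uniform 1 (solid 0 ?r)) 0" unfolding bd_0_iff using lim ref_value_eq by simp
 moreover have "SD (distr (uniform 1 (solid 0 ?r)) borel ((+) a))" unfolding tr[OF a] by(rule SDc[OF a])
 ultimately have "bd (distr (uniform 1 (solid 0 ?r)) borel ((+) a)) 0"
  using bd_translation[OF SDc[OF V0], of a 0] by blast
 thus ?thesis unfolding tr[OF a] uniform_solid[OF a r(1) zero_le_one] .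
qed

end

section \<open>From grid cells to open sets, Borel sets and densities\<close>

context positive_dimension
begin

text \<open>By additivity the value on the complement of \<open>C i\<close> is close to the
  difference between the values of \<open>nu\<close> and of its restriction to \<open>C i\<close>,
  which continuity makes small. The second summand is the deviation due to the mass of the
  complement.\<close>

lemma bd_residual:
 assumes nu: "carried S nu" and C: "!!i. C i : sets borel" "incseq C" "emeasure nu (- (\<Union>i. C i)) = 0" and dl: "dl > 0"
 shows "EX i0. ALL i>=i0. bd (wgt nu (indicator (- C i))) (dl + abs(H0)*measure nu (- C i))"
proof -
 obtain i0 where i0: "!!i. i >= i0 ==> EVT n. abs(h (wgt nu (indicator (C i))) n - h nu n) <= dl"
  using h_continuous_sets[OF nu C dl] by blast
 have "bd (wgt nu (indicator (- C i))) (dl + abs(H0)*measure nu (- C i))" if i: "i >= i0" for i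
  unfolding bd_def
 proof (intro allI impI)
  fix eps :: real assume e: "eps > 0"
  have CB: "- C i : sets borel" using C(1)[of i] by(simp only: borel_comp)
  have full: "wgt nu (indicator (C i Un - C i)) = nu"
  by(rule wgt_full) (use carried_sets[OF nu] in auto)
  have "EVT n. abs(h (wgt nu (indicator (C i Un - C i))) n - h (wgt nu (indicator (C i))) n - h (wgt nu (indicator (- C i))) n) <= eps"
  by(intro ev_abs_le h_Borel_additive[OF nu C(1) CB] e) auto
  thus "EVT n. abs(h (wgt nu (indicator (- C i))) n - H0*measure (wgt nu (indicator (- C i))) UNIV) <= dl + abs(H0)*measure nu (- C i) + eps"
  using i0[OF i]
  proof eventually_elim
  case (elim n)
  have "abs(H0*measure nu (- C i)) = abs(H0)*measure nu (- C i)" by(simp add: abs_mult)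
  thus ?case using elim unfolding full measure_wgt_on[OF carried_sets[OF nu] CB] by linarith
  qed
 qed
 thus ?thesis by blast
qed

text \<open>An open set is, inside the box, the increasing union over the levels of the grid cells
  contained in it. A relative error \<open>eps\<close> on cells is inherited by finite disjoint
  unions and by limits. The map \<open>T\<close> is the inverse of a parametrisation, or the
  identity in the flat case.\<close>

lemma bd_preimages_open:
 assumes nu: "carried S nu" and T: "T : borel \<rightarrow>\<^sub>M borel"
  and B: "B = hcube J (\<chi> i. if i : J then - real R else 0) (2*real R)" "emeasure nu (- (T -` B)) = 0"
  and cells: "!!j z. j >= j0 ==> z : B ==> bd (wgt nu (indicator (T -` gcell J (2 ^ j) z))) (eps*measure nu (T -` gcell J (2 ^ j) z))"
  and eps: "0 <= eps" and G: "open G"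
 shows "bd (wgt nu (indicator (T -` G))) (eps*measure nu (T -` G))"
proof -
 have TB: "T -` A : sets borel" if "A : sets borel" for A using measurable_sets[OF T that] by simp
 have fin: "finite_measure nu" by(rule subdens_finite[OF carr_SD[OF nu]])
 note s = carried_sets[OF nu]
 have BV: "B <= V" unfolding B(1) by(rule hcube_subset)
 have bB: "bounded B" unfolding B(1) by(rule hcube_bounded)
 define \<C> where "\<C> j = {c. EX z:B. c = gcell J (2 ^ j) z & c <= G}" for j
 define E where "E j = \<Union>(\<C> j)" for j
 have fC: "finite (\<C> j)" for j
  by(rule finite_subset[OF _ gcells_finite[OF bB, of J "2 ^ j"]]) (auto simp: \<C>_def)
 have cB: "c : sets borel" if "c : \<C> j" for c j
  using that gcell_borel[of "2 ^ j" J] by(auto simp: \<C>_def)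
 have EB: "E j : sets borel" for j unfolding E_def using fC cB by(intro sets.finite_Union) auto
 have disj: "disjoint_family_on (%c. T -` c) (\<C> j)" for j
  unfolding disjoint_family_on_def
 proof (intro ballI impI)
  fix c c' assume c: "c : \<C> j" "c' : \<C> j" "c ~= c'"
  have "c Int c' = {}"
  proof (rule ccontr)
  assume "c Int c' ~= {}"
  then obtain y where "y : c" "y : c'" by blast
  hence "gcell J (2 ^ j) y = c" "gcell J (2 ^ j) y = c'" using c by(auto simp: \<C>_def dest: gcell_eqI)
  thus False using c(3) by simp
  qed
  thus "T -` c Int T -` c' = {}" by auto
 qed
 have EG: "E j <= G" for j by(auto simp: E_def \<C>_def)
 have vE: "T -` E j = (UN c:\<C> j. T -` c)" for j by(auto simp: E_def)
 have Ebd: "bd (wgt nu (indicator (T -` E j))) (eps*measure nu (T -` G))" if "j >= j0" for j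
 proof -
  have "bd (wgt nu (indicator (T -` E j))) (SUM c:\<C> j. eps*measure nu (T -` c))"
  unfolding vE
  proof (rule bd_UN[OF nu fC _ disj])
  show "T -` c : sets borel" if "c : \<C> j" for c using cB[OF that] by(rule TB)
  show "bd (wgt nu (indicator (T -` c))) (eps*measure nu (T -` c))" if "c : \<C> j" for c
  using that cells[OF \<open>j >= j0\<close>] by(auto simp: \<C>_def)
  qed
  moreover have "(SUM c:\<C> j. eps*measure nu (T -` c)) <= eps*measure nu (T -` G)"
  proof -
  have "(SUM c:\<C> j. measure nu (T -` c)) = measure nu (T -` E j)"
  unfolding vE by(intro finite_measure.finite_measure_finite_Union[OF fin, symmetric] fC disj) (use cB TB s in auto)
  also have "... <= measure nu (T -` G)"
  using EG TB[OF borel_open[OF G]] s by(intro finite_measure.finite_measure_mono[OF fin]) auto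
  finally show ?thesis using eps by(simp add: sum_distrib_left[symmetric] mult_left_mono)
  qed
  ultimately show ?thesis by(rule bd_mono)
 qed
 have inc: "E j <= E (Suc j)" for j
 proof
  fix y assume "y : E j"
  then obtain z where z: "z : B" "y : gcell J (2 ^ j) z" "gcell J (2 ^ j) z <= G" by(auto simp: E_def \<C>_def)
  have yB: "y : B" using hcube_int_grid[OF B(1) _ z(1), of "2 ^ j"] z(2) by auto
  have "gcell J (2 ^ Suc j) y <= gcell J (2 ^ j) z" using gcell_refine[of J j y] gcell_eqI[OF z(2)] by simp
  thus "y : E (Suc j)" using z(3) yB BV gcell_self[of y J "2 ^ Suc j"] unfolding E_def \<C>_def by blast
 qed
 have cov: "B Int G <= (\<Union>j. E (j + j0))"
 proof
  fix y assume y: "y : B Int G"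
  then obtain e where e: "e > 0" "ball y e <= G" using G by(auto simp: open_contains_ball)
  obtain j where j: "real CARD('n)/e < 2 ^ j" using real_arch_pow[of 2] by auto
  have "real CARD('n)*(1/real (2 ^ (j + j0))) < e"
  proof -
  have "(2::real) ^ j <= 2 ^ (j + j0)" by(intro power_increasing) auto
  hence "real CARD('n)/e < 2 ^ (j + j0)" using j by linarith
  thus ?thesis using e(1) by(simp add: field_simps)
  qed
  hence "gcell J (2 ^ (j + j0)) y <= ball y e"
  using hcube_diameter[of y J "grid_corner J (2 ^ (j + j0)) y" "1/real (2 ^ (j + j0))"] gcell_self[of y J "2 ^ (j + j0)"] y BV
  by(fastforce simp: gcell_eq dest: hcube_diameter)
  hence "y : E (j + j0)" using y e(2) BV gcell_self[of y J "2 ^ (j + j0)"] unfolding E_def \<C>_def by blast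
  thus "y : (\<Union>j. E (j + j0))" by blast
 qed
 let ?rho = "wgt nu (indicator (T -` G))"
 have rho: "carried S ?rho" by(rule carried_restrict[OF nu TB[OF borel_open[OF G]]])
 show ?thesis
 proof (rule bd_limit[where v = "%j. indicator (T -` E (j + j0))", OF rho])
  show "(indicator (T -` E (j + j0)) :: _ => real) : borel_measurable borel" for j using TB[OF EB] by simp
  have mono: "E (i + j0) <= E (j + j0)" if "i <= j" for i j
  using lift_Suc_mono_le[of E "i + j0" "j + j0"] inc that by auto
  show "indicator (T -` E (i + j0)) x <= (indicator (T -` E (j + j0)) x :: real)" if "i <= j" for i j x
  using mono[OF that] by(auto simp: indicator_def)
  show "AE x in ?rho. (%j. indicator (T -` E (j + j0)) x :: real) \<longlonglongrightarrow> 1"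
  proof (rule AE_indicator_limit)
  show "incseq (%j. T -` E (j + j0))" using mono by(auto simp: incseq_def)
  have UB: "(\<Union>j. T -` E (j + j0)) : sets borel" using TB[OF EB] by auto
  have "emeasure ?rho (- (\<Union>j. T -` E (j + j0))) = emeasure nu (T -` G Int - (\<Union>j. T -` E (j + j0)))"
  using TB[OF borel_open[OF G]] UB by(intro em_wgt_on s) (simp_all only: borel_comp)
  also have "... <= emeasure nu (- (T -` B))"
  proof (rule emeasure_mono)
  show "T -` G Int - (\<Union>j. T -` E (j + j0)) <= - (T -` B)" using cov by auto
  have "T -` B : sets borel" by(rule TB) (simp add: B(1) hcb)
  thus "- (T -` B) : sets nu" unfolding s by(simp only: borel_comp)
  qed
  finally show "emeasure ?rho (- (\<Union>j. T -` E (j + j0))) = 0" using B(2) by simp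
  qed (use s TB[OF EB] in auto)
  show "bd (wgt ?rho (indicator (T -` E (j + j0)))) (eps*measure nu (T -` G))" for j
  proof -
  have "T -` G Int T -` E (j + j0) = T -` E (j + j0)" using EG[of "j + j0"] by auto
  thus ?thesis using Ebd[of "j + j0"] by(simp add: wgt_wgt_on s TB[OF borel_open[OF G]] TB[OF EB])
  qed
 qed (auto simp: indicator_def)
qed

text \<open>Outer regularity encloses \<open>A\<close> in an open set with small excess. No bound on
  the excess in terms of its mass is available here, so it is controlled through continuity by
  \<open>bd_residual\<close> and removed by \<open>bd_Diff\<close>.\<close>

lemma bd_preimages_Borel:
 assumes nu: "carried S nu" and T: "T : borel \<rightarrow>\<^sub>M (borel :: (real^'n) measure)"
  and op: "!!G. open G ==> bd (wgt nu (indicator (T -` G))) (eps*measure nu (T -` G))"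
  and eps: "0 <= eps" and A: "A : sets borel"
 shows "bd (wgt nu (indicator (T -` A))) (eps*measure nu (T -` A))"
proof (rule bd_closed)
 fix e :: real assume e: "e > 0"
 have TB: "T -` A : sets borel" if "A : sets borel" for A using measurable_sets[OF T that] by simp
 interpret nu: finite_measure nu by(rule subdens_finite[OF carr_SD[OF nu]])
 note s = carried_sets[OF nu]
 have Tm: "T : nu \<rightarrow>\<^sub>M borel" using T s by(simp cong: measurable_cong_sets)
 have sp: "space nu = UNIV" by(rule SD_space[OF carr_SD[OF nu]])
 have dm: "measure (distr nu borel T) C = measure nu (T -` C)" if "C : sets borel" for C
  using that Tm sp by(simp add: measure_distr)
 interpret D: finite_measure "distr nu borel T" by(rule nu.finite_measure_distr[OF Tm])
 have "EX U. open U & A <= U & measure nu (T -` (U - A)) <= 1/real (Suc i)" for i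
 proof -
  have "emeasure (distr nu borel T) A = (INF U\<in>{U. A <= U & open U}. emeasure (distr nu borel T) U)"
  by(rule outer_regular) (use A D.emeasure_finite in auto)
  moreover have "emeasure (distr nu borel T) A < emeasure (distr nu borel T) A + ennreal (1/real (Suc i))"
  by(simp add: D.emeasure_eq_measure flip: ennreal_plus) (auto simp: ennreal_less_iff)
  ultimately have "(INF U\<in>{U. A <= U & open U}. emeasure (distr nu borel T) U) < emeasure (distr nu borel T) A + ennreal (1/real (Suc i))"
  by simp
  then obtain U where U: "A <= U" "open U" "emeasure (distr nu borel T) U < emeasure (distr nu borel T) A + ennreal (1/real (Suc i))"
  unfolding INF_less_iff by blast
  have "ennreal (measure (distr nu borel T) U) < ennreal (measure (distr nu borel T) A + 1/real (Suc i))"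
  using U(3) unfolding D.emeasure_eq_measure by(subst ennreal_plus) auto
  from iffD1[OF ennreal_less_iff[OF measure_nonneg] this]
  have "measure (distr nu borel T) U < measure (distr nu borel T) A + 1/real (Suc i)" .
  moreover have "measure (distr nu borel T) (U - A) = measure (distr nu borel T) U - measure (distr nu borel T) A"
  using U A by(intro D.finite_measure_Diff) auto
  ultimately have "measure nu (T -` (U - A)) <= 1/real (Suc i)" using U A by(subst dm[symmetric]) auto
  thus ?thesis using U by blast
 qed
 hence "ALL i. EX U. open U & A <= U & measure nu (T -` (U - A)) <= 1/real (Suc i)" by blast
 from choice[OF this] obtain U where U: "!!i. open (U i)" "!!i. A <= U i" "!!i. measure nu (T -` (U i - A)) <= 1/real (Suc i)" by blast
 \<comment> \<open>Finite intersections make the open sets decrease, so that the sets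
   \<open>C i\<close> increase to a set of full measure, as continuity requires.\<close>
 define W where "W i = (\<Inter>k\<le>i. U k)" for i
 have W: "open (W i)" "A <= W i" "W i <= U i" for i unfolding W_def using U by(auto intro!: open_INT)
 define C where "C i = T -` (- (W i - A))" for i
 have WA: "W i - A : sets borel" for i using W(1) A by auto
 have CB: "C i : sets borel" for i unfolding C_def by(rule TB) (use WA in "simp only: borel_comp")
 have mC: "measure nu (- C i) <= 1/real (Suc i)" for i
 proof -
  have "measure nu (- C i) <= measure nu (T -` (U i - A))"
  using W(3)[of i] TB[of "U i - A"] U(1)[of i] A s by(intro nu.finite_measure_mono) (auto simp: C_def)
  thus ?thesis using U(3)[of i] by linarith
 qed
 have inc: "incseq C" unfolding incseq_def C_def W_def by auto
 have "measure nu (- (\<Union>i. C i)) <= 1/real (Suc i)" for i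
 proof -
  have "- C i : sets nu" using CB[of i] s by(simp only: borel_comp)
  hence "measure nu (- (\<Union>i. C i)) <= measure nu (- C i)" by(intro nu.finite_measure_mono) auto
  thus ?thesis using mC[of i] by linarith
 qed
 hence "measure nu (- (\<Union>i. C i)) <= 0"
  by(intro LIMSEQ_le_const[OF LIMSEQ_inverse_real_of_nat]) (auto simp: inverse_eq_divide)
 hence "emeasure nu (- (\<Union>i. C i)) = 0" by(simp add: nu.emeasure_eq_measure measure_le_0_iff)
 then obtain i0 where i0: "!!i. i >= i0 ==> bd (wgt nu (indicator (- C i))) (e/2 + abs(H0)*measure nu (- C i))"
  using bd_residual[OF nu CB inc, of "e/2"] e by auto
 obtain k where k: "(eps + abs(H0))/(e/2) < real k" using reals_Archimedean2 by blast
 define i where "i = max i0 k"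
 have "(eps + abs(H0))/(e/2) <= real (Suc i)" using k by(simp add: i_def)
 hence small: "(eps + abs(H0))*(1/real (Suc i)) <= e/2" using e by(simp add: field_simps)
 have eq: "T -` A Un - C i = T -` (W i)" "T -` A Int - C i = {}" using W(2)[of i] by(auto simp: C_def)
 have CB': "- C i : sets borel" using CB[of i] by(simp only: borel_comp)
 have "bd (wgt nu (indicator (T -` A))) (eps*measure nu (T -` W i) + (e/2 + abs(H0)*measure nu (- C i)))"
 proof (rule bd_Diff[OF nu TB[OF A] CB' eq(2)])
  show "bd (wgt nu (indicator (T -` A Un - C i))) (eps*measure nu (T -` W i))"
  unfolding eq(1) by(rule op[OF W(1)])
  show "bd (wgt nu (indicator (- C i))) (e/2 + abs(H0)*measure nu (- C i))"
  by(rule i0) (simp add: i_def)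
 qed
 moreover have "eps*measure nu (T -` W i) + (e/2 + abs(H0)*measure nu (- C i)) <= eps*measure nu (T -` A) + e"
 proof -
  have "measure nu (T -` W i) = measure nu (T -` A) + measure nu (- C i)"
  unfolding eq(1)[symmetric] using TB[OF A] CB' s eq(2) by(intro nu.finite_measure_Union) auto
  hence 1: "eps*measure nu (T -` W i) = eps*measure nu (T -` A) + eps*measure nu (- C i)"
  by(simp only: distrib_left)
  have "(eps + abs(H0))*measure nu (- C i) <= (eps + abs(H0))*(1/real (Suc i))"
  using eps mC[of i] by(intro mult_left_mono) auto
  hence "(eps + abs(H0))*measure nu (- C i) <= e/2" using small by(rule order_trans)
  hence 2: "eps*measure nu (- C i) + abs(H0)*measure nu (- C i) <= e/2" by(simp only: distrib_right)
  show ?thesis using 1 2 by linarith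
 qed
 ultimately show "bd (wgt nu (indicator (T -` A))) (eps*measure nu (T -` A) + e)" by(rule bd_mono)
qed

text \<open>Simple functions approximate the density from below. Where a simple function is constant
  the measure is a multiple of a restriction of \<open>nu\<close>, and scaling applies.\<close>

lemma bd_preimages_density:
 assumes nu: "carried S nu" and T: "T : borel \<rightarrow>\<^sub>M (borel :: (real^'n) measure)"
  and Bor: "!!A. A : sets borel ==> bd (wgt nu (indicator (T -` A))) (eps*measure nu (T -` A))"
  and eps: "0 <= eps" and u: "u : borel_measurable borel" "!!x. 0 <= u x" "SD (wgt nu (%x. u (T x)))"
 shows "bd (wgt nu (%x. u (T x))) (eps*measure (wgt nu (%x. u (T x))) UNIV)"
proof -
 have TB: "T -` A : sets borel" if "A : sets borel" for A using measurable_sets[OF T that] by simp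
 note s = carried_sets[OF nu]
 let ?rho = "wgt nu (%x. u (T x))"
 have uT: "(%x. u (T x)) : borel_measurable borel" using measurable_compose[OF T u(1)] by simp
 have rho: "carried S ?rho" by(rule carried_wgt[OF nu u(3) uT])
 have "EX f. incseq f & (ALL i. simple_function borel (f i)) & (ALL x. bdd_above (range (%i. f i x))) &
  (ALL i x. 0 <= f i x) & u = (SUP i. f i)"
  by(rule borel_measurable_implies_simple_function_sequence_real) (use u in auto)
 then obtain f where f: "incseq f" "!!i. simple_function borel (f i)" "!!x. bdd_above (range (%i. f i x))"
  "!!i x. 0 <= f i x" "u = (SUP i. f i)" by blast
 have ux: "u x = (SUP i. f i x)" for x unfolding f(5) by(simp add: Sup_fun_def image_image)
 have fle: "f i x <= u x" for i x unfolding ux by(intro cSUP_upper f(3)) simp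
 have fmono: "f i x <= f j x" if "i <= j" for i j x using f(1) that by(auto simp: incseq_def le_fun_def)
 have flim: "(%i. f i x) \<longlonglongrightarrow> u x" for x unfolding ux
  by(rule LIMSEQ_incseq_SUP[OF f(3)]) (use fmono in "auto simp: incseq_def")
 have fm: "f i : borel_measurable borel" for i by(rule borel_measurable_simple_function[OF f(2)])
 have fT: "(%x. f i (T x)) : borel_measurable borel" for i using measurable_compose[OF T fm] by simp
 \<comment> \<open>Continuity is stated for weights in the unit interval increasing to 1, so each
   approximation is written relative to the limit. Where \<open>u\<close> vanishes the quotient is
   0, but that set is null for \<open>?rho\<close>.\<close>
 define v where "v i x = f i (T x)/u (T x)" for i x
 have vm: "v i : borel_measurable borel" for i unfolding v_def using fT uT by measurable
 have v0: "0 <= v i x" for i x using f(4) u(2) by(simp add: v_def)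
 have v1: "v i x <= 1" for i x using fle[of i "T x"] u(2)[of "T x"] by(cases "u (T x) = 0") (auto simp: v_def)
 have rv: "wgt ?rho (v i) = wgt nu (%x. f i (T x))" for i
 proof -
  have "u (T x) * v i x = f i (T x)" for x using fle[of i "T x"] f(4)[of i "T x"] by(cases "u (T x) = 0") (auto simp: v_def)
  thus ?thesis using s uT vm u(2) v0 by(subst wgt_wgt) auto
 qed
 have mrho: "emeasure ?rho {x : space ?rho. u (T x) = 0} = 0"
 proof -
  have Z: "{x : space ?rho. u (T x) = 0} : sets borel"
  using uT SD_space[OF u(3)] by simp
  show ?thesis using Z by(subst em_wgt[OF s uT]) (auto intro!: nn_integral_zero' AE_I2 simp: indicator_def)
 qed
 show ?thesis
 proof (rule bd_limit[where v = v, OF rho vm v0 v1])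
  show "v i x <= v j x" if "i <= j" for i j x using fmono[OF that] u(2) by(simp add: v_def divide_right_mono)
  have "AE x in ?rho. u (T x) ~= 0"
  by(rule AE_I[OF _ mrho]) (use uT SD_space[OF u(3)] s in auto)
  thus "AE x in ?rho. (%i. v i x) \<longlonglongrightarrow> 1"
  proof (rule eventually_mono)
  fix x assume "u (T x) ~= 0"
  hence "(%i. v i x) \<longlonglongrightarrow> u (T x)/u (T x)" unfolding v_def by(intro tendsto_divide tendsto_const flim) auto
  thus "(%i. v i x) \<longlonglongrightarrow> 1" using \<open>u (T x) ~= 0\<close> by simp
  qed
  fix i
  let ?rhoi = "wgt nu (%x. f i (T x))"
  have SDi: "SD ?rhoi" unfolding rv[symmetric] by(rule SD_wgt[OF carr_SD[OF rho] vm v0 v1])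
  have ci: "carried S ?rhoi" by(rule carried_wgt[OF nu SDi fT])
  define A where "A c = T -` {y. f i y = c}" for c
  have fB: "{y. f i y = c} : sets borel" for c using fm[of i] by simp
  have AB: "A c : sets borel" for c unfolding A_def by(rule TB[OF fB])
  have fr: "finite (range (f i))" using simple_functionD(1)[OF f(2)[of i]] by simp
  have disj: "disjoint_family_on A (range (f i))" by(auto simp: disjoint_family_on_def A_def)
  have cov: "(UN c:range (f i). A c) = UNIV" by(auto simp: A_def)
  have each: "bd (wgt ?rhoi (indicator (A c))) (eps*measure ?rhoi (A c))" for c
  proof (cases "c > 0")
  case True
  let ?tau = "wgt nu (indicator (A c))"
  have tau: "carried S ?tau" by(rule carried_restrict[OF nu AB])
  have e: "wgt ?rhoi (indicator (A c)) = wgt ?tau (%_. c)"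
  proof -
  have "(%x. f i (T x)*indicator (A c) x) = (%x. indicator (A c) x*c)" by(auto simp: A_def indicator_def)
  thus ?thesis using s fT AB f(4) True by(subst (1 2) wgt_wgt) auto
  qed
  have SDc: "SD (wgt ?tau (%_. c))" unfolding e[symmetric] by(rule SD_restrict[OF SDi AB])
  have "bd (wgt ?tau (%_. c)) (c*(eps*measure nu (A c)))"
  by(rule bd_scale[OF tau True SDc]) (use Bor[OF fB] in "simp add: A_def")
  moreover have "measure ?rhoi (A c) = c*measure nu (A c)"
  using measure_wgt_const[of ?tau c] measure_wgt_on[OF s AB, of c] measure_wgt_on[of ?rhoi "A c"] AB s True e by simp
  ultimately show ?thesis unfolding e by(simp add: mult.assoc mult.left_commute)
  next
  case False
  have "emeasure ?rhoi (A c) = (\<integral>\<^sup>+x. ennreal (f i (T x))*indicator (A c) x \<partial>nu)" by(rule em_wgt[OF s fT AB])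
  also have "... = (\<integral>\<^sup>+x. 0 \<partial>nu)"
  proof (rule nn_integral_cong)
  fix x
  show "ennreal (f i (T x))*indicator (A c) x = 0"
  using False by(cases "x : A c") (auto simp: A_def ennreal_neg)
  qed
  finally have "emeasure (wgt ?rhoi (indicator (A c))) UNIV = 0" using s AB by(simp add: em_wgt_on)
  hence "bd (wgt ?rhoi (indicator (A c))) 0" by(intro bd_null SD_restrict[OF SDi AB])
  thus ?thesis by(rule bd_mono) (use eps in auto)
  qed
  have b1: "bd (wgt ?rhoi (indicator (UN c:range (f i). A c))) (SUM c:range (f i). eps*measure ?rhoi (A c))"
  by(rule bd_UN[OF ci fr AB disj each])
  have b2: "wgt ?rhoi (indicator (UN c:range (f i). A c)) = ?rhoi"
  unfolding cov by(rule wgt_full) (use s in auto)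
  have "(SUM c:range (f i). measure ?rhoi (A c)) = measure ?rhoi (UN c:range (f i). A c)"
  by(rule finite_measure.finite_measure_finite_Union[OF subdens_finite[OF SDi] fr _ disj, symmetric])
  (use AB s in auto)
  hence b3: "(SUM c:range (f i). measure ?rhoi (A c)) = measure ?rhoi UNIV" by(simp only: cov)
  have "bd ?rhoi (eps*measure ?rhoi UNIV)" using b1 unfolding b2 sum_distrib_left[symmetric] b3 .
  moreover have "measure ?rhoi UNIV <= measure ?rho UNIV"
  proof -
  have U: "(UNIV :: (real^'n) set) : sets borel" by simp
  have "emeasure ?rhoi UNIV <= emeasure ?rho UNIV"
  unfolding em_wgt[OF s fT U] em_wgt[OF s uT U]
  by(intro nn_integral_mono mult_right_mono ennreal_leI fle) auto
  thus ?thesis using SD_emeasure[OF SDi] SD_emeasure[OF u(3)] by simp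
  qed
  ultimately have "bd ?rhoi (eps*measure ?rho UNIV)" by(elim bd_mono) (use eps in "auto intro: mult_left_mono")
  thus "bd (wgt ?rho (v i)) (eps*measure ?rho UNIV)" unfolding rv .
 qed
qed

lemma simplex_over_hcube:
 obtains s where "int d simplex s" "s <= V" "hcube J a r <= s"
proof -
 obtain M where M: "!!y. y : hcube J a r ==> norm y <= M" using hcube_bounded[of J a r] unfolding bounded_iff by blast
 obtain s where s: "int (card J) simplex s" "s <= V" "V Int cball 0 M <= s" by(rule simplex_over_ball)
 have "hcube J a r <= s" using M s(3) hcube_subset[of J a r] by(auto simp: subset_iff)
 thus ?thesis using that s card_J by simp
qed

lemma uniform_compl: "A : sets borel ==> A <= B ==> B : sets borel ==> 0 <= kap ==> emeasure (uniform kap A) (- B) = 0"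
proof -
 assume a: "A : sets borel" "A <= B" "B : sets borel" "0 <= kap"
 have "A Int - B = {}" using a(2) by blast
 thus ?thesis using emeasure_uniform[OF a(1) _ a(4), of "- B"] a(3) by(simp add: borel_comp hausdorff_outer_empty)
qed

lemma carried_uniform_hcube:
 assumes "a : V" "0 < r" "0 <= kap" "kap*(r ^ d*cvol) <= 1" "int d simplex s" "s <= V" "hcube J a r <= s"
 shows "carried s (uniform kap (hcube J a r))"
proof -
 have "csimplex J s" using simplex_curved[of J s] assms(5,6) card_J by simp
 thus ?thesis unfolding carried_def
  using SD_uniform_hcube(1)[OF assms(1-4)] uniform_compl[OF hcb assms(7) csimplex_borel assms(3)] by blast
qed

lemma bd_uniform_grid_cell:
 assumes j: "cvol <= 2 ^ j" and k: "0 < kap" "kap*((1/2 ^ j) ^ d*cvol) <= 1"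
 shows "bd (uniform kap (gcell J (2 ^ j) z)) 0"
proof -
 let ?a = "grid_corner J (2 ^ j) z" and ?r = "1/real (2 ^ j)"
 obtain s where s: "int d simplex s" "s <= V" "hcube J ?a ?r <= s" by(rule simplex_over_hcube)
 have "(2::real) ^ j <= (2 ^ j) ^ d" using d_pos self_le_power[of "2 ^ j :: real" d] by simp
 hence vol: "cvol/real (2 ^ j) ^ d <= 1" using j by simp
 have b: "bd (uniform 1 (hcube J ?a ?r)) 0" by(rule bd_small_cube[OF _ vol grid_corner_in]) simp
 have c1: "carried s (uniform 1 (hcube J ?a ?r))"
  by(rule carried_uniform_hcube[OF grid_corner_in _ _ _ s]) (use vol in "auto simp: power_one_over")
 have e: "wgt (uniform 1 (hcube J ?a ?r)) (%_. kap) = uniform kap (hcube J ?a ?r)"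
  using k by(subst wgt_uniform_const) (auto simp: hcb)
 have "SD (wgt (uniform 1 (hcube J ?a ?r)) (%_. kap))" unfolding e
  by(rule SD_uniform_hcube(1)[OF grid_corner_in]) (use k in auto)
 from bd_scale[OF c1 k(1) this b] show ?thesis unfolding e by(simp add: gcell_eq)
qed

text \<open>The half side is a positive integer, so that the grids fit the box exactly.\<close>

lemma dominating_box:
 fixes X :: "(real^'n) set"
 assumes "bounded X" "X <= V"
 obtains B R where "B = hcube J (\<chi> i. if i : J then - real R else 0) (2*real R)" "X <= B" "0 < R"
proof -
 obtain M where M: "!!y. y : X ==> norm y <= M" using assms(1) unfolding bounded_iff by blast
 obtain R where R: "M < real R" using reals_Archimedean2 by blast
 have "X <= hcube J (\<chi> i. if i : J then - real (Suc R) else 0) (2*real (Suc R))"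
 proof
  fix y assume y: "y : X"
  have "abs(y $ i) < real (Suc R)" for i using M[OF y] R component_le_norm_cart[of y i] by simp
  thus "y : hcube J (\<chi> i. if i : J then - real (Suc R) else 0) (2*real (Suc R))"
  using y assms(2) by(auto simp: hcube_def plane_def abs_less_iff less_imp_le) (smt (verit))+
 qed
 thus ?thesis using that[of _ "Suc R"] by blast
qed

lemma uniform_box:
 assumes B: "B = hcube J (\<chi> i. if i : J then - real R else 0) (2*real R)" "0 < R"
 obtains kap where "0 < kap" "SD (uniform kap B)" "emeasure (uniform kap B) UNIV = 1" "kap*((2*real R) ^ d*cvol) <= 1"
proof -
 define kap where "kap = 1/((2*real R) ^ d*cvol)"
 have k: "0 < kap" "kap*((2*real R) ^ d*cvol) = 1" using B(2) cvol(1) by(auto simp: kap_def)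
 have a: "(\<chi> i. if i : J then - real R else 0) : V" by(simp add: plane_def)
 note U = SD_uniform_hcube[OF a, of "2*real R" kap]
 have 1: "SD (uniform kap B)" "measure (uniform kap B) UNIV = 1" unfolding B(1) using U k B(2) by simp_all
 hence "emeasure (uniform kap B) UNIV = 1" using SD_emeasure[OF 1(1)] by simp
 thus ?thesis using that k 1(1) by auto
qed

lemma density_of_uniform:
 assumes mu: "SD mu" "emeasure mu (- B) = 0" and B: "B : sets borel" and k: "0 < kap"
 obtains u where "u : borel_measurable borel" "!!x. 0 <= u x" "mu = wgt (uniform kap B) u"
proof -
 obtain g where g[measurable]: "g : borel_measurable borel" and g0: "!!x. 0 <= g x" and ge: "mu = density (hausdorff d) (%x. ennreal (g x))"
  using mu(1) by(rule subdensE) blast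
 have "wgt (uniform kap B) (%x. g x/kap) = density (hausdorff d) (%x. ennreal (kap*indicator B x*(g x/kap)))"
  unfolding uniform_def using k g0 B by(subst wgt_density) auto
 also have "... = density (hausdorff d) (%x. ennreal (g x*indicator B x))" using k by(simp add: mult.commute)
 also have "... = wgt mu (indicator B)" unfolding ge using g0 B by(subst wgt_density) auto
 also have "... = mu" by(rule wgt_full[OF SD_sets[OF mu(1)] B mu(2)])
 finally show ?thesis using that[of "%x. g x/kap"] g0 k by simp
qed

text \<open>The passage from cells to densities with \<open>T\<close> the identity and relative
  error 0, applied to a uniform measure on a box with respect to which \<open>mu\<close> has a
  density.\<close>

lemma bd_flat:
 assumes mu: "SD mu" and X: "X : sets borel" "bounded X" "X <= V" "emeasure mu (- X) = 0"
 shows "bd mu 0"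
proof -
 obtain B R where B: "B = hcube J (\<chi> i. if i : J then - real R else 0) (2*real R)" "X <= B" "0 < R"
  by(rule dominating_box[OF X(2,3)])
 obtain kap where k: "0 < kap" "SD (uniform kap B)" "kap*((2*real R) ^ d*cvol) <= 1"
  by(rule uniform_box[OF B(1,3)])
 have BB: "B : sets borel" unfolding B(1) by(rule hcb)
 have "emeasure mu (- B) <= emeasure mu (- X)" using B(2) X(1) SD_sets[OF mu] by(intro emeasure_mono) (auto simp: borel_comp)
 hence muB: "emeasure mu (- B) = 0" using X(4) by simp
 obtain u where u: "u : borel_measurable borel" "!!x. 0 <= u x" "mu = wgt (uniform kap B) u"
  by(rule density_of_uniform[OF mu muB BB k(1)]) blast
 have a: "(\<chi> i. if i : J then - real R else 0) : V" by(simp add: plane_def)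
 obtain s where s: "int d simplex s" "s <= V" "B <= s" unfolding B(1) by(rule simplex_over_hcube)
 have nu: "carried s (uniform kap B)"
  unfolding B(1) by(rule carried_uniform_hcube[OF a _ _ k(3) s(1,2)]) (use B k s(3) in auto)
 \<comment> \<open>From these levels on, grid cells have mass at most 1, with density 1 as well as
   with density \<open>kap\<close>.\<close>
 obtain j0 where j0: "cvol < 2 ^ j0" using real_arch_pow[of 2] by auto
 obtain j1 where j1: "kap*cvol < 2 ^ j1" using real_arch_pow[of 2] by auto
 have T: "(%x::real^'n. x) : borel \<rightarrow>\<^sub>M borel" by simp
 have "bd (wgt (uniform kap B) (indicator ((%x. x) -` G))) (0*measure (uniform kap B) ((%x. x) -` G))" if "open G" for G
 proof (rule bd_preimages_open[OF nu T B(1) _ _ _ that, where ?j0.0 = "max j0 j1"])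
  show "emeasure (uniform kap B) (- ((%x. x) -` B)) = 0" using uniform_compl[OF BB order_refl BB] k by simp
  fix j z assume j: "max j0 j1 <= j" and z: "z : B"
  have p: "(2::real) ^ j0 <= 2 ^ j" "(2::real) ^ j1 <= 2 ^ j" using j by(auto intro!: power_increasing)
  have sub: "gcell J (2 ^ j) z <= B" by(rule hcube_int_grid[OF B(1) _ z]) simp
  have "(2::real) ^ j <= (2 ^ j) ^ d" using d_pos self_le_power[of "2 ^ j :: real" d] by simp
  hence "kap*cvol <= (2 ^ j) ^ d" using j1 p by linarith
  hence kc: "kap*((1/2 ^ j) ^ d*cvol) <= 1" by(simp add: power_one_over field_simps)
  have "cvol <= 2 ^ j" using j0 p(1) by linarith
  hence "bd (uniform kap (gcell J (2 ^ j) z)) 0" by(rule bd_uniform_grid_cell[OF _ k(1) kc])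
  moreover have "B Int gcell J (2 ^ j) z = gcell J (2 ^ j) z" using sub by blast
  ultimately show "bd (wgt (uniform kap B) (indicator ((%x. x) -` gcell J (2 ^ j) z))) (0*measure (uniform kap B) ((%x. x) -` gcell J (2 ^ j) z))"
  using k(1) BB by(simp add: wgt_uniform_indicator gcell_borel)
 qed simp
 hence Bor: "bd (wgt (uniform kap B) (indicator ((%x. x) -` A))) (0*measure (uniform kap B) ((%x. x) -` A))" if "A : sets borel" for A
  by(intro bd_preimages_Borel[OF nu T _ _ that]) auto
 show ?thesis using bd_preimages_density[OF nu T Bor _ u(1,2)] u(3) mu by simp
qed

end

section \<open>Cut-off functions\<close>

text \<open>The cube is the lowest power of the positive part that is twice continuously
  differentiable at 0.\<close>

definition ramp :: "real => real" where "ramp v = (max 0 v) ^ 3"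

lemma DERIV_max_power: "((%v. (max 0 v) ^ Suc (Suc k)) has_real_derivative real (Suc (Suc k))*(max 0 v) ^ Suc k) (at v)"
proof -
 consider "v < 0" | "v = 0" | "v > 0" by linarith
 thus ?thesis
 proof cases
  case 1
  have "((%_. 0) has_real_derivative 0) (at v)" by simp
  hence "((%v. (max 0 v) ^ Suc (Suc k)) has_real_derivative 0) (at v)"
  by(rule has_field_derivative_transform_within_open[where S = "{..<0}"]) (use 1 in auto)
  thus ?thesis using 1 by simp
 next
  case 3
  have "((%v. v ^ Suc (Suc k)) has_real_derivative real (Suc (Suc k)) * v ^ Suc k) (at v)"
  using DERIV_pow[of "Suc (Suc k)" v] by simp
  hence "((%v. (max 0 v) ^ Suc (Suc k)) has_real_derivative real (Suc (Suc k)) * v ^ Suc k) (at v)"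
  by(rule has_field_derivative_transform_within_open[where S = "{0<..}"]) (use 3 in auto)
  thus ?thesis using 3 by simp
 next
  case 2
  have "((%h::real. (max 0 h) ^ Suc (Suc k)/h) \<longlongrightarrow> 0) (at 0)"
  proof (rule Lim_null_comparison)
  have "norm ((max 0 h) ^ Suc (Suc k)/h) <= abs(h) ^ Suc k" for h :: real
  proof (cases "h <= 0")
  case True
  hence "max 0 h = 0" by simp
  hence "norm ((max 0 h) ^ Suc (Suc k)/h) = 0" by(simp only:) simp
  moreover have "0 <= abs(h) ^ Suc k" by(rule zero_le_power) simp
  ultimately show ?thesis by linarith
  next
  case False
  thus ?thesis by simp
  qed
  thus "\<forall>\<^sub>F h in at 0. norm ((max 0 h) ^ Suc (Suc k)/h) <= abs(h) ^ Suc k" by simp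
  have "((%h::real. abs(h) ^ Suc k) \<longlongrightarrow> abs(0) ^ Suc k) (at 0)" by(intro tendsto_intros)
  thus "((%h::real. abs(h) ^ Suc k) \<longlongrightarrow> 0) (at 0)" by simp
  qed
  thus ?thesis using 2 by(simp add: DERIV_def)
 qed
qed

text \<open>Reflecting a second ramp against the first makes the function flat to second order at
  both ends: it is 0 up to 0 and 1 from 1 on.\<close>

definition step :: "real => real" where "step v = 1 - ramp (1 - ramp v)"

lemma ramp_deriv: "(ramp has_real_derivative 3*(max 0 v) ^ 2) (at v)"
 using DERIV_max_power[of 1 v] by(simp add: ramp_def[abs_def] numeral_3_eq_3 numeral_2_eq_2)

lemma ramp_deriv2: "((%v. 3*(max 0 v) ^ 2) has_real_derivative 6*max 0 v) (at v)"
 using DERIV_cmult[OF DERIV_max_power[of 0 v], of 3] by(simp add: numeral_2_eq_2)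

lemma C2map_ramp: 
 fixes u :: "'a::euclidean_space => real"
 assumes "C2map U u" shows "C2map U (%x. ramp (u x))"
 by(rule C2map_compose_real[OF assms ramp_deriv ramp_deriv2]) (intro continuous_intros)

lemma ramp_bounds: "0 <= ramp v" "v <= 1 ==> ramp v <= 1" "v <= 0 ==> ramp v = 0" "1 <= v ==> 1 <= ramp v"
 by(auto simp: ramp_def max_def power_le_one)

lemma step_bounds: "0 <= step v" "step v <= 1"
 "v <= 0 ==> step v = 0" "1 <= v ==> step v = 1"
proof -
 show "0 <= step v" using ramp_bounds(2)[of "1 - ramp v"] ramp_bounds(1)[of v] by(simp add: step_def)
 show "step v <= 1" using ramp_bounds(1)[of "1 - ramp v"] by(simp add: step_def)
 show "step v = 0" if "v <= 0" using ramp_bounds(3)[OF that] by(simp add: step_def ramp_def)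
 show "step v = 1" if "1 <= v" using ramp_bounds(3)[of "1 - ramp v"] ramp_bounds(4)[OF that] by(simp add: step_def)
qed

text \<open>The derivative is a product of two factors of modulus at most 3 for arguments up to 1;
  beyond 1 the outer factor vanishes.\<close>

lemma step_lipschitz: "abs(step x - step y) <= 9*abs(x - y)"
proof -
 let ?D = "%v. 3*(max 0 (1 - ramp v)) ^ 2*(3*(max 0 v) ^ 2)"
 have der: "(step has_real_derivative ?D v) (at v)" for v
 proof -
  have "((%v. 1 - ramp v) has_real_derivative 0 - 3*(max 0 v) ^ 2) (at v)"
  by(intro DERIV_diff DERIV_const ramp_deriv)
  from DERIV_chain2[OF ramp_deriv this]
  have "((%v. ramp (1 - ramp v)) has_real_derivative 3*(max 0 (1 - ramp v)) ^ 2*(0 - 3*(max 0 v) ^ 2)) (at v)" .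
  from DERIV_diff[OF DERIV_const this, of 1] show ?thesis by(simp add: step_def[abs_def])
 qed
 have bound: "norm (?D v) <= 9" for v
 proof (cases "v <= 1")
  case True
  have "0 <= max 0 (1 - ramp v)" "max 0 (1 - ramp v) <= 1" "0 <= max 0 v" "max 0 v <= 1"
  using True ramp_bounds(1)[of v] by auto
  hence "(max 0 (1 - ramp v)) ^ 2 <= 1" "(max 0 v) ^ 2 <= 1" by(auto intro!: power_le_one)
  hence "(3*(max 0 (1 - ramp v)) ^ 2)*(3*(max 0 v) ^ 2) <= 3*3" by(intro mult_mono) auto
  thus ?thesis by(simp add: abs_mult)
 next
  case False
  hence "max 0 (1 - ramp v) = 0" using ramp_bounds(4)[of v] by auto
  thus ?thesis by simp
 qed
 have "norm (step x - step y) <= 9*norm (x - y)"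
  by(rule field_differentiable_bound[of UNIV]) (use der bound in auto)
 thus ?thesis by simp
qed

definition bump :: "'n::finite set => real => real => real^'n => real" where
 "bump J eta r z = (\<Prod>i\<in>J. step (z $ i/(eta*r)) * step ((r - z $ i)/(eta*r)))"

lemma C2map_mult:
 fixes f g :: "'a::euclidean_space => real"
 shows "C2map U f ==> C2map U g ==> C2map U (%x. f x*g x)"
 using C2map_scaleR[of U f g] by simp

lemma C2map_step:
 fixes u :: "'a::euclidean_space => real"
 assumes "C2map U u" shows "C2map U (%x. step (u x))"
proof -
 have minus: "C2map U (%x. 1 - f x)" if "C2map U f" for f :: "'a => real"
  using C2map_add[OF C2map_const[of U "1::real"] C2map_mult[OF C2map_const[of U "- 1 :: real"] that]]
  by simp
 show ?thesis unfolding step_def by(intro minus C2map_ramp assms)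
qed

lemma C2map_bump: "C2map UNIV (bump (J :: 'n::finite set) eta r)"
proof -
 have lin: "C2map UNIV (%z :: real^'n. c + k*z $ i)" for c k i
  using C2map_add[OF C2map_const C2map_linear[OF bounded_linear_mult_right[THEN bounded_linear_compose, OF bounded_linear_vec_nth]], of UNIV c k i] .
 have "C2map UNIV (%z. step (z $ i/(eta*r)) * step ((r - z $ i)/(eta*r)))" for i :: 'n
  using C2map_mult[OF C2map_step[OF lin[of 0 "1/(eta*r)" i]] C2map_step[OF lin[of "r/(eta*r)" "- 1/(eta*r)" i]]]
  by(simp add: diff_divide_distrib)
 note base = this
 have "C2map UNIV (%z. \<Prod>i\<in>I. step (z $ i/(eta*r)) * step ((r - z $ i)/(eta*r)))"
  if "finite I" for I :: "'n set"
  using that by(induction I rule: finite_induct) (simp_all add: C2map_const C2map_mult base)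
 thus ?thesis unfolding bump_def[abs_def] by simp
qed

lemma step_product_bounds: "0 <= step a * step b" "step a * step b <= 1"
 using mult_le_one[of "step a" "step b"] by(auto simp: step_bounds)

lemma bump_bounds: "0 <= bump J eta r z" "bump J eta r z <= 1"
 unfolding bump_def using step_product_bounds by(auto intro!: prod_nonneg prod_le_1)

lemma bump_outside:
 assumes "0 < eta" "0 < r" "i : J" "~ (0 < z $ i & z $ i < r)" shows "bump J eta r z = 0"
proof -
 have "step (z $ i/(eta*r)) * step ((r - z $ i)/(eta*r)) = 0"
 proof (cases "z $ i <= 0")
  case True
  hence "z $ i/(eta*r) <= 0" using assms by(simp add: divide_nonpos_pos)
  thus ?thesis by(simp add: step_bounds)
 next
  case False
  hence "(r - z $ i)/(eta*r) <= 0" using assms by(simp add: divide_nonpos_pos)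
  thus ?thesis by(simp add: step_bounds)
 qed
 thus ?thesis unfolding bump_def using assms(3) by(intro prod_zero) auto
qed

lemma bump_inside:
 assumes "0 < eta" "0 < r" "!!i. i : J ==> eta*r <= z $ i & z $ i <= (1 - eta)*r" shows "bump J eta r z = 1"
 unfolding bump_def
proof (rule prod.neutral, rule ballI)
 fix i assume i: "i : J"
 have p: "0 < eta*r" using assms by simp
 have "1 <= z $ i/(eta*r)" "1 <= (r - z $ i)/(eta*r)"
  using assms(3)[OF i] p by(auto simp: le_divide_eq algebra_simps)
 thus "step (z $ i/(eta*r)) * step ((r - z $ i)/(eta*r)) = 1" by(simp add: step_bounds)
qed

text \<open>Each coordinate contributes two steps, one per face, each with constant
  \<open>9/(eta*r)\<close>; differences of products of numbers in the unit interval are at most the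
  sum of the differences of the factors.\<close>

lemma bump_lipschitz:
 fixes x y :: "real^'n::finite"
 assumes "0 < eta" "0 < r"
 shows "abs(bump J eta r x - bump J eta r y) <= 18*real CARD('n)/(eta*r)*dist x y"
proof -
 let ?f = "%z :: real^'n. %i. step (z $ i/(eta*r)) * step ((r - z $ i)/(eta*r))"
 have p: "0 < eta*r" using assms by simp
 have each: "abs(?f x i - ?f y i) <= 18/(eta*r)*dist x y" for i
 proof -
  let ?a = "step (x $ i/(eta*r))" and ?b = "step ((r - x $ i)/(eta*r))"
  let ?a' = "step (y $ i/(eta*r))" and ?b' = "step ((r - y $ i)/(eta*r))"
  have co: "abs(x $ i - y $ i) <= dist x y" using component_le_norm_cart[of "x - y" i] by(simp add: dist_norm)
  have q: "abs(u/(eta*r) - v/(eta*r)) = abs(u - v)/(eta*r)" for u v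
  using p by(simp add: diff_divide_distrib[symmetric])
  have "9*(abs(x $ i - y $ i)/(eta*r)) <= 9*(dist x y/(eta*r))" using co p by(simp add: divide_right_mono)
  hence 1: "abs(?a - ?a') <= 9*(dist x y/(eta*r))"
  using step_lipschitz[of "x $ i/(eta*r)" "y $ i/(eta*r)"] unfolding q by linarith
  have "9*(abs((r - x $ i) - (r - y $ i))/(eta*r)) <= 9*(dist x y/(eta*r))" using co p by(simp add: divide_right_mono)
  hence 2: "abs(?b - ?b') <= 9*(dist x y/(eta*r))"
  using step_lipschitz[of "(r - x $ i)/(eta*r)" "(r - y $ i)/(eta*r)"] unfolding q by linarith
  have "abs(?a - ?a')*?b <= abs(?a - ?a')*1" "?a'*abs(?b - ?b') <= 1*abs(?b - ?b')"
  by(intro mult_left_mono mult_right_mono step_bounds; simp)+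
  moreover have "?f x i - ?f y i = (?a - ?a')*?b + ?a'*(?b - ?b')" by(simp add: algebra_simps)
  hence "abs(?f x i - ?f y i) <= abs(?a - ?a')*?b + ?a'*abs(?b - ?b')"
  using abs_triangle_ineq[of "(?a - ?a')*?b" "?a'*(?b - ?b')"] by(simp add: abs_mult step_bounds)
  ultimately show ?thesis using 1 2 by simp
 qed
 have "norm ((\<Prod>i\<in>J. ?f x i) - (\<Prod>i\<in>J. ?f y i)) <= (SUM i:J. norm (?f x i - ?f y i))"
  by(rule norm_prod_diff) (auto simp: abs_mult step_bounds intro!: mult_le_one)
 also have "... <= (SUM i:J. 18/(eta*r)*dist x y)" using each by(intro sum_mono) simp
 also have "... = real (card J)*(18/(eta*r)*dist x y)" by simp
 also have "... <= real CARD('n)*(18/(eta*r)*dist x y)"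
  using p by(intro mult_right_mono) (auto simp: card_mono)
 finally show ?thesis unfolding bump_def by(simp add: mult.assoc mult.left_commute)
qed

text \<open>No condition is imposed on coordinates outside of \<open>J\<close>: the set is open in
  the whole space, where the maps have to be twice differentiable.\<close>

definition open_cube :: "'n set => real => (real^'n) set" where
 "open_cube J r = {z. ALL i:J. 0 < z $ i & z $ i < r}"

text \<open>The Lipschitz constant \<open>18*CARD('n)/(eta*r)\<close> of the cut-off meets the bound
  \<open>t*(CARD('n)*r)\<close> on the remainder. The side \<open>r\<close> cancels, so the factor
  is the same for cubes of all sizes.\<close>

definition graft_factor :: "'n::finite set => real => real" where
 "graft_factor J eta = 1 + 18*real CARD('n)/eta*real CARD('n)"

lemma graft_factor_ge_1: "0 < eta ==> 1 <= graft_factor J eta" by(simp add: graft_factor_def)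

text \<open>\<open>W\<close> is the cut-off times \<open>w\<close>, extended by 0. Its Lipschitz
  constant is that of \<open>w\<close> plus the one of the cut-off times the maximum of
  \<open>w\<close>; the latter is small because \<open>w\<close> vanishes at a point of the
  cube.\<close>

lemma graft:
 fixes J :: "'n::finite set" and G :: "(real^'n) set" and w :: "real^'n => real^'n" and x0 :: "real^'n"
 assumes eta: "0 < eta" and r: "0 < r" and t: "0 <= t" and G: "open G" "{z. ALL i:J. 0 <= z $ i & z $ i <= r} <= G" and w: "C2map G w"
  and lip: "!!x y. x : plane J ==> y : plane J ==> (ALL i:J. 0 <= x $ i & x $ i <= r) ==>
  (ALL i:J. 0 <= y $ i & y $ i <= r) ==> dist (w x) (w y) <= t*dist x y"
  and x0: "x0 : plane J" "ALL i:J. 0 <= x0 $ i & x0 $ i <= r" "w x0 = 0"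
 shows "EX W. C2map UNIV W & (ALL x:plane J. ALL y:plane J. dist (W x) (W y) <= graft_factor J eta*t*dist x y) &
  (ALL x. x ~: open_cube J r --> W x = 0) &
  (ALL x. (ALL i:J. eta*r <= x $ i & x $ i <= (1 - eta)*r) --> W x = w x)"
proof -
  let ?n = "real CARD('n)"
  define C where "C = graft_factor J eta"
  have C1: "1 <= C" unfolding C_def by(rule graft_factor_ge_1[OF eta])
  note C_def = C_def[unfolded graft_factor_def]
  have Cg: "graft_factor J eta = C" by(simp add: C_def graft_factor_def)
  let ?K = "{z :: real^'n. ALL i:J. 0 <= z $ i & z $ i <= r}"
  let ?\<chi> = "bump J eta r"
  define W where "W x = (if x : G then ?\<chi> x *\<^sub>R w x else 0)" for x
  have out: "?\<chi> x = 0" if "x ~: open_cube J r" for x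
  using that bump_outside[OF eta r] by(auto simp: open_cube_def)
  have oK: "open_cube J r <= ?K" by(auto simp: open_cube_def less_imp_le)
  have W0: "W x = 0" if "x ~: open_cube J r" for x using out[OF that] by(simp add: W_def)
  have "?K = (\<Inter>i\<in>J. {z. 0 <= z $ i} Int {z. z $ i <= r})" by auto
  hence "closed ?K" by(simp only:) (intro closed_INT ballI closed_Int closed_Collect_le continuous_intros)
  hence oc: "open (- ?K)" by(simp add: open_Compl)
  have "C2map G W"
  by(rule C2map_transform[OF C2map_scaleR[OF C2map_subset[OF C2map_bump] w] G(1)])
  (auto simp: W_def)
  moreover have "C2map (- ?K) W"
  by(rule C2map_transform[OF C2map_const[of _ 0] oc]) (use W0 oK in blast)
  ultimately have "C2map (G Un - ?K) W" by(rule C2map_Un[OF _ _ G(1) oc])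
  moreover have "G Un - ?K = UNIV" using G(2) by blast
  ultimately have tw: "C2map UNIV W" by simp
  have wb: "norm (w x) <= t*(?n*r)" if x: "x : plane J" "x : ?K" for x
  proof -
  have "abs((x - x0) $ i) <= r" for i
  proof (cases "i : J")
  case True
  hence "0 <= x $ i" "x $ i <= r" "0 <= x0 $ i" "x0 $ i <= r" using x x0 by auto
  thus ?thesis by(simp add: abs_le_iff)
  qed (use x x0 r in "auto simp: plane_def")
  hence "(SUM i:UNIV. abs((x - x0) $ i)) <= (SUM i:(UNIV :: 'n set). r)" by(intro sum_mono)
  hence "dist x x0 <= ?n*r" using norm_le_l1_cart[of "x - x0"] by(simp add: dist_norm)
  hence "t*dist x x0 <= t*(?n*r)" by(rule mult_left_mono[OF _ t])
  moreover have "norm (w x) <= t*dist x x0" using lip[OF x(1) x0(1)] x(2) x0(2,3) by(simp add: dist_norm)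
  ultimately show ?thesis by linarith
  qed
  have \<chi>w: "abs(?\<chi> x - ?\<chi> y)*norm (w x) <= 18*?n/eta*?n*t*dist x y"
  if x: "x : plane J" "x : ?K" for x y
  proof -
  have "abs(?\<chi> x - ?\<chi> y)*norm (w x) <= (18*?n/(eta*r)*dist x y)*(t*(?n*r))"
  by(intro mult_mono bump_lipschitz[OF eta r] wb[OF x]) (use eta r in auto)
  also have "... = 18*?n/eta*?n*t*dist x y" using eta r by(simp add: field_simps)
  finally show ?thesis .
  qed
  have WK: "W x = ?\<chi> x *\<^sub>R w x" if "x : ?K" for x using that G(2) by(auto simp: W_def)
  have Cd: "18*?n/eta*?n*t*D <= C*t*D" "C*t*D = t*D + 18*?n/eta*?n*t*D" if "0 <= D" for D
  using that t by(auto simp: C_def algebra_simps)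
  have half: "dist (W x) (W y) <= C*t*dist x y" if x: "x : plane J" "x : ?K" and y: "y ~: ?K" for x y
  proof -
  have y0: "W y = 0" "?\<chi> y = 0" using W0[of y] out[of y] oK y by blast+
  have "dist (W x) (W y) = abs(?\<chi> x - ?\<chi> y)*norm (w x)" using y0 WK[OF x(2)] by simp
  also have "... <= C*t*dist x y" using \<chi>w[OF x, of y] Cd(1)[of "dist x y"] by simp
  finally show ?thesis .
  qed
  have lipW: "dist (W x) (W y) <= C*t*dist x y" if x: "x : plane J" and y: "y : plane J" for x y
  proof (cases "x : ?K")
  case xK: True
  show ?thesis
  proof (cases "y : ?K")
  case yK: True
  have "W x - W y = ?\<chi> y *\<^sub>R (w x - w y) + (?\<chi> x - ?\<chi> y) *\<^sub>R w x"
  unfolding WK[OF xK] WK[OF yK] by(simp add: algebra_simps)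
  hence "norm (W x - W y) <= ?\<chi> y*norm (w x - w y) + abs(?\<chi> x - ?\<chi> y)*norm (w x)"
  using norm_triangle_ineq[of "?\<chi> y *\<^sub>R (w x - w y)" "(?\<chi> x - ?\<chi> y) *\<^sub>R w x"] bump_bounds(1)[of J eta r y] by simp
  moreover have "?\<chi> y*norm (w x - w y) <= 1*norm (w x - w y)"
  by(intro mult_right_mono bump_bounds) simp
  moreover have "norm (w x - w y) <= t*dist x y" using lip[OF x y] xK yK by(simp add: dist_norm)
  ultimately show ?thesis using \<chi>w[OF x xK, of y] Cd(2)[of "dist x y"] by(simp add: dist_norm)
  next
  case False
  thus ?thesis by(rule half[OF x xK])
  qed
  next
  case xK: False
  show ?thesis
  proof (cases "y : ?K")
  case True
  thus ?thesis using half[OF y True xK] by(simp add: dist_commute)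
  next
  case False
  hence "W x = 0" "W y = 0" using W0[of x] W0[of y] oK xK by blast+
  thus ?thesis using C1 t by simp
  qed
  qed
  have inn: "W x = w x" if "ALL i:J. eta*r <= x $ i & x $ i <= (1 - eta)*r" for x
  proof -
  have "x : ?K"
  proof (rule CollectI, rule ballI)
  fix i assume "i : J"
  hence "eta*r <= x $ i" "x $ i <= (1 - eta)*r" using that by auto
  moreover have "0 <= eta*r" "(1 - eta)*r <= r" using eta r by(auto simp: algebra_simps)
  ultimately show "0 <= x $ i & x $ i <= r" by linarith
  qed
  thus ?thesis using WK bump_inside[OF eta r, of J x] that by simp
  qed
  show ?thesis unfolding Cg using tw lipW W0 inn by blast
qed

section \<open>Nearly isometric maps\<close>

text \<open>The isometry \<open>I\<close> and the remainder \<open>W\<close> are kept apart,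
  although only \<open>I x + W x\<close> matters as a map, so that the remainder can be cut off,
  translated or summed over tiles.\<close>

definition flat_map :: "'n::finite set => real => (real^'n => real^'n) => (real^'n => real^'n) => bool" where
 "flat_map J t I W \<longleftrightarrow> linear I & (ALL x:plane J. norm (I x) = norm x) & C2map UNIV W &
  (ALL x:plane J. ALL y:plane J. dist (W x) (W y) <= t*dist x y)"

lemma plane_diff: "x : plane J ==> y : plane J ==> x - y : plane J"
 by(simp add: plane_def)

lemma plane_plus: "x : plane J ==> y : plane J ==> x + y : plane J"
 by(simp add: plane_def)

lemma flat_map_dist:
 assumes "flat_map J t I W" "x : plane J" "y : plane J"
 shows "abs(dist (I x + W x) (I y + W y) - dist x y) <= t*dist x y"
proof -
 have I: "norm (I (x - y)) = norm (x - y)" and lin: "linear I" and W: "dist (W x) (W y) <= t*dist x y"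
  using assms plane_diff[OF assms(2,3)] by(auto simp: flat_map_def)
 have "abs(norm ((I x + W x) - (I y + W y)) - norm (I (x - y))) <= norm ((I x + W x) - (I y + W y) - I (x - y))"
  by(rule norm_triangle_ineq3)
 also have "(I x + W x) - (I y + W y) - I (x - y) = W x - W y" by(simp add: linear_diff[OF lin])
 finally show ?thesis using W I by(simp add: dist_norm)
qed

lemma flat_map_lower:
 assumes "flat_map J t I W" "t <= 1/2" "x : plane J" "y : plane J"
 shows "dist x y <= 2*dist (I x + W x) (I y + W y)"
proof -
 have "t*dist x y <= 1/2*dist x y" using assms(2) by(rule mult_right_mono) simp
 thus ?thesis using flat_map_dist[OF assms(1,3,4)] by linarith
qed

lemma flat_map_inj: "flat_map J t I W ==> t <= 1/2 ==> inj_on (%x. I x + W x) (plane J)"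
 by(rule inj_onI) (use flat_map_lower in fastforce)

lemma flat_map_continuous: "flat_map J t I W ==> continuous_on A (%x. I x + W x)"
proof (rule continuous_on_subset[of UNIV])
 assume f: "flat_map J t I W"
 hence "C2map UNIV W" "linear I" by(auto simp: flat_map_def)
 hence W: "continuous_on UNIV W" and I: "bounded_linear I" by(auto elim: C2mapE simp: linear_conv_bounded_linear)
 show "continuous_on UNIV (%x. I x + W x)" by(rule continuous_on_add[OF linear_continuous_on[OF I] W])
qed simp

lemma flat_map_meas: "flat_map J t I W ==> (%x. I x + W x) : borel \<rightarrow>\<^sub>M borel"
 by(intro borel_measurable_continuous_onI flat_map_continuous)

lemma derivative_lipschitz_bound:
 fixes W :: "'a::real_normed_vector => 'b::real_normed_vector"
 assumes W: "(W has_derivative W') (at p)" and lip: "!!s. norm (W (p + s *\<^sub>R v) - W p) <= t*(abs(s)*norm v)"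
 shows "norm (W' v) <= t*norm v"
proof (cases "v = 0")
 case True
 thus ?thesis using W by(simp add: linear_0 has_derivative_linear)
next
 case False
 have lin: "linear W'" by(rule has_derivative_linear[OF W])
 have lim: "((%y. norm (W (p + y) - W p - W' y)/norm y) \<longlongrightarrow> 0) (at 0)" using W by(simp add: has_derivative_at)
 have "filterlim (%s::real. s *\<^sub>R v) (at 0) (at 0)"
  unfolding filterlim_at using False by(auto intro!: tendsto_eq_intros simp: eventually_at_filter)
 from filterlim_compose[OF lim this]
 have "((%s. norm (W (p + s *\<^sub>R v) - W p - W' (s *\<^sub>R v))/norm (s *\<^sub>R v)) \<longlongrightarrow> 0) (at 0)" .
 hence "((%s. (norm (W (p + s *\<^sub>R v) - W p - W' (s *\<^sub>R v))/norm (s *\<^sub>R v) + t)*norm v) \<longlongrightarrow> (0 + t)*norm v) (at 0)"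
  by(intro tendsto_intros)
 hence l2: "((%s. (norm (W (p + s *\<^sub>R v) - W p - W' (s *\<^sub>R v))/norm (s *\<^sub>R v) + t)*norm v) \<longlongrightarrow> t*norm v) (at 0)" by simp
 show ?thesis
 proof (rule tendsto_lowerbound[OF l2])
  have "norm (W' v) <= (norm (W (p + s *\<^sub>R v) - W p - W' (s *\<^sub>R v))/norm (s *\<^sub>R v) + t)*norm v" if s: "s ~= 0" for s
  proof -
  have "abs(s)*norm (W' v) = norm (W' (s *\<^sub>R v))" by(simp add: linear_cmul[OF lin])
  also have "... <= norm (W (p + s *\<^sub>R v) - W p) + norm (W (p + s *\<^sub>R v) - W p - W' (s *\<^sub>R v))"
  using norm_triangle_ineq4[of "W (p + s *\<^sub>R v) - W p" "W (p + s *\<^sub>R v) - W p - W' (s *\<^sub>R v)"] by simp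
  also have "... <= t*(abs(s)*norm v) + norm (W (p + s *\<^sub>R v) - W p - W' (s *\<^sub>R v))" using lip[of s] by simp
  also have "... = abs(s)*((norm (W (p + s *\<^sub>R v) - W p - W' (s *\<^sub>R v))/norm (s *\<^sub>R v) + t)*norm v)"
  using s False by(simp add: field_simps)
  finally show ?thesis using s by(simp add: mult_le_cancel_left)
  qed
  thus "\<forall>\<^sub>F s in at 0. norm (W' v) <= (norm (W (p + s *\<^sub>R v) - W p - W' (s *\<^sub>R v))/norm (s *\<^sub>R v) + t)*norm v"
  by(auto simp: eventually_at_filter)
 qed simp
qed

text \<open>On directions of the plane the remainder has derivative of norm at most 1/2 and cannot
  cancel the isometric part, so the differential is injective.\<close>

lemma flat_map_C2:
 fixes J :: "'n::finite set"
 assumes f: "flat_map J t I W" and t: "t <= 1/2" and s: "s <= plane J"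
 shows "C2_embedding_on s (%x. I x + W x)"
proof -
 have I: "linear I" "!!x. x : plane J ==> norm (I x) = norm x" and W: "C2map UNIV W"
  and lip: "!!x y. x : plane J ==> y : plane J ==> dist (W x) (W y) <= t*dist x y"
  using f by(auto simp: flat_map_def)
 have bI: "bounded_linear I" using I(1) by(simp add: linear_conv_bounded_linear)
 have tw: "C2map UNIV (%x. I x + W x)" by(intro C2map_add C2map_linear bI W)
 obtain W' W'' where W': "!!x. (W has_derivative W' x) (at x)" and "!!h x. ((%y. W' y h) has_derivative W'' h x) (at x)"
  using W by(rule C2mapE) (metis UNIV_I)
 have "inj_on (frechet_derivative (%x. I x + W x) (at p)) (span ((%q. q - p) ` s))" if p: "p : s" for p
 proof -
  have der: "((%x. I x + W x) has_derivative (%v. I v + W' p v)) (at p)"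
  by(intro has_derivative_add bounded_linear_imp_has_derivative bI W')
  have fd: "frechet_derivative (%x. I x + W x) (at p) = (%v. I v + W' p v)" using frechet_derivative_at[OF der] by simp
  have sp: "span ((%q. q - p) ` s) <= plane J"
  by(rule span_minimal[OF _ subspace_plane]) (use s p in "auto intro!: plane_diff")
  show ?thesis unfolding fd
  proof (subst linear_injective_on_subspace_0[OF has_derivative_linear[OF der] subspace_span], intro ballI impI)
  fix v assume v: "v : span ((%q. q - p) ` s)" "I v + W' p v = 0"
  have vV: "v : plane J" using v(1) sp by blast
  have pV: "p : plane J" using p s by blast
  have "norm (W' p v) <= t*norm v"
  proof (rule derivative_lipschitz_bound[OF W'])
  fix c :: real
  have "p + c *\<^sub>R v : plane J" using pV vV by(simp add: plane_def)
  thus "norm (W (p + c *\<^sub>R v) - W p) <= t*(abs(c)*norm v)" using lip[of "p + c *\<^sub>R v" p] pV by(simp add: dist_norm)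
  qed
  moreover have "norm (I v) = norm (W' p v)" using v(2) by(metis add_eq_0_iff norm_minus_cancel)
  ultimately have "norm v <= t*norm v" using I(2)[OF vV] by simp
  also have "... <= 1/2*norm v" using t by(rule mult_right_mono) simp
  finally show "v = 0" by simp
  qed
 qed
 thus ?thesis unfolding C2_embedding_on_def
  using inj_on_subset[OF flat_map_inj[OF f t] s] C2map_imp_C2_on[OF tw]
  by(intro conjI exI[of _ UNIV] exI[of _ "%x. I x + W x"]) auto
qed

lemma flat_map_0: "flat_map J t I W ==> 0 <= t' ==> flat_map J t' I (%_. 0)"
 by(simp add: flat_map_def C2map_const)

lemma flat_map_mono: "flat_map J t I W ==> t <= t' ==> flat_map J t' I W"
 unfolding flat_map_def by(meson mult_right_mono order_trans zero_le_dist)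

lemma flat_map_shift:
 assumes "flat_map J t I W" "c : plane J" shows "flat_map J t I (%x. W (x - c) - b)"
proof -
 have "C2map ((%x. - c + x) -` UNIV) (%x. W (- c + x))"
  using C2map_compose_affine[of UNIV W "%x. x" "- c"] assms(1) by(simp add: flat_map_def bounded_linear_ident)
 hence "C2map UNIV (%x. W (x - c) + - b)" by(intro C2map_add C2map_const) simp
 moreover have "dist (W (x - c)) (W (y - c)) <= t*dist x y" if "x : plane J" "y : plane J" for x y
 proof -
  have "dist (W (x - c)) (W (y - c)) <= t*dist (x - c) (y - c)"
  using assms(1) plane_diff[OF that(1) assms(2)] plane_diff[OF that(2) assms(2)]
  unfolding flat_map_def by blast
  thus ?thesis by(simp add: dist_norm)
 qed
 ultimately show ?thesis using assms(1) by(simp add: flat_map_def dist_norm)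
qed

text \<open>\<open>K\<close> lies, up to the translation \<open>b\<close>, in the image of a small
  cube under a nearly isometric map whose remainder already vanishes off the open cube;
  \<open>T\<close> is a continuous inverse on \<open>K\<close>.\<close>

definition flat_patch :: "'n::finite set => real => real => (real^'n) set => bool" where
 "flat_patch J t r0 K \<longleftrightarrow> (EX r b I W T. 0 < r & r <= r0 & flat_map J t I W & (ALL x. x ~: open_cube J r --> W x = 0) &
  continuous_on K T & (ALL u:K. T u : hcube J 0 r & b + (I (T u) + W (T u)) = u))"

lemma span_simplex_directions:
 fixes J :: "'n::finite set"
 assumes "int (card J) simplex s" "s <= plane J" "p : s"
 shows "plane J <= span ((%q. q - p) ` s)"
proof
 fix v assume v: "v : plane J"
 let ?A = "(+) p ` span ((%q. q - p) ` s)"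
 have "affine hull s <= ?A"
 proof (rule hull_minimal)
  show "s <= ?A"
  proof
  fix q assume "q : s"
  hence "q - p : span ((%q. q - p) ` s)" by(intro span_base) auto
  thus "q : ?A" by(intro image_eqI[of _ _ "q - p"]) auto
  qed
  show "affine ?A" by(rule affine_translation[THEN iffD1, OF subspace_imp_affine[OF subspace_span]])
 qed
 moreover have "p + v : affine hull s"
  unfolding simplex_affine_hull_plane[OF assms(1,2)] using v assms(2,3) by(auto simp: plane_plus)
 ultimately have "p + v : ?A" by blast
 thus "v : span ((%q. q - p) ` s)" by auto
qed

text \<open>The derivative vanishes at 0 and is continuous, hence is below \<open>t\<close> on a
  ball, and the ball is convex.\<close>

lemma small_remainder:
 fixes w :: "'a::euclidean_space => 'b::real_normed_vector"
 assumes w: "C2map G w" and G: "open G" "0 : G" and d0: "(w has_derivative (%_. 0)) (at 0)" and t: "0 < t"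
 obtains rho where "0 < rho" "ball 0 rho <= G" "!!x y. x : ball 0 rho ==> y : ball 0 rho ==> dist (w x) (w y) <= t*dist x y"
proof -
 obtain w' w'' where w': "!!x. x : G ==> (w has_derivative w' x) (at x)"
  "!!h x. x : G ==> ((%y. w' y h) has_derivative w'' h x) (at x)"
  "!!h k. continuous_on G (%x. w'' h x k)" "!!h. continuous_on G (%x. w' x h)" "continuous_on G w"
  using w by(rule C2mapE) blast
 have z: "w' 0 = (%_. 0)" by(rule has_derivative_unique[OF w'(1)[OF G(2)] d0])
 define F where "F x = (SUM b:Basis. norm (w' x b))" for x
 have "continuous_on G F" unfolding F_def by(intro continuous_intros w'(4))
 hence "isCont F 0" using G by(simp add: continuous_on_eq_continuous_at)
 hence "(F \<longlongrightarrow> F 0) (nhds 0)" unfolding isCont_def tendsto_at_iff_tendsto_nhds by simp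
 moreover have "F 0 < t" using t by(simp add: F_def z)
 ultimately have "\<forall>\<^sub>F x in nhds 0. F x < t" by(rule order_tendstoD(2))
 moreover have "\<forall>\<^sub>F x in nhds 0. x : G" using G by(rule eventually_nhds_in_open)
 ultimately have "\<forall>\<^sub>F x in nhds 0. F x < t & x : G" by(rule eventually_conj)
 then obtain rho where rho: "0 < rho" "!!x. dist x 0 < rho ==> F x < t & x : G" unfolding eventually_nhds_metric by auto
 show ?thesis
 proof (rule that[OF rho(1)])
  show "ball 0 rho <= G" using rho(2) by(auto simp: dist_commute)
  fix x y :: 'a assume xy: "x : ball 0 rho" "y : ball 0 rho"
  have "norm (w x - w y) <= t*norm (x - y)"
  proof (rule differentiable_bound[OF convex_ball _ _ xy])
  fix z :: 'a assume "z : ball 0 rho"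
  hence zG: "z : G" "F z < t" using rho(2)[of z] by(auto simp: dist_commute)
  show "(w has_derivative w' z) (at z within ball 0 rho)" using w'(1)[OF zG(1)] by(rule has_derivative_at_withinI)
  have lin: "linear (w' z)" by(rule has_derivative_linear[OF w'(1)[OF zG(1)]])
  show "onorm (w' z) <= t"
  proof (rule onorm_le)
  fix h :: 'a
  have "w' z h = w' z (SUM b:Basis. (h \<bullet> b) *\<^sub>R b)" by(simp add: euclidean_representation)
  also have "... = (SUM b:Basis. (h \<bullet> b) *\<^sub>R w' z b)" by(simp add: linear_sum[OF lin] linear_cmul[OF lin])
  finally have "norm (w' z h) <= (SUM b:Basis. norm ((h \<bullet> b) *\<^sub>R w' z b))" by(simp only: norm_sum)
  also have "... <= (SUM b:Basis. norm h*norm (w' z b))"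
  by(intro sum_mono) (auto intro!: mult_right_mono Basis_le_norm)
  also have "... = norm h*F z" by(simp add: F_def sum_distrib_left)
  also have "... <= t*norm h" using zG(2) by(simp add: mult.commute mult_right_mono)
  finally show "norm (w' z h) <= t*norm h" .
  qed
  qed
  thus "dist (w x) (w y) <= t*dist x y" by(simp add: dist_norm)
 qed
qed

text \<open>An isometry \<open>If\<close> of the plane onto the tangent space at \<open>p\<close>
  replaces the differential \<open>D\<close> after the linear change of parameters \<open>L\<close>
  with \<open>D (L z) = M z\<close>. In these parameters the embedding is a constant plus
  \<open>M z\<close> plus \<open>w0 z\<close>, where \<open>w0\<close> has derivative 0 at the
  origin; a cut-off of \<open>w0\<close> on a small cube gives the patch.\<close>

lemma flat_patch_at:
 fixes J :: "'n::finite set" and Phi :: "real^'n => real^'n"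
 assumes s: "int (card J) simplex s" "s <= plane J" "C2_embedding_on s Phi" and p: "p : s" and t: "0 < t" and r0: "0 < r0"
 shows "EX O1 K. open O1 & p : O1 & compact K & K <= Phi ` s & Phi ` (s Int O1) <= K & flat_patch J t r0 K"
proof -
 let ?V = "plane J"
 define C where "C = graft_factor J (1/4)"
 have q: "0 < (1/4 :: real)" by simp
 have C: "1 <= C" unfolding C_def by(rule graft_factor_ge_1[OF q])
 note gr = graft[OF q, where J = J, folded C_def]
 obtain U g where g: "open U" "s <= U" "C2map U g" "!!x. x : s ==> g x = Phi x" "inj_on Phi s"
  "!!p. p : s ==> inj_on (frechet_derivative g (at p)) (span ((%q. q - p) ` s))"
  using s(3) by(rule C2_embedding_onE) blast
 obtain g' g'' where g': "!!x. x : U ==> (g has_derivative g' x) (at x)"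
  "!!h x. x : U ==> ((%y. g' y h) has_derivative g'' h x) (at x)"
  "!!h k. continuous_on U (%x. g'' h x k)" "!!h. continuous_on U (%x. g' x h)" "continuous_on U g"
  using g(3) by(rule C2mapE) blast
 define D where "D = g' p"
 have pU: "p : U" using p g(2) by blast
 have gD: "(g has_derivative D) (at p)" unfolding D_def by(rule g'(1)[OF pU])
 have linD: "linear D" by(rule has_derivative_linear[OF gD])
 have "frechet_derivative g (at p) = D" using frechet_derivative_at[OF gD] by simp
 hence injD: "inj_on D ?V" using inj_on_subset[OF g(6)[OF p] span_simplex_directions[OF s(1,2) p]] by simp
 have subV: "subspace ?V" by(rule subspace_plane)
 have subDV: "subspace (D ` ?V)" by(rule linear_subspace_image[OF linD subV])
 have dimDV: "dim ?V = dim (D ` ?V)"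
  by(rule dim_image_eq[OF linD, symmetric]) (use injD subV in "simp add: span_eq_iff[THEN iffD2]")
 obtain If Gi where I: "linear If" "linear Gi" "If ` ?V = D ` ?V" "Gi ` (D ` ?V) = ?V" "!!x. x : ?V ==> norm (If x) = norm x"
  "!!x. x : D ` ?V ==> norm (Gi x) = norm x" "!!x. x : ?V ==> Gi (If x) = x" "!!x. x : D ` ?V ==> If (Gi x) = x"
  by(rule isometries_subspaces[OF subV subDV dimDV]) blast
 obtain Dp where Dp: "range Dp <= ?V" "linear Dp" "!!v. v : ?V ==> Dp (D v) = v"
  using linear_exists_left_inverse_on[OF linD subV injD] by auto
 \<comment> \<open>Simplices lie in the plane, but the maps must be defined on the whole space: the
   coordinate projection extends them.\<close>
 define P where "P z = (\<chi> i. if i : J then z $ i else 0)" for z :: "real^'n"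
 have linP: "linear P" by(rule linearI) (auto simp: P_def vec_eq_iff)
 have PV: "P z : ?V" for z by(simp add: P_def plane_def)
 have Pid: "P z = z" if "z : ?V" for z using that by(auto simp: P_def plane_def vec_eq_iff)
 define M where "M z = If (P z)" for z
 have linM: "linear M" unfolding M_def using linear_compose[OF linP I(1)] by(simp add: o_def)
 have bM: "bounded_linear M" using linM by(simp add: linear_conv_bounded_linear)
 define L where "L z = Dp (M z)" for z
 have linL: "linear L" unfolding L_def using linear_compose[OF linM Dp(2)] by(simp add: o_def)
 have bL: "bounded_linear L" using linL by(simp add: linear_conv_bounded_linear)
 have MP: "M (P z) = M z" for z unfolding M_def Pid[OF PV] ..
 have LP: "L (P z) = L z" for z unfolding L_def MP ..
 have DL: "D (L z) = M z" for z
 proof -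
  have "If (P z) : D ` ?V" using I(3) PV by blast
  then obtain v where v: "v : ?V" "If (P z) = D v" by blast
  thus ?thesis unfolding L_def M_def using Dp(3) by simp
 qed
 define G0 where "G0 = (%z. p + L z) -` U"
 have oG0: "open G0" unfolding G0_def
  by(rule open_vimage[OF g(1)]) (intro continuous_intros linear_continuous_on bL)
 have L0: "L 0 = 0" "M 0 = 0" using linL linM by(simp_all add: linear_0)
 have zG0: "0 : G0" using pU L0 by(simp add: G0_def)
 have G0P: "z : G0" if "P z : G0" for z using that by(simp add: G0_def LP)
 define w0 where "w0 z = g (p + L z) + (- M z + - g p)" for z
 have tw0: "C2map G0 w0" unfolding w0_def G0_def
  by(intro C2map_add C2map_const C2map_linear bounded_linear_minus bM C2map_compose_affine g(3) bL)
 have w00: "w0 0 = 0" by(simp add: w0_def L0)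
 have w0P: "w0 (P z) = w0 z" for z by(simp add: w0_def LP MP)
 have dw0: "(w0 has_derivative (%_. 0)) (at 0)"
 proof -
  have 1: "((%z. p + L z) has_derivative (%z. 0 + L z)) (at 0)"
  by(intro has_derivative_add has_derivative_const bounded_linear_imp_has_derivative bL)
  have "(g has_derivative D) (at (p + L 0))" using gD L0 by simp
  from has_derivative_compose[OF 1 this] have "((%z. g (p + L z)) has_derivative (%z. D (L z))) (at 0)" by simp
  hence "(w0 has_derivative (%z. D (L z) + (- M z + 0))) (at 0)" unfolding w0_def
  by(intro has_derivative_add has_derivative_minus bounded_linear_imp_has_derivative bM has_derivative_const)
  thus ?thesis by(simp add: DL)
 qed
 \<comment> \<open>The cut-off multiplies the Lipschitz constant by \<open>C\<close>, so the
   remainder has to be flatter by this factor in advance.\<close>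
 have tC: "0 < t/C" using t C by simp
 obtain rho where rho: "0 < rho" "ball 0 rho <= G0" "!!x y. x : ball 0 rho ==> y : ball 0 rho ==> dist (w0 x) (w0 y) <= t/C*dist x y"
  by(rule small_remainder[OF tw0 oG0 zG0 dw0 tC]) blast
 let ?n = "real CARD('n)"
 define r where "r = min r0 (rho/?n)"
 have r: "0 < r" "r <= r0" "?n*r <= rho" using r0 rho(1) by(auto simp: r_def min_def field_simps)
 \<comment> \<open>The centre of the cube \<open>hcube J 0 r\<close>: the remainder is recentred
   there, so that it vanishes at a point of the cube.\<close>
 define m where "m = (\<chi> i. if i : J then r/2 else 0)"
 have mV: "m : ?V" by(simp add: m_def plane_def)
 have near: "P (z - m) : ball 0 rho" if z: "ALL i:J. 0 <= z $ i & z $ i <= r" for z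
 proof -
  have "abs(P (z - m) $ i) <= r/2" for i
  proof (cases "i : J")
  case True
  hence "0 <= z $ i" "z $ i <= r" using z by auto
  moreover have "P (z - m) $ i = z $ i - r/2" using True by(simp add: P_def m_def)
  ultimately show ?thesis by linarith
  qed (use r in "simp add: P_def")
  hence "(SUM i:UNIV. abs(P (z - m) $ i)) <= (SUM i:(UNIV :: 'n set). r/2)" by(intro sum_mono)
  hence "norm (P (z - m)) <= ?n*(r/2)" using norm_le_l1_cart[of "P (z - m)"] by simp
  also have "... < ?n*r" using r by simp
  finally show ?thesis using r(3) by simp
 qed
 define w where "w z = w0 (z - m)" for z
 define G where "G = (%z. - m + z) -` G0"
 have oG: "open G" unfolding G_def by(rule open_vimage[OF oG0]) (intro continuous_intros)
 have cG: "{z. ALL i:J. 0 <= z $ i & z $ i <= r} <= G"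
 proof
  fix z :: "real^'n" assume "z : {z. ALL i:J. 0 <= z $ i & z $ i <= r}"
  hence "P (z - m) : G0" using near rho(2) by blast
  hence "z - m : G0" by(rule G0P)
  thus "z : G" by(simp add: G_def)
 qed
 have tw: "C2map G w" unfolding G_def w_def
  using C2map_compose_affine[OF tw0, of "%x. x" "- m"] by(simp add: bounded_linear_ident vimage_def)
 have "EX W. C2map UNIV W & (ALL x:?V. ALL y:?V. dist (W x) (W y) <= C*(t/C)*dist x y) &
  (ALL x. x ~: open_cube J r --> W x = 0) &
  (ALL x. (ALL i:J. 1/4*r <= x $ i & x $ i <= (1 - 1/4)*r) --> W x = w x)"
 proof (rule gr[OF r(1) _ oG cG tw _ mV])
  show "dist (w x) (w y) <= t/C*dist x y"
  if "x : ?V" "y : ?V" "ALL i:J. 0 <= x $ i & x $ i <= r" "ALL i:J. 0 <= y $ i & y $ i <= r" for x y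
  using rho(3)[OF near[OF that(3)] near[OF that(4)]] Pid[OF plane_diff[OF that(1) mV]] Pid[OF plane_diff[OF that(2) mV]]
  by(simp add: w_def dist_norm)
  show "ALL i:J. 0 <= m $ i & m $ i <= r" using r by(simp add: m_def)
  show "w m = 0" by(simp add: w_def w00)
 qed (use tC in simp)
 then obtain W where W: "C2map UNIV W" "ALL x:?V. ALL y:?V. dist (W x) (W y) <= C*(t/C)*dist x y"
  "ALL x. x ~: open_cube J r --> W x = 0" "ALL x. (ALL i:J. 1/4*r <= x $ i & x $ i <= (1 - 1/4)*r) --> W x = w x" by blast
 have flat: "flat_map J t M W"
  unfolding flat_map_def using linM W(1,2) C I(5) by(simp add: M_def Pid)
 define Z where "Z y = Gi (D (y - p))" for y
 have bZ: "continuous_on A Z" for A unfolding Z_def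
  using linear_continuous_on_compose[OF linear_continuous_on_compose[OF _ linD] I(2), of A "%y. y - p"]
  by(simp add: continuous_on_diff continuous_on_id continuous_on_const)
 \<comment> \<open>\<open>Z y\<close> are the new parameters of \<open>y\<close>. Staying within
   \<open>r/4\<close> of the centre means staying at distance at least \<open>r/4\<close> from the
   faces, where the cut-off with margin 1/4 is identically 1.\<close>
 define O1 where "O1 = {y. ALL i:J. abs(Z y $ i) < r/4}"
 define F where "F = {y. ALL i:J. abs(Z y $ i) <= r/4}"
 have "O1 = (\<Inter>i\<in>J. {y. abs(Z y $ i) < r/4})" by(auto simp: O1_def)
 hence oO: "open O1" by(simp only:) (intro open_INT ballI open_Collect_less continuous_intros bZ; simp)
 have "F = (\<Inter>i\<in>J. {y. abs(Z y $ i) <= r/4})" by(auto simp: F_def)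
 hence cF: "closed F" by(simp only:) (intro closed_INT ballI closed_Collect_le continuous_intros bZ)
 have "Z p = 0" using linD I(2) by(simp add: Z_def linear_0)
 hence pO: "p : O1" using r by(simp add: O1_def)
 define K where "K = Phi ` (s Int F)"
 have cs: "compact s" by(rule compact_simplex[OF s(1)])
 have cont: "continuous_on s Phi" by(rule C2_embedding_on_continuous[OF s(3)])
 have cK: "compact K" unfolding K_def
  by(rule compact_continuous_image[OF continuous_on_subset[OF cont]]) (use cs cF in auto)
 define T where "T u = m + Z (the_inv_into s Phi u)" for u
 have KS: "K <= Phi ` s" by(auto simp: K_def)
 have cT: "continuous_on K T" unfolding T_def
  by(intro continuous_on_add continuous_on_const continuous_on_compose2[OF bZ[of UNIV]]
  continuous_on_subset[OF continuous_on_inv_into[OF cont cs g(5)] KS]) auto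
 have main: "T u : hcube J 0 r & (g p - M m) + (M (T u) + W (T u)) = u" if u: "u : K" for u
 proof -
  obtain y where y: "y : s" "y : F" "u = Phi y" using u by(auto simp: K_def)
  have Tu: "T u = m + Z y" using y the_inv_into_f_f[OF g(5) y(1)] by(simp add: T_def)
  have yp: "y - p : ?V" using y p s(2) by(auto intro: plane_diff)
  hence Dy: "D (y - p) : D ` ?V" by blast
  hence ZV: "Z y : ?V" unfolding Z_def using I(4) by blast
  have MZ: "M (Z y) = D (y - p)" unfolding M_def Pid[OF ZV] unfolding Z_def by(rule I(8)[OF Dy])
  have "p + L (Z y) = y" unfolding L_def MZ using Dp(3)[OF yp] by simp
  hence w0Z: "w0 (Z y) = Phi y - M (Z y) - g p" using g(4)[OF y(1)] by(simp add: w0_def)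
  have Zi: "- (r/4) <= Z y $ i" "Z y $ i <= r/4" if "i : J" for i
  using y(2) that by(auto simp: F_def abs_le_iff)
  have in4: "1/4*r <= (m + Z y) $ i & (m + Z y) $ i <= (1 - 1/4)*r" if "i : J" for i
  using Zi[OF that] that by(simp add: m_def)
  have WT: "W (m + Z y) = w0 (Z y)" using W(4) in4 by(simp add: w_def)
  have "m + Z y : hcube J 0 r"
  unfolding hcube_def
  proof (rule CollectI, intro conjI ballI allI impI)
  show "0 $ i <= (m + Z y) $ i" "(m + Z y) $ i < 0 $ i + r" if "i : J" for i using in4[OF that] r(1) by simp_all
  show "(m + Z y) $ i = 0" if "i ~: J" for i using that plane_plus[OF mV ZV] by(simp add: plane_def)
  qed
  moreover have "(g p - M m) + (M (m + Z y) + W (m + Z y)) = Phi y"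
  unfolding WT w0Z linear_add[OF linM] by simp
  ultimately show ?thesis unfolding Tu y(3)[symmetric] by blast
 qed
 have "flat_patch J t r0 K" unfolding flat_patch_def
  by(rule exI[of _ r], rule exI[of _ "g p - M m"], rule exI[of _ M], rule exI[of _ W], rule exI[of _ T])
  (use r flat W(3) cT main in blast)
 moreover have "Phi ` (s Int O1) <= K" unfolding K_def O1_def F_def by force
 ultimately show ?thesis using oO pO cK KS by blast
qed

lemma csimplex_patches:
 fixes J :: "'n::finite set"
 assumes S: "csimplex J S" and t: "0 < t" and r0: "0 < r0"
 obtains KK where "finite KK" "S <= \<Union>KK" "!!K. K : KK ==> compact K & flat_patch J t r0 K"
proof -
 obtain s Phi where s: "int (card J) simplex s" "s <= plane J" "C2_embedding_on s Phi" "S = Phi ` s"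
  using S by(rule csimplexE)
 have "ALL p:s. EX O1 K. open O1 & p : O1 & compact K & K <= Phi ` s & Phi ` (s Int O1) <= K & flat_patch J t r0 K"
  using flat_patch_at[OF s(1-3) _ t r0] by blast
 from bchoice[OF this] obtain O' where "ALL p:s. EX K. open (O' p) & p : O' p & compact K & K <= Phi ` s & Phi ` (s Int O' p) <= K & flat_patch J t r0 K"
  by(elim exE)
 from bchoice[OF this] obtain K where K': "ALL p:s. open (O' p) & p : O' p & compact (K p) & K p <= Phi ` s & Phi ` (s Int O' p) <= K p & flat_patch J t r0 (K p)"
  by(elim exE)
 note K = bspec[OF K']
 have "s <= (UN p:s. O' p)" using K by blast
 then obtain C where C: "C <= s" "finite C" "s <= (UN p:C. O' p)"
  by(rule compactE_image[OF compact_simplex[OF s(1)], rotated]) (use K in blast)+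
 show ?thesis
 proof (rule that[of "K ` C"])
  show "S <= \<Union>(K ` C)"
  proof
  fix u assume "u : S"
  then obtain y where y: "y : s" "u = Phi y" using s(4) by blast
  then obtain p where p: "p : C" "y : O' p" using C(3) by blast
  hence "Phi y : K p" using K[of p] C(1) y(1) by blast
  thus "u : \<Union>(K ` C)" using p y by blast
  qed
 qed (use C K in auto)
qed

lemma flat_map_inverse:
 fixes J :: "'n::finite set"
 assumes f: "flat_map J t I W" "t <= 1/2" and s: "compact s" "s <= plane J"
 obtains T where "T : borel \<rightarrow>\<^sub>M borel" "!!x. x : s ==> T (I x + W x) = x"
proof -
 let ?Phi = "%x. I x + W x"
 have inj: "inj_on ?Phi s" by(rule inj_on_subset[OF flat_map_inj[OF f] s(2)])
 have cont: "continuous_on s ?Phi" by(rule flat_map_continuous[OF f(1)])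
 have "compact (?Phi ` s)" by(rule compact_continuous_image[OF cont s(1)])
 hence B: "?Phi ` s : sets borel" by(simp add: borel_closed compact_imp_closed)
 define g where "g = the_inv_into s ?Phi"
 have cg: "continuous_on (?Phi ` s) g" unfolding g_def by(rule continuous_on_inv_into[OF cont s(1) inj])
 have c0: "continuous_on (- ?Phi ` s) (%u. 0 :: real^'n)" by(rule continuous_on_const)
 define T where "T u = (if u : ?Phi ` s then g u else 0)" for u
 have "T : borel_measurable borel"
  unfolding T_def using borel_measurable_continuous_on_if[OF B cg c0] by simp
 moreover have "T (?Phi x) = x" if "x : s" for x using that the_inv_into_f_f[OF inj that] by(simp add: T_def g_def)
 ultimately show ?thesis using that[of T] by blast
qed

lemma distr_cong_on:
 assumes "sets mu = sets borel" "s : sets borel" "emeasure mu (- s) = 0" "f : borel \<rightarrow>\<^sub>M borel" "g : borel \<rightarrow>\<^sub>M borel"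
  "!!x. x : s ==> f x = g x"
 shows "distr mu borel f = distr mu borel g"
proof (rule distr_cong_AE)
 have sp: "space mu = UNIV" using sets_eq_imp_space_eq[OF assms(1)] by simp
 show "AE x in mu. f x = g x"
  by(rule AE_I[of _ _ "- s"]) (use assms sp in "auto simp: borel_comp")
 show "f : mu \<rightarrow>\<^sub>M borel" "g : mu \<rightarrow>\<^sub>M borel" using assms by(simp_all cong: measurable_cong_sets)
qed simp_all

lemma wgt_distr_inverse:
 assumes mu: "sets mu = sets borel" "s : sets borel" "emeasure mu (- s) = 0" and Phi: "Phi : borel \<rightarrow>\<^sub>M borel" "T : borel \<rightarrow>\<^sub>M borel"
  and T: "!!x. x : s ==> T (Phi x) = x" and u: "u : borel_measurable borel"
 shows "wgt (distr mu borel Phi) (%x. u (T x)) = distr (wgt mu u) borel Phi"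
proof -
 have uT: "(%x. u (T x)) : borel_measurable borel" using measurable_compose[OF Phi(2) u] by simp
 have sp: "space mu = UNIV" using sets_eq_imp_space_eq[OF mu(1)] by simp
 have "wgt mu (%x. u (T (Phi x))) = wgt mu u"
 proof (rule wgt_cong_AE[OF mu(1) _ u])
  show "(%x. u (T (Phi x))) : borel_measurable borel" using measurable_compose[OF Phi(1) uT] by simp
  show "AE x in mu. u (T (Phi x)) = u x"
  by(rule AE_I[of _ _ "- s"]) (use T mu sp in "auto simp: borel_comp")
 qed
 thus ?thesis using wgt_distr[OF mu(1) Phi(1) uT] by simp
qed

lemma wgt_indicator_inverse:
 assumes mu: "sets mu = sets borel" "s : sets borel" "emeasure mu (- s) = 0" and Phi: "Phi : borel \<rightarrow>\<^sub>M borel" "T : borel \<rightarrow>\<^sub>M borel"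
  and T: "!!x. x : s ==> T (Phi x) = x" and A: "A : sets borel"
 shows "wgt (distr mu borel Phi) (indicator (T -` A)) = distr (wgt mu (indicator A)) borel Phi"
proof -
 have "(%x. indicator A (T x)) = (indicator (T -` A) :: _ => real)" by(auto simp: indicator_def fun_eq_iff)
 thus ?thesis using wgt_distr_inverse[OF mu Phi T, of "indicator A"] A by simp
qed

lemma vimage_borel: "T : borel \<rightarrow>\<^sub>M borel ==> A : sets borel ==> T -` A : sets borel"
 using measurable_sets[of T borel borel A] by simp

lemma wgt_indicator_null:
 assumes "sets mu = sets borel" "A : sets borel" "B : sets borel" "emeasure mu B = 0"
 shows "emeasure (wgt mu (indicator A)) B = 0"
proof -
 have "emeasure mu (A Int B) <= emeasure mu B" using assms by(intro emeasure_mono) auto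
 thus ?thesis using assms by(simp add: em_wgt_on)
qed

section \<open>Errors of nearly isometric images, bounded by a multiple of the mass\<close>

context positive_dimension
begin

lemma simplex_borel: "int d simplex s ==> s : sets borel" for s :: "(real^'n) set"
 by(intro borel_closed compact_imp_closed compact_simplex)

lemma carried_flat:
 fixes s :: "(real^'n) set"
 assumes s: "int d simplex s" "s <= V" and f: "flat_map J t I W" "t <= 1/2" and mu: "SD mu" "emeasure mu (- s) = 0"
 shows "carried ((%x. I x + W x) ` s) (distr mu borel (%x. I x + W x))"
proof -
 let ?Phi = "%x. I x + W x"
 have C2: "C2_embedding_on s ?Phi" by(rule flat_map_C2[OF f s(2)])
 have cs: "csimplex J (?Phi ` s)" unfolding csimplex_def using s C2 card_J by blast
 have B: "?Phi ` s : sets borel" by(rule csimplex_borel[OF cs])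
 note m = flat_map_meas[OF f(1)]
 have "SD (distr mu borel ?Phi)"
  by(rule subdens_distr[OF mu(1) m simplex_borel[OF s(1)] mu(2), where C = 2])
  (use flat_map_lower[OF f] s(2) B csimplex_hausdorff_finite[OF cs] card_J in auto)
 moreover have "emeasure (distr mu borel ?Phi) (- ?Phi ` s) = 0"
 proof -
  have "emeasure (distr mu borel ?Phi) (- ?Phi ` s) = emeasure mu (?Phi -` (- ?Phi ` s))"
  using m B SD_sets[OF mu(1)] SD_space[OF mu(1)] by(subst emeasure_distr) (auto simp: borel_comp cong: measurable_cong_sets)
  also have "... <= emeasure mu (- s)"
  using simplex_borel[OF s(1)] SD_sets[OF mu(1)] by(intro emeasure_mono) (auto simp: borel_comp)
  finally show ?thesis using mu(2) by simp
 qed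
 ultimately show ?thesis using cs by(simp add: carried_def)
qed

text \<open>Flat measures have error 0, so metric stability for the normalised measure bounds the
  error of its nearly isometric images. The threshold \<open>t\<close> depends on \<open>mu\<close>
  and \<open>s\<close>; removing this dependence is the purpose of everything up to
  \<open>flat_map_error\<close>.\<close>

lemma stability:
 fixes s :: "(real^'n) set"
 assumes s: "int d simplex s" "s <= V" and mu: "SD mu" "emeasure mu (- s) = 0" and eps: "eps > 0"
 obtains t where "0 < t" "t <= 1/2" "!!I W. flat_map J t I W ==> bd (distr mu borel (%x. I x + W x)) eps"
proof (cases "emeasure mu UNIV = 0")
 case True
 show ?thesis
 proof (rule that[of "1/2"])
  fix I W :: "real^'n => real^'n" assume f: "flat_map J (1/2) I W"
  have "SD (distr mu borel (%x. I x + W x))" using carried_flat[OF s f _ mu] by(simp add: carried_def)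
  moreover have "emeasure (distr mu borel (%x. I x + W x)) UNIV = 0"
  using True flat_map_meas[OF f] SD_sets[OF mu(1)] SD_space[OF mu(1)]
  by(subst emeasure_distr) (auto cong: measurable_cong_sets)
  ultimately have "bd (distr mu borel (%x. I x + W x)) 0" by(rule bd_null)
  thus "bd (distr mu borel (%x. I x + W x)) eps" by(rule bd_mono) (use eps in simp)
 qed simp_all
next
 case False
 obtain q m where q: "SD q" "emeasure q UNIV = 1" "0 < m" "m <= 1" "mu = wgt q (%_. m)" "q = wgt mu (%_. 1/m)"
  by(rule normalize[OF mu(1) False]) blast
 have sB: "- s : sets borel" using simplex_borel[OF s(1)] by(simp only: borel_comp)
 have qs: "emeasure q (- s) = 0" unfolding q(6) using mu sB by(simp add: em_wgt_const SD_sets)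
 have bq: "bd q 0"
  by(rule bd_flat[OF q(1) simplex_borel[OF s(1)] compact_imp_bounded[OF compact_simplex[OF s(1)]] s(2) qs])
 obtain t where t: "0 < t" "!!Phi. Phi : borel \<rightarrow>\<^sub>M borel ==> C2_embedding_on s Phi ==> SD (distr q borel Phi) ==>
  (!!x y. x : s ==> y : s ==> abs(dist (Phi x) (Phi y) - dist x y) <= t*dist x y) ==>
  EVT n. abs(h (distr q borel Phi) n - h q n) <= eps"
  by(rule stability_prob[OF s q(1,2) qs eps]) blast
 show ?thesis
 proof (rule that[of "min t (1/2)"])
  fix I W :: "real^'n => real^'n" assume f: "flat_map J (min t (1/2)) I W"
  let ?Phi = "%x. I x + W x"
  note mm = flat_map_meas[OF f]
  have c: "carried (?Phi ` s) (distr q borel ?Phi)" by(rule carried_flat[OF s f _ q(1) qs]) simp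
  have "EVT n. abs(h (distr q borel ?Phi) n - h q n) <= eps"
  proof (rule t(2)[OF mm flat_map_C2[OF f _ s(2)] carr_SD[OF c]])
  fix x y assume "x : s" "y : s"
  thus "abs(dist (?Phi x) (?Phi y) - dist x y) <= t*dist x y"
  using flat_map_dist[OF flat_map_mono[OF f, of t]] s(2) by auto
  qed simp
  hence b: "bd (distr q borel ?Phi) (0 + eps)"
  by(rule bd_near[OF bq]) (rule measure_distr_UNIV[OF SD_sets[OF q(1)] mm])
  have r: "wgt (distr q borel ?Phi) (%_. m) = distr mu borel ?Phi"
  unfolding q(5) by(rule wgt_const_distr[OF q(1) mm])
  have cmu: "carried (?Phi ` s) (distr mu borel ?Phi)" by(rule carried_flat[OF s f _ mu]) simp
  have "bd (wgt (distr q borel ?Phi) (%_. m)) (m*(0 + eps))"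
  by(rule bd_scale[OF c q(3) _ b]) (unfold r, rule carr_SD[OF cmu])
  thus "bd (distr mu borel ?Phi) eps" unfolding r
  by(rule bd_mono) (use q(3,4) eps mult_right_mono[of m 1 eps] in simp)
 qed (use t(1) in auto)
qed

text \<open>An arbitrary measure on a curved simplex is decomposed into translates of images of
 measures in small cubes under nearly isometric maps.\<close>

lemma bd_of_flat_patches:
 assumes t: "0 < t" "t <= 1/2" and r0: "0 < r0" and e: "0 <= e"
  and bd: "!!I W r nu. flat_map J t I W ==> 0 < r ==> r <= r0 ==> (ALL x. x ~: open_cube J r --> W x = 0) ==> SD nu ==>
  emeasure nu (- hcube J 0 r) = 0 ==> bd (distr nu borel (%x. I x + W x)) (e*measure nu UNIV)"
  and mu: "carried S mu"
 shows "bd mu (e*measure mu UNIV)"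
proof -
 have S: "csimplex J S" "emeasure mu (- S) = 0" using mu by(auto simp: carried_def)
 note sm = carried_sets[OF mu]
 obtain KK where K: "finite KK" "S <= \<Union>KK" "!!K. K : KK ==> compact K & flat_patch J t r0 K"
  by(rule csimplex_patches[OF S(1) t(1) r0]) blast
 obtain xs where xs: "set xs = KK" using finite_list[OF K(1)] by blast
 define f where "f i = (if i < length xs then xs ! i else {})" for i
 define A where "A = disjointed f"
 have fK: "f i : KK" if "i < length xs" for i using that xs nth_mem[OF that] by(simp add: f_def)
 have fB: "f i : sets borel" for i
 proof (cases "i < length xs")
  case True
  thus ?thesis using K(3)[OF fK[OF True]] by(simp add: borel_closed compact_imp_closed)
 qed (simp add: f_def)
 have AB: "A i : sets borel" for i unfolding A_def disjointed_def using fB by auto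
 have Af: "A i <= f i" for i unfolding A_def by(rule disjointed_subset)
 have disj: "disjoint_family_on A {..<length xs}"
  unfolding A_def by(rule disjoint_family_on_mono[OF subset_UNIV disjoint_family_disjointed])
 have UA: "(UN i:{..<length xs}. A i) = \<Union>KK"
 proof -
  have "(UN i:{0..<length xs}. A i) = (UN i:{0..<length xs}. f i)" unfolding A_def by(rule finite_UN_disjointed_eq)
  also have "... = (UN i:{0..<length xs}. xs ! i)" by(simp add: f_def)
  also have "... = \<Union>(set xs)" using nth_image[of "length xs" xs] by simp
  finally show ?thesis using xs by(simp add: lessThan_atLeast0)
 qed
 have each: "bd (wgt mu (indicator (A i))) (e*measure mu (A i))" if i: "i < length xs" for i
 proof -
  let ?K = "f i" let ?rho = "wgt mu (indicator (A i))"
  have cK: "compact ?K" and "flat_patch J t r0 ?K" using K(3)[OF fK[OF i]] by auto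
  then obtain r b I W T where p: "0 < r" "r <= r0" "flat_map J t I W" "ALL x. x ~: open_cube J r --> W x = 0" "continuous_on ?K T"
  "!!u. u : ?K ==> T u : hcube J 0 r & b + (I (T u) + W (T u)) = u" unfolding flat_patch_def by blast
  let ?Phi = "%x. I x + W x"
  note mPhi = flat_map_meas[OF p(3)]
  define T' where "T' u = (if u : ?K then T u else 0)" for u
  have mT: "T' : borel \<rightarrow>\<^sub>M borel" unfolding T'_def
  by(rule borel_measurable_continuous_on_if[OF fB p(5) continuous_on_const])
  have T': "T' u : hcube J 0 r" "b + ?Phi (T' u) = u" "T' u : V" if "u : A i" for u
  using p(6)[of u] that Af[of i] hcube_subset[of J 0 r] by(auto simp: T'_def)
  have rho: "SD ?rho" by(rule SD_restrict[OF carr_SD[OF mu] AB])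
  have cAB: "- A i : sets borel" using AB by(simp only: borel_comp)
  have rhoA: "emeasure ?rho (- A i) = 0" using AB cAB sm by(simp add: em_wgt_on)
  have sr: "sets ?rho = sets borel" using sm by simp
  let ?nu = "distr ?rho borel T'"
  \<comment> \<open>Images of Borel sets need not be Borel; as a preimage inside the compact image
    of \<open>?K\<close> this one is.\<close>
  have TA: "T' ` A i = T ` ?K Int (%x. b + ?Phi x) -` A i"
  proof
  show "T' ` A i <= T ` ?K Int (%x. b + ?Phi x) -` A i"
  proof
  fix x assume "x : T' ` A i"
  then obtain u where u: "u : A i" "x = T' u" by blast
  have "u : ?K" using u(1) Af by blast
  hence "x : T ` ?K" using u(2) by(simp add: T'_def)
  moreover have "b + ?Phi x = u" using T'(2)[OF u(1)] u(2) by simp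
  ultimately show "x : T ` ?K Int (%x. b + ?Phi x) -` A i" using u(1) by simp
  qed
  show "T ` ?K Int (%x. b + ?Phi x) -` A i <= T' ` A i"
  proof
  fix x assume x: "x : T ` ?K Int (%x. b + ?Phi x) -` A i"
  then obtain u where u: "u : ?K" "x = T u" by blast
  hence "b + ?Phi x = u" using p(6)[OF u(1)] by simp
  hence "u : A i" using x by simp
  thus "x : T' ` A i" using u by(intro image_eqI[of _ _ u]) (simp_all add: T'_def)
  qed
  qed
  have "compact (T ` ?K)" by(rule compact_continuous_image[OF p(5) cK])
  hence TK: "T ` ?K : sets borel" by(simp add: borel_closed compact_imp_closed)
  have mb: "(%x. b + ?Phi x) : borel \<rightarrow>\<^sub>M borel"
  by(intro borel_measurable_continuous_onI continuous_on_add continuous_on_const flat_map_continuous[OF p(3)])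
  have TAB: "T' ` A i : sets borel" unfolding TA by(rule sets.Int[OF TK vimage_borel[OF mb AB]])
  have sub: "T' ` A i <= hcube J 0 r" using T'(1) by blast
  have SDnu: "SD ?nu"
  proof (rule subdens_distr[OF rho mT AB rhoA, where C = 2])
  fix x y assume xy: "x : A i" "y : A i"
  have "dist x y = dist (?Phi (T' x)) (?Phi (T' y))"
  using T'(2)[OF xy(1)] T'(2)[OF xy(2)] dist_add_cancel[of b "?Phi (T' x)" "?Phi (T' y)"] by simp
  also have "... <= dist (T' x) (T' y) + t*dist (T' x) (T' y)"
  using flat_map_dist[OF p(3) T'(3)[OF xy(1)] T'(3)[OF xy(2)]] by linarith
  also have "... <= 2*dist (T' x) (T' y)" using t(2) mult_right_mono[of t 1 "dist (T' x) (T' y)"] by simp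
  finally show "dist x y <= 2*dist (T' x) (T' y)" .
  next
  show "hausdorff_outer d (T' ` A i) < \<infinity>"
  by(rule hausdorff_outer_finite) (use sub hcube_subset bounded_subset[OF hcube_bounded sub] in blast)+
  qed (use TAB in auto)
  have nu0: "emeasure ?nu (- hcube J 0 r) = 0"
  proof -
  have hc: "- hcube J 0 r : sets borel" by(simp only: borel_comp hcb)
  have "emeasure ?nu (- hcube J 0 r) = emeasure ?rho (T' -` (- hcube J 0 r))"
  using mT hc sr SD_space[OF rho] by(subst emeasure_distr) (auto cong: measurable_cong_sets)
  also have "... <= emeasure ?rho (- A i)" using cAB sr T'(1) by(intro emeasure_mono) auto
  finally show ?thesis using rhoA by simp
  qed
  have b1: "bd (distr ?nu borel ?Phi) (e*measure ?nu UNIV)" by(rule bd[OF p(3,1,2,4) SDnu nu0])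
  obtain s where s: "int d simplex s" "s <= V" "hcube J 0 r <= s" by(rule simplex_over_hcube)
  have "emeasure ?nu (- s) <= emeasure ?nu (- hcube J 0 r)"
  using s(3) hcb[of J 0 r] by(intro emeasure_mono) (auto simp: borel_comp)
  hence "emeasure ?nu (- s) = 0" using nu0 by simp
  hence SDPhi: "SD (distr ?nu borel ?Phi)" using carr_SD[OF carried_flat[OF s(1,2) p(3) t(2) SDnu]] by blast
  have "distr (distr ?nu borel ?Phi) borel ((+) b) = distr ?rho borel (%u. b + ?Phi (T' u))"
  proof -
  have mTr: "T' : ?rho \<rightarrow>\<^sub>M borel" using mT sr by(simp cong: measurable_cong_sets)
  have "distr ?nu borel ?Phi = distr ?rho borel (?Phi \<circ> T')" by(rule distr_distr[OF mPhi mTr])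
  moreover have "?Phi \<circ> T' : ?rho \<rightarrow>\<^sub>M borel" using measurable_comp[OF mTr mPhi] .
  ultimately show ?thesis using distr_distr[OF shift_meas[of b], of "?Phi \<circ> T'" ?rho] by(simp add: o_def)
  qed
  also have "... = distr ?rho borel (%u. u)"
  proof (rule distr_cong_on[OF sr AB rhoA])
  show "(%u. b + ?Phi (T' u)) : borel \<rightarrow>\<^sub>M borel" using measurable_compose[OF mT mb] .
  qed (use T'(2) in auto)
  also have "... = ?rho" using sr by(intro distr_id2) simp
  finally have eq: "distr (distr ?nu borel ?Phi) borel ((+) b) = ?rho" .
  have "bd ?rho (e*measure ?nu UNIV)" using bd_translation[OF SDPhi, of b] b1 rho unfolding eq by blast
  thus ?thesis by(simp only: measure_distr_UNIV[OF sr mT] measure_wgt_on[OF sm AB])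
 qed
 have "bd (wgt mu (indicator (UN i:{..<length xs}. A i))) (SUM i:{..<length xs}. e*measure mu (A i))"
  by(rule bd_UN[OF mu _ AB disj]) (use each in auto)
 moreover have KB: "\<Union>KK : sets borel" unfolding UA[symmetric] using AB by auto
 have "emeasure mu (- \<Union>KK) <= emeasure mu (- S)"
  using K(2) carried_borel[OF mu] sm by(intro emeasure_mono) (auto simp: borel_comp)
 hence full: "wgt mu (indicator (\<Union>KK)) = mu" using S(2) KB sm by(intro wgt_full) auto
 moreover have "(SUM i:{..<length xs}. measure mu (A i)) <= measure mu UNIV"
 proof -
  have "(SUM i:{..<length xs}. measure mu (A i)) = measure mu (UN i:{..<length xs}. A i)"
  by(rule finite_measure.finite_measure_finite_Union[OF subdens_finite[OF carr_SD[OF mu]] _ _ disj, symmetric]) (use AB sm in auto)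
  also have "... <= measure mu UNIV"
  using sm by(intro finite_measure.finite_measure_mono[OF subdens_finite[OF carr_SD[OF mu]]]) auto
  finally show ?thesis .
 qed
 ultimately show ?thesis unfolding UA full sum_distrib_left[symmetric]
  by(elim bd_mono) (use e in "auto intro: mult_left_mono")
qed

text \<open>With remainder 0 the map meets every threshold \<open>t\<close>, so the error is below
  every \<open>eps\<close>.\<close>

lemma bd_isometric_image:
 fixes s :: "(real^'n) set"
 assumes s: "int d simplex s" "s <= V" and mu: "SD mu" "emeasure mu (- s) = 0" and f: "flat_map J t I W"
 shows "bd (distr mu borel (%x. I x + 0)) 0"
proof (rule bd_closed)
 fix eps :: real assume "eps > 0"
 then obtain u where u: "0 < u" "!!I W. flat_map J u I W ==> bd (distr mu borel (%x. I x + W x)) eps"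
  by(rule stability[OF s mu]) blast
 show "bd (distr mu borel (%x. I x + 0)) (0 + eps)" using u(2)[OF flat_map_0[OF f]] u(1) by simp
qed

text \<open>If the error were not bounded by a multiple of the mass, bad pieces of mass \<open>2 powr (-k)\<close>
 with errors tending to infinity could be placed into disjoint cubes of a single simplex;
 each of them can be realised by a map that is isometric outside of its cube.\<close>

lemma local_error_bounded:
 "EX k>0. ALL I W r nu. flat_map J (1/2 ^ k) I W --> 0 < r --> r <= 1/2 ^ k --> (ALL x. x ~: open_cube J r --> W x = 0) -->
  SD nu --> emeasure nu (- hcube J 0 r) = 0 --> bd (distr nu borel (%x. I x + W x)) (4 ^ k*measure nu UNIV)"
proof (rule ccontr)
 assume contra: "~ ?thesis"
 \<comment> \<open>A counterexample of level \<open>k\<close>, normalised to mass 1 by scaling. It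
   is used at levels \<open>Suc k\<close>, where the constants are at most 1/2.\<close>
 define P where "P k = (%(I, W, r, q). flat_map J (1/2 ^ k) I W & 0 < r & r <= 1/2 ^ k & (ALL x. x ~: open_cube J r --> W x = 0) &
  SD q & emeasure q UNIV = 1 & emeasure q (- hcube J 0 r) = 0 & ~ bd (distr q borel (%x. I x + W x)) (4 ^ k))" for k :: nat
 have ex: "EX X. P (Suc k) X" for k
 proof -
  obtain I W r nu where w: "flat_map J (1/2 ^ Suc k) I W" "0 < r" "r <= 1/2 ^ Suc k" "ALL x. x ~: open_cube J r --> W x = 0"
  "SD nu" "emeasure nu (- hcube J 0 r) = 0" "~ bd (distr nu borel (%x. I x + W x)) (4 ^ Suc k*measure nu UNIV)"
  using contra by blast
  let ?Phi = "%x. I x + W x"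
  have half: "1/2 ^ Suc k <= (1/2 :: real)" by(simp add: field_simps)
  note m = flat_map_meas[OF w(1)]
  obtain s where s: "int d simplex s" "s <= V" "hcube J 0 r <= s" by(rule simplex_over_hcube)
  have null_s: "emeasure tau (- s) = 0" if "sets tau = sets borel" "emeasure tau (- hcube J 0 r) = 0" for tau
  proof -
  have "emeasure tau (- s) <= emeasure tau (- hcube J 0 r)"
  using s(3) hcb[of J 0 r] that(1) by(intro emeasure_mono) (auto simp: borel_comp)
  thus ?thesis using that(2) by simp
  qed
  have SDPhi: "carried (?Phi ` s) (distr tau borel ?Phi)" if "SD tau" "emeasure tau (- hcube J 0 r) = 0" for tau
  by(rule carried_flat[OF s(1,2) w(1) half that(1) null_s[OF SD_sets[OF that(1)] that(2)]])
  have ne: "emeasure nu UNIV ~= 0"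
  proof
  assume z: "emeasure nu UNIV = 0"
  have "emeasure (distr nu borel ?Phi) UNIV = 0"
  using z m SD_sets[OF w(5)] SD_space[OF w(5)] by(subst emeasure_distr) (auto cong: measurable_cong_sets)
  hence "bd (distr nu borel ?Phi) 0" by(rule bd_null[OF carr_SD[OF SDPhi[OF w(5,6)]]])
  hence "bd (distr nu borel ?Phi) (4 ^ Suc k*measure nu UNIV)" by(rule bd_mono) simp
  thus False using w(7) by blast
  qed
  obtain q m' where q: "SD q" "emeasure q UNIV = 1" "0 < m'" "m' <= 1" "nu = wgt q (%_. m')" "q = wgt nu (%_. 1/m')" "m' = measure nu UNIV"
  by(rule normalize[OF w(5) ne]) blast
  have hc: "- hcube J 0 r : sets borel" by(simp only: borel_comp hcb)
  have q0: "emeasure q (- hcube J 0 r) = 0" unfolding q(6) using w(6) hc SD_sets[OF w(5)] by(simp add: em_wgt_const)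
  have "~ bd (distr q borel ?Phi) (4 ^ Suc k)"
  proof
  assume b: "bd (distr q borel ?Phi) (4 ^ Suc k)"
  have r: "wgt (distr q borel ?Phi) (%_. m') = distr nu borel ?Phi"
  unfolding q(5) by(rule wgt_const_distr[OF q(1) m])
  have "bd (wgt (distr q borel ?Phi) (%_. m')) (m'*4 ^ Suc k)"
  by(rule bd_scale[OF SDPhi[OF q(1) q0] q(3) _ b]) (unfold r, rule carr_SD[OF SDPhi[OF w(5,6)]])
  hence "bd (distr nu borel ?Phi) (m'*4 ^ Suc k)" unfolding r .
  thus False using w(7) by(simp add: q(7)[symmetric] mult.commute)
  qed
  hence "P (Suc k) (I, W, r, q)" unfolding P_def using w(1-4) q(1,2) q0 by simp
  thus ?thesis by blast
 qed
 have "ALL k. EX X. P (Suc k) X" by(rule allI) (rule ex)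
 from choice[OF this] obtain X where X: "ALL k. P (Suc k) (X k)" by(elim exE)
 define I where "I k = fst (X k)" for k
 define W where "W k = fst (snd (X k))" for k
 define r where "r k = fst (snd (snd (X k)))" for k
 define q where "q k = snd (snd (snd (X k)))" for k
 have "P (Suc k) (I k, W k, r k, q k)" for k using X by(simp add: I_def W_def r_def q_def)
 hence fm: "flat_map J (1/2 ^ Suc k) (I k) (W k)" and r: "0 < r k" "r k <= 1/2 ^ Suc k" and W0: "!!x. x ~: open_cube J (r k) ==> W k x = 0"
  and q: "SD (q k)" "emeasure (q k) UNIV = 1" "emeasure (q k) (- hcube J 0 (r k)) = 0"
  and bad: "~ bd (distr (q k) borel (%x. I k x + W k x)) (4 ^ Suc k)" for k
  unfolding P_def by auto
 have half: "1/2 ^ Suc k <= (1/2 :: real)" for k by(simp add: field_simps)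
 obtain i0 where i0: "i0 : J" using d_pos card_J by(metis card.empty ex_in_conv less_numeral_extra(3))
 \<comment> \<open>Along the coordinate \<open>i0\<close> the cubes occupy the disjoint intervals
   from \<open>2/2 ^ Suc k\<close> to \<open>3/2 ^ Suc k\<close>, which have room for the sides
   \<open>r k\<close>.\<close>
 define c :: "nat => real^'n" where "c k = (\<chi> i. if i = i0 then 2/2 ^ Suc k else 0)" for k
 have cV: "c k : V" for k using i0 by(auto simp: c_def plane_def)
 define b where "b k = hcube J (c k) (r k)" for k
 have bB: "b k : sets borel" for k unfolding b_def by(rule hcb)
 have cbB: "- b k : sets borel" for k using bB by(simp only: borel_comp)
 have b_i0: "2/2 ^ Suc k <= x $ i0" "x $ i0 < 3/2 ^ Suc k" if "x : b k" for x k
 proof -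
  have "c k $ i0 <= x $ i0" "x $ i0 < c k $ i0 + r k" using that i0 by(auto simp: b_def hcube_def)
  moreover have "c k $ i0 = 2/2 ^ Suc k" by(simp add: c_def)
  moreover have "3/2 ^ Suc k = 2/2 ^ Suc k + 1/(2 :: real) ^ Suc k" by(simp add: add_divide_distrib[symmetric])
  ultimately show "2/2 ^ Suc k <= x $ i0" "x $ i0 < 3/2 ^ Suc k" using r(2)[of k] by linarith+
 qed
 have b_lt: False if "x : b k" "x : b l" "k < l" for x k l
 proof -
  have "(2::real) ^ Suc (Suc k) <= 2 ^ Suc l" using that(3) by(intro power_increasing) auto
  hence "3/2 ^ Suc l <= 3/(2::real) ^ Suc (Suc k)" by(intro divide_left_mono) auto
  also have "... <= 2/2 ^ Suc k" by(simp add: field_simps)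
  finally show False using b_i0(2)[OF that(2)] b_i0(1)[OF that(1)] by linarith
 qed
 have b_disj: "k = l" if "x : b k" "x : b l" for x k l using b_lt[OF that] b_lt[OF that(2,1)] by(metis linorder_neqE_nat)
 obtain s where s: "int d simplex s" "s <= V" "hcube J 0 4 <= s" by(rule simplex_over_hcube)
 have r1: "r k <= 1" for k using r(2)[of k] half[of k] by linarith
 have bs: "b k <= s" for k
 proof -
  have "c k $ i >= 0" "c k $ i + r k <= 4" for i
  proof -
  have k1: "1/(2::real) ^ k <= 1" and k2: "0 <= 1/(2::real) ^ k" by simp_all
  have ck: "c k $ i = 1/2 ^ k | c k $ i = 0" by(simp add: c_def)
  thus "c k $ i >= 0" using k2 by linarith
  show "c k $ i + r k <= 4" using ck k1 r1[of k] by linarith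
  qed
  hence "b k <= hcube J 0 4" unfolding b_def hcube_def by(auto intro: order_trans less_le_trans)
  thus ?thesis using s(3) by blast
 qed
 have hs: "hcube J 0 (r k) <= s" for k using s(3) r1[of k] unfolding hcube_def by force
 have null_s: "emeasure tau (- s) = 0" if "sets tau = sets borel" "emeasure tau (- Y) = 0" "Y <= s" "Y : sets borel" for tau :: "(real^'n) measure" and Y
 proof -
  have "emeasure tau (- s) <= emeasure tau (- Y)" using that by(intro emeasure_mono) (auto simp: borel_comp)
  thus ?thesis using that(2) by simp
 qed
 define p where "p k = distr (q k) borel ((+) (c k))" for k
 have qs: "emeasure (q k) (- s) = 0" for k by(rule null_s[OF SD_sets[OF q(1)] q(3) hs hcb])
 have "csimplex J s" using simplex_curved[of J s] s(1,2) card_J by simp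
 hence "carried s (q k)" for k using q(1) qs by(simp add: carried_def)
 hence p: "SD (p k)" for k unfolding p_def by(intro carr_SD[OF carried_translation])
 have p1: "emeasure (p k) UNIV = 1" for k
  unfolding p_def using shift_meas[of "c k"] SD_sets[OF q(1)] SD_space[OF q(1)] q(2)
  by(subst emeasure_distr) (auto cong: measurable_cong_sets)
 have pb: "emeasure (p k) (- b k) = 0" for k
 proof -
  have "(+) (c k) -` (- b k) = - hcube J 0 (r k)"
  using cV[of k] by(auto simp: b_def hcube_def plane_def)
  thus ?thesis unfolding p_def
  using shift_meas[of "c k"] SD_sets[OF q(1)] SD_space[OF q(1)] q(3)[of k] cbB
  by(subst emeasure_distr) (auto cong: measurable_cong_sets)
 qed
 have "ALL k. EX g. g : borel_measurable borel & (ALL x. 0 <= g x) & p k = density (hausdorff d) (%x. ennreal (g x))"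
  using p unfolding subdens_def by blast
 from choice[OF this] obtain g where g: "!!k. g k : borel_measurable borel" "!!k x. 0 <= g k x" "!!k. p k = density (hausdorff d) (%x. ennreal (g k x))"
  by blast
 define a :: "nat => real" where "a k = (1/2) ^ Suc k" for k
 have a: "0 < a k" for k by(simp add: a_def)
 define F where "F k x = a k*(g k x*indicator (b k) x)" for k x
 have mF: "F k : borel_measurable borel" for k unfolding F_def using g(1) bB by measurable
 have F0: "0 <= F k x" for k x using g(2) a[of k] by(simp add: F_def)
 define G where "G x = (\<Sum>k. F k x)" for x
 have mG: "G : borel_measurable borel" unfolding G_def by(intro borel_measurable_suminf mF)
 have Fz: "F l x = 0" if "x : b k" "l ~= k" for l k x using b_disj[OF that(1), of l] that(2) by(auto simp: F_def indicator_def)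
 have Gb: "G x = F k x" if "x : b k" for k x
  unfolding G_def using suminf_finite[of "{k}" "%l. F l x"] Fz[OF that] by simp
 have Gn: "F k x = 0" "G x = 0" if "x ~: (\<Union>k. b k)" for x k
 proof -
  show F: "F k x = 0" for k using that by(simp add: F_def)
  show "G x = 0" unfolding G_def by(simp add: F)
 qed
 have G0: "0 <= G x" for x using Gb[of x] Gn(2)[of x] F0 by(cases "x : (\<Union>k. b k)") auto
 have eG: "ennreal (G x) = (\<Sum>k. ennreal (F k x))" for x
 proof (cases "x : (\<Union>k. b k)")
  case True
  then obtain k where k: "x : b k" by blast
  show ?thesis using suminf_finite[of "{k}" "%l. ennreal (F l x)"] Fz[OF k] Gb[OF k] by simp
 qed (use Gn in simp)
 define mu where "mu = density (hausdorff d) (%x. ennreal (G x))"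
 have "emeasure mu UNIV = (\<integral>\<^sup>+x. ennreal (G x) \<partial>hausdorff d)" unfolding mu_def using mG by(subst emeasure_density) auto
 also have "... = (\<Sum>k. \<integral>\<^sup>+x. ennreal (F k x) \<partial>hausdorff d)" unfolding eG using mF by(intro nn_integral_suminf) auto
 also have "... <= (\<Sum>k. ennreal (a k))"
 proof (rule suminf_le)
  fix k
  have "(\<integral>\<^sup>+x. ennreal (F k x) \<partial>hausdorff d) <= (\<integral>\<^sup>+x. ennreal (a k)*ennreal (g k x) \<partial>hausdorff d)"
  using g(2) a[of k] by(intro nn_integral_mono) (auto simp: F_def indicator_def ennreal_mult[symmetric])
  also have "... = ennreal (a k)*(\<integral>\<^sup>+x. ennreal (g k x) \<partial>hausdorff d)" using g(1) by(intro nn_integral_cmult) auto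
  also have "(\<integral>\<^sup>+x. ennreal (g k x) \<partial>hausdorff d) = emeasure (p k) UNIV" unfolding g(3) using g(1) by(subst emeasure_density) auto
  finally show "(\<integral>\<^sup>+x. ennreal (F k x) \<partial>hausdorff d) <= ennreal (a k)" using p1 by simp
 qed auto
 also have "... = ennreal 1" unfolding a_def by(rule suminf_ennreal_eq[OF _ power_half_series]) simp
 finally have SDmu: "SD mu" unfolding subdens_def mu_def using mG G0 by auto
 note smu = SD_sets[OF SDmu]
 have csB: "- s : sets borel" using simplex_borel[OF s(1)] by(simp only: borel_comp)
 have mus: "emeasure mu (- s) = 0"
 proof -
  have "emeasure mu (- s) = (\<integral>\<^sup>+x. ennreal (G x)*indicator (- s) x \<partial>hausdorff d)"
  unfolding mu_def using mG csB by(intro emeasure_density) auto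
  also have "... = (\<integral>\<^sup>+x. 0 \<partial>(hausdorff d :: (real^'n) measure))"
  proof (rule nn_integral_cong)
  fix x
  show "ennreal (G x)*indicator (- s) x = 0"
  proof (cases "x : s")
  case False
  hence "x ~: (\<Union>k. b k)" using bs by blast
  thus ?thesis using Gn(2) by simp
  qed simp
  qed
  finally show ?thesis by simp
 qed
 have mub: "wgt mu (indicator (b k)) = wgt (p k) (%_. a k)" for k
 proof -
  have "wgt mu (indicator (b k)) = density (hausdorff d) (%x. ennreal (G x*indicator (b k) x))"
  unfolding mu_def using mG G0 bB by(intro wgt_density) auto
  also have "(%x. G x*indicator (b k) x) = (%x. g k x*indicator (b k) x*a k)"
  using Gb by(auto simp: F_def indicator_def fun_eq_iff)
  also have "density (hausdorff d) (%x. ennreal (g k x*indicator (b k) x*a k)) = wgt (density (hausdorff d) (%x. ennreal (g k x*indicator (b k) x))) (%_. a k)"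
  using g(1,2) bB a[of k] by(intro wgt_density[symmetric]) auto
  also have "density (hausdorff d) (%x. ennreal (g k x*indicator (b k) x)) = wgt (p k) (indicator (b k))"
  unfolding g(3) using g(1,2) bB by(intro wgt_density[symmetric]) auto
  also have "... = p k" by(rule wgt_full[OF SD_sets[OF p] bB pb])
  finally show ?thesis .
 qed
 \<comment> \<open>Stability is used once, for the measure \<open>mu\<close> that contains all bad
   pieces; a level \<open>k\<close> is then chosen whose map meets the threshold.\<close>
 obtain t where t: "0 < t" "t <= 1/2" "!!I W. flat_map J t I W ==> bd (distr mu borel (%x. I x + W x)) 1"
  by(rule stability[OF s(1,2) SDmu mus, of 1]) auto
 obtain k where k: "(1/2) ^ k < t" using real_arch_pow_inv[OF t(1), of "1/2"] by auto
 have "1/2 ^ Suc k <= (1/2 :: real) ^ k" by(simp add: power_one_over field_simps)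
 hence kt: "1/2 ^ Suc k <= t" using k by linarith
 \<comment> \<open>The bad map of level \<open>k\<close>, moved to its cube. Off the cube the
   remainder is 0, so one nearly isometric map of the whole simplex realises it.\<close>
 define W' where "W' x = W k (x - c k) - 0" for x
 have f': "flat_map J t (I k) W'" unfolding W'_def
  by(rule flat_map_mono[OF flat_map_shift[OF fm cV] kt])
 let ?Psi = "%x. I k x + W' x"
 note mPsi = flat_map_meas[OF f']
 have cPsi: "carried (?Psi ` s) (distr mu borel ?Psi)" by(rule carried_flat[OF s(1,2) f' t(2) SDmu mus])
 obtain T where T: "T : borel \<rightarrow>\<^sub>M borel" "!!x. x : s ==> T (?Psi x) = x"
  by(rule flat_map_inverse[OF f' t(2) compact_simplex[OF s(1)] s(2)]) blast
 have inv: "wgt (distr mu borel ?Psi) (indicator (T -` A)) = distr (wgt mu (indicator A)) borel ?Psi"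
  if "A : sets borel" for A
  by(rule wgt_indicator_inverse[OF smu simplex_borel[OF s(1)] mus mPsi T(1) _ that]) (rule T(2))
 let ?A = "T -` b k" and ?B = "T -` (- b k)"
 have full: "wgt (distr mu borel ?Psi) (indicator (?A Un ?B)) = distr mu borel ?Psi"
 proof -
  have "?A Un ?B = UNIV" by blast
  moreover have "wgt (distr mu borel ?Psi) (indicator UNIV) = distr mu borel ?Psi"
  by(rule wgt_full) auto
  ultimately show ?thesis by(simp only:)
 qed
 \<comment> \<open>Off the cube the map is isometric and the error is 0, so the whole error, at most
   1, is inherited by the piece in the cube.\<close>
 have "bd (wgt (distr mu borel ?Psi) (indicator ?B)) 0"
 proof -
  let ?tau = "wgt mu (indicator (- b k))"
  have tau: "SD ?tau" by(rule SD_restrict[OF SDmu cbB])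
  have taus: "emeasure ?tau (- s) = 0" by(rule wgt_indicator_null[OF smu cbB csB mus])
  have sb: "s - b k : sets borel" using simplex_borel[OF s(1)] bB by auto
  have e: "distr ?tau borel ?Psi = distr ?tau borel (%x. I k x + 0)"
  proof (rule distr_cong_on[OF _ sb _ mPsi flat_map_meas[OF flat_map_0[OF fm order_refl]]])
  show "sets ?tau = sets borel" using smu by simp
  have "- b k Int - (s - b k) <= - s" by blast
  hence "emeasure mu (- b k Int - (s - b k)) <= emeasure mu (- s)" using csB smu by(intro emeasure_mono) auto
  moreover have "- (s - b k) : sets borel" using sb by(simp only: borel_comp)
  ultimately show "emeasure ?tau (- (s - b k)) = 0" using mus by(simp add: em_wgt_on[OF smu cbB])
  fix x assume x: "x : s - b k"
  have "x - c k ~: open_cube J (r k)"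
  proof
  assume o: "x - c k : open_cube J (r k)"
  have "x : V" using x s(2) by blast
  hence "x : b k" using o by(auto simp: b_def hcube_def open_cube_def plane_def less_imp_le algebra_simps)
  thus False using x by blast
  qed
  thus "I k x + W' x = I k x + 0" by(simp add: W'_def W0)
  qed
  have "bd (distr ?tau borel (%x. I k x + 0)) 0" by(rule bd_isometric_image[OF s(1,2) tau taus fm])
  thus ?thesis unfolding inv[OF cbB] e .
 qed
 hence "bd (wgt (distr mu borel ?Psi) (indicator ?A)) (1 + 0)"
  by(intro bd_Diff[OF cPsi vimage_borel[OF T(1) bB] vimage_borel[OF T(1) cbB]]) (use t(3)[OF f'] full in auto)
 hence bA: "bd (distr (wgt (p k) (%_. a k)) borel ?Psi) 1" unfolding inv[OF bB] mub by simp
 have rp: "distr (wgt (p k) (%_. a k)) borel ?Psi = wgt (distr (p k) borel ?Psi) (%_. a k)"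
  by(rule wgt_const_distr[OF p mPsi, symmetric])
 have ps: "emeasure (p k) (- s) = 0" by(rule null_s[OF SD_sets[OF p] pb bs bB])
 have cp: "carried (?Psi ` s) (distr (p k) borel ?Psi)" by(rule carried_flat[OF s(1,2) f' t(2) p ps])
 have "SD (wgt (distr (p k) borel ?Psi) (%_. a k))"
  using carr_SD[OF carried_restrict[OF cPsi vimage_borel[OF T(1) bB[of k]]]] unfolding inv[OF bB[of k]] mub rp .
 hence "bd (distr (p k) borel ?Psi) (1/a k)"
  using bd_scale_iff[OF cp a[of k], of "1/a k"] bA unfolding rp using a[of k] by simp
 moreover have "distr (p k) borel ?Psi = distr (distr (q k) borel (%x. I k x + W k x)) borel ((+) (I k (c k)))"
 proof -
  have mc: "(+) (c k) : q k \<rightarrow>\<^sub>M borel" using shift_meas[of "c k"] SD_sets[OF q(1)] by(simp cong: measurable_cong_sets)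
  have mk: "(%x. I k x + W k x) : q k \<rightarrow>\<^sub>M borel" using flat_map_meas[OF fm] SD_sets[OF q(1)] by(simp cong: measurable_cong_sets)
  have lin: "linear (I k)" using fm[of k] by(simp add: flat_map_def)
  have "?Psi \<circ> (+) (c k) = (+) (I k (c k)) \<circ> (%x. I k x + W k x)"
  by(auto simp: fun_eq_iff W'_def linear_add[OF lin])
  thus ?thesis unfolding p_def
  using distr_distr[OF mPsi mc] distr_distr[OF shift_meas[of "I k (c k)"] mk] by simp
 qed
 moreover have "SD (distr (q k) borel (%x. I k x + W k x))"
  by(rule carr_SD[OF carried_flat[OF s(1,2) fm half q(1) qs]])
 ultimately have "bd (distr (q k) borel (%x. I k x + W k x)) (1/a k)"
  using bd_translation[of "distr (q k) borel (%x. I k x + W k x)" "I k (c k)"] carr_SD[OF cp] by simp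
 \<comment> \<open>Undoing the weight \<open>a k\<close> turns the error 1 into
   \<open>2 ^ Suc k\<close>, below the \<open>4 ^ Suc k\<close> that the bad piece was assumed to
   exceed.\<close>
 moreover have "1/a k <= 4 ^ Suc k"
 proof -
  have "1/a k = 2 ^ Suc k" by(simp add: a_def power_one_over)
  also have "... <= 4 ^ Suc k" by(rule power_mono) simp_all
  finally show ?thesis .
 qed
 ultimately show False using bad[of k] bd_mono by blast
qed

lemma error_bounded:
 obtains e where "0 <= e" "!!S mu. carried S mu ==> bd mu (e*measure mu UNIV)"
proof -
 obtain k where k: "0 < k" "!!I W r nu. flat_map J (1/2 ^ k) I W ==> 0 < r ==> r <= 1/2 ^ k ==> (ALL x. x ~: open_cube J r --> W x = 0) ==>
  SD nu ==> emeasure nu (- hcube J 0 r) = 0 ==> bd (distr nu borel (%x. I x + W x)) (4 ^ k*measure nu UNIV)"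
  using local_error_bounded by blast
 have "(2::real) ^ 1 <= 2 ^ k" using k(1) by(intro power_increasing) auto
 hence h: "1/2 ^ k <= (1/2 :: real)" by(simp add: field_simps)
 show ?thesis
 proof (rule that[of "4 ^ k"])
  show "bd mu (4 ^ k*measure mu UNIV)" if "carried S mu" for S mu
  by(rule bd_of_flat_patches[OF _ h _ _ k(2) that, where ?r0.0 = "1/2 ^ k"]) auto
 qed simp
qed

end

section \<open>Arbitrarily small relative errors by tiling\<close>

context positive_dimension
begin

lemma h_UN:
 assumes mu: "carried S mu" and "finite I" "!!i. i : I ==> A i : sets borel" "disjoint_family_on A I"
 shows "((%n. h (wgt mu (indicator (UN i:I. A i))) n - (SUM i:I. h (wgt mu (indicator (A i))) n)) \<longlongrightarrow> 0) at_top"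
 using assms(2-)
proof (induction I)
 case empty
 have "(h (wgt mu (indicator {})) \<longlongrightarrow> 0) at_top"
  by(rule h_null[OF SD_restrict[OF carr_SD[OF mu]]]) (auto simp: em_wgt_on carried_sets[OF mu])
 thus ?case by(simp only: UN_empty sum.empty diff_0_right)
next
 case (insert i I)
 let ?U = "UN j:I. A j"
 have IH: "((%n. h (wgt mu (indicator ?U)) n - (SUM j:I. h (wgt mu (indicator (A j))) n)) \<longlongrightarrow> 0) at_top"
  by(rule insert.IH) (use insert in "auto simp: disjoint_family_on_def")
 have dj: "A i Int ?U = {}" using insert(2,5) by(auto simp: disjoint_family_on_def)
 have UB: "?U : sets borel" using insert by auto
 have AB: "A i : sets borel" using insert by auto
 have "((%n. (h (wgt mu (indicator (A i Un ?U))) n - h (wgt mu (indicator (A i))) n - h (wgt mu (indicator ?U)) n)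
  + (h (wgt mu (indicator ?U)) n - (SUM j:I. h (wgt mu (indicator (A j))) n))) \<longlongrightarrow> 0 + 0) at_top"
  by(rule tendsto_add[OF h_Borel_additive[OF mu AB UB dj] IH])
 thus ?case using insert(1,2) by(simp add: algebra_simps)
qed

text \<open>The translated remainders have disjoint supports, so at most one of them is nonzero at
  each point. In the difference of two points at most two summands survive, which is the factor
  2.\<close>

lemma tiled_map:
 fixes W0 :: "real^'n => real^'n"
 assumes f: "flat_map J t I W0" and t: "0 <= t" and N: "N > 0" and W0: "!!x. x ~: open_cube J (1/real N) ==> W0 x = 0"
  and Wt: "!!x. Wt x = (SUM k:PiE J (%_. {..<N}). W0 (x - c k))"
  and c: "!!k. c k = (\<chi> i. if i : J then real (k i)/real N else 0)"
 shows "flat_map J (2*t) I Wt"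
  and "!!k y. k : PiE J (%_. {..<N}) ==> y : hcube J 0 (1/real N) ==> Wt (c k + y) = W0 y"
proof -
 let ?Z = "PiE J (%_. {..<N})" and ?r = "1/real N"
 have fZ: "finite ?Z" by(intro finite_PiE) auto
 have r: "0 < ?r" using N by simp
 have sep: "real a/real N + ?r <= real b/real N" if "a < b" for a b :: nat
 proof -
  have "real a + 1 <= real b" using that by linarith
  thus ?thesis using N by(simp add: add_divide_distrib[symmetric] divide_right_mono)
 qed
 have uniq: "k = l" if kl: "k : ?Z" "l : ?Z" and x: "ALL i:J. 0 < (x - c k) $ i & (x - c k) $ i < ?r" "ALL i:J. 0 <= (x - c l) $ i & (x - c l) $ i < ?r" for k l x
 proof (rule PiE_ext[OF kl])
  fix i assume i: "i : J"
  have "0 < x $ i - real (k i)/real N" "x $ i - real (k i)/real N < ?r"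
  "0 <= x $ i - real (l i)/real N" "x $ i - real (l i)/real N < ?r"
  using x i by(auto simp: c)
  thus "k i = l i" using sep[of "k i" "l i"] sep[of "l i" "k i"] by(cases "k i" "l i" rule: linorder_cases) linarith+
 qed
 have V: "c k : V" for k by(simp add: c plane_def)
 have tw: "C2map UNIV (%x. W0 (x - c k))" and lip: "!!x y. x : V ==> y : V ==> dist (W0 (x - c k)) (W0 (y - c k)) <= t*dist x y" for k
  using flat_map_shift[OF f V[of k], of 0] by(auto simp: flat_map_def)
 have "C2map UNIV Wt" unfolding Wt[abs_def] by(rule C2map_sum[OF fZ tw])
 moreover have "dist (Wt x) (Wt y) <= 2*t*dist x y" if xy: "x : V" "y : V" for x y
 proof -
  define A where "A z = {k : ?Z. z - c k : open_cube J ?r}" for z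
  have A1: "card (A z) <= 1" for z
  proof -
  have "a = b" if "a : A z" "b : A z" for a b
  by(rule uniq[of a b z]) (use that in "auto simp: A_def open_cube_def less_imp_le")
  thus ?thesis by(intro card_le_Suc0_iff_eq[THEN iffD2, folded One_nat_def]) (use fZ in "auto simp: A_def")
  qed
  let ?D = "%k. W0 (x - c k) - W0 (y - c k)"
  have sub: "A x Un A y <= ?Z" by(auto simp: A_def)
  have "Wt x - Wt y = (SUM k:?Z. ?D k)" by(simp add: Wt sum_subtractf)
  also have "... = (SUM k:A x Un A y. ?D k)"
  by(rule sum.mono_neutral_right[OF fZ sub]) (auto simp: A_def W0)
  finally have "norm (Wt x - Wt y) <= (SUM k:A x Un A y. norm (?D k))" by(simp only: norm_sum)
  also have "... <= (SUM k:A x Un A y. t*dist x y)"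
  by(intro sum_mono) (use lip[OF xy] in "simp add: dist_norm")
  also have "... = real (card (A x Un A y))*(t*dist x y)" by simp
  also have "... <= 2*(t*dist x y)"
  proof (rule mult_right_mono)
  have "card (A x Un A y) <= card (A x) + card (A y)" by(rule card_Un_le)
  thus "real (card (A x Un A y)) <= 2" using A1[of x] A1[of y] by linarith
  qed (use t in simp)
  finally show ?thesis by(simp add: dist_norm)
 qed
 ultimately show "flat_map J (2*t) I Wt" using f by(simp add: flat_map_def)
 fix k y assume k: "k : ?Z" and y: "y : hcube J 0 ?r"
 have "Wt (c k + y) = (SUM l:?Z. W0 (c k + y - c l))" by(rule Wt)
 also have "... = (SUM l:{k}. W0 (c k + y - c l))"
 proof (rule sum.mono_neutral_right[OF fZ])
  show "ALL l:?Z - {k}. W0 (c k + y - c l) = 0"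
  proof
  fix l assume l: "l : ?Z - {k}"
  have "c k + y - c l ~: open_cube J ?r"
  proof
  assume o: "c k + y - c l : open_cube J ?r"
  have "l = k" by(rule uniq[of l k "c k + y"]) (use l k o y in "auto simp: open_cube_def hcube_def")
  thus False using l by simp
  qed
  thus "W0 (c k + y - c l) = 0" by(rule W0)
  qed
 qed (use k in auto)
 finally show "Wt (c k + y) = W0 y" by simp
qed

lemma hcube_1_tiling:
 assumes "N > 0"
 shows "(UN k:PiE J (%_. {..<N}). hcube J (\<chi> i. if i : J then real (k i)/real N else 0) (1/real N)) = hcube J (0 :: real^'n) 1"
  (is "(UN k:?Z. ?b k) = ?Q")
 and "disjoint_family_on (%k. hcube J (\<chi> i. if i : J then real (k i)/real N else 0) (1/real N) :: (real^'n) set) (PiE J (%_. {..<N}))"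
proof -
 have ks: "real k/real N <= y & y < real k/real N + 1/real N \<longleftrightarrow> \<lfloor>real N*y\<rfloor> = int k" for k y
  using assms by(simp add: floor_eq_iff field_simps)
 show "(UN k:?Z. ?b k) = ?Q"
 proof
  show "(UN k:?Z. ?b k) <= ?Q"
  proof
  fix y assume "y : (UN k:?Z. ?b k)"
  then obtain k where k: "k : ?Z" "y : ?b k" by blast
  have "0 <= y $ i & y $ i < 1" if i: "i : J" for i
  proof -
  have "k i < N" using k(1) i by auto
  hence "real (k i) + 1 <= real N" by linarith
  hence "real (k i)/real N + 1/real N <= 1" using assms by(simp add: add_divide_distrib[symmetric])
  moreover have "real (k i)/real N <= y $ i" "y $ i < real (k i)/real N + 1/real N" using k(2) i by(auto simp: hcube_def)
  moreover have "0 <= real (k i)/real N" by simp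
  ultimately show ?thesis by linarith
  qed
  thus "y : ?Q" using k(2) by(auto simp: hcube_def)
  qed
  show "?Q <= (UN k:?Z. ?b k)"
  proof
  fix y assume y: "y : ?Q"
  define k where "k = (\<lambda>i\<in>J. nat \<lfloor>real N*y $ i\<rfloor>)"
  have k: "int (k i) = \<lfloor>real N*y $ i\<rfloor>" "k i < N" if i: "i : J" for i
  proof -
  have y': "0 <= y $ i" "y $ i < 1" using y i by(auto simp: hcube_def)
  hence "0 <= \<lfloor>real N*y $ i\<rfloor>" by simp
  moreover have "real N*y $ i < real N" using y' assms by simp
  hence "\<lfloor>real N*y $ i\<rfloor> < int N" by(simp add: floor_less_iff)
  ultimately show "int (k i) = \<lfloor>real N*y $ i\<rfloor>" "k i < N" using i by(auto simp: k_def nat_less_iff)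
  qed
  have "k : ?Z" using k(2) by(auto simp: k_def)
  moreover have "y : ?b k" using y k(1) ks by(auto simp: hcube_def)
  ultimately show "y : (UN k:?Z. ?b k)" by blast
  qed
 qed
 show "disjoint_family_on ?b ?Z" unfolding disjoint_family_on_def
 proof (intro ballI impI)
  fix k l assume kl: "k : ?Z" "l : ?Z" "k ~= l"
  show "?b k Int ?b l = {}"
  proof (rule ccontr)
  assume "~ ?thesis"
  then obtain y where y: "y : ?b k" "y : ?b l" by blast
  have "k = l"
  proof (rule PiE_ext[OF kl(1,2)])
  fix i assume "i : J"
  hence "\<lfloor>real N*y $ i\<rfloor> = int (k i)" "\<lfloor>real N*y $ i\<rfloor> = int (l i)"
  using y ks[of "k i" "y $ i"] ks[of "l i" "y $ i"] by(auto simp: hcube_def)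
  thus "k i = l i" by simp
  qed
  thus False using kl(3) by simp
  qed
 qed
qed

lemma hcube_shift: assumes a: "a : V" shows "(+) a ` hcube J 0 r = hcube J a r"
proof
 show "(+) a ` hcube J 0 r <= hcube J a r" using a by(auto simp: hcube_def plane_def)
 show "hcube J a r <= (+) a ` hcube J 0 r"
 proof
  fix y assume "y : hcube J a r"
  hence "y - a : hcube J 0 r" using a by(auto simp: hcube_def plane_def algebra_simps)
  thus "y : (+) a ` hcube J 0 r" by(intro image_eqI[of _ _ "y - a"]) auto
 qed
qed

text \<open>The density of the uniform probability measure on the unit cube, so that a cube of side
  \<open>r\<close> has mass \<open>r ^ d\<close>.\<close>

definition umass :: real where "umass = 1/cvol"

lemma umass: "0 < umass" "umass*(r ^ d*cvol) = r ^ d"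
 using cvol(1) by(auto simp: umass_def)

lemma emeasure_compl_mono: "sets tau = sets borel ==> Y : sets borel ==> Y <= s ==> emeasure tau (- Y) = 0 ==> emeasure tau (- s) = 0"
 for tau :: "(real^'n) measure"
 using emeasure_mono[of "- s" "- Y" tau] by(auto simp: borel_comp)

text \<open>The unit cube is tiled by translated copies of one cell. Since the copies contribute
 equally, an error of \<open>e\<close> for the whole cube means a relative error of \<open>e\<close> for the cell.\<close>

lemma bd_periodic_cell:
 assumes s: "int d simplex s" "s <= V" "hcube J 0 1 <= s"
  and st: "!!I W. flat_map J t0 I W ==> bd (distr (uniform umass (hcube J 0 1)) borel (%x. I x + W x)) e"
  and f: "flat_map J t I W0" and t: "0 <= t" "2*t <= t0" "t0 <= 1/2"
  and N: "N > 0" and W0: "!!x. x ~: open_cube J (1/real N) ==> W0 x = 0"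
 shows "bd (distr (uniform umass (hcube J 0 (1/real N))) borel (%x. I x + W0 x)) (e*(1/real N) ^ d)"
proof -
 let ?Z = "PiE J (%_. {..<N})" and ?r = "1/real N" and ?kap = umass
 let ?Th = "%x. I x + W0 x"
 define c :: "('n => nat) => real^'n" where "c k = (\<chi> i. if i : J then real (k i)/real N else 0)" for k
 define Wt where "Wt x = (SUM k:?Z. W0 (x - c k))" for x
 have "flat_map J (2*t) I Wt" by(rule tiled_map(1)[OF f t(1) N _ Wt_def c_def]) (rule W0)
 hence ft: "flat_map J t0 I Wt" by(rule flat_map_mono[OF _ t(2)])
 have tile: "Wt (c k + y) = W0 y" if "k : ?Z" "y : hcube J 0 (1/real N)" for k y
  by(rule tiled_map(2)[OF f t(1) N _ Wt_def c_def that]) (rule W0)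
 let ?Psi = "%x. I x + Wt x"
 have r: "0 < ?r" "?r <= 1" using N by auto
 have t12: "t <= 1/2" using t by linarith
 have V0: "0 : V" by(simp add: plane_def)
 have cV: "c k : V" for k by(simp add: c_def plane_def)
 have k0: "0 <= ?kap" using umass(1) by simp
 have rd: "?r ^ d <= 1" using r by(intro power_le_one) auto
 let ?b = "%k. hcube J (c k) ?r"
 let ?u = "uniform ?kap (hcube J 0 1)" and ?v = "uniform ?kap (hcube J 0 ?r)"
 have SDu: "SD ?u" "measure ?u UNIV = 1"
  using SD_uniform_hcube[OF V0, of 1 ?kap] umass(2)[of 1] k0 by auto
 have SDb: "SD (uniform ?kap (hcube J a ?r))" "measure (uniform ?kap (hcube J a ?r)) UNIV = ?r ^ d" if "a : V" for a
  using SD_uniform_hcube[OF that r(1) k0] umass(2)[of ?r] rd by auto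
 have us: "emeasure ?u (- s) = 0" by(rule uniform_compl[OF hcb s(3) simplex_borel[OF s(1)] k0])
 have sub0: "hcube J 0 ?r <= s" using s(3) r(2) by(force simp: hcube_def)
 have u0s: "emeasure ?v (- s) = 0" by(rule uniform_compl[OF hcb sub0 simplex_borel[OF s(1)] k0])
 note mPsi = flat_map_meas[OF ft] and m0 = flat_map_meas[OF f]
 define nu where "nu = distr ?u borel ?Psi"
 have cnu: "carried (?Psi ` s) nu" unfolding nu_def by(rule carried_flat[OF s(1,2) ft t(3) SDu(1) us])
 define nu0 where "nu0 = distr ?v borel ?Th"
 have cnu0: "carried (?Th ` s) nu0" unfolding nu0_def by(rule carried_flat[OF s(1,2) f t12 SDb(1)[OF V0] u0s])
 obtain T where T: "T : borel \<rightarrow>\<^sub>M borel" "!!x. x : s ==> T (?Psi x) = x"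
  by(rule flat_map_inverse[OF ft t(3) compact_simplex[OF s(1)] s(2)]) blast
 have inv: "wgt (distr ?u borel ?Psi) (indicator (T -` A)) = distr (wgt ?u (indicator A)) borel ?Psi"
  if "A : sets borel" for A
  by(rule wgt_indicator_inverse[OF SD_sets[OF SDu(1)] simplex_borel[OF s(1)] us mPsi T(1) _ that]) (rule T(2))
 have fZ: "finite ?Z" by(intro finite_PiE) auto
 have UQ: "(UN k:?Z. ?b k) = hcube J 0 1" and disj: "disjoint_family_on ?b ?Z"
  using hcube_1_tiling[OF N] unfolding c_def by blast+
 \<comment> \<open>On each tile the periodic map is the map of the first cell followed by a
   translation by \<open>I (c k)\<close>; hence all pieces of the image have the same value.\<close>
 have piece: "wgt nu (indicator (T -` ?b k)) = distr nu0 borel ((+) (I (c k)))" if k: "k : ?Z" for k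
 proof -
  have "?b k <= hcube J 0 1" using UQ k by blast
  hence "hcube J 0 1 Int ?b k = ?b k" by blast
  hence 1: "wgt ?u (indicator (?b k)) = uniform ?kap (?b k)"
  using wgt_uniform_indicator[OF hcb[of J 0 1] hcb[of J "c k" ?r] k0] by simp
  note im = hcube_shift[OF cV, of k ?r]
  have 2: "uniform ?kap (?b k) = distr ?v borel ((+) (c k))"
  using uniform_translation[OF hcb[of J 0 ?r] k0, of "c k"] im by simp
  have lin: "linear I" using f by(simp add: flat_map_def)
  have mc: "(+) (c k) : ?v \<rightarrow>\<^sub>M borel" using shift_meas[of "c k"] SD_sets[OF SDb(1)[OF V0]] by(simp cong: measurable_cong_sets)
  have m0': "?Th : ?v \<rightarrow>\<^sub>M borel" using m0 SD_sets[OF SDb(1)[OF V0]] by(simp cong: measurable_cong_sets)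
  have "wgt nu (indicator (T -` ?b k)) = distr (distr ?v borel ((+) (c k))) borel ?Psi"
  unfolding nu_def inv[OF hcb] 1 2 ..
  also have "... = distr ?v borel (?Psi \<circ> (+) (c k))" by(rule distr_distr[OF mPsi mc])
  also have "... = distr ?v borel ((+) (I (c k)) \<circ> ?Th)"
  proof (rule distr_cong_on[OF SD_sets[OF SDb(1)[OF V0]] hcb uniform_compl[OF hcb order_refl hcb k0]])
  show "?Psi \<circ> (+) (c k) : borel \<rightarrow>\<^sub>M borel" by(rule measurable_comp[OF shift_meas mPsi])
  show "(+) (I (c k)) \<circ> ?Th : borel \<rightarrow>\<^sub>M borel" by(rule measurable_comp[OF m0 shift_meas])
  fix y assume "y : hcube J 0 ?r"
  thus "(?Psi \<circ> (+) (c k)) y = ((+) (I (c k)) \<circ> ?Th) y" using tile[OF k, of y] by(simp add: linear_add[OF lin])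
  qed
  also have "... = distr (distr ?v borel ?Th) borel ((+) (I (c k)))"
  by(rule distr_distr[OF shift_meas m0', symmetric])
  finally show ?thesis unfolding nu0_def .
 qed
 have TB: "T -` ?b k : sets borel" for k by(rule vimage_borel[OF T(1) hcb])
 have dT: "disjoint_family_on (%k. T -` ?b k) ?Z" using disj by(auto simp: disjoint_family_on_def)
 have hk: "h (wgt nu (indicator (T -` ?b k))) n = h nu0 n" if "k : ?Z" "n > 0" for k n
  unfolding piece[OF that(1)]
  by(rule h_translation[OF carr_SD[OF cnu0] _ that(2)])
  (unfold piece[OF that(1), symmetric], rule carr_SD[OF carried_restrict[OF cnu TB]])
 have "card ?Z = N ^ d" using card_J by(simp add: card_funcsetE)
 hence cZ: "real (card ?Z) = real N ^ d" by simp
 have full: "wgt nu (indicator (UN k:?Z. T -` ?b k)) = nu"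
 proof -
  have "(UN k:?Z. T -` ?b k) = T -` hcube J 0 1" using UQ by blast
  moreover have "wgt ?u (indicator (hcube J 0 1)) = ?u"
  by(rule wgt_full[OF SD_sets[OF SDu(1)] hcb uniform_compl[OF hcb order_refl hcb k0]])
  ultimately show ?thesis unfolding nu_def using inv[OF hcb[of J 0 1]] by simp
 qed
 have mass: "measure nu UNIV = 1" "measure nu0 UNIV = ?r ^ d"
  unfolding nu_def nu0_def using measure_distr_UNIV[OF SD_sets[OF SDu(1)] mPsi] measure_distr_UNIV[OF SD_sets[OF SDb(1)[OF V0]] m0] SDu(2) SDb(2)[OF V0] by simp_all
 have bnu: "bd nu e" unfolding nu_def by(rule st[OF ft])
 have "bd nu0 (e*?r ^ d)" unfolding bd_def
 proof (intro allI impI)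
  fix eps :: real assume e: "eps > 0"
  define eps' where "eps' = eps*real N ^ d/2"
  have e': "0 < eps'" using e N by(simp add: eps'_def)
  have "EVT n. abs(h (wgt nu (indicator (UN k:?Z. T -` ?b k))) n - (SUM k:?Z. h (wgt nu (indicator (T -` ?b k))) n)) <= eps'"
  by(rule ev_abs_le[OF h_UN[OF cnu fZ TB dT] e'])
  moreover have "EVT n. abs(h nu n - H0*measure nu UNIV) <= e + eps'" using bnu e' unfolding bd_def by blast
  ultimately show "EVT n. abs(h nu0 n - H0*measure nu0 UNIV) <= e*?r ^ d + eps"
  using eventually_gt_at_top[of 0]
  proof eventually_elim
  case (elim n)
  have S: "(SUM k:?Z. h (wgt nu (indicator (T -` ?b k))) n) = real N ^ d*h nu0 n"
  using hk elim(3) cZ by simp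
  have "abs(real N ^ d*h nu0 n - H0) <= e + 2*eps'" using elim(1,2) unfolding full S mass by linarith
  hence "?r ^ d*abs(real N ^ d*h nu0 n - H0) <= ?r ^ d*(e + 2*eps')" by(rule mult_left_mono) simp
  moreover have "?r ^ d*abs(real N ^ d*h nu0 n - H0) = abs(?r ^ d*(real N ^ d*h nu0 n - H0))" by(simp add: abs_mult)
  moreover have "?r ^ d*(real N ^ d*h nu0 n - H0) = h nu0 n - H0*?r ^ d" using N by(simp add: power_one_over field_simps)
  moreover have "?r ^ d*(e + 2*eps') = e*?r ^ d + eps" using N by(simp add: eps'_def power_one_over field_simps)
  ultimately show ?case unfolding mass by simp
  qed
 qed
 thus ?thesis unfolding nu0_def .
qed

text \<open>The set contains a cube of side \<open>(1 - 2*eta)*r\<close>, and Bernoulli's inequality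
  bounds the missing fraction \<open>1 - (1 - 2*eta) ^ d\<close>.\<close>

lemma margin_mass:
 assumes eta: "0 < eta" "eta < 1/2" and r: "0 < r" "r <= 1"
 shows "measure (uniform umass (hcube J 0 r)) (- {x. ALL i:J. eta*r <= x $ i & x $ i <= (1 - eta)*r}) <= 2*real d*eta*r ^ d"
  and "{x :: real^'n. ALL i:J. eta*r <= x $ i & x $ i <= (1 - eta)*r} : sets borel"
proof -
 let ?E = "{x :: real^'n. ALL i:J. eta*r <= x $ i & x $ i <= (1 - eta)*r}"
 let ?u = "uniform umass (hcube J 0 r)"
 have "?E = (\<Inter>i\<in>J. {x. eta*r <= x $ i} Int {x. x $ i <= (1 - eta)*r})" by auto
 hence "closed ?E" by(simp only:) (intro closed_INT ballI closed_Int closed_Collect_le continuous_intros)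
 thus EB: "?E : sets borel" by(rule borel_closed)
 have V0: "0 : V" by(simp add: plane_def)
 have k0: "0 <= umass" using umass(1) by simp
 have rd: "r ^ d <= 1" using r by(intro power_le_one) auto
 note U = SD_uniform_hcube[OF V0 r(1) k0, unfolded umass(2), OF rd]
 interpret U: finite_measure ?u by(rule subdens_finite[OF U(1)])
 define a :: "real^'n" where "a = (\<chi> i. if i : J then eta*r else 0)"
 have aV: "a : V" by(simp add: a_def plane_def)
 define r' where "r' = (1 - 2*eta)*r"
 have r': "0 < r'" using eta r by(simp add: r'_def)
 let ?I = "hcube J a r'"
 have top: "eta*r + r' = (1 - eta)*r" by(simp add: r'_def algebra_simps)
 have "?I <= ?E" by(auto simp: hcube_def a_def top less_imp_le)
 have "?I <= hcube J 0 r"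
 proof
  fix x assume x: "x : ?I"
  have "0 <= x $ i & x $ i < r" if i: "i : J" for i
  proof -
  have "eta*r <= x $ i" "x $ i < (1 - eta)*r" using x i top by(auto simp: hcube_def a_def)
  moreover have "0 <= eta*r" "(1 - eta)*r <= r" using eta r by(auto simp: algebra_simps)
  ultimately show ?thesis by linarith
  qed
  thus "x : hcube J 0 r" using x by(auto simp: hcube_def)
 qed
 hence "hcube J 0 r Int ?I = ?I" by blast
 hence "emeasure ?u ?I = ennreal umass*ennreal (r' ^ d*cvol)"
  using emeasure_uniform[OF hcb[of J 0 r] hcb[of J a r'] k0] hausdorff_hcube[OF aV r'] by simp
 also have "... = ennreal (r' ^ d)" using k0 r' cvol(1) umass(2)[of r'] by(simp add: ennreal_mult[symmetric])
 finally have mI: "measure ?u ?I = r' ^ d" unfolding measure_def using r' by simp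
 have us: "sets ?u = sets borel" by(rule SD_sets[OF U(1)])
 have "measure ?u (- ?E) <= measure ?u (UNIV - ?I)"
  using \<open>?I <= ?E\<close> hcb[of J a r'] us by(intro U.finite_measure_mono) auto
 also have "... = r ^ d - r' ^ d"
  using U.finite_measure_compl[of ?I] hcb[of J a r'] us SD_space[OF U(1)] U(2) mI by simp
 also have "... = (1 - (1 - 2*eta) ^ d)*r ^ d"
  unfolding r'_def power_mult_distrib by(simp add: left_diff_distrib)
 also have "... <= (2*real d*eta)*r ^ d"
 proof (rule mult_right_mono)
  have "1 + real d*(- 2*eta) <= (1 + (- 2*eta)) ^ d" using eta by(intro Bernoulli_inequality) simp
  thus "1 - (1 - 2*eta) ^ d <= 2*real d*eta" by simp
 qed (use r in simp)
 finally show "measure ?u (- ?E) <= 2*real d*eta*r ^ d" .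
qed

text \<open>On a cell the map is replaced by its cut-off version, for which tiling yields relative
  error \<open>eps/2\<close>. The two maps differ only on a margin of relative mass at most
  \<open>2*real d*eta\<close>, where the rough bound \<open>es\<close> applies. From cells the
  estimate passes to all densities with one threshold \<open>t\<close> for all measures.\<close>

lemma flat_map_error:
 assumes eps: "0 < eps"
 obtains t where "0 < t" "t <= 1/2" "!!I W mu X. flat_map J t I W ==> SD mu ==> X : sets borel ==> bounded X ==> X <= V ==>
  emeasure mu (- X) = 0 ==> bd (distr mu borel (%x. I x + W x)) (eps*measure mu UNIV)"
proof -
 obtain es where es: "0 <= es" "!!S mu. carried S mu ==> bd mu (es*measure mu UNIV)" by(rule error_bounded) blast
 \<comment> \<open>The margin is paid twice, once for removing it from the cut-off map and once for
   adding it to the original one; this \<open>eta\<close> makes the total at most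
   \<open>eps/2\<close>.\<close>
 define eta where "eta = min (1/4) (eps/(8*real d*(es + 1)))"
 have dp: "0 < real d" using d_pos by simp
 have eta: "0 < eta" "eta < 1/2" using eps es(1) dp by(auto simp: eta_def)
 have etae: "2*es*(2*real d*eta) <= eps/2"
 proof -
  have "eta <= eps/(8*real d*(es + 1))" by(simp add: eta_def)
  hence "eta*(8*real d*(es + 1)) <= eps" using es(1) dp by(simp add: pos_le_divide_eq)
  moreover have "0 <= eta*(8*real d)" using eta dp by simp
  ultimately show ?thesis by(simp add: algebra_simps)
 qed
 define C where "C = graft_factor J eta"
 have C: "1 <= C" unfolding C_def by(rule graft_factor_ge_1[OF eta(1)])
 note gr = graft[OF eta(1), where J = J, folded C_def]
 have V0: "0 : V" by(simp add: plane_def)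
 have k0: "0 <= umass" using umass(1) by simp
 obtain s1 where s1: "int d simplex s1" "s1 <= V" "hcube J 0 1 <= s1" by(rule simplex_over_hcube)
 have SDu: "SD (uniform umass (hcube J 0 1))" using SD_uniform_hcube(1)[OF V0, of 1 umass] umass(2)[of 1] k0 by auto
 have us1: "emeasure (uniform umass (hcube J 0 1)) (- s1) = 0"
  by(rule uniform_compl[OF hcb s1(3) simplex_borel[OF s1(1)] k0])
 obtain t0 where t0: "0 < t0" "t0 <= 1/2" "!!I W. flat_map J t0 I W ==> bd (distr (uniform umass (hcube J 0 1)) borel (%x. I x + W x)) (eps/2)"
  by(rule stability[OF s1(1,2) SDu us1, of "eps/2"]) (use eps in auto)
 \<comment> \<open>\<open>C\<close> is lost by the cut-off and 2 by the tiling; the tiled map then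
   meets the threshold \<open>t0\<close> exactly.\<close>
 define t where "t = t0/(2*C)"
 have t: "0 < t" "2*(C*t) = t0" using t0 C by(auto simp: t_def)
 have "t <= t0" using t0(1) C by(simp add: t_def divide_le_eq mult_le_cancel_left1)
 hence t12: "t <= 1/2" using t0(2) by linarith
 have Ct: "0 <= C*t" "C*t <= 1/2" using t(1) C t(2) t0(2) by(auto simp: mult_nonneg_nonneg)
 show ?thesis
 proof (rule that[OF t(1) t12])
  fix I W and mu and X :: "(real^'n) set"
  assume f: "flat_map J t I W" and mu: "SD mu" and X: "X : sets borel" "bounded X" "X <= V" "emeasure mu (- X) = 0"
  let ?Phi = "%x. I x + W x"
  note mPhi = flat_map_meas[OF f]
  have lin: "linear I" using f by(simp add: flat_map_def)
  have unit_cell: "bd (distr (uniform umass (hcube J a (1/real N))) borel ?Phi) (eps*(1/real N) ^ d)"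
  if a: "a : V" and N: "N > 0" for a N
  proof -
  let ?r = "1/real N" and ?kap = umass
  have r: "0 < ?r" "?r <= 1" using N by auto
  have rd: "?r ^ d <= 1" using r by(intro power_le_one) auto
  \<comment> \<open>The cell is moved to the origin and the value at its corner is subtracted,
    because the cut-off requires a remainder that vanishes somewhere in the cube.\<close>
  define w where "w x = W (x - - a) - W a" for x
  have naV: "- a : V" using a by(simp add: plane_def)
  have fw: "flat_map J t I w" unfolding w_def by(rule flat_map_shift[OF f naV])
  have "EX W0. C2map UNIV W0 & (ALL x:V. ALL y:V. dist (W0 x) (W0 y) <= C*t*dist x y) &
  (ALL x. x ~: open_cube J ?r --> W0 x = 0) & (ALL x. (ALL i:J. eta*?r <= x $ i & x $ i <= (1 - eta)*?r) --> W0 x = w x)"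
  proof (rule gr[OF r(1) less_imp_le[OF t(1)] open_UNIV _ _ _ V0])
  show "C2map UNIV w" using fw by(simp add: flat_map_def)
  show "dist (w x) (w y) <= t*dist x y" if "x : V" "y : V" for x y using fw that by(simp add: flat_map_def)
  qed (use r in "auto simp: w_def")
  then obtain W0 where W0: "C2map UNIV W0" "!!x y. x : V ==> y : V ==> dist (W0 x) (W0 y) <= C*t*dist x y"
  "!!x. x ~: open_cube J ?r ==> W0 x = 0" "!!x. (ALL i:J. eta*?r <= x $ i & x $ i <= (1 - eta)*?r) ==> W0 x = w x" by blast
  have f0: "flat_map J (C*t) I W0" using f W0(1,2) by(simp add: flat_map_def)
  let ?v = "uniform ?kap (hcube J 0 ?r)" and ?Th = "%x. I x + W0 x" and ?Xi = "%x. I x + w x"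
  note m0 = flat_map_meas[OF f0] and m1 = flat_map_meas[OF fw]
  have SD0: "SD ?v" using SD_uniform_hcube(1)[OF V0 r(1) k0] umass(2)[of ?r] rd by auto
  note su = SD_sets[OF SD0]
  have b0: "bd (distr ?v borel ?Th) (eps/2*?r ^ d)"
  by(rule bd_periodic_cell[OF s1 t0(3) f0 Ct(1) _ t0(2) N W0(3)]) (use t(2) in auto)
  let ?E = "{x :: real^'n. ALL i:J. eta*?r <= x $ i & x $ i <= (1 - eta)*?r}"
  note mm = margin_mass[OF eta r]
  have EB: "?E : sets borel" by(rule mm(2))
  have cEB: "- ?E : sets borel" using EB by(simp only: borel_comp)
  have sub0: "hcube J 0 ?r <= s1" using s1(3) r(2) by(force simp: hcube_def)
  have u0s: "emeasure ?v (- s1) = 0" by(rule uniform_compl[OF hcb sub0 simplex_borel[OF s1(1)] k0])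
  have c0: "carried (?Th ` s1) (distr ?v borel ?Th)" by(rule carried_flat[OF s1(1,2) f0 Ct(2) SD0 u0s])
  have c1: "carried (?Xi ` s1) (distr ?v borel ?Xi)" by(rule carried_flat[OF s1(1,2) fw t12 SD0 u0s])
  obtain T0 where T0: "T0 : borel \<rightarrow>\<^sub>M borel" "!!x. x : s1 ==> T0 (?Th x) = x"
  by(rule flat_map_inverse[OF f0 Ct(2) compact_simplex[OF s1(1)] s1(2)]) blast
  obtain T1 where T1: "T1 : borel \<rightarrow>\<^sub>M borel" "!!x. x : s1 ==> T1 (?Xi x) = x"
  by(rule flat_map_inverse[OF fw t12 compact_simplex[OF s1(1)] s1(2)]) blast
  have i0: "wgt (distr ?v borel ?Th) (indicator (T0 -` A)) = distr (wgt ?v (indicator A)) borel ?Th"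
  if "A : sets borel" for A
  by(rule wgt_indicator_inverse[OF su simplex_borel[OF s1(1)] u0s m0 T0(1) _ that]) (rule T0(2))
  have i1: "wgt (distr ?v borel ?Xi) (indicator (T1 -` A)) = distr (wgt ?v (indicator A)) borel ?Xi"
  if "A : sets borel" for A
  by(rule wgt_indicator_inverse[OF su simplex_borel[OF s1(1)] u0s m1 T1(1) _ that]) (rule T1(2))
  have mar: "measure (distr (wgt ?v (indicator (- ?E))) borel F) UNIV <= 2*real d*eta*?r ^ d" if F: "F : borel \<rightarrow>\<^sub>M borel" for F :: "real^'n => real^'n"
  proof -
  have "measure (distr (wgt ?v (indicator (- ?E))) borel F) UNIV = measure ?v (- ?E)"
  using measure_distr_UNIV[of "wgt ?v (indicator (- ?E))" F] F su measure_wgt_on[OF su cEB] by simp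
  thus ?thesis using mm(1) by simp
  qed
  have margin: "bd tau (es*(2*real d*eta*?r ^ d))" if "carried S tau" "measure tau UNIV <= 2*real d*eta*?r ^ d" for S tau
  using es(2)[OF that(1)] by(rule bd_mono) (use that(2) es(1) in "auto intro: mult_left_mono")
  have full0: "wgt (distr ?v borel ?Th) (indicator (T0 -` ?E Un T0 -` (- ?E))) = distr ?v borel ?Th"
  proof -
  have "T0 -` ?E Un T0 -` (- ?E) = UNIV" by blast
  moreover have "wgt (distr ?v borel ?Th) (indicator UNIV) = distr ?v borel ?Th"
  by(rule wgt_full) auto
  ultimately show ?thesis by(simp only:)
  qed
  have full1: "wgt (distr ?v borel ?Xi) (indicator (T1 -` ?E Un T1 -` (- ?E))) = distr ?v borel ?Xi"
  proof -
  have "T1 -` ?E Un T1 -` (- ?E) = UNIV" by blast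
  moreover have "wgt (distr ?v borel ?Xi) (indicator UNIV) = distr ?v borel ?Xi"
  by(rule wgt_full) auto
  ultimately show ?thesis by(simp only:)
  qed
  have mar0: "bd (wgt (distr ?v borel ?Th) (indicator (T0 -` (- ?E)))) (es*(2*real d*eta*?r ^ d))"
  by(rule margin[OF carried_restrict[OF c0 vimage_borel[OF T0(1) cEB]]]) (unfold i0[OF cEB], rule mar[OF m0])
  have mar1: "bd (wgt (distr ?v borel ?Xi) (indicator (T1 -` (- ?E)))) (es*(2*real d*eta*?r ^ d))"
  by(rule margin[OF carried_restrict[OF c1 vimage_borel[OF T1(1) cEB]]]) (unfold i1[OF cEB], rule mar[OF m1])
  \<comment> \<open>Inside the margin the cut-off and the original map coincide, so this estimate is
    also one for the original map, to which the margin is added back below.\<close>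
  have "bd (wgt (distr ?v borel ?Th) (indicator (T0 -` ?E))) (eps/2*?r ^ d + es*(2*real d*eta*?r ^ d))"
  by(rule bd_Diff[OF c0 vimage_borel[OF T0(1) EB] vimage_borel[OF T0(1) cEB] _ mar0]) (use full0 b0 in auto)
  moreover have "distr (wgt ?v (indicator ?E)) borel ?Th = distr (wgt ?v (indicator ?E)) borel ?Xi"
  by(rule distr_cong_on[OF _ EB _ m0 m1]) (use su cEB EB W0(4) in "auto simp: em_wgt_on")
  ultimately have in1: "bd (wgt (distr ?v borel ?Xi) (indicator (T1 -` ?E))) (eps/2*?r ^ d + es*(2*real d*eta*?r ^ d))"
  unfolding i0[OF EB] i1[OF EB] by simp
  have "bd (wgt (distr ?v borel ?Xi) (indicator (T1 -` ?E Un T1 -` (- ?E)))) (eps/2*?r ^ d + es*(2*real d*eta*?r ^ d) + es*(2*real d*eta*?r ^ d))"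
  by(rule bd_Un[OF c1 vimage_borel[OF T1(1) EB] vimage_borel[OF T1(1) cEB] _ mar1 in1]) auto
  hence "bd (distr ?v borel ?Xi) (eps/2*?r ^ d + es*(2*real d*eta*?r ^ d) + es*(2*real d*eta*?r ^ d))" unfolding full1 .
  moreover have "eps/2*?r ^ d + es*(2*real d*eta*?r ^ d) + es*(2*real d*eta*?r ^ d) <= eps*?r ^ d"
  proof -
  have "(2*es*(2*real d*eta))*?r ^ d <= eps/2*?r ^ d" by(rule mult_right_mono[OF etae]) simp
  thus ?thesis by(simp add: algebra_simps)
  qed
  ultimately have b1: "bd (distr ?v borel ?Xi) (eps*?r ^ d)" by(rule bd_mono)
  note im = hcube_shift[OF a, of ?r]
  have ua: "uniform ?kap (hcube J a ?r) = distr ?v borel ((+) a)"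
  using uniform_translation[OF hcb[of J 0 ?r] k0, of a] im by simp
  have ma: "(+) a : ?v \<rightarrow>\<^sub>M borel" using shift_meas[of a] su by(simp cong: measurable_cong_sets)
  have m1': "?Xi : ?v \<rightarrow>\<^sub>M borel" using m1 su by(simp cong: measurable_cong_sets)
  have "?Phi \<circ> (+) a = (+) (I a + W a) \<circ> ?Xi"
  by(auto simp: fun_eq_iff w_def linear_add[OF lin] add.commute)
  hence eq: "distr (uniform ?kap (hcube J a ?r)) borel ?Phi = distr (distr ?v borel ?Xi) borel ((+) (I a + W a))"
  unfolding ua using distr_distr[OF mPhi ma] distr_distr[OF shift_meas[of "I a + W a"] m1'] by simp
  show ?thesis unfolding eq
  using bd_translation[OF carr_SD[OF c1] carr_SD[OF carried_translation[OF c1]]] b1 by blast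
  qed
  \<comment> \<open>From cells to \<open>mu\<close>: the image of the uniform measure on a box takes
    the part of \<open>nu\<close>, the inverse of the map that of \<open>T\<close>, and
    \<open>mu\<close> has a density with respect to the uniform measure.\<close>
  obtain B R where B: "B = hcube J (\<chi> i. if i : J then - real R else 0) (2*real R)" "X <= B" "0 < R"
  by(rule dominating_box[OF X(2,3)])
  obtain kap where k: "0 < kap" "SD (uniform kap B)"
  by(rule uniform_box[OF B(1,3)])
  have BB: "B : sets borel" unfolding B(1) by(rule hcb)
  have muB: "emeasure mu (- B) = 0" by(rule emeasure_compl_mono[OF SD_sets[OF mu] X(1) B(2) X(4)])
  obtain u where u: "u : borel_measurable borel" "!!x. 0 <= u x" "mu = wgt (uniform kap B) u"
  by(rule density_of_uniform[OF mu muB BB k(1)]) blast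
  obtain s where s: "int d simplex s" "s <= V" "B <= s" unfolding B(1) by(rule simplex_over_hcube)
  have k0': "0 <= kap" using k(1) by simp
  have uB: "emeasure (uniform kap B) (- B) = 0" by(rule uniform_compl[OF BB order_refl BB k0'])
  have us: "emeasure (uniform kap B) (- s) = 0" by(rule emeasure_compl_mono[OF SD_sets[OF k(2)] BB s(3) uB])
  define nu where "nu = distr (uniform kap B) borel ?Phi"
  have cnu: "carried (?Phi ` s) nu" unfolding nu_def by(rule carried_flat[OF s(1,2) f t12 k(2) us])
  obtain T where T: "T : borel \<rightarrow>\<^sub>M borel" "!!x. x : s ==> T (?Phi x) = x"
  by(rule flat_map_inverse[OF f t12 compact_simplex[OF s(1)] s(2)]) blast
  have inv: "wgt nu (indicator (T -` A)) = distr (wgt (uniform kap B) (indicator A)) borel ?Phi"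
  if "A : sets borel" for A
  unfolding nu_def by(rule wgt_indicator_inverse[OF SD_sets[OF k(2)] simplex_borel[OF s(1)] us mPhi T(1) _ that]) (rule T(2))
  have mTB: "measure nu (T -` A) = measure (wgt (uniform kap B) (indicator A)) UNIV" if A: "A : sets borel" for A
  proof -
  have "measure nu (T -` A) = measure (wgt nu (indicator (T -` A))) UNIV"
  by(rule measure_wgt_on[OF carried_sets[OF cnu] vimage_borel[OF T(1) A], symmetric])
  also have "... = measure (wgt (uniform kap B) (indicator A)) UNIV"
  unfolding inv[OF A] by(rule measure_distr_UNIV[OF _ mPhi]) (simp add: SD_sets[OF k(2)])
  finally show ?thesis .
  qed
  have op: "bd (wgt nu (indicator (T -` G))) (eps*measure nu (T -` G))" if "open G" for G
  proof (rule bd_preimages_open[OF cnu T(1) B(1) _ _ _ that, where ?j0.0 = 0])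
  have "emeasure (distr (uniform kap B) borel ?Phi) (- (T -` B)) = emeasure (uniform kap B) (?Phi -` (- (T -` B)))"
  using mPhi vimage_borel[OF T(1) BB] SD_sets[OF k(2)] SD_space[OF k(2)]
  by(subst emeasure_distr) (auto simp: borel_comp cong: measurable_cong_sets)
  also have "... <= emeasure (uniform kap B) (- B)"
  using T(2) s(3) BB SD_sets[OF k(2)] by(intro emeasure_mono) (auto simp: borel_comp)
  finally show "emeasure nu (- (T -` B)) = 0" using uB by(simp add: nu_def)
  fix j z assume z: "z : B"
  let ?a = "grid_corner J (2 ^ j) z" and ?r = "1/real (2 ^ j)"
  let ?c = "hcube J ?a ?r"
  have ce: "gcell J (2 ^ j) z = ?c" by(rule gcell_eq) simp
  have "?c <= B" using hcube_int_grid[OF B(1) _ z, of "2 ^ j"] ce by simp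
  hence "B Int ?c = ?c" by blast
  hence rc: "wgt (uniform kap B) (indicator ?c) = uniform kap ?c"
  using wgt_uniform_indicator[OF BB hcb[of J ?a ?r] k0'] by simp
  have SDc: "SD (uniform kap ?c)" unfolding rc[symmetric] by(rule SD_restrict[OF k(2) hcb])
  have rd: "?r ^ d <= 1" by(intro power_le_one) auto
  note U1 = SD_uniform_hcube[OF grid_corner_in[of J "2 ^ j" z], of ?r umass, unfolded umass(2)]
  have SD1: "SD (uniform umass ?c)" "measure (uniform umass ?c) UNIV = ?r ^ d" using U1 k0 rd by auto
  have re: "wgt (uniform umass ?c) (%_. kap/umass) = uniform kap ?c"
  using wgt_uniform_const[OF hcb[of J ?a ?r] k0, of "kap/umass"] k(1) umass(1) by simp
  have cs: "?c <= s" using \<open>?c <= B\<close> s(3) by blast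
  have c1s: "emeasure (uniform umass ?c) (- s) = 0"
  by(rule uniform_compl[OF hcb cs simplex_borel[OF s(1)] k0])
  have cs': "emeasure (uniform kap ?c) (- s) = 0"
  by(rule uniform_compl[OF hcb cs simplex_borel[OF s(1)] k0'])
  have cc: "carried (?Phi ` s) (distr (uniform umass ?c) borel ?Phi)" by(rule carried_flat[OF s(1,2) f t12 SD1(1) c1s])
  have rr: "wgt (distr (uniform umass ?c) borel ?Phi) (%_. kap/umass) = distr (uniform kap ?c) borel ?Phi"
  unfolding wgt_const_distr[OF SD1(1) mPhi] re ..
  have "bd (wgt (distr (uniform umass ?c) borel ?Phi) (%_. kap/umass)) (kap/umass*(eps*?r ^ d))"
  proof (rule bd_scale[OF cc])
  show "0 < kap/umass" using k(1) umass(1) by simp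
  show "SD (wgt (distr (uniform umass ?c) borel ?Phi) (%_. kap/umass))"
  unfolding rr by(rule carr_SD[OF carried_flat[OF s(1,2) f t12 SDc cs']])
  show "bd (distr (uniform umass ?c) borel ?Phi) (eps*?r ^ d)" by(rule unit_cell[OF grid_corner_in]) simp
  qed
  moreover have "measure (uniform kap ?c) UNIV = kap/umass*?r ^ d"
  using measure_wgt_const[OF SD_sets[OF SD1(1)], of "kap/umass"] k(1) umass(1) SD1(2) unfolding re by simp
  ultimately have "bd (distr (uniform kap ?c) borel ?Phi) (eps*measure (uniform kap ?c) UNIV)"
  unfolding rr by(simp add: mult.left_commute)
  thus "bd (wgt nu (indicator (T -` gcell J (2 ^ j) z))) (eps*measure nu (T -` gcell J (2 ^ j) z))"
  unfolding ce inv[OF hcb] mTB[OF hcb] rc .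
  qed (use eps in simp)
  have Bor: "bd (wgt nu (indicator (T -` A))) (eps*measure nu (T -` A))" if "A : sets borel" for A
  by(rule bd_preimages_Borel[OF cnu T(1) op _ that]) (use eps in auto)
  have e: "wgt nu (%x. u (T x)) = distr mu borel ?Phi"
  unfolding nu_def u(3) by(rule wgt_distr_inverse[OF SD_sets[OF k(2)] simplex_borel[OF s(1)] us mPhi T(1) _ u(1)]) (rule T(2))
  have mus: "emeasure mu (- s) = 0" by(rule emeasure_compl_mono[OF SD_sets[OF mu] BB s(3) muB])
  have SDf: "SD (wgt nu (%x. u (T x)))" unfolding e by(rule carr_SD[OF carried_flat[OF s(1,2) f t12 mu mus]])
  have "bd (wgt nu (%x. u (T x))) (eps*measure (wgt nu (%x. u (T x))) UNIV)"
  by(rule bd_preimages_density[OF cnu T(1) Bor _ u(1,2) SDf]) (use eps in auto)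
  thus "bd (distr mu borel ?Phi) (eps*measure mu UNIV)"
  unfolding e measure_distr_UNIV[OF SD_sets[OF mu] mPhi] .
 qed
qed

text \<open>The decomposition into patches adds the errors of the pieces to at most
  \<open>eps\<close> times the total mass, for every \<open>eps\<close>.\<close>

lemma carried_bd:
 assumes mu: "carried S mu" shows "bd mu 0"
proof (rule bd_closed)
 fix eps :: real assume e: "eps > 0"
 obtain t where t: "0 < t" "t <= 1/2" "!!I W mu X. flat_map J t I W ==> SD mu ==> X : sets borel ==> bounded X ==> X <= V ==>
  emeasure mu (- X) = 0 ==> bd (distr mu borel (%x. I x + W x)) (eps*measure mu UNIV)"
  by(rule flat_map_error[OF e]) blast
 have "bd mu (eps*measure mu UNIV)"
 proof (rule bd_of_flat_patches[OF t(1,2) zero_less_one _ _ mu])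
  fix I W r nu assume "flat_map J t I W" "SD nu" "emeasure nu (- hcube J 0 r) = 0"
  thus "bd (distr nu borel (%x. I x + W x)) (eps*measure nu UNIV)"
  by(intro t(3)[OF _ _ hcb hcube_bounded hcube_subset])
 qed (use e in simp)
 thus "bd mu (0 + eps)"
  by(rule bd_mono) (use e SD_measure_le1[OF carr_SD[OF mu]] mult_left_mono[of "measure mu UNIV" 1 eps] in simp)
qed

end

section \<open>Admissible triangulations, dimension 0 and conclusion\<close>

text \<open>The directions of \<open>sg\<close> span a space of the same dimension as
  \<open>plane J\<close>; an isometry between the two moves the parameter simplex from the space of
  the complex into the plane. The last clause keeps track of faces.\<close>

lemma simplex_chart:
 fixes J :: "'n::finite set" and sg :: "'k::euclidean_space set"
 assumes sg: "int (card J) simplex sg" and phi: "C2_embedding_on sg phi"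
 obtains s p L where "int (card J) simplex s" "s <= plane J" "C2_embedding_on s (%x :: real^'n. phi (p + L x))"
  "phi ` sg = (%x. phi (p + L x)) ` s"
  "!!F. F <= sg ==> EX F'. F' <= s & aff_dim F' <= aff_dim F & phi ` F = (%x. phi (p + L x)) ` F'"
proof -
 let ?V = "plane J"
 have ne: "sg ~= {}" using sg by auto
 then obtain p where p: "p : sg" by blast
 let ?W = "span ((%q. q - p) ` sg)"
 have tr: "(+) (- p) ` sg = (%q. q - p) ` sg" by(simp add: image_def)
 have "aff_dim ((%q. q - p) ` sg) = int (card J)"
  using aff_dim_translation_eq[of "- p" sg] aff_dim_simplex[OF sg] unfolding tr by simp
 moreover have "0 : (%q. q - p) ` sg" using p by(intro image_eqI[of _ _ p]) auto
 ultimately have "int (dim ((%q. q - p) ` sg)) = int (card J)" using aff_dim_zero[OF hull_inc, of "(%q. q - p) ` sg"] by simp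
 hence dim: "dim ?V = dim ?W" by(simp add: dim_plane)
 obtain L G where LG: "linear L" "linear G" "L ` ?V = ?W" "G ` ?W = ?V" "!!x. x : ?V ==> norm (L x) = norm x"
  "!!x. x : ?W ==> norm (G x) = norm x" "!!x. x : ?V ==> G (L x) = x" "!!x. x : ?W ==> L (G x) = x"
  by(rule isometries_subspaces[OF subspace_plane subspace_span dim]) blast
 have inW: "q - p : ?W" if "q : sg" for q using that by(intro span_base) auto
 define \<gamma> where "\<gamma> q = G (q - p)" for q
 have bk: "p + L (\<gamma> q) = q" if "q : sg" for q using LG(8)[OF inW[OF that]] by(simp add: \<gamma>_def)
 let ?s = "\<gamma> ` sg"
 have se: "?s = G ` ((+) (- p) ` sg)" by(simp add: image_image \<gamma>_def)
 have s: "int (card J) simplex ?s" unfolding se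
  by(rule simplex_linear_image[OF simplex_translation[OF sg] LG(2,1)]) (use LG(8) inW in auto)
 have sV: "?s <= ?V" using inW LG(4) by(auto simp: \<gamma>_def)
 have C2: "C2_embedding_on ?s (%x. phi (p + L x))"
 proof (rule C2_embedding_on_compose_affine[OF phi LG(1)])
  show "(%x. p + L x) ` ?s <= sg" using bk by auto
  have "span ((%(p, q). q - p) ` (?s \<times> ?s)) <= ?V"
  by(rule span_minimal[OF _ subspace_plane]) (use sV in "auto intro!: plane_diff")
  moreover have "inj_on L ?V" by(rule inj_on_inverseI[where g = G]) (rule LG(7))
  ultimately show "inj_on L (span ((%(p, q). q - p) ` (?s \<times> ?s)))" by(rule inj_on_subset[rotated])
 qed
 have im: "phi ` F = (%x. phi (p + L x)) ` (\<gamma> ` F)" if "F <= sg" for F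
 proof -
  have "(%x. phi (p + L x)) ` (\<gamma> ` F) = (%q. phi (p + L (\<gamma> q))) ` F" by(simp add: image_image)
  also have "... = phi ` F" by(rule image_cong) (use that bk in auto)
  finally show ?thesis by simp
 qed
 show ?thesis
 proof (rule that[OF s sV C2 im[OF order_refl]])
  fix F assume F: "F <= sg"
  have "\<gamma> ` F = G ` ((+) (- p) ` F)" by(simp add: image_image \<gamma>_def)
  hence "aff_dim (\<gamma> ` F) <= aff_dim ((+) (- p) ` F)" using aff_dim_linear_image_le[OF LG(2)] by simp
  hence "aff_dim (\<gamma> ` F) <= aff_dim F" by(simp only: aff_dim_translation_eq)
  thus "EX F'. F' <= ?s & aff_dim F' <= aff_dim F & phi ` F = (%x. phi (p + L x)) ` F'"
  using F im[OF F] by(intro exI[of _ "\<gamma> ` F"]) auto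
 qed
qed

text \<open>The second claim makes overlaps of simplices null. The third serves the degenerate case:
  a simplex of the plane lies in a dilated translate of the unit cube and is null together with
  it.\<close>

lemma simplex_image_curved:
 fixes J :: "'n::finite set" and phi :: "'k::euclidean_space => real^'n"
 assumes "int (card J) simplex sg" "C2_embedding_on sg phi"
 shows "csimplex J (phi ` sg)"
  and "F <= sg ==> aff_dim F < int (card J) ==> hausdorff_outer (card J) (phi ` F) = 0"
  and "hausdorff_outer (card J) (cube J 1) = 0 ==> hausdorff_outer (card J) (phi ` sg) = 0"
proof -
 obtain s p L where s: "int (card J) simplex s" "s <= plane J" "C2_embedding_on s (%x :: real^'n. phi (p + L x))"
  "phi ` sg = (%x. phi (p + L x)) ` s"
  "!!F. F <= sg ==> EX F'. F' <= s & aff_dim F' <= aff_dim F & phi ` F = (%x. phi (p + L x)) ` F'"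
  by(rule simplex_chart[OF assms]) blast
 have cs: "compact s" "convex s" using compact_simplex[OF s(1)] convex_simplex[OF s(1)] by auto
 have bs: "bounded s" by(rule compact_imp_bounded[OF cs(1)])
 show "csimplex J (phi ` sg)"
  unfolding csimplex_def using s(1-4) by(intro exI[of _ s] exI[of _ "%x. phi (p + L x)"]) auto
 show "hausdorff_outer (card J) (phi ` F) = 0" if F: "F <= sg" "aff_dim F < int (card J)"
 proof -
  obtain F' where F': "F' <= s" "aff_dim F' <= aff_dim F" "phi ` F = (%x. phi (p + L x)) ` F'" using s(5)[OF F(1)] by blast
  have "hausdorff_outer (card J) F' = 0"
  by(rule hausdorff_lowdim_0[OF order_trans[OF F'(1) s(2)] bounded_subset[OF bs F'(1)]]) (use F'(2) F(2) in linarith)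
  thus ?thesis unfolding F'(3) by(rule C2_embedding_image_null[OF s(3) cs F'(1)])
 qed
 show "hausdorff_outer (card J) (phi ` sg) = 0" if z: "hausdorff_outer (card J) (cube J 1) = 0"
 proof -
  obtain M where M: "!!x. x : s ==> norm x <= M" using bs unfolding bounded_iff by blast
  define R where "R = abs(M) + 1"
  have R: "0 < R" by(simp add: R_def)
  define a :: "real^'n" where "a = (\<chi> i. if i : J then - R else 0)"
  have "s <= (+) a ` ((*\<^sub>R) (2*R) ` cube J 1)"
  proof
  fix x assume x: "x : s"
  have "abs(x $ i) <= R" for i using M[OF x] component_le_norm_cart[of x i] by(simp add: R_def)
  hence b: "- R <= x $ i" "x $ i <= R" for i by(auto simp: abs_le_iff minus_le_iff)
  have xV: "x $ i = 0" if "i ~: J" for i using x s(2) that by(auto simp: plane_def)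
  have "(1/(2*R)) *\<^sub>R (x - a) : cube J 1" unfolding cube_def
  proof (rule CollectI, intro conjI ballI allI impI)
  show "0 <= ((1/(2*R)) *\<^sub>R (x - a)) $ i" "((1/(2*R)) *\<^sub>R (x - a)) $ i <= 1" if "i : J" for i
  using that b[of i] R by(auto simp: a_def)
  show "((1/(2*R)) *\<^sub>R (x - a)) $ i = 0" if "i ~: J" for i using that xV by(simp add: a_def)
  qed
  moreover have "x = a + (2*R) *\<^sub>R ((1/(2*R)) *\<^sub>R (x - a))" using R by simp
  ultimately show "x : (+) a ` ((*\<^sub>R) (2*R) ` cube J 1)" by blast
  qed
  moreover have "hausdorff_outer (card J) ((+) a ` ((*\<^sub>R) (2*R) ` cube J 1)) = 0"
  using R z by(simp add: hausdorff_translation hausdorff_scaleR)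
  ultimately have "hausdorff_outer (card J) s = 0" by(rule hausdorff_null_subset)
  thus ?thesis unfolding s(4) by(rule C2_embedding_image_null[OF s(3) cs order_refl])
 qed
qed

lemma measure_sum_null_overlaps:
 assumes "finite_measure mu" "finite I" "!!i. i : I ==> A i : sets mu"
  "!!i j. i : I ==> j : I ==> i ~= j ==> emeasure mu (A i Int A j) = 0"
 shows "(SUM i:I. measure mu (A i)) = measure mu (UN i:I. A i)"
proof -
 interpret finite_measure mu by fact
 define B where "B = (UN x:{(i, j). i : I & j : I & i ~= j}. A (fst x) Int A (snd x))"
 have fin: "finite {(i, j). i : I & j : I & i ~= j}" by(rule finite_subset[of _ "I \<times> I"]) (use assms(2) in auto)
 have B: "B : null_sets mu" unfolding B_def
  by(rule null_sets_UN'[OF countable_finite[OF fin]]) (use assms(3,4) in "auto simp: null_sets_def")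
 have e: "measure mu (X - B) = measure mu X" if "X : sets mu" for X by(rule measure_Diff_null_set[OF that B])
 have "(SUM i:I. measure mu (A i)) = (SUM i:I. measure mu (A i - B))" by(intro sum.cong refl e[symmetric] assms(3))
 also have "... = measure mu (UN i:I. A i - B)"
 proof (rule finite_measure_finite_Union[OF assms(2), symmetric])
  show "(%i. A i - B) ` I <= sets mu" using assms(3) B by auto
  show "disjoint_family_on (%i. A i - B) I" unfolding disjoint_family_on_def B_def by fastforce
 qed
 also have "(UN i:I. A i - B) = (UN i:I. A i) - B" by blast
 also have "measure mu ... = measure mu (UN i:I. A i)" by(rule e) (use assms(2,3) in auto)
 finally show ?thesis .
qed

lemma triangulation_cover:
 fixes K :: "'k::euclidean_space set set"
 assumes K: "admissible_triangulation d K phi M"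
 shows "finite K" "inj_on phi (\<Union>K)" "M = (UN sg:top_simplices d K. phi ` sg)" "!!sg. sg : K ==> C2_embedding_on sg phi" "compact M"
  "!!sg tau. sg : K ==> tau : K ==> (sg Int tau) face_of sg"
proof -
 have sc: "simplicial_complex K" and hom: "\<exists>\<psi>. homeomorphism (\<Union>K) M phi \<psi>" and pure: "purely_dimensional d K"
  using K by(auto simp: admissible_triangulation_def C2_triangulation_def)
 show fin: "finite K" using sc by(simp add: simplicial_complex_def)
 show "C2_embedding_on sg phi" if "sg : K" for sg using K that by(simp add: admissible_triangulation_def C2_triangulation_def)
 show "compact M" using K by(simp add: admissible_triangulation_def)
 show "(sg Int tau) face_of sg" if "sg : K" "tau : K" for sg tau using sc that unfolding simplicial_complex_def by blast
 obtain \<psi> where h: "homeomorphism (\<Union>K) M phi \<psi>" using hom by blast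
 show "inj_on phi (\<Union>K)" by(rule inj_on_inverseI[where g = \<psi>]) (use h in "auto simp: homeomorphism_def")
 have "\<Union>K = \<Union>(top_simplices d K)"
 proof
  show "\<Union>K <= \<Union>(top_simplices d K)"
  proof
  fix x assume "x : \<Union>K"
  then obtain tau where tau: "tau : K" "x : tau" by blast
  obtain sg where sg: "sg : K" "tau <= sg" "ALL rho:K. sg <= rho --> sg = rho" using finite_has_maximal2[OF fin tau(1)] by blast
  hence "int d simplex sg" using pure by(force simp: purely_dimensional_def)
  thus "x : \<Union>(top_simplices d K)" using sg tau by(auto simp: top_simplices_def)
  qed
 qed (auto simp: top_simplices_def)
 thus "M = (UN sg:top_simplices d K. phi ` sg)" using h by(auto simp: homeomorphism_def)
qed

context poisson_functional
begin

text \<open>In dimension 0 a curved simplex is a point and \<open>mu\<close> a multiple of an atom.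
  The reference limit concerns the atom at the origin; translation invariance and control
  homogeneity do the rest, the factor being harmless because the values converge.\<close>

lemma carried_bd_0:
 assumes d0: "d = 0" and mu: "carried S mu" shows "bd mu 0"
proof (cases "emeasure mu UNIV = 0")
 case True
 thus ?thesis by(rule bd_null[OF carr_SD[OF mu]])
next
 case False
 have J: "J = {}" using card_J d0 by simp
 have "csimplex J S" "emeasure mu (- S) = 0" using mu by(auto simp: carried_def)
 then obtain s :: "(real^'n) set" and Phi where "int 0 simplex s" and S: "S = Phi ` s" using J by(elim csimplexE) auto
 then obtain x where "s = {x}" by(auto simp: simplex_zero)
 then obtain y where y: "S = {y}" using S by auto
 have my: "emeasure mu (- {y}) = 0" using \<open>emeasure mu (- S) = 0\<close> y by simp
 have cube: "cube J 1 = {0 :: real^'n}" by(auto simp: cube_def J vec_eq_iff)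
 have V0: "hausdorff_outer d {0 :: real^'n} = ennreal cvol" using cvol(2) cube by simp
 have "hausdorff_outer d {0 :: real^'n} <= 1"
  by(rule hausdorff_le_finite_covers, rule exI[of _ "{()}"], rule exI[of _ "%_. {0}"]) (auto simp: hausdorff_weight_def d0)
 hence v1: "cvol <= 1" unfolding V0 by(simp add: ennreal_le_1)
 have Vy: "hausdorff_outer d {y} = ennreal cvol" using hausdorff_translation[of d y "{0}"] V0 by simp
 define u where "u z = uniform 1 {z :: real^'n}" for z
 have SDu: "SD (u z)" if "hausdorff_outer d {z} = ennreal cvol" for z
  unfolding u_def by(rule SD_uniform) (use that v1 in "auto simp: ennreal_le_1")
 have mass_u: "measure (u z) UNIV = cvol" if "hausdorff_outer d {z} = ennreal cvol" for z
  using that cvol(1) by(simp add: measure_def u_def emeasure_uniform)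
 have tr: "distr (u 0) borel ((+) y) = u y" unfolding u_def by(subst uniform_translation) auto
 have "bd (u 0) 0" unfolding bd_0_iff mass_u[OF V0] using reference_limit ref_value_eq by(simp add: u_def cube)
 hence "bd (distr (u 0) borel ((+) y)) 0"
  using bd_translation[OF SDu[OF V0], of y 0] SDu[OF Vy] tr by simp
 hence lim: "(h (u y) \<longlongrightarrow> H0*cvol) at_top" unfolding tr bd_0_iff mass_u[OF Vy] .
 define p where "p = measure mu UNIV/cvol"
 have p: "0 < p" using False cvol(1) SD_emeasure[OF carr_SD[OF mu]] by(auto simp: p_def zero_less_measure_iff less_le)
 have sm: "sets mu = sets borel" by(rule carried_sets[OF mu])
 have su: "sets (u y) = sets borel" by(rule SD_sets[OF SDu[OF Vy]])
 have eq: "mu = wgt (u y) (%_. p)"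
 proof (rule measure_eqI)
  show "sets mu = sets (wgt (u y) (%_. p))" using sm su by simp
  have red: "emeasure mu A = emeasure mu ({y} Int A)" if A: "A : sets borel" for A
  proof -
  have "emeasure mu A = emeasure (wgt mu (indicator {y})) A"
  using wgt_full[OF sm _ my] by simp
  also have "... = emeasure mu ({y} Int A)" by(rule em_wgt_on[OF sm _ A]) simp
  finally show ?thesis .
  qed
  fix A assume "A : sets mu"
  hence A: "A : sets borel" using sm by simp
  have r: "emeasure (wgt (u y) (%_. p)) A = ennreal p*hausdorff_outer d ({y} Int A)"
  using em_wgt_const[OF su A] emeasure_uniform[of "{y}" A 1] A by(simp add: u_def)
  show "emeasure mu A = emeasure (wgt (u y) (%_. p)) A"
  proof (cases "y : A")
  case True
  hence "{y} Int A = {y} Int UNIV" by blast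
  hence "emeasure mu A = ennreal (measure mu UNIV)"
  using red[OF A] red[of UNIV] SD_emeasure[OF carr_SD[OF mu], of UNIV] by simp
  also have "... = ennreal p*ennreal cvol" using p cvol(1) by(simp add: p_def ennreal_mult[symmetric])
  finally show ?thesis unfolding r using True Vy by simp
  next
  case False
  hence "{y} Int A = {}" by blast
  thus ?thesis unfolding r red[OF A] by(simp add: hausdorff_outer_empty)
  qed
 qed
 have SDp: "SD (wgt (u y) (%_. p))" unfolding eq[symmetric] by(rule carr_SD[OF mu])
 have "emeasure (u y) UNIV ~= 0" using mass_u[OF Vy] cvol(1) by(auto simp: measure_def)
 then obtain rho where rho: "(rho \<longlongrightarrow> 1) at_top" "EVT n. h (wgt (u y) (%_. p)) n = p*rho n*h (u y) (p*n)"
  using h_scale_pos[OF SDu[OF Vy] _ p SDp] by blast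
 have "((%n. p*rho n*h (u y) (p*n)) \<longlongrightarrow> p*1*(H0*cvol)) at_top"
  by(intro tendsto_intros rho(1) tendsto_rescale[OF p lim])
 hence "(h (wgt (u y) (%_. p)) \<longlongrightarrow> p*1*(H0*cvol)) at_top"
  by(rule Lim_transform_eventually) (use rho(2) in "auto elim: eventually_mono")
 hence "(h mu \<longlongrightarrow> p*1*(H0*cvol)) at_top" unfolding eq[symmetric] .
 moreover have "p*1*(H0*cvol) = H0*measure mu UNIV"
 proof -
  have "p*cvol = measure mu UNIV" using cvol(1) by(simp add: p_def)
  thus ?thesis by(simp add: mult.left_commute)
 qed
 ultimately show ?thesis unfolding bd_0_iff by(simp only:)
qed

lemma carried_limit:
 assumes mu: "carried S mu" shows "(h mu \<longlongrightarrow> H0*measure mu UNIV) at_top"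
proof (cases "d = 0")
 case True
 from carried_bd_0[OF this mu] show ?thesis unfolding bd_0_iff .
next
 case False
 interpret positive_dimension H J d by unfold_locales (use False in simp)
 show ?thesis using carried_bd[OF mu] by(simp add: bd_0_iff)
qed

text \<open>Simplex additivity for the given triangulation reduces the limit to its simplices.
  Distinct top simplices meet in faces of smaller dimension, whose images are null, so the masses of
  the pieces sum up to 1 and the limits to \<open>H0\<close>.\<close>

lemma triangulated_limit:
 fixes K :: "'n complex_space set set"
 assumes K: "admissible_triangulation d K phi M" and f: "prob_density_on d M f"
 shows "((%n. 1/n*expected d H n (%x. n*f x) dist) \<longlongrightarrow> H0) at_top"
proof -
 note K' = triangulation_cover[OF K]
 let ?T = "top_simplices d K"
 have T: "sg : K" "int (card J) simplex sg" if "sg : ?T" for sg using that card_J by(auto simp: top_simplices_def)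
 have fT: "finite ?T" using K'(1) by(simp add: top_simplices_def)
 have fm: "f : borel_measurable borel" and f0: "!!x. 0 <= f x" and fM: "!!x. x ~: M ==> f x = 0"
  and f1: "(\<integral>\<^sup>+x. ennreal (f x) \<partial>hausdorff d) = 1" using f by(auto simp: prob_density_on_def)
 define mu where "mu = density (hausdorff d) (%x. ennreal (f x))"
 have mu1: "emeasure mu UNIV = 1" using mass_eq_emeasure[OF fm, of d] f1 by(simp add: mu_def mass_def)
 have mu: "SD mu" unfolding subdens_def using mu1 fm f0 by(auto simp: mu_def)
 note sm = SD_sets[OF mu]
 have cs: "csimplex J (phi ` sg)" if "sg : ?T" for sg
  by(rule simplex_image_curved(1)[OF T(2)[OF that] K'(4)[OF T(1)[OF that]]])
 have B: "phi ` sg : sets borel" if "sg : ?T" for sg by(rule csimplex_borel[OF cs[OF that]])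
 have car: "carried (phi ` sg) (wgt mu (indicator (phi ` sg)))" if "sg : ?T" for sg
  unfolding carried_def using cs[OF that] SD_restrict[OF mu B[OF that]] B[OF that] sm
  by(simp add: em_wgt_on borel_comp)
 have null: "emeasure mu (phi ` sg Int phi ` tau) = 0" if st: "sg : ?T" "tau : ?T" "sg ~= tau" for sg tau
 proof -
  have im: "phi ` sg Int phi ` tau = phi ` (sg Int tau)"
  using inj_on_image_Int[OF K'(2), of sg tau] T(1)[OF st(1)] T(1)[OF st(2)] by blast
  have fa: "(sg Int tau) face_of sg" "(tau Int sg) face_of tau" using K'(6) T(1)[OF st(1)] T(1)[OF st(2)] by blast+
  have ad: "aff_dim sg = int (card J)" "aff_dim tau = int (card J)" using aff_dim_simplex T(2)[OF st(1)] T(2)[OF st(2)] by auto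
  have cv: "convex sg" "convex tau" using convex_simplex T(2)[OF st(1)] T(2)[OF st(2)] by auto
  have "aff_dim (sg Int tau) < int (card J)"
  proof (cases "sg Int tau = sg")
  case False
  thus ?thesis using face_of_aff_dim_lt[OF cv(1) fa(1)] ad by simp
  next
  case True
  hence "tau Int sg ~= tau" using st(3) by blast
  thus ?thesis using face_of_aff_dim_lt[OF cv(2) fa(2)] ad by(simp add: Int_commute)
  qed
  hence "hausdorff_outer (card J) (phi ` (sg Int tau)) = 0"
  by(intro simplex_image_curved(2)[OF T(2)[OF st(1)] K'(4)[OF T(1)[OF st(1)]]]) auto
  hence z: "hausdorff_outer d (phi ` sg Int phi ` tau) = 0" unfolding im card_J .
  show ?thesis by(rule SD_null[OF mu sets.Int[OF B[OF st(1)] B[OF st(2)]] z])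
 qed
 have MB: "M : sets borel" using K'(5) by(simp add: borel_closed compact_imp_closed)
 have "emeasure mu (- M) = (\<integral>\<^sup>+x. ennreal (f x)*indicator (- M) x \<partial>hausdorff d)"
  unfolding mu_def using fm MB by(intro emeasure_density) (auto simp: borel_comp)
 also have "... = (\<integral>\<^sup>+x. 0 \<partial>(hausdorff d :: (real^'n) measure))"
  by(rule nn_integral_cong) (use fM in "auto simp: indicator_def")
 finally have "emeasure mu (- M) = 0" by simp
 hence "emeasure (wgt mu (indicator M)) UNIV = 1" using wgt_full[OF sm MB] mu1 by simp
 hence "emeasure mu M = 1" using sm MB by(simp add: em_wgt_on)
 hence "measure mu M = 1" by(simp add: measure_def)
 hence total: "(SUM sg:?T. measure mu (phi ` sg)) = 1"
  using measure_sum_null_overlaps[OF subdens_finite[OF mu] fT, of "%sg. phi ` sg"] B null sm K'(3) by simp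
 have each: "((%n. 1/n*expected d H n (%x. n*(f x*indicator (phi ` sg) x)) dist) \<longlongrightarrow> H0*measure mu (phi ` sg)) at_top"
  if s: "sg : ?T" for sg
 proof -
  have r: "wgt mu (indicator (phi ` sg)) = density (hausdorff d) (%x. ennreal (f x*indicator (phi ` sg) x))"
  unfolding mu_def using fm f0 B[OF s] by(intro wgt_density) auto
  have "EVT n. h (wgt mu (indicator (phi ` sg))) n = 1/n*expected d H n (%x. n*(f x*indicator (phi ` sg) x)) dist"
  using eventually_gt_at_top[of 0]
  proof eventually_elim
  case (elim n)
  show ?case unfolding r by(rule h_expected[symmetric]) (use fm f0 B[OF s] elim in auto)
  qed
  from Lim_transform_eventually[OF carried_limit[OF car[OF s]] this] show ?thesis
  by(simp only: measure_wgt_on[OF sm B[OF s]])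
 qed
 let ?E = "%n. expected d H n (%x. n*f x) dist" and ?S = "%n. SUM sg:?T. expected d H n (%x. n*(f x*indicator (phi ` sg) x)) dist"
 have "((%n. 1/n*abs(?E n - ?S n)) \<longlongrightarrow> 0) at_top" using additive K f unfolding simplex_additivity_def by blast
 hence "((%n. abs(1/n*(?E n - ?S n))) \<longlongrightarrow> 0) at_top"
  by(rule Lim_transform_eventually) (rule eventually_mono[OF eventually_gt_at_top[of 0]], simp add: abs_mult)
 hence 1: "((%n. 1/n*(?E n - ?S n)) \<longlongrightarrow> 0) at_top" by(rule tendsto_rabs_zero_cancel)
 have "((%n. SUM sg:?T. 1/n*expected d H n (%x. n*(f x*indicator (phi ` sg) x)) dist) \<longlongrightarrow> (SUM sg:?T. H0*measure mu (phi ` sg))) at_top"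
  by(intro tendsto_sum each)
 hence 2: "((%n. 1/n*?S n) \<longlongrightarrow> H0) at_top"
  unfolding sum_distrib_left[symmetric] total mult_1_right .
 have "((%n. 1/n*(?E n - ?S n) + 1/n*?S n) \<longlongrightarrow> 0 + H0) at_top" by(rule tendsto_add[OF 1 2])
 thus ?thesis by(simp only: distrib_left[symmetric] diff_add_cancel add_0)
qed

end

text \<open>If the unit cube is null, so are all curved simplices and with them the triangulated
  space, on which no function can have integral 1.\<close>

lemma degenerate_no_density:
 fixes J :: "'n::finite set" and K :: "'n complex_space set set" and phi :: "'n complex_space => real^'n"
 assumes z: "hausdorff_outer (card J) (cube J 1) = 0" and K: "admissible_triangulation (card J) K phi M"
 shows "~ prob_density_on (card J) M f"
proof
 assume f: "prob_density_on (card J) M f"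
 note K' = triangulation_cover[OF K]
 have "hausdorff_outer (card J) (UN sg:top_simplices (card J) K. phi ` sg) = 0"
 proof (rule hausdorff_UN_null)
  show "finite (top_simplices (card J) K)" using K'(1) by(simp add: top_simplices_def)
  fix sg assume "sg : top_simplices (card J) K"
  hence "sg : K" "int (card J) simplex sg" by(auto simp: top_simplices_def)
  thus "hausdorff_outer (card J) (phi ` sg) = 0" using simplex_image_curved(3)[of J sg phi] K'(4) z by blast
 qed
 hence M0: "hausdorff_outer (card J) M = 0" using K'(3) by simp
 have MB: "M : sets borel" using K'(5) by(simp add: borel_closed compact_imp_closed)
 have "M : null_sets (hausdorff (card J))" using M0 MB by(simp add: null_sets_def emeasure_hausdorff)
 hence "AE x in hausdorff (card J). x ~: M" by(rule AE_not_in)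
 hence "AE x in (hausdorff (card J) :: (real^'n) measure). ennreal (f x) = 0"
  by(rule eventually_mono) (use f in "auto simp: prob_density_on_def")
 hence "(\<integral>\<^sup>+x. ennreal (f x) \<partial>hausdorff (card J)) = (\<integral>\<^sup>+x. 0 \<partial>(hausdorff (card J) :: (real^'n) measure))"
  by(rule nn_integral_cong_AE)
 thus False using f by(simp add: prob_density_on_def)
qed

theorem theorem3p4:
  fixes H :: "'n::finite functional" and J :: "'n set" and d :: nat
  assumes "card J = d"
    and "has_expectations d H"
    and "metric_compatible d H"
    and "rigidity H"
    and "control_homogeneity d H"
    and "scale_invariant_reference J H"
    and "continuity d H"
    and "cube_additivity J H"
    and "simplex_additivity d H"
    and "metric_stability d H"
  shows "\<exists>Hs::real. \<forall>(M :: (real^'n) set) f. admissibly_triangulable d M \<and> good_density d M f \<longrightarrow>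
           ((\<lambda>n::real. 1 / n * expected d H n (\<lambda>x. n * f x) dist) \<longlongrightarrow> Hs) at_top"
proof (cases "hausdorff_outer d (cube J 1) = 0")
 \<comment> \<open>No space under consideration carries a density, so any number serves as the
   limit.\<close>
 case True
 thus ?thesis
  using degenerate_no_density[of J] assms(1) by(auto simp: admissibly_triangulable_def good_density_def)
next
 case False
 interpret poisson_functional H J d
  by unfold_locales (use assms False in "auto simp: zero_less_iff_neq_zero")
 show ?thesis
  by(rule exI[of _ H0]) (use triangulated_limit in "auto simp: admissibly_triangulable_def good_density_def")
qed

end
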